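(* Fix $p>15$. There exist constants $N_0=N_0(a,b,\rho_0,c,\alpha,\gamma,\mathcal E^0,p)$ and $0<c_0<1$ such that for any integer $N\ge N_0$ there exists a set $\Omega_N$ with $$\operatorname{mes}(\Omega_N)\lesssim(\log\log N)^{-c_0},\qquad \operatorname{compl}(\Omega_N)\lesssim N^2(\log N)^p,$$ such that for any $\omega\in\Omega^0\cap\mathbb T_{c,\alpha}\setminus\Omega_N$ there exists a set $\mathcal E_{N,\omega}$ with $$\operatorname{mes}(\mathcal E_{N,\omega})\lesssim(\log\log N)^{-c_0},\qquad \operatorname{compl}(\mathcal E_{N,\omega})\lesssim N(\log N)^6,$$ such that for any $x\in\mathbb T$, if $E_j^{(N)}(x,\omega)\in\mathcal E^0\setminus\mathcal E_{N,\omega}$ for some $j$, then $$\left|E_j^{(N)}(x,\omega)-E_k^{(N)}(x,\omega)\right|\ge\frac1{N(\log N)^p}$$ for any $k\ne j$.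
   Context: $\mathbb T=\mathbb R/\mathbb Z$ and $\mathbb H_\rho=\{z\in\mathbb C:|\mathrm{Im}\,z|<\rho\}$. The functions $a:\mathbb T\to\mathbb R$ and $b:\mathbb T\to\mathbb C$ are real analytic, $b$ is not identically zero, and both extend ($1$-periodically) complex analytically to a set containing the closure of $\mathbb H_{\rho_0}$, $\rho_0>0$; $\tilde b$ denotes the complex analytic extension of $\bar b$ from $\mathbb T$ to $\mathbb H_{\rho_0}$. For fixed $0<c\ll1$, $\alpha>1$, $\mathbb T_{c,\alpha}=\{\omega\in(0,1):\|n\omega\|\ge \frac{c}{n(\log n)^\alpha}\text{ for all integers }n\ge2\}$, where $\|\cdot\|$ is the distance to the nearest integer. $H^{(N)}(z,\omega)$ is the $N\times N$ tridiagonal matrix, rows and columns indexed by $0,\dots,N-1$, with diagonal entries $a(z+k\omega)$ ($0\le k\le N-1$), entries $-b(z+(k+1)\omega)$ in position $(k,k+1)$ and $-\tilde b(z+(k+1)\omega)$ in position $(k+1,k)$ ($0\le k\le N-2$). It is Hermitian for real $z=x$ and $\omega$. $E_j^{(N)}(x,\omega)$, $j=1,\dots,N$, are its eigenvalues. The transfer matrices are $M_N(x,\omega,E)=\prod_{j=N-1}^{0}\frac1{b(x+(j+1)\omega)}\begin{pmatrix}a(x+j\omega)-E&-\tilde b(x+j\omega)\\ b(x+(j+1)\omega)&0\end{pmatrix}$ (factors in order of decreasing $j$ from left to right), and the Lyapunov exponent is $L(\omega,E)=\lim_{N\to\infty}\frac1N\int_{\mathbb T}\log\|M_N(x,\omega,E)\|\,dx$.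 Standing assumption: $\Omega^0=(\omega',\omega'')$ and $\mathcal E^0=(E',E'')$ are bounded intervals and $\gamma>0$ is such that $L(\omega,E)>\gamma$ for all $(\omega,E)\in\Omega^0\times\mathcal E^0$. For a real set $S$ (in $\mathbb R$ or $\mathbb T$), "$\operatorname{mes}(S)\le u$, $\operatorname{compl}(S)\le C$" means that $S$ is contained in a set $S'$ which is a union of at most $C$ intervals with Lebesgue measure $\operatorname{mes}(S')\le u$. The symbol $\lesssim$ means $\le$ up to an absolute multiplicative constant. *)

theory Defs
  imports
    "HOL-Analysis.Analysis"
    "HOL-Complex_Analysis.Complex_Analysis"
    "Jordan_Normal_Form.Char_Poly"
begin

text \<open>
  Functions on the circle \<open>\<real>/\<int>\<close> are represented by \<open>1\<close>-periodic functions on \<open>real\<close>.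
\<close>

definition strip :: "real \<Rightarrow> complex set" where
  "strip \<rho> = {z. \<bar>Im z\<bar> < \<rho>}"

text \<open>
  The library predicate \<open>analytic_on S\<close> means holomorphic in a neighbourhood of every point of
  \<open>S\<close>, i.e. on an open set containing \<open>S\<close>.
\<close>

definition extends_analytically :: "real \<Rightarrow> (real \<Rightarrow> complex) \<Rightarrow> bool" where
  "extends_analytically \<rho> f \<longleftrightarrow>
     (\<exists>F. F analytic_on closure (strip \<rho>) \<and>
          (\<forall>z\<in>closure (strip \<rho>). F (z + 1) = F z) \<and>
          (\<forall>x. F (complex_of_real x) = f x))"

definition admissible :: "(real \<Rightarrow> real) \<Rightarrow> (real \<Rightarrow> complex) \<Rightarrow> real \<Rightarrow> bool" where
  "admissible a b \<rho>0 \<longleftrightarrow>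
     0 < \<rho>0 \<and>
     (\<forall>x. a (x + 1) = a x) \<and> (\<forall>x. b (x + 1) = b x) \<and>
     extends_analytically \<rho>0 (\<lambda>x. complex_of_real (a x)) \<and>
     extends_analytically \<rho>0 b \<and>
     (\<exists>x. b x \<noteq> 0)"

definition diophantine :: "real \<Rightarrow> real \<Rightarrow> real set" where
  "diophantine c \<alpha> =
     {\<omega>. 0 < \<omega> \<and> \<omega> < 1 \<and>
          (\<forall>n::nat. n \<ge> 2 \<longrightarrow> infdist (real n * \<omega>) \<int> \<ge> c / (real n * ln (real n) powr \<alpha>))}"

text \<open>
  The phase is always real below, and on the real line the analytic extension of the complex
  conjugate of \<open>b\<close> is \<open>cnj (b x)\<close>.
\<close>

definition jacobi_matrix ::
  "(real \<Rightarrow> real) \<Rightarrow> (real \<Rightarrow> complex) \<Rightarrow> nat \<Rightarrow> real \<Rightarrow> real \<Rightarrow> complex Matrix.mat" where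
  "jacobi_matrix a b N x \<omega> =
     Matrix.mat N N (\<lambda>(i, j).
       if j = i then complex_of_real (a (x + real i * \<omega>))
       else if j = i + 1 then - b (x + real (i + 1) * \<omega>)
       else if i = j + 1 then - cnj (b (x + real (j + 1) * \<omega>))
       else 0)"

text \<open>
  The eigenvalues of the matrix in increasing order, repeated according to multiplicity; the list
  has length \<open>N\<close>. Taking real parts only changes the type: the matrix is Hermitian (see
  \<open>mset_jacobi_eigenvalues\<close>).
\<close>

definition jacobi_eigenvalues ::
  "(real \<Rightarrow> real) \<Rightarrow> (real \<Rightarrow> complex) \<Rightarrow> nat \<Rightarrow> real \<Rightarrow> real \<Rightarrow> real list" where
  "jacobi_eigenvalues a b N x \<omega> =
     sorted_list_of_multiset (image_mset Re (proots (char_poly (jacobi_matrix a b N x \<omega>))))"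

definition jacobi_E ::
  "(real \<Rightarrow> real) \<Rightarrow> (real \<Rightarrow> complex) \<Rightarrow> nat \<Rightarrow> nat \<Rightarrow> real \<Rightarrow> real \<Rightarrow> real" where
  "jacobi_E a b N j x \<omega> = jacobi_eigenvalues a b N x \<omega> ! (j - 1)"

definition transfer_step ::
  "(real \<Rightarrow> real) \<Rightarrow> (real \<Rightarrow> complex) \<Rightarrow> nat \<Rightarrow> real \<Rightarrow> real \<Rightarrow> real \<Rightarrow> complex^2^2" where
  "transfer_step a b j x \<omega> E =
     Finite_Cartesian_Product.mat (1 / b (x + real (j + 1) * \<omega>)) **
     vector [vector [complex_of_real (a (x + real j * \<omega>) - E), - cnj (b (x + real j * \<omega>))],
             vector [b (x + real (j + 1) * \<omega>), 0]]"

primrec transfer_matrix ::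
  "(real \<Rightarrow> real) \<Rightarrow> (real \<Rightarrow> complex) \<Rightarrow> nat \<Rightarrow> real \<Rightarrow> real \<Rightarrow> real \<Rightarrow> complex^2^2" where
  "transfer_matrix a b 0 x \<omega> E = Finite_Cartesian_Product.mat 1"
| "transfer_matrix a b (Suc n) x \<omega> E = transfer_step a b n x \<omega> E ** transfer_matrix a b n x \<omega> E"

text \<open>
  The zeros of \<open>b\<close> contribute only a null set of phases to the integral, so the conventions
  \<open>1 / 0 = 0\<close> and \<open>ln 0 = 0\<close> have no effect. The limit always exists, by subadditivity.
\<close>

definition lyapunov :: "(real \<Rightarrow> real) \<Rightarrow> (real \<Rightarrow> complex) \<Rightarrow> real \<Rightarrow> real \<Rightarrow> real" where
  "lyapunov a b \<omega> E =
     lim (\<lambda>N. 1 / real N *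
       (LINT x:{0..1}|lborel. ln (onorm (\<lambda>v. transfer_matrix a b N x \<omega> E *v v))))"

text \<open>
  \<open>mes_compl_le S u C\<close> renders ``mes S \<le> u, compl S \<le> C''.  Intervals may be of any
  kind, including degenerate ones; \<open>emeasure\<close> (rather than \<open>measure\<close>, which is \<open>0\<close> on sets of
  infinite measure) rules out unbounded ones.
\<close>

definition mes_compl_le :: "real set \<Rightarrow> real \<Rightarrow> real \<Rightarrow> bool" where
  "mes_compl_le S u C \<longleftrightarrow>
     (\<exists>\<I> :: real set set. finite \<I> \<and> real (card \<I>) \<le> C \<and> (\<forall>I\<in>\<I>. is_interval I) \<and>
        S \<subseteq> \<Union>\<I> \<and> emeasure lborel (\<Union>\<I>) \<le> ennreal u)"

lemma jacobi_matrix_carrier: "jacobi_matrix a b N x \<omega> \<in> carrier_mat N N"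
  by (simp add: jacobi_matrix_def)

lemma eigenvalue_jacobi_matrix_real:
  assumes "eigenvalue (jacobi_matrix a b N x \<omega>) e"
  shows "e \<in> \<real>"
proof -
  let ?H = "jacobi_matrix a b N x \<omega>"
  let ?h = "\<lambda>i j. ?H $$ (i, j)"
  have herm: "cnj (?h i j) = ?h j i" if "i < N" "j < N" for i j
    using that by (auto simp: jacobi_matrix_def)
  from assms obtain v where v: "v \<in> carrier_vec N" "v \<noteq> 0\<^sub>v N" "?H *\<^sub>v v = e \<cdot>\<^sub>v v"
    by (auto simp: eigenvalue_def eigenvector_def jacobi_matrix_def)
  define w where "w i = vec_index v i" for i
  have ev: "(\<Sum>j<N. ?h i j * w j) = e * w i" if "i < N" for i
  proof -
    have "vec_index (?H *\<^sub>v v) i = (\<Sum>j<N. ?h i j * w j)"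
      using that v(1) jacobi_matrix_carrier[of a b N x \<omega>]
      by (simp add: scalar_prod_def w_def atLeast0LessThan)
    then show ?thesis using v that by (simp add: w_def)
  qed
  define q where "q = (\<Sum>i<N. cnj (w i) * (\<Sum>j<N. ?h i j * w j))"
  define s where "s = (\<Sum>i<N. (cmod (w i))\<^sup>2)"
  have "q = (\<Sum>i<N. e * of_real ((cmod (w i))\<^sup>2))"
    unfolding q_def by (rule sum.cong) (simp_all add: ev complex_norm_square del: of_real_power)
  then have q_e: "q = e * of_real s"
    by (simp add: s_def sum_distrib_left)
  have "cnj q = (\<Sum>i<N. \<Sum>j<N. w i * ?h j i * cnj (w j))"
    by (simp add: q_def herm sum_distrib_left mult.assoc)
  also have "\<dots> = (\<Sum>j<N. \<Sum>i<N. w i * ?h j i * cnj (w j))"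
    by (rule sum.swap)
  also have "\<dots> = q"
    by (simp add: q_def sum_distrib_left mult_ac)
  finally have q_real: "cnj q = q" .
  obtain i where i: "i < N" "w i \<noteq> 0"
    using v(1,2) unfolding w_def by (metis carrier_vecD eq_vecI index_zero_vec(1) index_zero_vec(2))
  have "s > 0" unfolding s_def
    by (rule sum_pos2[of _ i]) (use i in auto)
  then have "cnj e = e" using q_real q_e by simp
  then show ?thesis by (simp add: Reals_cnj_iff)
qed

lemma mset_jacobi_eigenvalues:
  "image_mset complex_of_real (mset (jacobi_eigenvalues a b N x \<omega>)) =
     proots (char_poly (jacobi_matrix a b N x \<omega>))"
proof -
  let ?p = "char_poly (jacobi_matrix a b N x \<omega>)"
  have nz: "?p \<noteq> 0"
    using degree_monic_char_poly[OF jacobi_matrix_carrier[of a b N x \<omega>]] by auto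
  have "complex_of_real (Re e) = e" if "e \<in># proots ?p" for e
  proof -
    have "eigenvalue (jacobi_matrix a b N x \<omega>) e"
      using that nz eigenvalue_root_char_poly[OF jacobi_matrix_carrier[of a b N x \<omega>]] by simp
    then show ?thesis by (simp add: eigenvalue_jacobi_matrix_real)
  qed
  then have "image_mset (complex_of_real \<circ> Re) (proots ?p) = image_mset id (proots ?p)"
    by (intro image_mset_cong) simp
  then show ?thesis by (simp add: jacobi_eigenvalues_def multiset.map_comp)
qed

lemma length_jacobi_eigenvalues: "length (jacobi_eigenvalues a b N x \<omega>) = N"
proof -
  have "length (jacobi_eigenvalues a b N x \<omega>) =
      size (image_mset complex_of_real (mset (jacobi_eigenvalues a b N x \<omega>)))"
    by simp
  also have "\<dots> = N"
    unfolding mset_jacobi_eigenvalues size_proots_complex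
    using degree_monic_char_poly[OF jacobi_matrix_carrier[of a b N x \<omega>]] by simp
  finally show ?thesis .
qed

end

theory Submission
  imports Defs
    "HOL-Real_Asymp.Real_Asymp"
    "Jordan_Normal_Form.Schur_Decomposition"
begin

text \<open>
 Call a block of the operator resonant at energy \<open>E\<close> if one of its eigenvalues is very close to \<open>E\<close>. Since
 eigenvalues are Lipschitz in the phase and the frequency, a counting argument over nested grids shows
 that, off small sets of frequencies and energies, no block is resonant together with a translate of it by
 \<open>m\<close> sites, for \<open>m\<close> in a prescribed range.

 A non-resonant block has a determinant that is not much smaller than the supremum \<open>Phi\<close> of the
 determinants over all phases: if it were small at one phase, then (adding a small imaginary part to the
 energy, which gives Herglotz bounds for ratios of consecutive determinants) it would be small near a long
 piece of the orbit, and by a maximum principle everywhere. Submultiplicativity bounds the Lyapunov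
 exponent by \<open>ln Phi / n\<close> up to the mean of \<open>ln |b|\<close>, and at one of boundedly many scales \<open>ln Phi / n\<close> is
 almost stationary. At that scale Poisson's formula in a non-resonant block gives exponential decay of
 solutions. In the absence of double resonances the resonant blocks of an eigenvector of the whole
 operator are confined, first for blocks of length about \<open>ln N\<close> and then for blocks of length about
 \<open>(ln N) powr (1/100)\<close>, to a window so short that, away from the zeros of \<open>b\<close>, two eigenvectors with
 eigenvalues at distance \<open>1 / (N (ln N) powr p)\<close> have almost vanishing Wronskian there. They are then almost
 parallel, which contradicts their orthogonality.
\<close>

subsection \<open>Elimination of double resonances\<close>

text \<open>Two block lengths are forced. Off the resonant long blocks an eigenvector must be
  smaller than a power of 1/N, so their length is of order ln N; but across a window of that length
  the Wronskian recurrence loses a power of N. Short blocks of length l about (ln N) powr (1/100)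
  lead to a window of about l ^ 36 sites, where the loss is less than any power of N. Their
  resonances cannot be taken sharper than exp (- l powr (1/6)), the tolerance at which determinants
  are controlled, and excluding a double resonance at distance m needs a resolution below 1/m. So
  short blocks separate sites only up to a power of ln N, and the long blocks, at a resolution just
  above the gap to be proved, must first bring all sites into that range. The exponent 1/6 comes
  from the propagation of smallness: about n powr (1/5) nodes are affordable, with discs whose
  radius is a power of the tolerance. No large deviation estimate enters. All exceptional sets are
  bounded by a negative power of ln N, so the bound in ln (ln N) leaves room for every
  constant.\<close>

definition covers :: "real set => real => real => bool" where
 "covers Z n d \<longleftrightarrow> (\<exists>C. finite C \<and> real (card C) <= n \<and> Z \<subseteq> (\<Union>u\<in>C. {u..u + d}))"

lemma card_UN_le_bound:
 assumes "finite C" and "\<And>u. u \<in> C ==> real (card (D u)) <= n"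
 shows "real (card (\<Union>u\<in>C. D u)) <= real (card C) * n"
proof -
 have "real (card (\<Union>u\<in>C. D u)) <= real (\<Sum>u\<in>C. card (D u))" using card_UN_le[OF assms(1)] by (rule of_nat_mono)
 also have "... = (\<Sum>u\<in>C. real (card (D u)))" by simp
 also have "... <= real (card C) * n" using assms(2) by (rule sum_bounded_above)
 finally show ?thesis .
qed

lemma covers_empty: "0 <= n ==> covers {} n d" unfolding covers_def by (rule exI[of _ "{}"]) auto

lemma covers_mono: "covers Z n d ==> Z' \<subseteq> Z ==> n <= n' ==> covers Z' n' d" unfolding covers_def by (meson order_trans)

lemma covers_refine:
 assumes "covers Z n1 d1" and "\<And>u. covers (Z \<inter> {u..u + d1}) n2 d2" and "0 <= n2"
 shows "covers Z (n1 * n2) d2"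
proof -
 obtain C where C: "finite C" "real (card C) <= n1" "Z \<subseteq> (\<Union>u\<in>C. {u..u + d1})" using assms(1) unfolding covers_def by auto
 have "\<forall>u. \<exists>D. finite D \<and> real (card D) <= n2 \<and> Z \<inter> {u..u + d1} \<subseteq> (\<Union>v\<in>D. {v..v + d2})"
  using assms(2) unfolding covers_def by blast
 then obtain D where D: "\<And>u. finite (D u)" "\<And>u. real (card (D u)) <= n2"
  "\<And>u. Z \<inter> {u..u + d1} \<subseteq> (\<Union>v\<in>D u. {v..v + d2})" by metis
 have "real (card (\<Union>(D ` C))) <= real (card C) * n2" by (rule card_UN_le_bound[OF C(1) D(2)])
 also have "... <= n1 * n2" using C(2) assms(3) by (rule mult_right_mono)
 finally have c: "real (card (\<Union>(D ` C))) <= n1 * n2" .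
 have "Z \<subseteq> (\<Union>v\<in>\<Union>(D ` C). {v..v + d2})"
 proof
  fix w assume w: "w \<in> Z"
  then obtain u where u: "u \<in> C" "w \<in> {u..u + d1}" using C(3) by blast
  then obtain v where "v \<in> D u" "w \<in> {v..v + d2}" using D(3)[of u] w by blast
  thus "w \<in> (\<Union>v\<in>\<Union>(D ` C). {v..v + d2})" using u by blast
 qed
 thus ?thesis unfolding covers_def using c C(1) D(1) by blast
qed

lemma covers_unit_interval:
 assumes "0 < K" shows "covers {0..1} (real K) (1 / real K)"
proof -
 let ?C = "(\<lambda>i. real i / real K) ` {..<K}"
 have "{0..1::real} \<subseteq> (\<Union>u\<in>?C. {u..u + 1 / real K})"
 proof
  fix x :: real assume x: "x \<in> {0..1}"
  show "x \<in> (\<Union>u\<in>?C. {u..u + 1 / real K})"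
  proof (cases "x = 1")
   case True
   thus ?thesis using assms by (auto intro!: bexI[of _ "K - 1"] simp: field_simps of_nat_diff)
  next
   case False
   define i where "i = nat \<lfloor>x * real K\<rfloor>"
   have nn: "0 <= x * real K" using x by auto
   have i1: "real i <= x * real K" "x * real K < real i + 1" unfolding i_def using nn by linarith+
   have "x * real K < real K" using False x assms by auto
   hence "i < K" using i1(1) by linarith
   moreover have "real i / real K <= x" using i1 assms by (simp add: field_simps)
   moreover have "x <= real i / real K + 1 / real K" using i1 assms by (simp add: field_simps)
   ultimately show ?thesis by auto
  qed
 qed
 moreover have "card ?C <= K" using card_image_le[of "{..<K}" "\<lambda>i. real i / real K"] by simp
 ultimately show ?thesis unfolding covers_def by (intro exI[of _ ?C]) auto
qed

lemma card_int_interval_le: "p <= q + 1 ==> real (card {\<lceil>p::real\<rceil>..\<lfloor>q\<rfloor>}) <= q - p + 1"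
proof -
 assume pq: "p <= q + 1"
 have "card {\<lceil>p\<rceil>..\<lfloor>q\<rfloor>} = nat (\<lfloor>q\<rfloor> - \<lceil>p\<rceil> + 1)" by simp
 moreover have "real (nat k) <= r" if "real_of_int k <= r" "0 <= r" for k r using that by (cases "0 <= k") auto
 moreover have "real_of_int (\<lfloor>q\<rfloor> - \<lceil>p\<rceil> + 1) <= q - p + 1" by simp linarith
 ultimately show ?thesis using pq by (metis add.commute diff_ge_0_iff_ge diff_add_eq)
qed

text \<open>Markov's inequality for the multiplicity function of a family of intervals: its integral
  is the sum of the lengths, and it is at least \<open>k\<close> on \<open>S\<close>.\<close>

lemma markov_intervals:
 fixes u d :: "'i => real"
 assumes F: "finite F" and S: "S \<in> sets lborel" and d: "\<And>i. i \<in> F ==> 0 <= d i"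
  and k: "\<And>w. w \<in> S ==> k <= real (card {i\<in>F. w \<in> {u i..u i + d i}})" and "0 < k"
 shows "emeasure lborel S <= ennreal ((\<Sum>i\<in>F. d i) / k)"
proof -
 have "ennreal k * emeasure lborel S = (\<integral>\<^sup>+w. ennreal k * indicator S w \<partial>lborel)"
  using S by (simp add: nn_integral_cmult_indicator)
 also have "... <= (\<integral>\<^sup>+w. (\<Sum>i\<in>F. indicator {u i..u i + d i} w) \<partial>lborel)"
 proof (rule nn_integral_mono)
  fix w :: real
  have "(\<Sum>i\<in>F. indicator {u i..u i + d i} w :: ennreal) = of_nat (card {i\<in>F. w \<in> {u i..u i + d i}})"
   using F by (simp add: indicator_def sum.If_cases Int_def)
  also have "... = ennreal (real (card {i\<in>F. w \<in> {u i..u i + d i}}))" by (simp add: ennreal_of_nat_eq_real_of_nat)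
  finally show "ennreal k * indicator S w <= (\<Sum>i\<in>F. indicator {u i..u i + d i} w)" using k by (auto simp: indicator_def intro: ennreal_leI)
 qed
 also have "... = (\<Sum>i\<in>F. emeasure lborel {u i..u i + d i})" by (subst nn_integral_sum) auto
 also have "... = (\<Sum>i\<in>F. ennreal (d i))" using d by (intro sum.cong) auto
 also have "... = ennreal (\<Sum>i\<in>F. d i)" using d by (simp add: sum_ennreal)
 finally have *: "ennreal k * emeasure lborel S <= ennreal (\<Sum>i\<in>F. d i)" .
 have "emeasure lborel S = (ennreal (1/k) * ennreal k) * emeasure lborel S" using \<open>0 < k\<close> by (simp flip: ennreal_mult)
 also have "... <= ennreal (1/k) * ennreal (\<Sum>i\<in>F. d i)" unfolding mult.assoc using * by (rule mult_left_mono) simp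
 also have "... = ennreal ((\<Sum>i\<in>F. d i) / k)" using \<open>0 < k\<close> d by (simp flip: ennreal_mult add: sum_nonneg)
 finally show ?thesis .
qed

text \<open>What elimination uses of the block spectra: \<open>Sp x w\<close> stands for the
  eigenvalues of a block of length \<open>l\<close> at phase \<open>x\<close> and frequency
  \<open>w\<close>. The frequency enters the Lipschitz bound with the factor \<open>l\<close>
  because the phases \<open>x + k * w\<close> of the block move up to \<open>l\<close> times as fast
  as \<open>w\<close>.\<close>

locale resonance =
 fixes Sp :: "real => real => real set" and l :: nat and A :: real
 assumes finite_Sp: "finite (Sp x w)" and card_Sp: "card (Sp x w) <= l"
  and l_pos: "1 <= l" and A_ge: "1 <= A"
  and Sp_periodic: "Sp (x + 1) w = Sp x w"
  and Sp_lipschitz: "e \<in> Sp x w ==> \<exists>e'\<in>Sp x' w'. \<bar>e - e'\<bar> <= A * (\<bar>x - x'\<bar> + real l * \<bar>w - w'\<bar>)"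
begin

definition res :: "real => real => real => real => bool" where
 "res t x w E \<longleftrightarrow> (\<exists>e\<in>Sp x w. \<bar>e - E\<bar> <= t)"

text \<open>The number of resonant grid phases replaces the measure of the set of resonant phases.
  By \<open>card_not_good\<close> it is at most \<open>M\<close> for all but few energies, however
  fine the grid is.\<close>

definition bands :: "nat => real => real => real => nat set" where
 "bands J s w E = {j. j < J \<and> res (s / real J) (real j / real J) w E}"

definition double_res :: "nat => real => real => real => bool" where
 "double_res m t w E \<longleftrightarrow> (\<exists>x. res t x w E \<and> res t (x + real m * w) w E)"

lemma res_shift:
 assumes "res t x w E" and "t + A * (\<bar>x - x'\<bar> + real l * \<bar>w - w'\<bar>) + \<bar>E - E'\<bar> <= t'"
 shows "res t' x' w' E'"
proof -
 obtain e where e: "e \<in> Sp x w" "\<bar>e - E\<bar> <= t" using assms(1) unfolding res_def by auto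
 obtain e' where e': "e' \<in> Sp x' w'" "\<bar>e - e'\<bar> <= A * (\<bar>x - x'\<bar> + real l * \<bar>w - w'\<bar>)"
  using Sp_lipschitz[OF e(1)] by blast
 have "\<bar>e' - E'\<bar> <= \<bar>e - e'\<bar> + \<bar>e - E\<bar> + \<bar>E - E'\<bar>" by linarith
 thus ?thesis unfolding res_def using e e' assms(2) by (intro bexI[of _ e']) linarith+
qed

lemma res_add_nat: "res t (x + real k) w E = res t x w E"
proof (induction k)
 case (Suc k)
 have "Sp (x + real (Suc k)) w = Sp (x + real k) w" using Sp_periodic[of "x + real k" w] by (simp add: algebra_simps)
 thus ?case using Suc by (simp add: res_def)
qed simp

lemma res_add_int: "res t (x + of_int k) w E = res t x w E"
proof (cases "0 <= k")
 case True
 thus ?thesis using res_add_nat[of t x "nat k" w E] by simp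
next
 case False
 thus ?thesis using res_add_nat[of t "x + of_int k" "nat (- k)" w E] by simp
qed

text \<open>A resonant phase lies, modulo 1, less than one grid step to the right of a resonant grid
  point: the width \<open>s / J\<close> pays for this step and for the change of frequency.\<close>

lemma band_of:
 assumes "res t x w E" "0 < J" "t + A * (1 / real J + real l * \<bar>w - w'\<bar>) <= s / real J"
 obtains j k where "j \<in> bands J s w' E" "0 <= x - real j / real J - of_int k"
  "x - real j / real J - of_int k < 1 / real J"
proof -
 define i where "i = \<lfloor>x * real J\<rfloor>"
 define j where "j = nat (i mod int J)"
 define k where "k = i div int J"
 have J: "0 < real J" "0 < int J" using assms(2) by auto
 have j: "int j = i mod int J" unfolding j_def using J by simp
 have jJ: "j < J" using pos_mod_bound[OF J(2), of i] j by linarith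
 have ij: "i = k * int J + int j" unfolding j k_def by simp
 hence ir: "real_of_int i = of_int k * real J + real j" by (metis of_int_add of_int_mult of_int_of_nat_eq)
 have x1: "of_int i <= x * real J" "x * real J < of_int i + 1" unfolding i_def by linarith+
 have a: "0 <= x - real j / real J - of_int k" "x - real j / real J - of_int k < 1 / real J"
 proof -
  have "real j <= (x - of_int k) * real J" using x1(1) unfolding ir by (simp add: algebra_simps)
  hence "real j / real J <= x - of_int k" using J by (metis pos_divide_le_eq)
  thus "0 <= x - real j / real J - of_int k" by simp
  have "(x - of_int k) * real J < real j + 1" using x1(2) unfolding ir by (simp add: algebra_simps)
  hence "x - of_int k < (real j + 1) / real J" using J by (metis pos_less_divide_eq)
  thus "x - real j / real J - of_int k < 1 / real J" by (simp add: add_divide_distrib)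
 qed
 have "res t (x + of_int (- k)) w E" using assms(1) by (simp only: res_add_int)
 moreover have "A * (\<bar>x + of_int (- k) - real j / real J\<bar> + real l * \<bar>w - w'\<bar>) <= A * (1 / real J + real l * \<bar>w - w'\<bar>)"
  by (intro mult_left_mono add_right_mono) (use a A_ge in auto)
 ultimately have "res (s / real J) (real j / real J) w' E" using assms(3) by (elim res_shift) auto
 hence "j \<in> bands J s w' E" using jJ by (simp add: bands_def)
 thus ?thesis using that a by blast
qed

text \<open>If \<open>x\<close> and \<open>x + m * w\<close> are both resonant, they lie next to two
  bands \<open>i\<close> and \<open>j\<close>, so \<open>m * w\<close> is within
  \<open>1 / J\<close> of \<open>(j - i) / J\<close> modulo 1. As \<open>w\<close> varies over
  length \<open>d\<close>, about \<open>m * d\<close> integers are possible for each of the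
  \<open>M\<^sup>2\<close> pairs. The hypothesis on \<open>q\<close> makes \<open>Z\<close> so short
  that the bands of a single frequency \<open>w1\<close> serve for all of it.\<close>

lemma one_stage:
 assumes J: "0 < J" and m: "0 < m" and Z: "Z \<subseteq> {c..c + d}" and d: "0 <= d"
  and good: "\<And>w. w \<in> Z ==> real (card (bands J s w E)) <= M"
  and dbl: "\<And>w. w \<in> Z ==> double_res m t w E"
  and t: "t <= 1 / real J" and q: "A * real l * d <= q / real J" and s: "1 + A + q <= s"
 shows "covers Z (M\<^sup>2 * (real m * d + 3)) (2 / (real J * real m))"
proof (cases "Z = {}")
 case True
 thus ?thesis using d by (simp add: covers_empty)
next
 case False
 then obtain w1 where w1: "w1 \<in> Z" by blast
 define B where "B = bands J s w1 E"
 have finB: "finite B" unfolding B_def bands_def by simp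
 have cB: "real (card B) <= M" unfolding B_def using good[OF w1] .
 define p where "p i j = real m * c - (real j - real i) / real J - 1 / real J" for i j :: nat
 define r where "r i j = real m * (c + d) - (real j - real i) / real J + 1 / real J" for i j :: nat
 define f where "f i j k = ((real j - real i) / real J + of_int k - 1 / real J) / real m" for i j :: nat and k :: int
 define D where "D = (\<lambda>(i,j). f i j ` {\<lceil>p i j\<rceil>..\<lfloor>r i j\<rfloor>})"
 define C where "C = (\<Union>y\<in>B \<times> B. D y)"
 have J0: "0 < real J" "0 < real m" using J m by auto
 have J1: "1 / real J <= 1" using J by (simp add: field_simps)
 have cD: "real (card (D y)) <= real m * d + 3" for y
 proof -
  obtain i j where y: "y = (i,j)" by fastforce
  have "p i j <= r i j + 1" unfolding p_def r_def using d J0 by (simp add: algebra_simps)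
  hence "real (card {\<lceil>p i j\<rceil>..\<lfloor>r i j\<rfloor>}) <= r i j - p i j + 1" by (rule card_int_interval_le)
  also have "... <= real m * d + 3" unfolding p_def r_def using J1 by (simp add: algebra_simps)
  finally have "real (card {\<lceil>p i j\<rceil>..\<lfloor>r i j\<rfloor>}) <= real m * d + 3" .
  moreover have "card (D y) <= card {\<lceil>p i j\<rceil>..\<lfloor>r i j\<rfloor>}"
   unfolding D_def y by (simp only: prod.case) (rule card_image_le, simp)
  ultimately show ?thesis by linarith
 qed
 have "real (card C) <= real (card (B \<times> B)) * (real m * d + 3)" unfolding C_def by (rule card_UN_le_bound) (use finB cD in auto)
 also have "... = (real (card B))\<^sup>2 * (real m * d + 3)" by (simp add: card_cartesian_product power2_eq_square)
 also have "... <= M\<^sup>2 * (real m * d + 3)" using cB d by (intro mult_right_mono power_mono) auto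
 finally have cC: "real (card C) <= M\<^sup>2 * (real m * d + 3)" .
 have finC: "finite C" unfolding C_def D_def using finB by auto
 have "Z \<subseteq> (\<Union>u\<in>C. {u..u + 2 / (real J * real m)})"
 proof
  fix w assume w: "w \<in> Z"
  obtain x where x: "res t x w E" "res t (x + real m * w) w E" using dbl[OF w] unfolding double_res_def by auto
  have "w \<in> {c..c + d}" "w1 \<in> {c..c + d}" using Z w w1 by blast+
  hence ww: "\<bar>w - w1\<bar> <= d" by auto
  have "A * (1 / real J + real l * \<bar>w - w1\<bar>) <= A * (1 / real J + real l * d)" using ww A_ge by (intro mult_left_mono add_left_mono) auto
  also have "... <= A / real J + q / real J" using q by (simp add: algebra_simps)
  finally have "t + A * (1 / real J + real l * \<bar>w - w1\<bar>) <= (1 + A + q) / real J" using t by (simp add: add_divide_distrib)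
  also have "... <= s / real J" using s J0 by (simp add: divide_right_mono)
  finally have st: "t + A * (1 / real J + real l * \<bar>w - w1\<bar>) <= s / real J" .
  obtain i k where i: "i \<in> B" "0 <= x - real i / real J - of_int k" "x - real i / real J - of_int k < 1 / real J"
   using band_of[OF x(1) J st] unfolding B_def by blast
  obtain j k' where j: "j \<in> B" "0 <= x + real m * w - real j / real J - of_int k'"
   "x + real m * w - real j / real J - of_int k' < 1 / real J" using band_of[OF x(2) J st] unfolding B_def by blast
  define n where "n = k' - k"
  have n: "real m * w - (real j - real i) / real J - of_int n <= 1 / real J"
   "- (1 / real J) <= real m * w - (real j - real i) / real J - of_int n" unfolding n_def using i j by (simp_all add: diff_divide_distrib)
  have mw: "real m * c <= real m * w" "real m * w <= real m * (c + d)" using \<open>w \<in> {c..c + d}\<close> J0 by auto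
  have "p i j <= of_int n" "of_int n <= r i j" unfolding p_def r_def using n mw by linarith+
  hence "n \<in> {\<lceil>p i j\<rceil>..\<lfloor>r i j\<rfloor>}" by (auto simp: ceiling_le_iff le_floor_iff)
  hence "f i j n \<in> C" unfolding C_def D_def using i j by force
  moreover have "f i j n <= w" unfolding f_def using n J0 by (simp add: pos_divide_le_eq algebra_simps)
  moreover have "w <= f i j n + 2 / (real J * real m)"
  proof -
   have "f i j n + 2 / (real J * real m) = ((real j - real i) / real J + of_int n + 1 / real J) / real m"
    unfolding f_def using J0 by (simp add: field_simps)
   thus ?thesis using n J0 by (simp add: pos_le_divide_eq algebra_simps)
  qed
  ultimately show "w \<in> (\<Union>u\<in>C. {u..u + 2 / (real J * real m)})" by auto
 qed
 thus ?thesis unfolding covers_def using finC cC by blast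
qed

text \<open>Applied directly with the fine grid, \<open>one_stage\<close> would need intervals of
  length about \<open>1 / (l * J2)\<close>, hence \<open>J2\<close> at most \<open>m / l\<close> for
  a count of order \<open>m\<close>. After a first pass with \<open>J1\<close> the frequencies lie
  in intervals of length \<open>2 / (J1 * m)\<close>, on which the bands of a grid with
  \<open>J2\<close> up to \<open>m * J1 / l\<close> stay put. The total length
  \<open>40 * M ^ 4 / J2\<close> can then decay like the inverse square of \<open>m\<close>, and its
  sum over \<open>m\<close> can be small.\<close>

lemma two_stage:
 assumes J1: "0 < J1" and J2: "0 < J2" and Z: "Z \<subseteq> {0..1}"
  and good1: "\<And>w. w \<in> Z ==> real (card (bands J1 s w E)) <= M"
  and good2: "\<And>w. w \<in> Z ==> real (card (bands J2 s w E)) <= M"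
  and dbl: "\<And>w. w \<in> Z ==> double_res m t w E"
  and t: "t <= 1 / real J1" "t <= 1 / real J2" and s: "1 + 3 * A <= s" and M: "0 <= M"
  and m1: "l * J1 <= m" and m2: "l * J2 <= m * J1"
 shows "covers Z (20 * M ^ 4 * real m) (2 / (real J2 * real m))"
proof -
 \<comment> \<open>A change of frequency by \<open>d\<close> moves the phases of a block by at most
   one step of the \<open>J1\<close> grid.\<close>
 define d where "d = 1 / real (l * J1)"
 have lJ: "0 < l * J1" using J1 l_pos by simp
 hence m: "0 < m" using m1 by linarith
 have Jr: "0 < real J1" "0 < real J2" "0 < real m" "1 <= real J1" using J1 J2 m by auto
 have lr: "0 < real l" using l_pos by simp
 have c0: "covers Z (real (l * J1)) d" unfolding d_def using covers_unit_interval[OF lJ] Z by (rule covers_mono) simp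
 have "covers (Z \<inter> {u..u + d}) (M\<^sup>2 * (real m * d + 3)) (2 / (real J1 * real m))" for u
  by (rule one_stage[OF J1 m _ _ good1 dbl t(1), of _ u _ A])
    (use J1 lr s A_ge in \<open>auto simp: d_def\<close>)
 moreover have "M\<^sup>2 * (real m * d + 3) <= M\<^sup>2 * (4 * real m / real (l * J1))"
 proof -
  have "real (l * J1) <= real m" using m1 by linarith
  hence "3 <= 3 * (real m / real (l * J1))" using lJ by (simp add: field_simps)
  moreover have "4 * real m / real (l * J1) = real m * d + 3 * (real m / real (l * J1))" unfolding d_def by simp
  ultimately have "real m * d + 3 <= 4 * real m / real (l * J1)" by linarith
  thus ?thesis by (intro mult_left_mono) auto
 qed
 ultimately have "covers (Z \<inter> {u..u + d}) (M\<^sup>2 * (4 * real m / real (l * J1))) (2 / (real J1 * real m))" for u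
  by (meson covers_mono order_refl)
 hence c1: "covers Z (real (l * J1) * (M\<^sup>2 * (4 * real m / real (l * J1)))) (2 / (real J1 * real m))" by (intro covers_refine[OF c0]) auto
 have "covers (Z \<inter> {u..u + 2 / (real J1 * real m)}) (M\<^sup>2 * (real m * (2 / (real J1 * real m)) + 3)) (2 / (real J2 * real m))" for u
 proof (rule one_stage[OF J2 m _ _ good2 dbl t(2), of _ u _ "2 * A"])
  have "real l * real J2 <= real m * real J1" using m2 by (metis of_nat_le_iff of_nat_mult)
  hence "A * (real l * real J2) <= A * (real m * real J1)" using A_ge by (intro mult_left_mono) auto
  thus "A * real l * (2 / (real J1 * real m)) <= 2 * A / real J2" using Jr by (simp add: field_simps)
 qed (use J1 Jr s A_ge in auto)
 moreover have "M\<^sup>2 * (real m * (2 / (real J1 * real m)) + 3) <= M\<^sup>2 * 5" using Jr by (intro mult_left_mono) (auto simp: field_simps)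
 ultimately have "covers (Z \<inter> {u..u + 2 / (real J1 * real m)}) (M\<^sup>2 * 5) (2 / (real J2 * real m))" for u
  by (meson covers_mono order_refl)
 hence "covers Z (real (l * J1) * (M\<^sup>2 * (4 * real m / real (l * J1))) * (M\<^sup>2 * 5)) (2 / (real J2 * real m))"
  by (intro covers_refine[OF c1]) auto
 moreover have "real (l * J1) * (M\<^sup>2 * (4 * real m / real (l * J1))) * (M\<^sup>2 * 5) = 20 * M ^ 4 * real m"
  using lJ by (simp add: field_simps power4_eq_xxxx power2_eq_square)
 ultimately show ?thesis by metis
qed

lemma card_grid_near:
 assumes "0 < eps" "0 <= t"
 shows "real (card {g::nat. g < G \<and> \<bar>e - (E0 + real g * eps)\<bar> <= t}) <= 2 * t / eps + 1"
proof -
 let ?S = "{g::nat. g < G \<and> \<bar>e - (E0 + real g * eps)\<bar> <= t}"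
 have "int ` ?S \<subseteq> {\<lceil>(e - E0 - t) / eps\<rceil>..\<lfloor>(e - E0 + t) / eps\<rfloor>}"
  using assms by (auto simp: ceiling_le_iff le_floor_iff field_simps abs_le_iff)
 hence "card (int ` ?S) <= card {\<lceil>(e - E0 - t) / eps\<rceil>..\<lfloor>(e - E0 + t) / eps\<rfloor>}" by (rule card_mono[rotated]) simp
 moreover have "card (int ` ?S) = card ?S" by (rule card_image) (simp add: inj_on_def)
 moreover have "real (card {\<lceil>(e - E0 - t) / eps\<rceil>..\<lfloor>(e - E0 + t) / eps\<rfloor>}) <= (e - E0 + t) / eps - (e - E0 - t) / eps + 1"
  by (rule card_int_interval_le) (use assms in \<open>simp add: field_simps\<close>)
 moreover have "(e - E0 + t) / eps - (e - E0 - t) / eps + 1 = 2 * t / eps + 1" using assms by (simp add: field_simps)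
 ultimately show ?thesis by linarith
qed

text \<open>Double counting: summed over the energies, the number of bands is the sum over the grid
  phases of the number of energies close to one of at most \<open>l\<close> eigenvalues. As
  \<open>J * eps\<close> is at most 1, the result does not grow with \<open>J\<close>.\<close>

lemma card_not_good:
 assumes eps: "0 < eps" and J: "0 < J" "real J * eps <= 1" and s: "0 <= s" and M: "0 < M"
 shows "real (card {g::nat. g < G \<and> M < real (card (bands J s w (E0 + real g * eps)))}) <= real l * (2 * s + 1) / (M * eps)"
proof -
 let ?E = "\<lambda>g::nat. E0 + real g * eps"
 let ?S = "{g::nat. g < G \<and> M < real (card (bands J s w (?E g)))}"
 have J0: "0 < real J" using J by simp
 have one: "real (card {g. g < G \<and> res (s / real J) x w (?E g)}) <= real l * (2 * (s / real J) / eps + 1)" for x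
 proof -
  have "{g. g < G \<and> res (s / real J) x w (?E g)} \<subseteq> (\<Union>e\<in>Sp x w. {g. g < G \<and> \<bar>e - ?E g\<bar> <= s / real J})"
   by (auto simp: res_def)
  hence "card {g. g < G \<and> res (s / real J) x w (?E g)} <= card (\<Union>e\<in>Sp x w. {g. g < G \<and> \<bar>e - ?E g\<bar> <= s / real J})"
   by (rule card_mono[rotated]) (simp add: finite_Sp)
  hence "real (card {g. g < G \<and> res (s / real J) x w (?E g)}) <= real (card (\<Union>e\<in>Sp x w. {g. g < G \<and> \<bar>e - ?E g\<bar> <= s / real J}))"
   by simp
  also have "... <= real (card (Sp x w)) * (2 * (s / real J) / eps + 1)"
   by (rule card_UN_le_bound[OF finite_Sp]) (rule card_grid_near[OF eps], use s J0 in simp)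
  also have "... <= real l * (2 * (s / real J) / eps + 1)" using card_Sp eps s J0 by (intro mult_right_mono) auto
  finally show ?thesis .
 qed
 have "M * real (card ?S) = (\<Sum>g\<in>?S. M)" by simp
 also have "... <= (\<Sum>g\<in>?S. real (card (bands J s w (?E g))))" by (rule sum_mono) auto
 also have "... <= (\<Sum>g<G. real (card (bands J s w (?E g))))" by (rule sum_mono2) auto
 also have "... = (\<Sum>g<G. \<Sum>j<J. if res (s / real J) (real j / real J) w (?E g) then 1 else 0)" by (simp add: bands_def sum.If_cases Int_def)
 also have "... = (\<Sum>j<J. \<Sum>g<G. if res (s / real J) (real j / real J) w (?E g) then 1 else 0)" by (rule sum.swap)
 also have "... = (\<Sum>j<J. real (card {g. g < G \<and> res (s / real J) (real j / real J) w (?E g)}))" by (simp add: sum.If_cases Int_def)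
 also have "... <= (\<Sum>j<J. real l * (2 * (s / real J) / eps + 1))" by (rule sum_mono) (rule one)
 also have "... = real l * (2 * s + real J * eps) / eps" using J0 eps by (simp add: field_simps)
 also have "... <= real l * (2 * s + 1) / eps" using J(2) eps by (intro divide_right_mono mult_left_mono) auto
 finally show ?thesis using M eps by (simp add: field_simps)
qed


text \<open>Fubini's theorem in the form of counting. For a fixed energy and \<open>m\<close> the
  bad frequencies are few by \<open>two_stage\<close>; exchanging the order, outside a small set of
  frequencies at most a fraction \<open>\<nu>\<close> of a grid of energies is bad. Energies with
  too many bands are discarded separately, at each frequency, by \<open>card_not_good\<close>.
  Frequencies are removed in whole cells of a grid with \<open>H\<close> points, which bounds the
  complexity.\<close>

theorem elimination:
 fixes J1 J2 lev :: "nat => nat"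
 assumes eps: "0 < eps" and G: "0 < G" and \<nu>: "0 < \<nu>" and M: "0 < M"
  and fin: "finite Ls" "finite Ms" and lev: "\<And>m. m \<in> Ms ==> lev m \<in> Ls"
  and Jpos: "\<And>i. i \<in> Ls ==> 0 < J1 i \<and> 0 < J2 i"
  and Jeps: "\<And>i. i \<in> Ls ==> 4 * eps * real (J1 i) <= 1 \<and> 4 * eps * real (J2 i) <= 1"
  and Jm: "\<And>m. m \<in> Ms ==> l * J1 (lev m) <= m \<and> l * J2 (lev m) <= m * J1 (lev m) \<and> m <= mmax"
  and H: "0 < H" "A * real (l + mmax) <= eps * real H"
 shows "\<exists>C. finite C \<and> card C <= H \<and>
  emeasure lborel (\<Union>u\<in>C. {u..u + 1 / real H}) <= ennreal ((\<Sum>m\<in>Ms. 40 * M ^ 4 / real (J2 (lev m))) / \<nu>) \<and>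
  (\<forall>w\<in>{0..1} - (\<Union>u\<in>C. {u..u + 1 / real H}). \<exists>Bad \<subseteq> {..<G}.
    real (card Bad) <= \<nu> * real G + real (card Ls) * (2 * real l * (10 * A + 1) / (M * eps)) \<and>
    (\<forall>E. E0 <= E \<and> E < E0 + real G * eps \<and> (\<forall>g\<in>Bad. E \<notin> {E0 + real g * eps..E0 + real g * eps + eps}) -->
     (\<forall>m\<in>Ms. \<not> double_res m eps w E)))"
proof -
 define En where "En g = E0 + real g * eps" for g :: nat
 define s0 where "s0 = 1 + 3 * A"
 define good where "good s w e i \<longleftrightarrow> real (card (bands (J1 i) s w e)) <= M \<and> real (card (bands (J2 i) s w e)) <= M" for s w e i
 \<comment> \<open>The tolerance \<open>eps\<close> at the given energy becomes
   \<open>2 * eps\<close> at the grid energy and \<open>3 * eps\<close> at another frequency of the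
   same cell. The bound on the number of bands is imposed with the larger width
   \<open>s0 + 1\<close>, so that it survives with width \<open>s0\<close> at that other
   frequency.\<close>
 define n where "n w = {g. g < G \<and> (\<forall>i\<in>Ls. good (s0 + 1) w (En g) i) \<and> (\<exists>m\<in>Ms. double_res m (2 * eps) w (En g))}" for w
 define W where "W = {w\<in>{0..1}. \<nu> * real G < real (card (n w))}"
 define Z where "Z g m = {w\<in>{0..1}. good s0 w (En g) (lev m) \<and> double_res m (3 * eps) w (En g)}" for g m
 have J3: "3 * eps <= 1 / real (J1 i)" "3 * eps <= 1 / real (J2 i)" "eps <= 1 / real (J1 i)" "eps <= 1 / real (J2 i)" if "i \<in> Ls" for i
 proof -
  have J0: "0 < real (J1 i)" "0 < real (J2 i)" using Jpos[OF that] by auto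
  hence "0 < eps * real (J1 i)" "0 < eps * real (J2 i)" using eps by auto
  hence "3 * eps * real (J1 i) <= 1" "3 * eps * real (J2 i) <= 1" "eps * real (J1 i) <= 1" "eps * real (J2 i) <= 1" using Jeps[OF that] by linarith+
  thus "3 * eps <= 1 / real (J1 i)" "3 * eps <= 1 / real (J2 i)" "eps <= 1 / real (J1 i)" "eps <= 1 / real (J2 i)"
   using J0 by (simp_all add: pos_le_divide_eq)
 qed
 have "covers (Z g m) (20 * M ^ 4 * real m) (2 / (real (J2 (lev m)) * real m))" if m: "m \<in> Ms" for g m
  by (rule two_stage[of "J1 (lev m)" "J2 (lev m)" _ s0 "En g" M m "3 * eps"])
    (use Jpos[OF lev[OF m]] Jm[OF m] J3[OF lev[OF m]] M in \<open>auto simp: Z_def good_def s0_def\<close>)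
 hence ex: "m \<in> Ms ==> \<exists>D. finite D \<and> real (card D) <= 20 * M ^ 4 * real m \<and> Z g m \<subseteq> (\<Union>u\<in>D. {u..u + 2 / (real (J2 (lev m)) * real m)})" for g m
  unfolding covers_def by blast
 define D where "D g m = (SOME D. finite D \<and> real (card D) <= 20 * M ^ 4 * real m \<and> Z g m \<subseteq> (\<Union>u\<in>D. {u..u + 2 / (real (J2 (lev m)) * real m)}))" for g m
 have D: "finite (D g m)" "real (card (D g m)) <= 20 * M ^ 4 * real m"
  "Z g m \<subseteq> (\<Union>u\<in>D g m. {u..u + 2 / (real (J2 (lev m)) * real m)})" if "m \<in> Ms" for g m
  using someI_ex[OF ex[OF that, of g]] unfolding D_def by blast+
 define F where "F = (SIGMA g:{..<G}. SIGMA m:Ms. D g m)"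
 have finF: "finite F" unfolding F_def using fin D(1) by auto
 define u :: "nat \<times> nat \<times> real => real" where "u = (\<lambda>(g, m, v). v)"
 define d :: "nat \<times> nat \<times> real => real" where "d = (\<lambda>(g, m, v). 2 / (real (J2 (lev m)) * real m))"
 \<comment> \<open>Only cells that meet \<open>W\<close> are removed; \<open>count\<close> shows
   that the lower bound on the multiplicity holds on the whole of each such cell.\<close>
 define C where "C = (\<lambda>i. real i / real H) ` {i. i < H \<and> W \<inter> {real i / real H..real i / real H + 1 / real H} \<noteq> {}}"
 define S where "S = (\<Union>v\<in>C. {v..v + 1 / real H})"
 have finC: "finite C" and cardC: "card C <= H"
 proof -
  show "finite C" unfolding C_def by auto
  have "card C <= card {i. i < H \<and> W \<inter> {real i / real H..real i / real H + 1 / real H} \<noteq> {}}"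
   unfolding C_def by (rule card_image_le) simp
  also have "... <= card {..<H}" by (rule card_mono) auto
  finally show "card C <= H" by simp
 qed
 have H0: "0 < real H" using H by simp
 have move: "res t' x' w' e" if r: "res t x w e" and ww: "\<bar>w - w'\<bar> <= 1 / real H" and xx: "\<bar>x - x'\<bar> <= real mmax * (1 / real H)"
  and t: "t + eps <= t'" for t t' x x' w w' e
 proof (rule res_shift[OF r])
  have "A * (\<bar>x - x'\<bar> + real l * \<bar>w - w'\<bar>) <= A * (real mmax * (1 / real H) + real l * (1 / real H))"
   by (intro mult_left_mono add_mono) (use ww xx A_ge in auto)
  also have "... = A * real (l + mmax) / real H" by (simp add: algebra_simps add_divide_distrib)
  also have "... <= eps" using H H0 by (simp add: pos_divide_le_eq)
  finally show "t + A * (\<bar>x - x'\<bar> + real l * \<bar>w - w'\<bar>) + \<bar>e - e\<bar> <= t'" using t by simp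
 qed
 have count: "\<nu> * real G <= real (card {i\<in>F. w \<in> {u i..u i + d i}})" if w: "w \<in> S" for w
 proof -
  obtain i where i: "i < H" "W \<inter> {real i / real H..real i / real H + 1 / real H} \<noteq> {}"
   "w \<in> {real i / real H..real i / real H + 1 / real H}" using w unfolding S_def C_def by auto
  then obtain w1 where w1: "w1 \<in> W" "w1 \<in> {real i / real H..real i / real H + 1 / real H}" by blast
  have ww: "\<bar>w1 - w\<bar> <= 1 / real H" "\<bar>w - w1\<bar> <= 1 / real H" using i(3) w1(2) by auto
  have "real i + 1 <= real H" using i(1) by simp
  hence "(real i + 1) / real H <= 1" using H0 by simp
  hence w01: "w \<in> {0..1}" using i(3) by (auto simp: add_divide_distrib intro: order_trans[rotated])
  have "\<exists>m v. (g, m, v) \<in> F \<and> w \<in> {u (g, m, v)..u (g, m, v) + d (g, m, v)}" if g: "g \<in> n w1" for g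
  proof -
   obtain m where m: "m \<in> Ms" "double_res m (2 * eps) w1 (En g)" and gG: "g < G"
    and gd: "good (s0 + 1) w1 (En g) (lev m)" using g lev unfolding n_def by auto
   obtain x where x: "res (2 * eps) x w1 (En g)" "res (2 * eps) (x + real m * w1) w1 (En g)" using m(2) unfolding double_res_def by auto
   have "real m * \<bar>w1 - w\<bar> <= real mmax * (1 / real H)" using Jm[OF m(1)] ww by (intro mult_mono) auto
   hence "\<bar>(x + real m * w1) - (x + real m * w)\<bar> <= real mmax * (1 / real H)" by (simp add: abs_mult flip: right_diff_distrib)
   hence "res (3 * eps) (x + real m * w) w (En g)" using x(2) ww by (intro move[OF x(2)]) auto
   moreover have "res (3 * eps) x w (En g)" using ww by (intro move[OF x(1)]) auto
   ultimately have dr: "double_res m (3 * eps) w (En g)" unfolding double_res_def by auto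
   have b: "card (bands J s0 w (En g)) <= card (bands J (s0 + 1) w1 (En g))" if "eps <= 1 / real J" for J
   proof (rule card_mono)
    show "finite (bands J (s0 + 1) w1 (En g))" unfolding bands_def by simp
    have "res ((s0 + 1) / real J) y w1 (En g)" if "res (s0 / real J) y w (En g)" for y
     by (rule move[OF that]) (use \<open>eps <= 1 / real J\<close> ww in \<open>auto simp: add_divide_distrib\<close>)
    thus "bands J s0 w (En g) \<subseteq> bands J (s0 + 1) w1 (En g)" unfolding bands_def by blast
   qed
   have "good s0 w (En g) (lev m)" unfolding good_def
    using gd b[of "J1 (lev m)"] b[of "J2 (lev m)"] J3[OF lev[OF m(1)]] unfolding good_def by linarith
   hence "w \<in> Z g m" unfolding Z_def using dr w01 by simp
   then obtain v where "v \<in> D g m" "w \<in> {v..v + 2 / (real (J2 (lev m)) * real m)}" using D(3)[OF m(1)] by blast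
   thus ?thesis unfolding F_def u_def d_def using m gG by (intro exI[of _ m] exI[of _ v]) auto
  qed
  hence "n w1 \<subseteq> fst ` {i\<in>F. w \<in> {u i..u i + d i}}" by force
  hence "card (n w1) <= card (fst ` {i\<in>F. w \<in> {u i..u i + d i}})" by (rule card_mono[rotated]) (use finF in auto)
  also have "... <= card {i\<in>F. w \<in> {u i..u i + d i}}" by (rule card_image_le) (use finF in auto)
  finally show ?thesis using w1(1) unfolding W_def by auto
 qed
 have "(\<Sum>i\<in>F. d i) = (\<Sum>g<G. \<Sum>m\<in>Ms. \<Sum>v\<in>D g m. 2 / (real (J2 (lev m)) * real m))"
  unfolding F_def d_def by (subst sum.Sigma[symmetric], use fin D(1) in auto)+
 also have "... <= (\<Sum>g<G. \<Sum>m\<in>Ms. 40 * M ^ 4 / real (J2 (lev m)))"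
 proof (intro sum_mono)
  fix g m assume m: "m \<in> Ms"
  have "0 < l * J1 (lev m)" using l_pos Jpos[OF lev[OF m]] by simp
  hence m0: "0 < real m" using Jm[OF m] by linarith
  have "(\<Sum>v\<in>D g m. 2 / (real (J2 (lev m)) * real m)) = real (card (D g m)) * (2 / (real (J2 (lev m)) * real m))" by simp
  also have "... <= (20 * M ^ 4 * real m) * (2 / (real (J2 (lev m)) * real m))" using D(2)[OF m] by (intro mult_right_mono) auto
  also have "... = 40 * M ^ 4 / real (J2 (lev m))" using m0 by (simp add: field_simps)
  finally show "(\<Sum>v\<in>D g m. 2 / (real (J2 (lev m)) * real m)) <= 40 * M ^ 4 / real (J2 (lev m))" .
 qed
 also have "... = real G * (\<Sum>m\<in>Ms. 40 * M ^ 4 / real (J2 (lev m)))" by simp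
 finally have sumd: "(\<Sum>i\<in>F. d i) / (\<nu> * real G) <= (\<Sum>m\<in>Ms. 40 * M ^ 4 / real (J2 (lev m))) / \<nu>"
  using \<nu> G by (simp add: field_simps)
 have "emeasure lborel S <= ennreal ((\<Sum>i\<in>F. d i) / (\<nu> * real G))"
 proof (rule markov_intervals[OF finF _ _ count])
  show "S \<in> sets lborel" unfolding S_def using finC by auto
  show "0 <= d i" for i unfolding d_def by (auto split: prod.split)
 qed (use \<nu> G in auto)
 also have "... <= ennreal ((\<Sum>m\<in>Ms. 40 * M ^ 4 / real (J2 (lev m))) / \<nu>)" using sumd by (rule ennreal_leI)
 finally have meas: "emeasure lborel S <= ennreal ((\<Sum>m\<in>Ms. 40 * M ^ 4 / real (J2 (lev m))) / \<nu>)" .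
 have main: "\<exists>Bad \<subseteq> {..<G}.
    real (card Bad) <= \<nu> * real G + real (card Ls) * (2 * real l * (10 * A + 1) / (M * eps)) \<and>
    (\<forall>E. E0 <= E \<and> E < E0 + real G * eps \<and> (\<forall>g\<in>Bad. E \<notin> {E0 + real g * eps..E0 + real g * eps + eps}) -->
     (\<forall>m\<in>Ms. \<not> double_res m eps w E))" if w: "w \<in> {0..1} - S" for w
 proof -
  define Bd where "Bd J = {g. g < G \<and> M < real (card (bands J (s0 + 1) w (En g)))}" for J
  \<comment> \<open>An energy cell is bad through a double resonance or through too many bands at
    some level. Off the bad cells a double resonance at \<open>E\<close> would give one, with
    tolerance \<open>2 * eps\<close>, at the grid energy to its left.\<close>
  define Bad where "Bad = n w \<union> (\<Union>i\<in>Ls. Bd (J1 i) \<union> Bd (J2 i))"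
  have "w \<notin> W"
  proof
   assume "w \<in> W"
   obtain i where i: "i < H" "w \<in> {real i / real H..real i / real H + 1 / real H}"
   proof (cases "w = 1")
    case True
    thus ?thesis using that[of "H - 1"] H H0 by (simp add: field_simps of_nat_diff)
   next
    case False
    have nn: "0 <= w * real H" "w * real H < real H" using w False H0 by auto
    have "real (nat \<lfloor>w * real H\<rfloor>) <= w * real H" "w * real H <= real (nat \<lfloor>w * real H\<rfloor>) + 1" using nn by linarith+
    moreover from this have "nat \<lfloor>w * real H\<rfloor> < H" using nn by linarith
    ultimately show ?thesis using that[of "nat \<lfloor>w * real H\<rfloor>"] H0
     by (auto simp: pos_divide_le_eq pos_le_divide_eq simp flip: add_divide_distrib)
   qed
   hence "w \<in> S" using \<open>w \<in> W\<close> unfolding S_def C_def by blast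
   thus False using w by simp
  qed
  hence n1: "real (card (n w)) <= \<nu> * real G" using w unfolding W_def by auto
  have Bd: "real (card (Bd J)) <= real l * (10 * A + 1) / (M * eps)" if "0 < J" "4 * eps * real J <= 1" for J
  proof -
   have "0 <= eps * real J" "4 * (eps * real J) <= 1" using eps that by (auto simp: mult.assoc)
   hence "real J * eps <= 1" unfolding mult.commute[of "real J"] by linarith
   hence "real (card (Bd J)) <= real l * (2 * (s0 + 1) + 1) / (M * eps)"
    unfolding Bd_def En_def using card_not_good[OF eps that(1) _ _ M, of "s0 + 1" G w E0] A_ge by (simp add: s0_def)
   also have "... <= real l * (10 * A + 1) / (M * eps)" using A_ge M eps by (intro divide_right_mono mult_left_mono) (auto simp: s0_def)
   finally show ?thesis .
  qed
  have finBd: "finite (Bd J)" for J unfolding Bd_def by simp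
  have "real (card (Bd (J1 i) \<union> Bd (J2 i))) <= 2 * real l * (10 * A + 1) / (M * eps)" if i: "i \<in> Ls" for i
   using card_Un_le[of "Bd (J1 i)" "Bd (J2 i)"] Bd[of "J1 i"] Bd[of "J2 i"] Jpos[OF i] Jeps[OF i] by simp
  hence "real (card (\<Union>i\<in>Ls. Bd (J1 i) \<union> Bd (J2 i))) <= real (card Ls) * (2 * real l * (10 * A + 1) / (M * eps))"
   by (rule card_UN_le_bound[OF fin(1)])
  hence cB: "real (card Bad) <= \<nu> * real G + real (card Ls) * (2 * real l * (10 * A + 1) / (M * eps))"
   using card_Un_le[of "n w" "\<Union>i\<in>Ls. Bd (J1 i) \<union> Bd (J2 i)"] n1 unfolding Bad_def by linarith
  have "Bad \<subseteq> {..<G}" unfolding Bad_def n_def Bd_def by auto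
  moreover have "\<not> double_res m eps w E" if E: "E0 <= E" "E < E0 + real G * eps"
   and nb: "\<forall>g\<in>Bad. E \<notin> {E0 + real g * eps..E0 + real g * eps + eps}" and m: "m \<in> Ms" for E m
  proof
   assume "double_res m eps w E"
   then obtain x where x: "res eps x w E" "res eps (x + real m * w) w E" unfolding double_res_def by auto
   define g where "g = nat \<lfloor>(E - E0) / eps\<rfloor>"
   have q: "0 <= (E - E0) / eps" "(E - E0) / eps < real G" using E eps by (auto simp: pos_divide_less_eq)
   have g: "real g <= (E - E0) / eps" "(E - E0) / eps < real g + 1" unfolding g_def using q by linarith+
   have gG: "g < G" using g q by linarith
   have gE: "En g <= E" "E <= En g + eps" unfolding En_def using g eps by (auto simp: pos_le_divide_eq pos_divide_less_eq algebra_simps)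
   have "g \<notin> Bad" using nb gE unfolding En_def by auto
   moreover have "double_res m (2 * eps) w (En g)" unfolding double_res_def
    using gE by (intro exI[of _ x] conjI res_shift[OF x(1)] res_shift[OF x(2)]) auto
   hence "g \<notin> n w ==> g \<in> Bad" unfolding n_def Bad_def Bd_def good_def using gG m by (auto simp: not_le)
   ultimately show False unfolding Bad_def by blast
  qed
  ultimately show ?thesis using cB by blast
 qed
 show ?thesis by (rule exI[of _ C]) (use finC cardC meas main in \<open>auto simp flip: S_def\<close>)
qed

end

subsection \<open>Propagation of smallness\<close>

lemma power_div_fact_le_exp: "0 <= (x::real) ==> x ^ n / fact n <= exp x"
proof -
 assume x: "0 <= x"
 have "sum (\<lambda>k. x ^ k /\<^sub>R fact k) {n} <= (\<Sum>k. x ^ k /\<^sub>R fact k)"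
  by (rule sum_le_suminf) (use x summable_exp_generic[of x] in auto)
 thus ?thesis by (simp add: exp_def divide_inverse mult.commute)
qed

lemma prod_abs_diff_nat:
 assumes "j < M"
 shows "(\<Prod>i\<in>{..<M} - {j}. \<bar>real i - real j\<bar>) = fact j * fact (M - 1 - j)"
proof -
 have *: "(\<Prod>i\<in>{..<Suc (j + k)} - {j}. \<bar>real i - real j\<bar>) = fact j * fact k" for k
 proof (induction k)
  case 0
  have "{..<Suc (j + 0)} - {j} = {0..<j}" by auto
  moreover have "(\<Prod>i\<in>{0..<j}. \<bar>real i - real j\<bar>) = (\<Prod>i\<in>{0..<j}. real (j - i))"
   by (rule prod.cong) (auto simp: of_nat_diff)
  ultimately show ?case by (simp add: fact_prod_rev)
 next
  case (Suc k)
  have "{..<Suc (j + Suc k)} - {j} = insert (Suc (j + k)) ({..<Suc (j + k)} - {j})" by auto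
  moreover have "\<bar>real (Suc (j + k)) - real j\<bar> = real (Suc k)" by simp
  ultimately show ?case using Suc.IH by (simp add: algebra_simps)
 qed
 from *[of "M - 1 - j"] assms show ?thesis by simp
qed

lemma periodic_shift_int:
 assumes "\<And>z. \<bar>Im z\<bar> < y1 ==> F (z + 1) = F z" "\<bar>Im z\<bar> < y1"
 shows "F (z + of_int k) = F (z :: complex)"
proof -
 have nat: "F (w + of_nat n) = F w" if "\<bar>Im w\<bar> < y1" for n w
 proof (induction n)
  case (Suc n)
  thus ?case using assms(1)[of "w + of_nat n"] that by (simp add: algebra_simps)
 qed simp
 show ?thesis
 proof (cases "0 <= k")
  case True
  thus ?thesis using nat[OF assms(2), of "nat k"] by simp
 next
  case False
  thus ?thesis using nat[of "z + of_int k" "nat (- k)"] assms(2) by simp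
 qed
qed

text \<open>The factor in \<open>h\<close> equalises the bounds on the two boundary lines. It is not
  periodic, but its modulus depends on the imaginary part only, so the modulus of \<open>h\<close>
  is periodic and attains its maximum on one rectangle.\<close>

lemma periodic_three_lines_upper:
 fixes F :: "complex => complex"
 assumes holo: "F holomorphic_on {z. \<bar>Im z\<bar> < y1}" and y: "0 < y" "y < y1"
  and per: "\<And>z. \<bar>Im z\<bar> < y1 ==> F (z + 1) = F z"
  and bd: "\<And>z. \<bar>Im z\<bar> <= y ==> norm (F z) <= exp B"
  and S: "\<And>x::real. norm (F (of_real x)) <= exp S" and z: "0 <= Im z" "Im z <= y"
 shows "norm (F z) <= exp (S + (B - S) * Im z / y)"
proof -
 define lam where "lam = (B - S) / y"
 define h where "h z = F z * exp (\<i> * of_real lam * z)" for z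
 have nh: "norm (h z) = norm (F z) * exp (- (lam * Im z))" for z by (simp add: h_def norm_mult)
 have hholo: "h holomorphic_on {z. \<bar>Im z\<bar> < y1}" unfolding h_def by (intro holomorphic_intros holo)
 have hS0: "norm (h z) <= exp S" if "Im z = 0" for z
 proof -
  have "z = of_real (Re z)" using that by (simp add: complex_eq_iff)
  hence "norm (F z) <= exp S" using S[of "Re z"] by metis
  thus ?thesis using nh[of z] that by simp
 qed
 have hSy: "norm (h z) <= exp S" if "Im z = y" for z
 proof -
  have "norm (h z) <= exp B * exp (- (lam * y))" unfolding nh that using bd[of z] that y by (intro mult_right_mono) auto
  also have "... = exp S" unfolding lam_def using y by (simp flip: exp_add)
  finally show ?thesis .
 qed
 define K where "K = cbox 0 (Complex 1 y)"
 have Kin: "w \<in> K \<longleftrightarrow> 0 <= Re w \<and> Re w <= 1 \<and> 0 <= Im w \<and> Im w <= y" for w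
  unfolding K_def by (auto simp: in_cbox_complex_iff)
 have "continuous_on K (\<lambda>z. norm (h z))" by (intro continuous_intros continuous_on_subset[OF holomorphic_on_imp_continuous_on[OF hholo]])
    (use Kin y in auto)
 moreover have "0 \<in> K" using Kin y by simp
 ultimately obtain z0 where z0: "z0 \<in> K" "\<And>w. w \<in> K ==> norm (h w) <= norm (h z0)"
  using continuous_attains_sup[of K "\<lambda>z. norm (h z)"] unfolding K_def by (metis compact_cbox empty_iff)
 have max: "norm (h w) <= norm (h z0)" if "0 <= Im w" "Im w <= y" for w
 proof -
  define w' where "w' = w + of_int (- \<lfloor>Re w\<rfloor>)"
  have "0 <= Re w' \<and> Re w' <= 1" unfolding w'_def by simp linarith
  hence "w' \<in> K" unfolding Kin using that by (simp add: w'_def)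
  moreover have "F w' = F w" unfolding w'_def by (rule periodic_shift_int[where F = F, OF per]) (use that y in auto)
  moreover have "Im w' = Im w" by (simp add: w'_def)
  ultimately show ?thesis using z0(2)[of w'] unfolding nh by simp
 qed
 have "norm (h z0) <= exp S"
 proof (cases "Im z0 = 0 \<or> Im z0 = y")
  case True
  thus ?thesis using hS0 hSy by blast
 next
  case False
  \<comment> \<open>An interior maximum makes \<open>h\<close> constant on the open strip and, by
    continuity, equal to a value on the real line, where the bound is known.\<close>
  define T where "T = {z. 0 < Im z} \<inter> {z. Im z < y}"
  have T: "open T" "convex T" unfolding T_def
   by (auto intro!: open_Int convex_Int open_halfspace_Im_gt open_halfspace_Im_lt convex_halfspace_Im_gt convex_halfspace_Im_lt)
  have z0T: "z0 \<in> T" using False z0(1) Kin unfolding T_def by auto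
  have "h constant_on T"
  proof (rule maximum_modulus_principle[where U = T and \<xi> = z0])
   show "h holomorphic_on T" by (rule holomorphic_on_subset[OF hholo]) (use y in \<open>auto simp: T_def\<close>)
  qed (use T z0T max in \<open>auto simp: T_def intro: convex_connected\<close>)
  hence const: "h w = h z0" if "w \<in> T" for w using that z0T unfolding constant_on_def by metis
  have clT: "closure T \<subseteq> {z. \<bar>Im z\<bar> < y1}"
  proof -
   have "closure T \<subseteq> {z. 0 <= Im z} \<inter> {z. Im z <= y}"
    by (rule closure_minimal) (auto simp: T_def intro!: closed_Int closed_halfspace_Im_ge closed_halfspace_Im_le)
   hence "0 <= Im w" "Im w <= y" if "w \<in> closure T" for w using that by blast+
   thus ?thesis using y by force
  qed
  have "of_real (Re z0) \<in> closure T"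
  proof (rule closure_approachable[THEN iffD2], intro allI impI)
   fix e :: real assume e: "0 < e"
   have "Complex (Re z0) (min (e / 2) (y / 2)) \<in> T" using e y by (auto simp: T_def)
   moreover have "dist (Complex (Re z0) (min (e / 2) (y / 2))) (of_real (Re z0)) < e" using e y by (simp add: dist_norm complex_of_real_def cmod_def)
   ultimately show "\<exists>w\<in>T. dist w (of_real (Re z0)) < e" by blast
  qed
  hence "h (of_real (Re z0)) = h z0"
   using continuous_constant_on_closure[OF continuous_on_subset[OF holomorphic_on_imp_continuous_on[OF hholo] clT] const] by blast
  thus ?thesis using hS0[of "of_real (Re z0)"] by simp
 qed
 hence "norm (F z) * exp (- (lam * Im z)) <= exp S" using max[OF z] unfolding nh by simp
 hence "norm (F z) * exp (- (lam * Im z)) * exp (lam * Im z) <= exp S * exp (lam * Im z)" by (rule mult_right_mono) simp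
 thus ?thesis unfolding mult.assoc exp_add[symmetric] by (simp add: lam_def)
qed

lemma periodic_three_lines:
 fixes F :: "complex => complex"
 assumes holo: "F holomorphic_on {z. \<bar>Im z\<bar> < y1}" and y: "0 < y" "y < y1"
  and per: "\<And>z. \<bar>Im z\<bar> < y1 ==> F (z + 1) = F z"
  and bd: "\<And>z. \<bar>Im z\<bar> <= y ==> norm (F z) <= exp B"
  and S: "\<And>x::real. norm (F (of_real x)) <= exp S" and z: "\<bar>Im z\<bar> <= y"
 shows "norm (F z) <= exp (S + (B - S) * \<bar>Im z\<bar> / y)"
proof (cases "0 <= Im z")
 case True
 thus ?thesis using periodic_three_lines_upper[OF holo y per bd S] z by simp
next
 case False
 define G where "G z = F (- z)" for z
 have "norm (G (- z)) <= exp (S + (B - S) * Im (- z) / y)"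
 proof (rule periodic_three_lines_upper[of G y1 y])
  have "F \<circ> uminus holomorphic_on {z. \<bar>Im z\<bar> < y1}" by (rule holomorphic_on_compose_gen[OF _ holo]) (auto intro!: holomorphic_intros)
  thus "G holomorphic_on {z. \<bar>Im z\<bar> < y1}" unfolding G_def comp_def .
  show "G (w + 1) = G w" if "\<bar>Im w\<bar> < y1" for w using per[of "- w - 1"] that by (simp add: G_def)
  show "norm (G (of_real x)) <= exp S" for x using S[of "- x"] by (simp add: G_def)
 qed (use y bd z False in \<open>auto simp: G_def\<close>)
 thus ?thesis using False by (simp add: G_def)
qed

text \<open>For nodes spaced like integers the product of the distances to node \<open>j\<close> is
  a product of two factorials, at least \<open>fact (M - 1) / 2 ^ (M - 1)\<close>, times a power of
  the spacing. Since \<open>M ^ (M - 1)\<close> is at most \<open>exp M * fact (M - 1)\<close>, the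
  factors \<open>1 / M\<close> in the spacing cost only an exponential in \<open>M\<close>.\<close>

lemma node_polynomial_lower_bound:
 fixes y :: "nat => real" and z :: complex
 assumes j: "j < M" and R: "0 < R" "R <= 1" and sep: "\<And>i k. i < M ==> k < M ==> \<bar>real i - real k\<bar> * (R / (4 * real M)) <= \<bar>y i - y k\<bar>"
  and rho: "0 < rho" "rho <= R / (8 * real M)" and z: "norm (z - of_real (y j)) = rho"
 shows "rho * ((R / 16) ^ M * exp (- real M)) <= norm (\<Prod>i<M. z - of_real (y i))"
proof -
 define d where "d = R / (8 * real M)"
 have M: "0 < real M" using j by simp
 have d: "0 < d" unfolding d_def using R M by simp
 have "(\<Prod>i\<in>{..<M} - {j}. \<bar>real i - real j\<bar> * d) <= (\<Prod>i\<in>{..<M} - {j}. norm (z - of_real (y i)))"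
 proof (rule prod_mono)
  fix i assume i: "i \<in> {..<M} - {j}"
  have one: "1 <= \<bar>real i - real j\<bar>" using i by (cases "i < j") auto
  have "\<bar>y i - y j\<bar> = norm (complex_of_real (y i) - of_real (y j))" by (metis norm_of_real of_real_diff)
  also have "... <= norm (z - of_real (y i)) + norm (z - of_real (y j))"
   using norm_triangle_ineq4[of "z - complex_of_real (y j)" "z - of_real (y i)"] by (simp add: add.commute)
  finally have "\<bar>y i - y j\<bar> - rho <= norm (z - of_real (y i))" using z by simp
  moreover have "\<bar>real i - real j\<bar> * (R / (4 * real M)) = 2 * (\<bar>real i - real j\<bar> * d)" unfolding d_def by simp
  moreover have "rho <= \<bar>real i - real j\<bar> * d" using rho(2) one d mult_right_mono[OF one, of d] unfolding d_def by linarith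
  ultimately show "0 <= \<bar>real i - real j\<bar> * d \<and> \<bar>real i - real j\<bar> * d <= norm (z - of_real (y i))"
   using sep[of i j] i j d by auto
 qed
 hence "(fact j * fact (M - 1 - j)) * d ^ (M - 1) <= (\<Prod>i\<in>{..<M} - {j}. norm (z - of_real (y i)))"
  using prod_abs_diff_nat[OF j] j by (simp add: prod.distrib)
 moreover have "(R / 16) ^ M * exp (- real M) <= (fact j * fact (M - 1 - j)) * d ^ (M - 1)"
 proof -
  have "fact (M - 1) = fact j * fact (M - 1 - j) * ((M - 1) choose j)" using binomial_fact_lemma[of j "M - 1"] j by simp
  moreover have "(M - 1) choose j <= 2 ^ (M - 1)" by (rule binomial_le_pow2)
  ultimately have "fact (M - 1) <= fact j * fact (M - 1 - j) * (2::nat) ^ (M - 1)" by simp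
  hence f: "(fact (M - 1) :: real) <= fact j * fact (M - 1 - j) * 2 ^ (M - 1)"
   by (metis (mono_tags) of_nat_fact of_nat_le_iff of_nat_mult of_nat_numeral of_nat_power)
  have "real M ^ (M - 1) <= exp (real M) * fact (M - 1)" using power_div_fact_le_exp[of "real M" "M - 1"] by (simp add: pos_divide_le_eq)
  also have "... <= exp (real M) * (fact j * fact (M - 1 - j) * 2 ^ (M - 1))" using f by (intro mult_left_mono) auto
  finally have g: "real M ^ (M - 1) * exp (- real M) <= fact j * fact (M - 1 - j) * 2 ^ (M - 1)" by (simp add: exp_minus field_simps)
  have "(R / 16) ^ M <= (R / 16) ^ (M - 1)" by (rule power_decreasing) (use R in auto)
  hence "(R / 16) ^ M * exp (- real M) <= (R / 16) ^ (M - 1) * exp (- real M)" by (rule mult_right_mono) simp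
  also have "(R / 16) ^ (M - 1) = (d / 2) ^ (M - 1) * real M ^ (M - 1)" unfolding d_def using M by (simp flip: power_mult_distrib)
  also have "... * exp (- real M) <= (d / 2) ^ (M - 1) * (fact j * fact (M - 1 - j) * 2 ^ (M - 1))"
   unfolding mult.assoc[of "(d / 2) ^ (M - 1)"] using g d by (intro mult_left_mono) auto
  also have "... = (fact j * fact (M - 1 - j)) * d ^ (M - 1)" by (simp add: power_divide)
  finally show ?thesis .
 qed
 ultimately have "(R / 16) ^ M * exp (- real M) <= (\<Prod>i\<in>{..<M} - {j}. norm (z - of_real (y i)))" by linarith
 moreover have "norm (\<Prod>i<M. z - of_real (y i)) = rho * (\<Prod>i\<in>{..<M} - {j}. norm (z - of_real (y i)))"
  using prod.remove[of "{..<M}" j "\<lambda>i. norm (z - of_real (y i))"] j z by (simp add: prod_norm)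
 ultimately show ?thesis using rho(1) by (simp add: mult_left_mono)
qed

text \<open>
 Compare \<open>F\<close>, by the maximum principle, with a high power of the polynomial vanishing at the nodes.
\<close>

lemma smallness_propagates:
 fixes F :: "complex => complex" and y :: "nat => real"
 assumes holo: "F holomorphic_on {z. \<bar>Im z\<bar> < y1}" and y0: "0 < y0" "y0 < y1"
  and per: "\<And>z. \<bar>Im z\<bar> < y1 ==> F (z + 1) = F z"
  and bd: "\<And>z. \<bar>Im z\<bar> <= y0 ==> norm (F z) <= exp B"
  and S: "\<And>x::real. norm (F (of_real x)) <= exp S" and x': "norm (F (of_real x')) = exp S"
  and SB: "S <= B"
  and R: "0 < R" "R <= 1" "R <= y0" and M: "0 < M" and q: "0 < q"
  and nodes: "\<And>i. i < M ==> \<bar>y i - (x' - R / 4 + (real i + 1/2) * (R / (2 * real M)))\<bar> <= R / (16 * real M)"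
  and rho: "0 < rho" "rho <= R / (8 * real M)" "exp (- real M) <= rho"
  and small: "\<And>i z. i < M ==> norm (z - of_real (y i)) <= rho ==> norm (F z) <= exp A"
  and gain: "(B - S) * R / y0 < real q * real M"
 shows "S <= A + 4 * real q * real M"
proof (rule ccontr)
 assume neg: "\<not> S <= A + 4 * real q * real M"
 \<comment> \<open>The nodes are within \<open>R / 4\<close> of \<open>x'\<close> and at least
   \<open>3 * R / 4\<close> away from the outer circle. Relative to its value at \<open>x'\<close>,
   \<open>p ^ q\<close> is therefore larger there by \<open>3 ^ (q * M)\<close>, which by
   \<open>gain\<close> outweighs the growth that the three lines theorem allows for
   \<open>F\<close>. On the circles around the nodes \<open>p ^ q\<close> drops at most by the
   exponential of \<open>4 * q * M\<close>, the loss in the conclusion.\<close>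
 define p where "p z = (\<Prod>i<M. z - complex_of_real (y i))" for z
 define U where "U = ball (complex_of_real x') R - (\<Union>i<M. cball (of_real (y i)) rho)"
 define g where "g z = F z / p z ^ q" for z
 have M0: "0 < real M" using M by simp
 have AS: "A < S" using neg by (smt (verit) of_nat_0_le_iff mult_nonneg_nonneg)
 have near: "\<bar>y i - x'\<bar> <= R / 4" if "i < M" for i
 proof -
  define s where "s = R / (16 * real M)"
  have s: "0 <= s" "R / (2 * real M) = 8 * s" "R / 4 = 4 * (real M * s)" unfolding s_def using R M0 by (auto simp: field_simps)
  have "(real i + 1) * s <= real M * s" using that s(1) by (intro mult_right_mono) auto
  hence "real i * s + s <= real M * s" by (simp add: algebra_simps)
  moreover have "0 <= real i * s" using s(1) by simp
  moreover have "\<bar>y i - (x' - 4 * (real M * s) + (8 * (real i * s) + 4 * s))\<bar> <= s"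
   using nodes[OF that, folded s_def] unfolding s(2,3) by (simp add: algebra_simps)
  ultimately show ?thesis unfolding s(3) using s(1) by (simp only: abs_le_iff) linarith
 qed
 have sep: "\<bar>real i - real k\<bar> * (R / (4 * real M)) <= \<bar>y i - y k\<bar>" if "i < M" "k < M" for i k
 proof (cases "i = k")
  case False
  define s where "s = R / (16 * real M)"
  have s: "0 <= s" "R / (2 * real M) = 8 * s" "R / (4 * real M) = 4 * s" unfolding s_def using R M0 by (auto simp: field_simps)
  have ni: "\<bar>y i - (x' - R / 4 + (real i + 1/2) * (8 * s))\<bar> <= s" "\<bar>y k - (x' - R / 4 + (real k + 1/2) * (8 * s))\<bar> <= s"
   using nodes[OF that(1), folded s_def] nodes[OF that(2), folded s_def] unfolding s(2) by auto
  have "\<bar>(real i - real k) * (8 * s)\<bar> <= \<bar>y i - y k\<bar> + 2 * s" using ni by (auto simp: algebra_simps abs_le_iff)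
  hence a: "\<bar>real i - real k\<bar> * (8 * s) <= \<bar>y i - y k\<bar> + 2 * s" using s(1) by (simp add: abs_mult)
  have one: "1 <= \<bar>real i - real k\<bar>" using False by (cases "i < k") auto
  have "2 * s <= \<bar>real i - real k\<bar> * (4 * s)" using mult_right_mono[OF one, of "4 * s"] s(1) by linarith
  thus ?thesis using a unfolding s(3) by linarith
 qed simp
 have nz: "p z \<noteq> 0" if "\<And>i. i < M ==> z \<noteq> of_real (y i)" for z unfolding p_def using that by auto
 have openU: "open U" unfolding U_def by (intro open_Diff closed_UN) auto
 have clU: "closure U \<subseteq> cball (of_real x') R - (\<Union>i<M. ball (of_real (y i)) rho)"
  by (rule closure_minimal) (auto simp: U_def intro!: closed_Diff)
 have Ustrip: "cball (of_real x') R \<subseteq> {z. \<bar>Im z\<bar> <= y0}"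
 proof
  fix z assume "z \<in> cball (complex_of_real x') R"
  hence "norm (z - of_real x') <= R" by (simp add: dist_norm norm_minus_commute)
  thus "z \<in> {z. \<bar>Im z\<bar> <= y0}" using abs_Im_le_cmod[of "z - of_real x'"] R by simp
 qed
 have pnz: "p z \<noteq> 0" if "z \<in> closure U" for z
 proof (rule nz)
  fix i assume "i < M"
  hence "z \<notin> ball (of_real (y i)) rho" using that clU by blast
  thus "z \<noteq> of_real (y i)" using rho by auto
 qed
 have hol: "g holomorphic_on T" if "T \<subseteq> {z. \<bar>Im z\<bar> < y1}" "\<And>z. z \<in> T ==> p z \<noteq> 0" for T
  unfolding g_def using that(2) unfolding p_def by (intro holomorphic_intros holomorphic_on_subset[OF holo that(1)]) auto
 have clstrip: "closure U \<subseteq> {z. \<bar>Im z\<bar> < y1}"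
 proof -
  have "closure U \<subseteq> {z. \<bar>Im z\<bar> <= y0}" using clU Ustrip by blast
  thus ?thesis using y0 by auto
 qed
 \<comment> \<open>Were \<open>x'\<close> in one of the small discs, \<open>small\<close> would give
   \<open>S <= A\<close>, against the negated conclusion.\<close>
 have xU: "of_real x' \<in> U"
 proof -
  have "norm (complex_of_real x' - of_real (y i)) > rho" if "i < M" for i
  proof (rule ccontr)
   assume "\<not> norm (complex_of_real x' - of_real (y i)) > rho"
   hence "exp S <= exp A" using small[OF that, of "of_real x'"] x' by simp
   thus False using AS by simp
  qed
  thus ?thesis unfolding U_def using R by (force simp: dist_norm norm_minus_commute)
 qed
 define v where "v = exp S / (R / 4) ^ (q * M)"
 have q0: "0 < real q * real M" using q M by simp
 have onU: "norm (g z) <= v * max (exp ((B - S) * R / y0 - real q * real M)) (exp (A - S + 4 * real q * real M))" if z: "z \<in> frontier U" for z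
 proof -
  have zc: "z \<in> closure U" "z \<notin> U" using z openU by (auto simp: frontier_def interior_open)
  hence zb: "z \<in> cball (of_real x') R" "\<And>i. i < M ==> z \<notin> ball (of_real (y i)) rho" using clU by auto
  have zpos: "norm (z - of_real x') <= R" using zb(1) by (simp add: dist_norm norm_minus_commute)
  consider "norm (z - of_real x') = R" | j where "j < M" "norm (z - of_real (y j)) = rho"
  proof (cases "norm (z - of_real x') = R")
   case False
   hence "z \<in> ball (of_real x') R" using zpos by (simp add: dist_norm norm_minus_commute)
   then obtain j where j: "j < M" "z \<in> cball (of_real (y j)) rho" using zc(2) unfolding U_def by auto
   thus ?thesis using that(2)[of j] zb(2)[OF j(1)] by (auto simp: dist_norm norm_minus_commute)
  qed (use that in auto)
  thus ?thesis
  proof cases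
   case 1
   have "norm (F z) <= exp (S + (B - S) * \<bar>Im z\<bar> / y0)" using periodic_three_lines[OF holo y0 per bd S, of z] zb(1) Ustrip by blast
   also have "... <= exp (S + (B - S) * R / y0)"
   proof -
    have "\<bar>Im z\<bar> <= R" using abs_Im_le_cmod[of "z - of_real x'"] zpos by simp
    thus ?thesis using SB y0 by (auto intro!: divide_right_mono mult_left_mono)
   qed
   finally have F1: "norm (F z) <= exp (S + (B - S) * R / y0)" .
   have "(3 * R / 4) ^ M <= norm (p z)"
   proof -
    have "(\<Prod>i<M. 3 * R / 4) <= (\<Prod>i<M. norm (z - complex_of_real (y i)))"
    proof (rule prod_mono)
     fix i assume "i \<in> {..<M}"
     hence "norm (complex_of_real (y i) - of_real x') <= R / 4" using near[of i] by (metis lessThan_iff norm_of_real of_real_diff real_norm_def)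
     moreover have "R <= norm (z - of_real (y i)) + norm (complex_of_real (y i) - of_real x')"
      using norm_triangle_ineq[of "z - of_real (y i)" "complex_of_real (y i) - of_real x'"] 1 by simp
     ultimately show "0 <= 3 * R / 4 \<and> 3 * R / 4 <= norm (z - complex_of_real (y i))" using R by simp
    qed
    thus ?thesis unfolding p_def by (simp add: prod_norm)
   qed
   hence p1: "((3 * R / 4) ^ M) ^ q <= norm (p z) ^ q" by (rule power_mono) (use R in auto)
   have e3: "exp (real q * real M) <= 3 ^ (q * M)"
   proof -
    have "exp (real q * real M) = exp 1 ^ (q * M)" by (simp flip: exp_of_nat_mult)
    also have "... <= 3 ^ (q * M)" by (intro power_mono exp_le) auto
    finally show ?thesis .
   qed
   have "norm (g z) = norm (F z) / norm (p z) ^ q" unfolding g_def by (simp add: norm_divide norm_power)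
   also have "... <= exp (S + (B - S) * R / y0) / ((3 * R / 4) ^ M) ^ q" using F1 p1 R by (intro frac_le) auto
   also have "((3 * R / 4) ^ M) ^ q = 3 ^ (q * M) * (R / 4) ^ (q * M)"
    by (simp add: power_mult[symmetric] mult.commute[of M] flip: power_mult_distrib)
   also have "exp (S + (B - S) * R / y0) / (3 ^ (q * M) * (R / 4) ^ (q * M)) <= exp (S + (B - S) * R / y0) / (exp (real q * real M) * (R / 4) ^ (q * M))"
    using e3 R by (intro divide_left_mono mult_right_mono) auto
   also have "... = v * exp ((B - S) * R / y0 - real q * real M)" unfolding v_def by (simp add: exp_diff exp_add)
   also have "... <= v * max (exp ((B - S) * R / y0 - real q * real M)) (exp (A - S + 4 * real q * real M))"
    unfolding v_def using R by (intro mult_left_mono) auto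
   finally show ?thesis .
  next
   case 2
   have F1: "norm (F z) <= exp A" using small[OF 2(1), of z] 2(2) by simp
   have "exp (- real M) * ((R / 16) ^ M * exp (- real M)) <= rho * ((R / 16) ^ M * exp (- real M))" using rho R by (intro mult_right_mono) auto
   also have "... <= norm (p z)" unfolding p_def by (rule node_polynomial_lower_bound[OF 2(1) R(1,2) sep rho(1,2) 2(2)])
   also have "exp (- real M) * ((R / 16) ^ M * exp (- real M)) = (R / 16) ^ M * exp (- (2 * real M))" by (simp add: mult_ac mult_exp_exp)
   finally have p0: "(R / 16) ^ M * exp (- (2 * real M)) <= norm (p z)" .
   have "(R / 4) ^ M * exp (- (4 * real M)) <= (R / 16) ^ M * exp (- (2 * real M))"
   proof -
    have "(4::real) <= exp 2"
    proof -
     have "(2::real) <= exp 1" using exp_ge_add_one_self[of 1] by simp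
     hence "(2::real) ^ 2 <= exp 1 ^ 2" by (rule power_mono) simp
     thus ?thesis by (simp flip: exp_of_nat_mult)
    qed
    hence "(4::real) ^ M <= exp 2 ^ M" by (rule power_mono) simp
    also have "exp (2::real) ^ M = exp (2 * real M)" by (simp flip: exp_of_nat_mult add: mult.commute)
    finally have "4 ^ M * exp (- (4 * real M)) <= exp (2 * real M) * exp (- (4 * real M))" by (rule mult_right_mono) simp
    hence a: "4 ^ M * exp (- (4 * real M)) <= exp (- (2 * real M))" by (simp flip: exp_add)
    have b: "(R / 4) ^ M = (R / 16) ^ M * 4 ^ M" by (simp flip: power_mult_distrib)
    show ?thesis unfolding b mult.assoc by (intro mult_left_mono a) (use R in auto)
   qed
   with p0 have "(R / 4) ^ M * exp (- (4 * real M)) <= norm (p z)" by linarith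
   hence p1: "((R / 4) ^ M * exp (- (4 * real M))) ^ q <= norm (p z) ^ q" by (rule power_mono) (use R in auto)
   have "norm (g z) = norm (F z) / norm (p z) ^ q" unfolding g_def by (simp add: norm_divide norm_power)
   also have "... <= exp A / ((R / 4) ^ M * exp (- (4 * real M))) ^ q" using F1 p1 R by (intro frac_le) auto
   also have "((R / 4) ^ M * exp (- (4 * real M))) ^ q = (R / 4) ^ (q * M) * exp (- (4 * real q * real M))"
   proof -
    have "exp (- (4 * real M)) ^ q = exp (real q * (- (4 * real M)))" by (rule exp_of_nat_mult[symmetric])
    also have "real q * (- (4 * real M)) = - (4 * real q * real M)" by simp
    finally have "exp (- (4 * real M)) ^ q = exp (- (4 * real q * real M))" .
    moreover have "((R / 4) ^ M) ^ q = (R / 4) ^ (q * M)" by (metis power_mult mult.commute)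
    ultimately show ?thesis by (simp only: power_mult_distrib)
   qed
   also have "exp A / ((R / 4) ^ (q * M) * exp (- (4 * real q * real M))) = v * exp (A - S + 4 * real q * real M)"
    unfolding v_def by (simp add: exp_diff exp_add exp_minus field_simps)
   also have "... <= v * max (exp ((B - S) * R / y0 - real q * real M)) (exp (A - S + 4 * real q * real M))"
    unfolding v_def using R by (intro mult_left_mono) auto
   finally show ?thesis .
  qed
 qed
 have bU: "bounded U" by (rule bounded_subset[OF bounded_ball[of "of_real x'" R]]) (auto simp: U_def)
 have g1: "norm (g (of_real x')) <= v * max (exp ((B - S) * R / y0 - real q * real M)) (exp (A - S + 4 * real q * real M))"
 proof (rule maximum_modulus_frontier[OF _ _ bU onU xU])
  show "g holomorphic_on interior U" by (rule hol) (use clstrip pnz closure_subset interior_subset in blast)+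
  show "continuous_on (closure U) g" by (rule holomorphic_on_imp_continuous_on[OF hol]) (use clstrip pnz in auto)
 qed
 have pp: "p (of_real x') \<noteq> 0" using pnz xU closure_subset by blast
 have "norm (p (of_real x')) <= (R / 4) ^ M"
 proof -
  have "norm (complex_of_real x' - of_real (y i)) <= R / 4" if "i < M" for i
   using near[OF that] by (metis abs_minus_commute norm_of_real of_real_diff real_norm_def)
  hence "(\<Prod>i<M. norm (complex_of_real x' - complex_of_real (y i))) <= (\<Prod>i<M. R / 4)" by (intro prod_mono) auto
  thus ?thesis unfolding p_def by (simp add: prod_norm)
 qed
 hence "norm (p (of_real x')) ^ q <= ((R / 4) ^ M) ^ q" by (rule power_mono) simp
 also have "... = (R / 4) ^ (q * M)" by (simp add: power_mult[symmetric] mult.commute)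
 finally have "v <= exp S / norm (p (of_real x')) ^ q" unfolding v_def using pp R by (intro divide_left_mono) auto
 also have "... = norm (g (of_real x'))" unfolding g_def using x' by (simp add: norm_divide norm_power)
 finally have "v * 1 <= v * max (exp ((B - S) * R / y0 - real q * real M)) (exp (A - S + 4 * real q * real M))" using g1 by linarith
 moreover have "0 < v" unfolding v_def using R by simp
 ultimately have "1 <= max (exp ((B - S) * R / y0 - real q * real M)) (exp (A - S + 4 * real q * real M))" by (metis mult_le_cancel_left_pos)
 hence "0 <= (B - S) * R / y0 - real q * real M \<or> 0 <= A - S + 4 * real q * real M" by (auto simp: le_max_iff_disj)
 thus False using gain neg by linarith
qed

subsection \<open>Finite Jacobi operators\<close>

definition jacobi_op :: "(int => real) => (int => complex) => (int => complex) => int => complex" where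
 "jacobi_op A B psi k = of_real (A k) * psi k - B (k + 1) * psi (k + 1) - cnj (B k) * psi (k - 1)"

text \<open>Vectors of a block are functions on all integers that vanish outside it. The Dirichlet
  condition at the block ends is then built in, and blocks are compared by translation.\<close>

definition vanishes_off :: "nat => (int => complex) => bool" where
 "vanishes_off n psi \<longleftrightarrow> (\<forall>k. k \<notin> {0..<int n} --> psi k = 0)"

definition inner_n :: "nat => (int => complex) => (int => complex) => complex" where
 "inner_n n phi psi = (\<Sum>k\<in>{0..<int n}. cnj (phi k) * psi k)"

definition norm2_n :: "nat => (int => complex) => real" where
 "norm2_n n psi = (\<Sum>k\<in>{0..<int n}. (cmod (psi k))\<^sup>2)"

lemma sum_int_shift:
 fixes f :: "int => 'a::comm_monoid_add"
 assumes "f 0 = 0" "f (int n) = 0"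
 shows "(\<Sum>k\<in>{0..<int n}. f (k + 1)) = (\<Sum>k\<in>{0..<int n}. f k)"
proof -
 have "(\<Sum>k\<in>{0..<int n}. f (k + 1)) = (\<Sum>k\<in>{1..<int n + 1}. f k)"
  by (rule sum.reindex_bij_witness[of _ "\<lambda>k. k - 1" "\<lambda>k. k + 1"]) auto
 also have "... = (\<Sum>k\<in>{1..<int n}. f k)" by (rule sum.mono_neutral_right) (use assms in \<open>auto simp: not_less intro: antisym\<close>)
 also have "... = (\<Sum>k\<in>{0..<int n}. f k)"
 proof (rule sum.mono_neutral_left)
  have "k = 0" if "k \<in> {0..<int n} - {1..<int n}" for k using that by auto
  thus "\<forall>i\<in>{0..<int n} - {1..<int n}. f i = 0" using assms(1) by blast
 qed auto
 finally show ?thesis .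
qed

lemma inner_jacobi_op:
 assumes "vanishes_off n phi" "vanishes_off n psi"
 shows "inner_n n phi (jacobi_op A B psi) = inner_n n (jacobi_op A B phi) psi"
proof -
 have z: "phi (- 1) = 0" "psi (- 1) = 0" "phi (int n) = 0" "psi (int n) = 0" using assms by (auto simp: vanishes_off_def)
 have 1: "(\<Sum>k\<in>{0..<int n}. B (k + 1) * cnj (phi (k + 1 - 1)) * psi (k + 1)) = (\<Sum>k\<in>{0..<int n}. B k * cnj (phi (k - 1)) * psi k)"
  by (rule sum_int_shift) (use z in auto)
 have 2: "(\<Sum>k\<in>{0..<int n}. cnj (B (k + 1)) * cnj (phi (k + 1)) * psi (k + 1 - 1)) = (\<Sum>k\<in>{0..<int n}. cnj (B k) * cnj (phi k) * psi (k - 1))"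
  by (rule sum_int_shift) (use z in auto)
 have "inner_n n phi (jacobi_op A B psi) = (\<Sum>k\<in>{0..<int n}. of_real (A k) * cnj (phi k) * psi k)
   - (\<Sum>k\<in>{0..<int n}. B (k + 1) * cnj (phi (k + 1 - 1)) * psi (k + 1)) - (\<Sum>k\<in>{0..<int n}. cnj (B k) * cnj (phi k) * psi (k - 1))"
  unfolding inner_n_def jacobi_op_def by (simp add: algebra_simps sum.distrib sum_subtractf)
 moreover have "inner_n n (jacobi_op A B phi) psi = (\<Sum>k\<in>{0..<int n}. of_real (A k) * cnj (phi k) * psi k)
   - (\<Sum>k\<in>{0..<int n}. cnj (B (k + 1)) * cnj (phi (k + 1)) * psi (k + 1 - 1)) - (\<Sum>k\<in>{0..<int n}. B k * cnj (phi (k - 1)) * psi k)"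
  unfolding inner_n_def jacobi_op_def by (simp add: algebra_simps sum.distrib sum_subtractf)
 ultimately show ?thesis unfolding 1 2 by simp
qed

lemma inner_n_self: "inner_n n psi psi = of_real (norm2_n n psi)" unfolding inner_n_def norm2_n_def of_real_sum
 by (rule sum.cong) (simp_all add: complex_norm_square mult.commute del: of_real_power)

lemma norm2_n_nonneg: "0 <= norm2_n n psi" unfolding norm2_n_def by (simp add: sum_nonneg)

lemma norm2_n_pos: "psi k \<noteq> 0 ==> k \<in> {0..<int n} ==> 0 < norm2_n n psi" unfolding norm2_n_def by (rule sum_pos2[of _ k]) auto

lemma norm2_n_pos_iff: "0 < norm2_n n psi \<longleftrightarrow> (\<exists>k\<in>{0..<int n}. psi k \<noteq> 0)"
proof
 show "\<exists>k\<in>{0..<int n}. psi k \<noteq> 0 ==> 0 < norm2_n n psi" using norm2_n_pos by blast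
 show "0 < norm2_n n psi ==> \<exists>k\<in>{0..<int n}. psi k \<noteq> 0"
 proof (rule ccontr)
  assume "0 < norm2_n n psi" "\<not> (\<exists>k\<in>{0..<int n}. psi k \<noteq> 0)"
  hence "norm2_n n psi = 0" unfolding norm2_n_def by (intro sum.neutral) auto
  thus False using \<open>0 < norm2_n n psi\<close> by simp
 qed
qed

lemma norm2_n_scale: "norm2_n n (\<lambda>k. c * psi k) = (cmod c)\<^sup>2 * norm2_n n psi"
 unfolding norm2_n_def by (simp add: norm_mult power_mult_distrib sum_distrib_left)

lemma jacobi_op_scale: "jacobi_op A B (\<lambda>k. c * psi k) k = c * jacobi_op A B psi k" unfolding jacobi_op_def by (simp add: algebra_simps)

text \<open>A minimiser of the norm of \<open>(H - E)psi\<close> on the unit sphere is an eigenvector of \<open>(H - E)\<^sup>2\<close>.\<close>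

lemma approx_eigenvector:
 assumes supp: "vanishes_off n psi" and pos: "0 < norm2_n n psi" and t: "0 <= t"
  and approx: "norm2_n n (\<lambda>k. jacobi_op A B psi k - of_real E * psi k) <= t\<^sup>2 * norm2_n n psi"
 shows "\<exists>e phi. \<bar>e - E\<bar> <= t \<and> vanishes_off n phi \<and> 0 < norm2_n n phi \<and>
  (\<forall>k\<in>{0..<int n}. jacobi_op A B phi k = of_real e * phi k)"
proof -
 define T where "T phi k = (if k \<in> {0..<int n} then jacobi_op A B phi k - of_real E * phi k else 0)" for phi k
 define Q where "Q phi = norm2_n n (T phi)" for phi
 define K where "K = {phi. vanishes_off n phi \<and> norm2_n n phi = 1}"
 have T_supp: "vanishes_off n (T phi)" for phi by (simp add: T_def vanishes_off_def)
 have T_scale: "T (\<lambda>k. c * xi k) = (\<lambda>k. c * T xi k)" for c xi by (rule ext) (simp add: T_def jacobi_op_scale algebra_simps)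
 have T_add: "T (\<lambda>k. xi k + c * \<eta> k) k = T xi k + c * T \<eta> k" for c xi \<eta> k
  by (simp add: T_def jacobi_op_def algebra_simps)
 have cont_coord: "continuous_on X (\<lambda>phi :: int => complex. phi k)" for X k
  by (rule continuous_on_subset[OF continuous_on_product_coordinates subset_UNIV])
 have contQ: "continuous_on X Q" for X
 proof -
  have "Q = (\<lambda>phi. \<Sum>k\<in>{0..<int n}. (cmod (of_real (A k) * phi k - B (k + 1) * phi (k + 1) - cnj (B k) * phi (k - 1) - of_real E * phi k))\<^sup>2)"
   unfolding Q_def T_def norm2_n_def jacobi_op_def by (intro ext sum.cong) auto
  thus ?thesis by (simp only:) (intro continuous_on_sum continuous_intros cont_coord)
 qed
 have cont2: "continuous_on X (norm2_n n)" for X unfolding norm2_n_def by (intro continuous_intros cont_coord)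
 \<comment> \<open>Entries in the unit disc on the block and zero elsewhere form a compact set in
   the product topology, by Tychonoff's theorem.\<close>
 have compK: "compact K"
 proof -
  define P where "P = (\<Pi>\<^sub>E k\<in>UNIV. if k \<in> {0..<int n} then cball (0::complex) 1 else {0})"
  have "compactin (product_topology (\<lambda>_. euclidean) UNIV) P" unfolding P_def by (subst compactin_PiE) auto
  hence "compact P" by (simp add: euclidean_product_topology)
  moreover have "closed {phi. norm2_n n phi = 1}" by (intro closed_Collect_eq cont2) auto
  moreover have "K = P \<inter> {phi. norm2_n n phi = 1}"
  proof (intro equalityI subsetI)
   fix phi assume phi: "phi \<in> K"
   have "cmod (phi k) <= 1" if k: "k \<in> {0..<int n}" for k
   proof -
    have "(cmod (phi k))\<^sup>2 <= norm2_n n phi" unfolding norm2_n_def by (rule member_le_sum) (use k in auto)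
    hence "(cmod (phi k))\<^sup>2 <= 1\<^sup>2" using phi by (simp add: K_def)
    thus ?thesis by (rule power2_le_imp_le) simp
   qed
   thus "phi \<in> P \<inter> {phi. norm2_n n phi = 1}" using phi by (auto simp: P_def K_def vanishes_off_def PiE_iff)
  next
   fix phi assume "phi \<in> P \<inter> {phi. norm2_n n phi = 1}"
   thus "phi \<in> K" by (auto simp: P_def K_def vanishes_off_def PiE_iff split: if_splits)
  qed
  ultimately show ?thesis using compact_Int_closed by metis
 qed
 define psi1 where "psi1 = (\<lambda>k. of_real (1 / sqrt (norm2_n n psi)) * psi k)"
 have "norm2_n n psi1 = (cmod (of_real (1 / sqrt (norm2_n n psi))))\<^sup>2 * norm2_n n psi" unfolding psi1_def by (rule norm2_n_scale)
 also have "... = 1" unfolding norm_of_real power2_abs using pos by (simp add: power_divide)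
 finally have psi1K: "psi1 \<in> K" using supp unfolding K_def psi1_def vanishes_off_def by auto
 have Tpsi1: "T psi1 = (\<lambda>k. of_real (1 / sqrt (norm2_n n psi)) * T psi k)" unfolding psi1_def by (rule T_scale)
 have QT: "Q psi = norm2_n n (\<lambda>k. jacobi_op A B psi k - of_real E * psi k)" unfolding Q_def T_def norm2_n_def by (rule sum.cong) auto
 have "Q psi1 = (cmod (of_real (1 / sqrt (norm2_n n psi))))\<^sup>2 * Q psi" unfolding Q_def Tpsi1 by (rule norm2_n_scale)
 also have "... = Q psi / norm2_n n psi" unfolding norm_of_real power2_abs using pos by (simp add: power_divide)
 also have "... <= t\<^sup>2" using approx pos unfolding QT by (simp add: pos_divide_le_eq)
 finally have Qpsi1: "Q psi1 <= t\<^sup>2" .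
 obtain phi where phi: "phi \<in> K" and min: "\<And>xi. xi \<in> K ==> Q phi <= Q xi"
  using continuous_attains_inf[OF compK _ contQ] psi1K by blast
 have phis: "vanishes_off n phi" and phi1: "norm2_n n phi = 1" using phi by (auto simp: K_def)
 define \<mu> where "\<mu> = sqrt (Q phi)"
 have Q0: "0 <= Q xi" for xi unfolding Q_def by (rule norm2_n_nonneg)
 have \<mu>: "0 <= \<mu>" "\<mu>\<^sup>2 = Q phi" "\<mu> <= t"
  using Q0[of phi] min[OF psi1K] Qpsi1 t unfolding \<mu>_def by (auto intro: real_le_lsqrt)
 have minall: "Q phi * norm2_n n xi <= Q xi" if xi: "vanishes_off n xi" for xi
 proof (cases "norm2_n n xi = 0")
  case True
  thus ?thesis using Q0 by simp
 next
  case False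
  hence p: "0 < norm2_n n xi" using norm2_n_nonneg[of n xi] by linarith
  define c where "c = complex_of_real (1 / sqrt (norm2_n n xi))"
  have c: "(cmod c)\<^sup>2 = 1 / norm2_n n xi" unfolding c_def norm_of_real power2_abs using p by (simp add: power_divide)
  have "(\<lambda>k. c * xi k) \<in> K" unfolding K_def using xi p by (auto simp: norm2_n_scale c vanishes_off_def)
  hence "Q phi <= Q (\<lambda>k. c * xi k)" by (rule min)
  also have "Q (\<lambda>k. c * xi k) = Q xi / norm2_n n xi" unfolding Q_def T_scale by (simp add: norm2_n_scale c)
  finally show ?thesis using p by (simp add: pos_le_divide_eq)
 qed
 have sym: "inner_n n xi (T \<eta>) = inner_n n (T xi) \<eta>" if "vanishes_off n xi" "vanishes_off n \<eta>" for xi \<eta>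
 proof -
  have "inner_n n xi (T \<eta>) = inner_n n xi (jacobi_op A B \<eta>) - of_real E * inner_n n xi \<eta>"
   unfolding inner_n_def T_def by (simp add: algebra_simps sum_subtractf sum_distrib_left)
  moreover have "inner_n n (T xi) \<eta> = inner_n n (jacobi_op A B xi) \<eta> - of_real E * inner_n n xi \<eta>"
   unfolding inner_n_def T_def by (simp add: algebra_simps sum_subtractf sum_distrib_left)
  ultimately show ?thesis using inner_jacobi_op[OF that] by simp
 qed
 \<comment> \<open>The residual serves as direction of variation: moving from \<open>phi\<close> by
   \<open>s * R\<close> changes the quadratic form by \<open>2 * s * norm2_n n R\<close> to first
   order, which for small negative \<open>s\<close> contradicts minimality unless \<open>R\<close>
   vanishes.\<close>
 define R where "R k = T (T phi) k - of_real (Q phi) * phi k" for k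
 have Rs: "vanishes_off n R" using T_supp[of "T phi"] phis unfolding R_def vanishes_off_def by auto
 have expand: "norm2_n n (\<lambda>k. xi k + of_real s * \<eta> k) = norm2_n n xi + 2 * s * Re (inner_n n \<eta> xi) + s\<^sup>2 * norm2_n n \<eta>" for xi \<eta> s
 proof -
  have "(cmod (x + of_real s * y))\<^sup>2 = (cmod x)\<^sup>2 + 2 * s * Re (cnj y * x) + s\<^sup>2 * (cmod y)\<^sup>2" for x y
   unfolding cmod_power2 by (simp add: power2_eq_square algebra_simps)
  thus ?thesis unfolding norm2_n_def inner_n_def Re_sum by (simp add: sum.distrib sum_distrib_left distrib_left)
 qed
 have Tlin: "T (\<lambda>k. phi k + of_real s * R k) = (\<lambda>k. T phi k + of_real s * T R k)" for s by (rule ext) (rule T_add)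
 have quad: "0 <= 2 * s * norm2_n n R + s\<^sup>2 * (norm2_n n (T R) - Q phi * norm2_n n R)" for s
 proof -
  have "vanishes_off n (\<lambda>k. phi k + of_real s * R k)" using phis Rs by (simp add: vanishes_off_def)
  from minall[OF this] have "Q phi * (1 + 2 * s * Re (inner_n n R phi) + s\<^sup>2 * norm2_n n R)
    <= Q phi + 2 * s * Re (inner_n n (T R) (T phi)) + s\<^sup>2 * norm2_n n (T R)"
   unfolding expand Q_def[of "\<lambda>k. phi k + of_real s * R k"] Tlin phi1 by (simp add: Q_def)
  hence "0 <= 2 * s * (Re (inner_n n (T R) (T phi)) - Q phi * Re (inner_n n R phi)) + s\<^sup>2 * (norm2_n n (T R) - Q phi * norm2_n n R)"
   by (simp add: algebra_simps)
  also have "inner_n n (T R) (T phi) = inner_n n R (T (T phi))" using sym[OF Rs T_supp] by simp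
  also have "inner_n n R (T (T phi)) = inner_n n R R + of_real (Q phi) * inner_n n R phi"
  proof -
   have "T (T phi) k = R k + of_real (Q phi) * phi k" for k unfolding R_def by simp
   thus ?thesis unfolding inner_n_def by (simp add: distrib_left sum.distrib sum_distrib_left mult_ac)
  qed
  also have "Re (inner_n n R R + of_real (Q phi) * inner_n n R phi) - Q phi * Re (inner_n n R phi) = Re (inner_n n R R)" by simp
  finally show ?thesis by (simp add: inner_n_self)
 qed
 have "norm2_n n R = 0"
 proof (rule ccontr)
  assume "norm2_n n R \<noteq> 0"
  hence p: "0 < norm2_n n R" using norm2_n_nonneg[of n R] by linarith
  define D where "D = \<bar>norm2_n n (T R) - Q phi * norm2_n n R\<bar> + 1"
  have D: "0 < D" "norm2_n n (T R) - Q phi * norm2_n n R <= D" unfolding D_def by auto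
  define s where "s = - norm2_n n R / D"
  have "s\<^sup>2 * (norm2_n n (T R) - Q phi * norm2_n n R) <= s\<^sup>2 * D" using D by (intro mult_left_mono) auto
  hence "0 <= 2 * s * norm2_n n R + s\<^sup>2 * D" using quad[of s] by linarith
  also have "... = - (norm2_n n R)\<^sup>2 / D" unfolding s_def using D by (simp add: power2_eq_square field_simps)
  also have "... < 0" using p D by simp
  finally show False by simp
 qed
 hence R0: "R k = 0" for k using Rs norm2_n_pos[of R k n] unfolding vanishes_off_def by (cases "k \<in> {0..<int n}") auto
 \<comment> \<open>Since \<open>T - \<mu>\<close> annihilates \<open>xi\<close>, either
   \<open>xi\<close> is an eigenvector for \<open>E + \<mu>\<close>, or \<open>xi\<close> vanishes
   and \<open>phi\<close> is one for \<open>E - \<mu>\<close>.\<close>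
 define xi where "xi k = T phi k + of_real \<mu> * phi k" for k
 have xis: "vanishes_off n xi" using T_supp[of phi] phis by (simp add: vanishes_off_def xi_def)
 have TT: "T (T phi) k = of_real (\<mu>\<^sup>2) * phi k" for k using R0[of k] unfolding R_def \<mu>(2) by simp
 have Txi: "T xi k = of_real \<mu> * xi k" for k
 proof -
  have "T xi k = T (T phi) k + of_real \<mu> * T phi k" unfolding xi_def by (rule T_add)
  also have "... = of_real \<mu> * xi k" unfolding TT xi_def by (simp add: algebra_simps power2_eq_square)
  finally show ?thesis .
 qed
 show ?thesis
 proof (cases "\<forall>k\<in>{0..<int n}. xi k = 0")
  case True
  have "jacobi_op A B phi k = of_real (E - \<mu>) * phi k" if k: "k \<in> {0..<int n}" for k
  proof -
   have "T phi k + of_real \<mu> * phi k = 0" using True k by (auto simp: xi_def)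
   thus ?thesis using k unfolding T_def by (simp add: algebra_simps)
  qed
  moreover have "\<bar>E - \<mu> - E\<bar> <= t" using \<mu> by simp
  moreover have "0 < norm2_n n phi" using phi1 by simp
  ultimately show ?thesis using phis by (intro exI[of _ "E - \<mu>"] exI[of _ phi]) blast
 next
  case False
  have "jacobi_op A B xi k = of_real (E + \<mu>) * xi k" if k: "k \<in> {0..<int n}" for k
   using Txi[of k] k unfolding T_def by (simp add: algebra_simps)
  moreover have "\<bar>E + \<mu> - E\<bar> <= t" using \<mu> by simp
  moreover have "0 < norm2_n n xi" using False by (simp add: norm2_n_pos_iff)
  ultimately show ?thesis using xis by blast
 qed
qed

text \<open>The continuant: the determinant of the tridiagonal block of \<open>n\<close> sites
  starting at \<open>i\<close>, with diagonal \<open>alpha\<close>, where \<open>c k\<close> is the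
  product of the two off-diagonal entries joining the sites \<open>k - 1\<close> and
  \<open>k\<close>.\<close>

fun cont :: "(int => complex) => (int => complex) => int => nat => complex" where
 "cont alpha c i 0 = 1"
| "cont alpha c i (Suc 0) = alpha i"
| "cont alpha c i (Suc (Suc n)) = alpha (i + int n + 1) * cont alpha c i (Suc n) - c (i + int n + 1) * cont alpha c i n"

lemma cont_minus: "cont (\<lambda>k. - alpha k) c i n = (- 1) ^ n * cont alpha c i n"
 by (induction alpha c i n rule: cont.induct) (simp_all add: algebra_simps)

definition tridiag :: "(nat => complex) => (nat => complex) => (nat => complex) => nat => complex Matrix.mat" where
 "tridiag d u v n = Matrix.mat n n (\<lambda>(i, j). if j = i then d i else if j = i + 1 then u i else if i = j + 1 then v j else 0)"

lemma tridiag_carrier: "tridiag d u v n \<in> carrier_mat n n" by (simp add: tridiag_def)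

lemma det_tridiag_Suc_Suc:
 "Determinant.det (tridiag d u v (Suc (Suc n))) =
   d (Suc n) * Determinant.det (tridiag d u v (Suc n)) - u n * v n * Determinant.det (tridiag d u v n)"
proof -
 let ?T = "tridiag d u v (Suc (Suc n))"
 define X where "X = mat_delete ?T (Suc n) n"
 have X: "X \<in> carrier_mat (Suc n) (Suc n)" unfolding X_def tridiag_def mat_delete_def by simp
 have d1: "mat_delete ?T (Suc n) (Suc n) = tridiag d u v (Suc n)" by (rule eq_matI) (auto simp: mat_delete_def tridiag_def)
 have d2: "mat_delete X n n = tridiag d u v n" by (rule eq_matI) (auto simp: mat_delete_def tridiag_def X_def)
 have Xcol: "X $$ (i, n) = (if i = n then u n else 0)" if "i < Suc n" for i using that by (auto simp: X_def mat_delete_def tridiag_def)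
 have "Determinant.det X = (\<Sum>i<Suc n. X $$ (i, n) * cofactor X i n)" by (rule laplace_expansion_column[OF X]) simp
 also have "... = (\<Sum>i<Suc n. if i = n then u n * cofactor X n n else 0)" by (rule sum.cong) (auto simp: Xcol)
 also have "... = u n * Determinant.det (tridiag d u v n)" by (simp add: cofactor_def d2)
 finally have dX: "Determinant.det X = u n * Determinant.det (tridiag d u v n)" .
 have Trow: "?T $$ (Suc n, j) = (if j = Suc n then d (Suc n) else if j = n then v n else 0)" if "j < Suc (Suc n)" for j
  using that by (auto simp: tridiag_def)
 have "Determinant.det ?T = (\<Sum>j<Suc (Suc n). ?T $$ (Suc n, j) * cofactor ?T (Suc n) j)" by (rule laplace_expansion_row[OF tridiag_carrier]) simp
 also have "... = (\<Sum>j<n. ?T $$ (Suc n, j) * cofactor ?T (Suc n) j) + v n * cofactor ?T (Suc n) n + d (Suc n) * cofactor ?T (Suc n) (Suc n)"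
  by (simp add: Trow)
 also have "(\<Sum>j<n. ?T $$ (Suc n, j) * cofactor ?T (Suc n) j) = 0" by (rule sum.neutral) (auto simp: Trow)
 also have "cofactor ?T (Suc n) n = - Determinant.det X" by (simp add: cofactor_def X_def)
 also have "cofactor ?T (Suc n) (Suc n) = Determinant.det (tridiag d u v (Suc n))" by (simp add: cofactor_def d1)
 finally show ?thesis unfolding dX by simp
qed

lemma det_tridiag:
 "Determinant.det (tridiag (\<lambda>i. alpha (int i)) u v n) = cont alpha (\<lambda>k. u (nat (k - 1)) * v (nat (k - 1))) 0 n"
proof (induction n rule: induct_nat_012)
 case 0
 show ?case by (simp add: tridiag_def)
next
 case 1
 show ?case by (simp add: tridiag_def det_single)
next
 case (ge2 n)
 thus ?case by (simp add: det_tridiag_Suc_Suc algebra_simps)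
qed

lemma cont_cong:
 "(\<And>k. i <= k ==> k < i + int n ==> alpha k = alpha' k) ==> (\<And>k. i < k ==> k < i + int n ==> c k = c' k) ==> cont alpha c i n = cont alpha' c' i n"
 by (induction alpha c i n rule: cont.induct) auto

section \<open>The Jacobi matrix as an operator on finitely supported sequences\<close>

locale jacobi_seq =
 fixes a :: "real => real" and b :: "real => complex" and x w :: real
begin

abbreviation "A k \<equiv> a (x + real_of_int k * w)"
abbreviation "B k \<equiv> b (x + real_of_int k * w)"

lemma mult_mat_vec_jacobi:
 assumes v: "dim_vec v = n" and psi: "\<And>k. psi k = (if k \<in> {0..<int n} then vec_index v (nat k) else 0)" and i: "i < n"
 shows "vec_index (jacobi_matrix a b n x w *\<^sub>v v) i = jacobi_op A B psi (int i)"
proof -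
 have "vec_index (jacobi_matrix a b n x w *\<^sub>v v) i = (\<Sum>j<n. jacobi_matrix a b n x w $$ (i, j) * vec_index v j)"
  using i v by (simp add: scalar_prod_def atLeast0LessThan jacobi_matrix_def)
 also have "... = (\<Sum>j<n. (if j = i then of_real (A (int i)) * vec_index v i else 0) +
   (if j = i + 1 then - B (int i + 1) * vec_index v (i + 1) else 0) + (if i = j + 1 then - cnj (B (int i)) * vec_index v j else 0))"
  by (rule sum.cong) (use i in \<open>auto simp: jacobi_matrix_def add.commute[of 1]\<close>)
 also have "... = of_real (A (int i)) * vec_index v i + (if i + 1 < n then - B (int i + 1) * vec_index v (i + 1) else 0)
   + (if 0 < i then - cnj (B (int i)) * vec_index v (i - 1) else 0)"
 proof -
  have "(\<Sum>j<n. if i = j + 1 then - cnj (B (int i)) * vec_index v j else 0) =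
   (\<Sum>j<n. if j = i - 1 then (if 0 < i then - cnj (B (int i)) * vec_index v (i - 1) else 0) else 0)" by (rule sum.cong) auto
  thus ?thesis using i by (simp add: sum.distrib)
 qed
 also have "... = jacobi_op A B psi (int i)" using i by (auto simp: jacobi_op_def psi nat_add_distrib nat_diff_distrib)
 finally show ?thesis .
qed

lemma eigenvalue_jacobi_iff:
 "eigenvalue (jacobi_matrix a b n x w) (of_real e) \<longleftrightarrow>
  (\<exists>psi. vanishes_off n psi \<and> 0 < norm2_n n psi \<and> (\<forall>k\<in>{0..<int n}. jacobi_op A B psi k = of_real e * psi k))"
proof
 assume "eigenvalue (jacobi_matrix a b n x w) (of_real e)"
 then obtain v where v: "v \<in> carrier_vec n" "v \<noteq> 0\<^sub>v n" "jacobi_matrix a b n x w *\<^sub>v v = of_real e \<cdot>\<^sub>v v"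
  by (auto simp: eigenvalue_def eigenvector_def jacobi_matrix_def)
 define psi where "psi k = (if k \<in> {0..<int n} then vec_index v (nat k) else 0)" for k
 have "jacobi_op A B psi k = of_real e * psi k" if "k \<in> {0..<int n}" for k
  using mult_mat_vec_jacobi[of v n psi "nat k"] v that by (auto simp: psi_def)
 moreover have "0 < norm2_n n psi"
 proof -
  obtain i where i: "i < n" "vec_index v i \<noteq> 0" using v(1,2) by (metis carrier_vecD eq_vecI index_zero_vec(1) index_zero_vec(2))
  thus ?thesis by (intro norm2_n_pos[of _ "int i"]) (auto simp: psi_def)
 qed
 moreover have "vanishes_off n psi" by (simp add: vanishes_off_def psi_def)
 ultimately show "\<exists>psi. vanishes_off n psi \<and> 0 < norm2_n n psi \<and> (\<forall>k\<in>{0..<int n}. jacobi_op A B psi k = of_real e * psi k)"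
  by blast
next
 assume "\<exists>psi. vanishes_off n psi \<and> 0 < norm2_n n psi \<and> (\<forall>k\<in>{0..<int n}. jacobi_op A B psi k = of_real e * psi k)"
 then obtain psi where psi: "vanishes_off n psi" "0 < norm2_n n psi" "\<And>k. k\<in>{0..<int n} ==> jacobi_op A B psi k = of_real e * psi k" by blast
 define v where "v = Matrix.vec n (\<lambda>i. psi (int i))"
 have psiv: "psi k = (if k \<in> {0..<int n} then vec_index v (nat k) else 0)" for k using psi(1) by (auto simp: vanishes_off_def v_def)
 have "jacobi_matrix a b n x w *\<^sub>v v = of_real e \<cdot>\<^sub>v v"
 proof (rule eq_vecI)
  fix i assume "i < dim_vec (of_real e \<cdot>\<^sub>v v)"
  hence i: "i < n" by (simp add: v_def)
  have "vec_index (jacobi_matrix a b n x w *\<^sub>v v) i = jacobi_op A B psi (int i)" by (rule mult_mat_vec_jacobi[OF _ psiv i]) (simp add: v_def)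
  thus "vec_index (jacobi_matrix a b n x w *\<^sub>v v) i = vec_index (of_real e \<cdot>\<^sub>v v) i" using i psi(3)[of "int i"] by (simp add: v_def)
 qed (simp add: v_def jacobi_matrix_def)
 moreover obtain k where "k \<in> {0..<int n}" "psi k \<noteq> 0" using psi(2) by (auto simp: norm2_n_pos_iff)
 hence "vec_index v (nat k) \<noteq> 0" "nat k < n" by (auto simp: v_def)
 hence "v \<noteq> 0\<^sub>v n" by auto
 ultimately show "eigenvalue (jacobi_matrix a b n x w) (of_real e)"
  unfolding eigenvalue_def eigenvector_def by (intro exI[of _ v]) (auto simp: v_def jacobi_matrix_def)
qed

lemma char_poly_jacobi_nonzero: "char_poly (jacobi_matrix a b n x w) \<noteq> 0"
 using degree_monic_char_poly[OF jacobi_matrix_carrier[of a b n x w]] by auto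

lemma set_jacobi_eigenvalues_iff:
 "e \<in> set (jacobi_eigenvalues a b n x w) \<longleftrightarrow>
  (\<exists>psi. vanishes_off n psi \<and> 0 < norm2_n n psi \<and> (\<forall>k\<in>{0..<int n}. jacobi_op A B psi k = of_real e * psi k))"
proof -
 have "e \<in> set (jacobi_eigenvalues a b n x w) \<longleftrightarrow>
  complex_of_real e \<in># image_mset complex_of_real (mset (jacobi_eigenvalues a b n x w))" by auto
 also have "... \<longleftrightarrow> eigenvalue (jacobi_matrix a b n x w) (of_real e)" unfolding mset_jacobi_eigenvalues
  by (simp add: char_poly_jacobi_nonzero eigenvalue_root_char_poly[OF jacobi_matrix_carrier])
 finally show ?thesis unfolding eigenvalue_jacobi_iff .
qed

lemma char_poly_jacobi:
 "char_poly (jacobi_matrix a b n x w) = (\<Prod>e\<leftarrow>jacobi_eigenvalues a b n x w. [:- of_real e, 1:])"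
proof -
 let ?p = "char_poly (jacobi_matrix a b n x w)"
 have "lead_coeff ?p = 1" using degree_monic_char_poly[OF jacobi_matrix_carrier[of a b n x w]] by auto
 hence "?p = (\<Prod>z\<in>#proots ?p. [:- z, 1:])" using complex_poly_decompose_multiset[of ?p] by simp
 also have "... = (\<Prod>e\<leftarrow>jacobi_eigenvalues a b n x w. [:- of_real e, 1:])" unfolding mset_jacobi_eigenvalues[symmetric]
  by (simp add: multiset.map_comp comp_def flip: prod_mset_prod_list mset_map)
 finally show ?thesis .
qed

lemma cont_eq_prod_eigenvalues:
 "cont (\<lambda>k. of_real (A k) - z) (\<lambda>k. of_real ((cmod (B k))\<^sup>2)) 0 n = (\<Prod>e\<leftarrow>jacobi_eigenvalues a b n x w. of_real e - z)"
proof -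
 let ?H = "jacobi_matrix a b n x w"
 have "- char_matrix ?H z = tridiag (\<lambda>i. z - of_real (A (int i))) (\<lambda>i. B (int i + 1)) (\<lambda>i. cnj (B (int i + 1))) n"
  by (rule eq_matI) (auto simp: char_matrix_def jacobi_matrix_def tridiag_def add.commute[of 1])
 hence "poly (char_poly ?H) z = cont (\<lambda>k. - (of_real (A k) - z)) (\<lambda>k. B (int (nat (k - 1)) + 1) * cnj (B (int (nat (k - 1)) + 1))) 0 n"
  using char_poly_matrix[OF jacobi_matrix_carrier[of a b n x w], of z]
   det_tridiag[of "\<lambda>k. z - of_real (A k)" "\<lambda>i. B (int i + 1)" "\<lambda>i. cnj (B (int i + 1))" n] by simp
 also have "... = cont (\<lambda>k. - (of_real (A k) - z)) (\<lambda>k. of_real ((cmod (B k))\<^sup>2)) 0 n"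
  by (rule cont_cong) (auto simp: complex_norm_square simp del: of_real_power)
 also have "... = (- 1) ^ n * cont (\<lambda>k. of_real (A k) - z) (\<lambda>k. of_real ((cmod (B k))\<^sup>2)) 0 n" by (rule cont_minus)
 finally have 1: "poly (char_poly ?H) z = (- 1) ^ n * cont (\<lambda>k. of_real (A k) - z) (\<lambda>k. of_real ((cmod (B k))\<^sup>2)) 0 n" .
 have "(\<Prod>e\<leftarrow>es. z - complex_of_real e) = (- 1) ^ length es * (\<Prod>e\<leftarrow>es. of_real e - z)" for es
  by (induction es) (auto simp: algebra_simps)
 hence "poly (char_poly ?H) z = (- 1) ^ n * (\<Prod>e\<leftarrow>jacobi_eigenvalues a b n x w. of_real e - z)"
  unfolding char_poly_jacobi by (simp add: poly_prod_list comp_def length_jacobi_eigenvalues)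
 with 1 show ?thesis by simp
qed

text \<open>The indices differ, but the eigenvalues may coincide; multiplicity in the list must then
  yield a two-dimensional eigenspace. A Schur decomposition whose triangular factor starts with the
  eigenvalue twice gives two independent vectors that span an invariant plane. Symmetry of the
  operator kills the off-diagonal entry \<open>c\<close>, and a Gram-Schmidt step makes the vectors
  orthogonal.\<close>

lemma two_orthogonal_eigenvectors:
 assumes j: "j < n" "k < n" "j \<noteq> k"
 defines "e1 \<equiv> jacobi_eigenvalues a b n x w ! j" and "e2 \<equiv> jacobi_eigenvalues a b n x w ! k"
 shows "\<exists>psi1 psi2. vanishes_off n psi1 \<and> vanishes_off n psi2 \<and> 0 < norm2_n n psi1 \<and> 0 < norm2_n n psi2 \<and> inner_n n psi1 psi2 = 0 \<and>
  (\<forall>k\<in>{0..<int n}. jacobi_op A B psi1 k = of_real e1 * psi1 k) \<and> (\<forall>k\<in>{0..<int n}. jacobi_op A B psi2 k = of_real e2 * psi2 k)"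
proof (cases "e1 = e2")
 case False
 define es where "es = jacobi_eigenvalues a b n x w"
 have "e1 \<in> set es" "e2 \<in> set es" using j by (auto simp: es_def e1_def e2_def length_jacobi_eigenvalues)
 then obtain psi1 psi2 where psi: "vanishes_off n psi1" "0 < norm2_n n psi1" "\<And>k. k\<in>{0..<int n} ==> jacobi_op A B psi1 k = of_real e1 * psi1 k"
  "vanishes_off n psi2" "0 < norm2_n n psi2" "\<And>k. k\<in>{0..<int n} ==> jacobi_op A B psi2 k = of_real e2 * psi2 k"
  unfolding es_def set_jacobi_eigenvalues_iff by blast
 have "of_real e2 * inner_n n psi1 psi2 = inner_n n psi1 (jacobi_op A B psi2)"
  unfolding inner_n_def sum_distrib_left by (rule sum.cong) (simp_all add: psi(6))
 also have "... = inner_n n (jacobi_op A B psi1) psi2" by (rule inner_jacobi_op[OF psi(1,4)])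
 also have "... = of_real e1 * inner_n n psi1 psi2" unfolding inner_n_def sum_distrib_left by (rule sum.cong) (simp_all add: psi(3))
 finally have "inner_n n psi1 psi2 = 0" using False by simp
 thus ?thesis using psi by blast
next
 case True
 let ?H = "jacobi_matrix a b n x w"
 let ?E = "complex_of_real e1"
 define es where "es = jacobi_eigenvalues a b n x w"
 have len: "length es = n" by (simp add: es_def length_jacobi_eigenvalues)
 have "es ! j \<in># mset es - {#es ! k#}"
 proof -
  have "nth_mset_ok": "mset es = {#es ! i. i \<in># mset_set {..<n}#}" by (metis len lessThan_atLeast0 map_nth mset_map mset_upt)
  have "mset_set {..<n} = add_mset k (add_mset j (mset_set ({..<n} - {k} - {j})))" using j by (simp add: mset_set.remove[symmetric])
  thus ?thesis unfolding nth_mset_ok by simp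
 qed
 then obtain R where R: "mset es = {#es ! k, es ! j#} + R"
  by (metis add_mset_add_single insert_DiffM j(2) len nth_mem_mset union_commute union_mset_add_mset_left add_mset_commute)
 obtain rs where rs: "mset rs = R" using ex_mset by blast
 have ek: "es ! k = e1" "es ! j = e1" using True by (simp_all add: es_def e1_def e2_def)
 \<comment> \<open>The Schur decomposition puts the eigenvalues on the diagonal in the order of this
   list.\<close>
 define fs where "fs = ?E # ?E # map complex_of_real rs"
 have mfs: "mset fs = image_mset complex_of_real (mset es)" unfolding R fs_def ek by (simp add: rs)
 have lenf: "length fs = n" using arg_cong[OF mfs, of size] len by simp
 have n2: "2 <= n" using j by linarith
 have "char_poly ?H = (\<Prod>e\<leftarrow>fs. [:- e, 1:])"
 proof -
  have "(\<Prod>e\<leftarrow>fs. [:- e, 1:]) = (\<Prod>z\<in>#mset fs. [:- z, 1:])" by (simp flip: prod_mset_prod_list mset_map)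
  also have "... = (\<Prod>e\<leftarrow>es. [:- of_real e, 1:])" unfolding mfs by (simp add: multiset.map_comp comp_def flip: prod_mset_prod_list mset_map)
  finally show ?thesis unfolding char_poly_jacobi es_def by simp
 qed
 moreover obtain U P Q :: "complex Matrix.mat" where sd: "schur_decomposition ?H fs = (U, P, Q)" by (metis prod_cases3)
 ultimately have U: "similar_mat_wit ?H U P Q" "upper_triangular U" "diag_mat U = fs"
  using schur_decomposition[OF jacobi_matrix_carrier[of a b n x w]] by auto
 have car: "?H \<in> carrier_mat n n" "U \<in> carrier_mat n n" "P \<in> carrier_mat n n" "Q \<in> carrier_mat n n"
  and PQ: "P * Q = 1\<^sub>m n" "Q * P = 1\<^sub>m n" "?H = P * U * Q" using similar_mat_witD2[OF jacobi_matrix_carrier U(1)] by auto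
 have HP: "?H * P = P * U"
 proof -
  have "?H * P = P * U * Q * P" using PQ(3) by simp
  also have "... = P * U * (Q * P)" by (rule assoc_mult_mat) (use car in auto)
  also have "... = P * U" unfolding PQ(2) using car by simp
  finally show ?thesis .
 qed
 define p where "p i = Matrix.col P i" for i
 define psi where "psi i k = (if k \<in> {0..<int n} then vec_index (p i) (nat k) else 0)" for i k
 have psis: "vanishes_off n (psi i)" for i by (simp add: vanishes_off_def psi_def)
 have U00: "U $$ (0,0) = ?E" "U $$ (1,1) = ?E" "U $$ (1,0) = 0" "\<And>i. 1 < i ==> i < n ==> U $$ (i,0) = 0 \<and> U $$ (i,1) = 0"
 proof -
  have "fs ! 0 = U $$ (0,0)" "fs ! 1 = U $$ (1,1)" using U(3) car(2) n2 unfolding diag_mat_def by auto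
  thus "U $$ (0,0) = ?E" "U $$ (1,1) = ?E" by (simp_all add: fs_def)
 qed (use U(2) car(2) n2 in \<open>auto simp: upper_triangular_def\<close>)
 have dim_p: "dim_vec (p i) = n" for i using car by (simp add: p_def)
 have op: "jacobi_op A B (psi i) (int r) = (\<Sum>m<n. P $$ (r, m) * U $$ (m, i))" if "r < n" "i < n" for i r
 proof -
  have "jacobi_op A B (psi i) (int r) = vec_index (?H *\<^sub>v p i) r"
   by (rule mult_mat_vec_jacobi[symmetric]) (use that dim_p in \<open>auto simp: psi_def\<close>)
  also have "... = (?H * P) $$ (r, i)" using that car by (simp add: p_def)
  also have "... = (\<Sum>m<n. P $$ (r, m) * U $$ (m, i))" unfolding HP using that car by (simp add: scalar_prod_def atLeast0LessThan)
  finally show ?thesis .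
 qed
 have psiP: "psi i (int r) = P $$ (r, i)" if "r < n" "i < n" for i r using that car by (simp add: psi_def p_def)
 have op0: "jacobi_op A B (psi 0) k = ?E * psi 0 k" if k: "k \<in> {0..<int n}" for k
 proof -
  define r where "r = nat k"
  have r: "r < n" "k = int r" using k by (auto simp: r_def)
  have "(\<Sum>m<n. P $$ (r, m) * U $$ (m, 0)) = (\<Sum>m<n. if m = 0 then P $$ (r, 0) * ?E else 0)"
  proof (rule sum.cong)
   fix m assume "m \<in> {..<n}"
   thus "P $$ (r, m) * U $$ (m, 0) = (if m = 0 then P $$ (r, 0) * ?E else 0)" using U00(1,3) U00(4)[of m] by (cases "m = 0"; cases "m = 1") auto
  qed simp
  thus ?thesis using op[of r 0] psiP[of r 0] r n2 by simp
 qed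
 define c where "c = U $$ (0,1)"
 have op1: "jacobi_op A B (psi 1) k = ?E * psi 1 k + c * psi 0 k" if k: "k \<in> {0..<int n}" for k
 proof -
  define r where "r = nat k"
  have r: "r < n" "k = int r" using k by (auto simp: r_def)
  have "(\<Sum>m<n. P $$ (r, m) * U $$ (m, 1)) = (\<Sum>m<n. (if m = 0 then P $$ (r, 0) * c else 0) + (if m = 1 then P $$ (r, 1) * ?E else 0))"
  proof (rule sum.cong)
   fix m assume "m \<in> {..<n}"
   thus "P $$ (r, m) * U $$ (m, 1) = (if m = 0 then P $$ (r, 0) * c else 0) + (if m = 1 then P $$ (r, 1) * ?E else 0)"
    using U00(2) U00(4)[of m] by (cases "m = 0"; cases "m = 1") (auto simp: c_def)
  qed simp
  thus ?thesis using op[of r 1] psiP[of r 0] psiP[of r 1] r n2 by (simp add: sum.distrib)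
 qed
 have indep: "\<exists>k\<in>{0..<int n}. psi 1 k \<noteq> s * psi 0 k" for s
 proof (rule ccontr)
  assume "\<not> (\<exists>k\<in>{0..<int n}. psi 1 k \<noteq> s * psi 0 k)"
  hence eq: "P $$ (r, 1) = s * P $$ (r, 0)" if "r < n" for r using psiP[OF that, of 1] psiP[OF that, of 0] n2 that by auto
  have "(Q * P) $$ (1, 1) = (\<Sum>r<n. Q $$ (1, r) * P $$ (r, 1))" using car n2 by (simp add: scalar_prod_def atLeast0LessThan)
  also have "... = s * (\<Sum>r<n. Q $$ (1, r) * P $$ (r, 0))" unfolding sum_distrib_left by (rule sum.cong) (use eq in auto)
  also have "(\<Sum>r<n. Q $$ (1, r) * P $$ (r, 0)) = (Q * P) $$ (1, 0)" using car n2 by (simp add: scalar_prod_def atLeast0LessThan)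
  finally show False unfolding PQ(2) using n2 by simp
 qed
 have pos0: "0 < norm2_n n (psi 0)"
 proof (rule ccontr)
  assume "\<not> 0 < norm2_n n (psi 0)"
  hence z: "P $$ (r, 0) = 0" if "r < n" for r using psiP[OF that, of 0] n2 that by (auto simp: norm2_n_pos_iff)
  have "(Q * P) $$ (0, 0) = (\<Sum>r<n. Q $$ (0, r) * P $$ (r, 0))" using car n2 by (simp add: scalar_prod_def atLeast0LessThan)
  also have "... = 0" by (rule sum.neutral) (simp add: z)
  finally show False unfolding PQ(2) using n2 by simp
 qed
 have "inner_n n (psi 0) (jacobi_op A B (psi 1)) = ?E * inner_n n (psi 0) (psi 1) + c * inner_n n (psi 0) (psi 0)"
 proof -
  have "inner_n n (psi 0) (jacobi_op A B (psi 1)) = (\<Sum>k\<in>{0..<int n}. ?E * (cnj (psi 0 k) * psi 1 k) + c * (cnj (psi 0 k) * psi 0 k))"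
   unfolding inner_n_def by (rule sum.cong[OF refl]) (subst op1, assumption, simp add: distrib_left mult_ac)
  thus ?thesis by (simp add: inner_n_def sum.distrib sum_distrib_left)
 qed
 moreover have "inner_n n (jacobi_op A B (psi 0)) (psi 1) = ?E * inner_n n (psi 0) (psi 1)"
  unfolding inner_n_def sum_distrib_left by (rule sum.cong[OF refl]) (subst op0, assumption, simp)
 ultimately have "c * inner_n n (psi 0) (psi 0) = 0" using inner_jacobi_op[OF psis[of 0] psis[of 1], of A B] by simp
 hence c0: "c = 0" using pos0 by (simp add: inner_n_self)
 define s where "s = inner_n n (psi 0) (psi 1) / inner_n n (psi 0) (psi 0)"
 define phi where "phi k = psi 1 k - s * psi 0 k" for k
 have "vanishes_off n phi" using psis by (simp add: vanishes_off_def phi_def)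
 moreover have "0 < norm2_n n phi" using indep[of s] by (auto simp: norm2_n_pos_iff phi_def)
 moreover have "inner_n n (psi 0) phi = 0"
 proof -
  have "inner_n n (psi 0) phi = inner_n n (psi 0) (psi 1) - s * inner_n n (psi 0) (psi 0)"
   unfolding inner_n_def phi_def by (simp add: algebra_simps sum_subtractf sum_distrib_left)
  thus ?thesis using pos0 by (simp add: s_def inner_n_self)
 qed
 moreover have "jacobi_op A B phi k = ?E * phi k" if k: "k \<in> {0..<int n}" for k
 proof -
  have "jacobi_op A B phi k = jacobi_op A B (psi 1) k - s * jacobi_op A B (psi 0) k" by (simp add: jacobi_op_def phi_def algebra_simps)
  thus ?thesis using op0[OF k] op1[OF k] c0 by (simp add: phi_def algebra_simps)
 qed
 ultimately show ?thesis using psis[of 0] pos0 op0 True by metis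
qed

end

subsection \<open>Continuants\<close>

lemma cont_shift: "cont alpha c (i + k) n = cont (\<lambda>j. alpha (j + k)) (\<lambda>j. c (j + k)) i n"
 by (induction n rule: induct_nat_012) (simp_all add: algebra_simps)

text \<open>A block is cut between two sites: a term of the determinant either does not cross the
  cut or uses exactly the pair of off-diagonal entries across it.\<close>

lemma cont_split:
 "cont alpha c i (Suc m + Suc n) =
   cont alpha c i (Suc m) * cont alpha c (i + int m + 1) (Suc n) - c (i + int m + 1) * cont alpha c i m * cont alpha c (i + int m + 2) n"
proof (induction n rule: induct_nat_012)
 case (ge2 n)
 have "cont alpha c i (Suc m + Suc (Suc (Suc n))) = alpha (i + int (m + n) + 3) * cont alpha c i (Suc m + Suc (Suc n))
   - c (i + int (m + n) + 3) * cont alpha c i (Suc m + Suc n)" by (simp add: algebra_simps)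
 thus ?case unfolding ge2 by (simp add: algebra_simps)
qed (simp_all add: algebra_simps)

lemma cont_left:
 "cont alpha c i (Suc (Suc n)) = alpha i * cont alpha c (i + 1) (Suc n) - c (i + 1) * cont alpha c (i + 2) n"
 using cont_split[of alpha c i 0 n] by simp

lemma cont_growth:
 assumes "\<And>k. cmod (alpha k) <= C" "\<And>k. cmod (c k) <= C" "1 <= C"
 shows "cmod (cont alpha c i (Suc n + k)) <= (2 * C) ^ k * max (cmod (cont alpha c i (Suc n))) (cmod (cont alpha c i n))"
proof -
 define u where "u m = max (cmod (cont alpha c i (Suc m))) (cmod (cont alpha c i m))" for m
 have step: "u (Suc m) <= 2 * C * u m" for m
 proof -
  have "cmod (cont alpha c i (Suc (Suc m))) <= cmod (alpha (i + int m + 1)) * cmod (cont alpha c i (Suc m)) + cmod (c (i + int m + 1)) * cmod (cont alpha c i m)"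
   using norm_triangle_ineq4 by (metis (no_types) cont.simps(3) norm_mult)
  also have "... <= C * u m + C * u m" unfolding u_def by (intro add_mono mult_mono assms) (use assms in auto)
  finally have "cmod (cont alpha c i (Suc (Suc m))) <= 2 * C * u m" by simp
  moreover have "1 * cmod (cont alpha c i (Suc m)) <= 2 * C * u m" unfolding u_def using assms(3) by (intro mult_mono) auto
  ultimately show ?thesis unfolding u_def by simp
 qed
 have "u (n + k) <= (2 * C) ^ k * u n"
 proof (induction k)
  case (Suc k)
  have "u (n + Suc k) <= 2 * C * u (n + k)" using step[of "n + k"] by simp
  also have "... <= 2 * C * ((2 * C) ^ k * u n)" using Suc assms(3) by (intro mult_left_mono) auto
  finally show ?case by (simp add: algebra_simps)
 qed simp
 thus ?thesis unfolding u_def by simp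
qed

lemma cont_upper:
 assumes "\<And>k. cmod (alpha k) <= C" "\<And>k. cmod (c k) <= C" "1 <= C"
 shows "cmod (cont alpha c i n) <= (2 * C) ^ n"
proof (cases n)
 case (Suc m)
 have "cmod (cont alpha c i (Suc 0 + m)) <= (2 * C) ^ m * max (cmod (cont alpha c i (Suc 0))) (cmod (cont alpha c i 0))"
  by (rule cont_growth[OF assms])
 also have "... <= (2 * C) ^ m * (2 * C)" using assms(1)[of i] assms(3) by (intro mult_left_mono) auto
 finally show ?thesis using Suc by (simp add: mult.commute)
qed simp

text \<open>The ratios satisfy \<open>h' = p - q / h\<close>, and a nonnegative \<open>q\<close>
  keeps them in the lower half plane. The error \<open>tau\<^sup>2 / 8\<close> allowed in
  \<open>q\<close> is divided by a ratio of modulus at least \<open>tau / 2\<close> and costs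
  \<open>tau / 4\<close>, exactly the difference between \<open>3/4 * tau\<close> and
  \<open>tau / 2\<close>.\<close>

lemma herglotz_sequence:
 fixes u p q :: "nat => complex"
 assumes u0: "u 0 \<noteq> 0" and u1: "u 1 = p 0 * u 0"
  and rec: "\<And>n. u (Suc (Suc n)) = p (Suc n) * u (Suc n) - q (Suc n) * u n"
  and tau: "0 < tau" and p: "\<And>n. Im (p n) <= - (3/4) * tau"
  and q: "\<And>n. \<exists>r\<ge>0. cmod (q n - of_real r) <= tau\<^sup>2 / 8"
 shows "u n \<noteq> 0 \<and> Im (u (Suc n) / u n) <= - (tau / 2)"
proof (induction n)
 case 0
 have "u 1 / u 0 = p 0" using u0 u1 by simp
 thus ?case using u0 p[of 0] tau by simp
next
 case (Suc n)
 define h where "h = u (Suc n) / u n"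
 have h: "Im h <= - (tau / 2)" "h \<noteq> 0" "u n \<noteq> 0" using Suc tau unfolding h_def by auto
 have un: "u (Suc n) \<noteq> 0" using h(2) unfolding h_def by auto
 have hn: "tau / 2 <= cmod h" using abs_Im_le_cmod[of h] h(1) tau by linarith
 obtain r where r: "0 <= r" "cmod (q (Suc n) - of_real r) <= tau\<^sup>2 / 8" using q by blast
 define e where "e = q (Suc n) - of_real r"
 have "u (Suc (Suc n)) / u (Suc n) = p (Suc n) - q (Suc n) / h" unfolding rec h_def using un h(3) by (simp add: field_simps)
 also have "... = p (Suc n) - of_real r / h - e / h" unfolding e_def by (simp add: diff_divide_distrib)
 finally have eq: "u (Suc (Suc n)) / u (Suc n) = p (Suc n) - of_real r / h - e / h" .
 have "Im (of_real r / h) = - r * Im h / (cmod h)\<^sup>2" by (simp add: Im_divide cmod_power2)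
 moreover have "0 <= - r * Im h / (cmod h)\<^sup>2" using r(1) h(1) tau by (intro divide_nonneg_nonneg) (auto simp: mult_nonneg_nonpos)
 ultimately have "0 <= Im (of_real r / h)" by simp
 moreover have "- Im (e / h) <= tau / 4"
 proof -
  have "- Im (e / h) <= cmod (e / h)" using abs_Im_le_cmod[of "e / h"] by linarith
  also have "... <= (tau\<^sup>2 / 8) / (tau / 2)" unfolding norm_divide using r(2) hn tau by (intro frac_le) (auto simp: e_def)
  also have "... = tau / 4" using tau by (simp add: power2_eq_square)
  finally show ?thesis .
 qed
 ultimately have "Im (u (Suc (Suc n)) / u (Suc n)) <= - (tau / 2)" unfolding eq using p[of "Suc n"] by simp
 thus ?case using un by simp
qed

text \<open>Satisfied at energies with imaginary part \<open>tau\<close> and phases very close to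
  the real line (\<open>herglotz_coeffs\<close>). The conditions concern each site separately, so
  two such families of coefficients may be mixed.\<close>

definition herglotz :: "real => (int => complex) => (int => complex) => bool" where
 "herglotz tau alpha c \<longleftrightarrow> 0 < tau \<and> (\<forall>k. Im (alpha k) <= - (3/4) * tau) \<and> (\<forall>k. \<exists>r\<ge>0. cmod (c k - of_real r) <= tau\<^sup>2 / 8)"

lemma herglotz_right:
 assumes "herglotz tau alpha c"
 shows "cont alpha c i n \<noteq> 0 \<and> Im (cont alpha c i (Suc n) / cont alpha c i n) <= - (tau / 2)"
proof -
 have "Suc n = n + 1" for n by simp
 show ?thesis by (rule herglotz_sequence[where p = "\<lambda>n. alpha (i + int n)" and q = "\<lambda>n. c (i + int n)"])
    (use assms in \<open>auto simp: herglotz_def algebra_simps\<close>)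
qed

text \<open>The same recurrence, run from the right end of the block by adding sites on the
  left.\<close>

lemma herglotz_left:
 assumes "herglotz tau alpha c"
 shows "Im (cont alpha c i (Suc n) / cont alpha c (i + 1) n) <= - (tau / 2)"
proof -
 define j where "j = i + 1 + int n"
 define u where "u m = cont alpha c (j - int m) m" for m
 have "u n \<noteq> 0 \<and> Im (u (Suc n) / u n) <= - (tau / 2)"
 proof (rule herglotz_sequence[where p = "\<lambda>m. alpha (j - int m - 1)" and q = "\<lambda>m. c (j - int m)"])
  show "u (Suc (Suc m)) = alpha (j - int (Suc m) - 1) * u (Suc m) - c (j - int (Suc m)) * u m" for m
   unfolding u_def using cont_left[of alpha c "j - int (Suc (Suc m))" m] by (simp add: algebra_simps)
 qed (use assms in \<open>auto simp: herglotz_def u_def\<close>)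
 moreover have "j - int (Suc n) = i" "j - int n = i + 1" by (simp_all add: j_def)
 ultimately show ?thesis unfolding u_def by metis
qed

lemma Im_le_imp_cmod_le:
 assumes "Im (z / w) <= - t" "0 < t" shows "cmod w <= cmod z / t"
proof (cases "w = 0")
 case False
 have "t <= cmod (z / w)" using abs_Im_le_cmod[of "z / w"] assms by linarith
 thus ?thesis using False assms(2) by (simp add: norm_divide field_simps)
qed (use assms in auto)

lemma herglotz_remove_right:
 assumes h: "herglotz tau alpha c"
 shows "cmod (cont alpha c i n) <= (2 / tau) ^ k * cmod (cont alpha c i (n + k))"
proof (induction k)
 case (Suc k)
 have tau: "0 < tau" using h by (simp add: herglotz_def)
 have "cmod (cont alpha c i (n + k)) <= cmod (cont alpha c i (Suc (n + k))) / (tau / 2)"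
  by (rule Im_le_imp_cmod_le) (use herglotz_right[OF h] tau in auto)
 hence "(2 / tau) ^ k * cmod (cont alpha c i (n + k)) <= (2 / tau) ^ k * (cmod (cont alpha c i (Suc (n + k))) / (tau / 2))"
  using tau by (intro mult_left_mono) auto
 with Suc show ?case by (simp add: mult_ac)
qed simp

lemma herglotz_remove_left:
 assumes h: "herglotz tau alpha c"
 shows "cmod (cont alpha c (i + int k) n) <= (2 / tau) ^ k * cmod (cont alpha c i (k + n))"
proof (induction k arbitrary: n)
 case (Suc k)
 have tau: "0 < tau" using h by (simp add: herglotz_def)
 have "cmod (cont alpha c (i + int k + 1) n) <= cmod (cont alpha c (i + int k) (Suc n)) / (tau / 2)"
  by (rule Im_le_imp_cmod_le) (use herglotz_left[OF h] tau in auto)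
 also have "... = (2 / tau) * cmod (cont alpha c (i + int k) (Suc n))" by simp
 also have "... <= (2 / tau) * ((2 / tau) ^ k * cmod (cont alpha c i (k + Suc n)))" by (intro mult_left_mono Suc.IH) (use tau in auto)
 finally show ?case by (simp add: algebra_simps)
qed simp

text \<open>The two pieces divided by the whole block give a diagonal entry of the resolvent. Its
  reciprocal, by \<open>cont_split\<close>, is \<open>hR\<close> minus the coupling to the right
  piece, and its imaginary part is at most \<open>- tau / 4\<close>.\<close>

lemma herglotz_diagonal:
 assumes h: "herglotz tau alpha c"
 shows "cmod (cont alpha c i m) * cmod (cont alpha c (i + int m + 1) n) <= (4 / tau) * cmod (cont alpha c i (Suc m + n))"
proof (cases n)
 case 0
 have tau: "0 < tau" using h by (simp add: herglotz_def)
 have "cmod (cont alpha c i m) <= cmod (cont alpha c i (Suc m)) / (tau / 2)"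
  by (rule Im_le_imp_cmod_le) (use herglotz_right[OF h] tau in auto)
 also have "... <= (4 / tau) * cmod (cont alpha c i (Suc m))" using tau by (simp add: divide_right_mono)
 finally show ?thesis using 0 by simp
next
 case (Suc k)
 have tau: "0 < tau" using h by (simp add: herglotz_def)
 define L R where "L = cont alpha c i m" and "R = cont alpha c (i + int m + 1) (Suc k)"
 define hR where "hR = cont alpha c i (Suc m) / L"
 define hL where "hL = R / cont alpha c (i + int m + 2) k"
 have nz: "L \<noteq> 0" "R \<noteq> 0" "cont alpha c (i + int m + 2) k \<noteq> 0" unfolding L_def R_def using herglotz_right[OF h] by auto
 have hRi: "Im hR <= - (tau / 2)" unfolding hR_def L_def using herglotz_right[OF h] by auto
 have hLi: "Im hL <= - (tau / 2)" unfolding hL_def R_def using herglotz_left[OF h, of "i + int m + 1" k] by (simp add: algebra_simps)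
 obtain r where r: "0 <= r" "cmod (c (i + int m + 1) - of_real r) <= tau\<^sup>2 / 8" using h unfolding herglotz_def by blast
 define e where "e = c (i + int m + 1) - of_real r"
 have hn: "tau / 2 <= cmod hL" using abs_Im_le_cmod[of hL] hLi tau by linarith
 have "Im (of_real r / hL) = - r * Im hL / (cmod hL)\<^sup>2" by (simp add: Im_divide cmod_power2)
 moreover have "0 <= - r * Im hL / (cmod hL)\<^sup>2" using r(1) hLi tau by (intro divide_nonneg_nonneg) (auto simp: mult_nonneg_nonpos)
 ultimately have 1: "0 <= Im (of_real r / hL)" by simp
 have "- Im (e / hL) <= cmod (e / hL)" using abs_Im_le_cmod[of "e / hL"] by linarith
 also have "... <= (tau\<^sup>2 / 8) / (tau / 2)" unfolding norm_divide using r(2) hn tau by (intro frac_le) (auto simp: e_def)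
 also have "... = tau / 4" using tau by (simp add: power2_eq_square)
 finally have 2: "- Im (e / hL) <= tau / 4" .
 have "cont alpha c i (Suc m + Suc k) / (L * R) = hR - of_real r / hL - e / hL"
  unfolding cont_split using nz by (simp add: hR_def hL_def e_def L_def R_def field_simps)
 hence "Im (cont alpha c i (Suc m + Suc k) / (L * R)) <= - (tau / 4)" using 1 2 hRi by simp
 hence "cmod (L * R) <= cmod (cont alpha c i (Suc m + Suc k)) / (tau / 4)" by (rule Im_le_imp_cmod_le) (use tau in simp)
 thus ?thesis using Suc by (simp add: norm_mult L_def R_def mult.commute)
qed

lemma cont_diff_one_site:
 assumes "\<And>k. k \<noteq> i + int m ==> alpha k = alpha' k" "\<And>k. k \<noteq> i + int m ==> c k = c' k"
 shows "cont alpha c i (Suc m + n) - cont alpha' c' i (Suc m + n) =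
  ((alpha (i + int m) - alpha' (i + int m)) * cont alpha' c' i m
   - (if m = 0 then 0 else (c (i + int m) - c' (i + int m)) * cont alpha' c' i (m - 1))) * cont alpha' c' (i + int m + 1) n"
proof -
 let ?k = "i + int m"
 have agree_R: "cont alpha c j r = cont alpha' c' j r" if "?k < j" for j r by (rule cont_cong) (use assms that in auto)
 have agree_L: "cont alpha c i r = cont alpha' c' i r" if "r <= m" for r by (rule cont_cong) (use assms that in auto)
 have mid: "cont alpha c ?k (Suc n) - cont alpha' c' ?k (Suc n) = (alpha ?k - alpha' ?k) * cont alpha' c' (?k + 1) n"
 proof (cases n)
  case (Suc r)
  have "c (?k + 1) = c' (?k + 1)" using assms(2) by simp
  thus ?thesis unfolding Suc cont_left using agree_R[of "?k + 1"] agree_R[of "?k + 2"] by (simp add: algebra_simps)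
 qed simp
 show ?thesis
 proof (cases m)
  case 0
  thus ?thesis using mid by simp
 next
  case (Suc l)
  have k: "i + int l + 1 = ?k" "i + int l + 2 = ?k + 1" using Suc by auto
  have "cont alpha c i (Suc l + Suc n) - cont alpha' c' i (Suc l + Suc n) = cont alpha' c' i (Suc l) * (cont alpha c ?k (Suc n) - cont alpha' c' ?k (Suc n))
    - (c ?k - c' ?k) * cont alpha' c' i l * cont alpha' c' (?k + 1) n"
   unfolding cont_split k using agree_L[of "Suc l"] agree_L[of l] agree_R[of "?k + 1"] Suc by (simp add: algebra_simps)
  thus ?thesis unfolding mid using Suc by (simp add: algebra_simps)
 qed
qed

text \<open>The coefficients are exchanged one site at a time. By \<open>cont_diff_one_site\<close>
  each exchange changes the continuant by a small multiple of the pieces on both sides of the site,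
  which \<open>herglotz_diagonal\<close> bounds by the continuant itself. The bound has to be
  multiplicative because it is applied to values that may be exponentially small.\<close>

lemma herglotz_perturb:
 assumes h: "herglotz tau alpha c" "herglotz tau alpha' c'" and d: "\<And>k. cmod (alpha k - alpha' k) <= d" "\<And>k. cmod (c k - c' k) <= d"
 shows "cmod (cont alpha c i n) <= (1 + d * (1 + 2 / tau) * (4 / tau)) ^ n * cmod (cont alpha' c' i n)"
proof -
 define s where "s = d * (1 + 2 / tau) * (4 / tau)"
 have tau: "0 < tau" using h by (simp add: herglotz_def)
 have d0: "0 <= d" using d(1)[of 0] norm_ge_zero order_trans by blast
 have s0: "0 <= s" unfolding s_def using tau d0 by simp
 define alphaj where "alphaj j k = (if k < i + int j then alpha k else alpha' k)" for j k
 define cj where "cj j k = (if k < i + int j then c k else c' k)" for j k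
 have hj: "herglotz tau (alphaj j) (cj j)" for j using h unfolding herglotz_def alphaj_def cj_def by auto
 have step: "cmod (cont (alphaj (Suc j)) (cj (Suc j)) i n) <= (1 + s) * cmod (cont (alphaj j) (cj j) i n)" if j: "j < n" for j
 proof -
  obtain r where r: "n = Suc j + r" using j by (metis less_iff_Suc_add add_Suc)
  let ?k = "i + int j"
  let ?L = "cont (alphaj j) (cj j) i j" and ?R = "cont (alphaj j) (cj j) (?k + 1) r"
  define \<Delta> where "\<Delta> = cont (alphaj (Suc j)) (cj (Suc j)) i n - cont (alphaj j) (cj j) i n"
  have \<Delta>: "\<Delta> =
   ((alphaj (Suc j) ?k - alphaj j ?k) * ?L - (if j = 0 then 0 else (cj (Suc j) ?k - cj j ?k) * cont (alphaj j) (cj j) i (j - 1))) * ?R"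
   unfolding \<Delta>_def r by (rule cont_diff_one_site) (auto simp: alphaj_def cj_def)
  have "cmod \<Delta> <= (d * cmod ?L + d * (2 / tau * cmod ?L)) * cmod ?R"
  proof -
   have 1: "cmod ((alphaj (Suc j) ?k - alphaj j ?k) * ?L) <= d * cmod ?L"
    unfolding norm_mult using d by (intro mult_right_mono) (auto simp: alphaj_def)
   have 2: "cmod (if j = 0 then 0 else (cj (Suc j) ?k - cj j ?k) * cont (alphaj j) (cj j) i (j - 1)) <= d * (2 / tau * cmod ?L)"
   proof (cases "j = 0")
    case False
    have "cmod (cont (alphaj j) (cj j) i (j - 1)) <= (2 / tau) ^ 1 * cmod (cont (alphaj j) (cj j) i (j - 1 + 1))"
     by (rule herglotz_remove_right[OF hj])
    hence "cmod (cont (alphaj j) (cj j) i (j - 1)) <= 2 / tau * cmod ?L" using False by simp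
    moreover have "cmod (cj (Suc j) ?k - cj j ?k) <= d" using d by (auto simp: cj_def)
    ultimately have "cmod (cj (Suc j) ?k - cj j ?k) * cmod (cont (alphaj j) (cj j) i (j - 1)) <= d * (2 / tau * cmod ?L)"
     using d0 by (intro mult_mono) auto
    thus ?thesis using False by (simp only: if_False norm_mult)
   qed (use d0 tau in auto)
   show ?thesis unfolding \<Delta> norm_mult[of _ ?R] by (rule mult_right_mono[OF order_trans[OF norm_triangle_ineq4 add_mono[OF 1 2]]]) simp
  qed
  also have "... = d * (1 + 2 / tau) * (cmod ?L * cmod ?R)"
  proof -
   have "(x * y + x * (t * y)) * z = x * (1 + t) * (y * z)" for x y z t :: real by (simp add: algebra_simps)
   thus ?thesis .
  qed
  also have "... <= d * (1 + 2 / tau) * ((4 / tau) * cmod (cont (alphaj j) (cj j) i n))"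
   unfolding r using tau d0 by (intro mult_left_mono herglotz_diagonal[OF hj]) auto
  finally have "cmod \<Delta> <= s * cmod (cont (alphaj j) (cj j) i n)" unfolding s_def by (simp only: mult.assoc)
  thus ?thesis unfolding \<Delta>_def using norm_triangle_ineq2[of "cont (alphaj (Suc j)) (cj (Suc j)) i n" "cont (alphaj j) (cj j) i n"]
   by (simp add: algebra_simps)
 qed
 have "j <= n ==> cmod (cont (alphaj j) (cj j) i n) <= (1 + s) ^ j * cmod (cont (alphaj 0) (cj 0) i n)" for j
 proof (induction j)
  case (Suc j)
  have "cmod (cont (alphaj (Suc j)) (cj (Suc j)) i n) <= (1 + s) * cmod (cont (alphaj j) (cj j) i n)" using step Suc by simp
  also have "... <= (1 + s) * ((1 + s) ^ j * cmod (cont (alphaj 0) (cj 0) i n))" using Suc s0 by (intro mult_left_mono) auto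
  finally show ?case by (simp add: mult_ac)
 qed simp
 from this[of n] have "cmod (cont (alphaj n) (cj n) i n) <= (1 + s) ^ n * cmod (cont (alphaj 0) (cj 0) i n)" by simp
 moreover have "cont (alphaj n) (cj n) i n = cont alpha c i n" by (rule cont_cong) (auto simp: alphaj_def cj_def)
 moreover have "cont (alphaj 0) (cj 0) i n = cont alpha' c' i n" by (rule cont_cong) (auto simp: alphaj_def cj_def)
 ultimately show ?thesis by (simp add: s_def)
qed

text \<open>Sites can be removed on the left at the cost of the Herglotz bound and added on the right at
 the cost of an exponential, so a continuant at a shifted position is controlled by the
 unshifted one.\<close>

lemma herglotz_translate:
 assumes h: "herglotz tau alpha c" and tau: "tau <= 2" and C: "\<And>k. cmod (alpha k) <= C" "\<And>k. cmod (c k) <= C" "1 <= C"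
  and k: "k <= K" "K < n" and i: "i <= 2" "i <= n"
 shows "cmod (cont alpha c (int k) (n - i)) <= (2 * C) ^ K * (2 / tau) ^ (K + 2) * cmod (cont alpha c 0 n)"
proof -
 have tau0: "0 < tau" using h by (simp add: herglotz_def)
 have one: "1 <= 2 / tau" "1 <= 2 * C" using tau tau0 C(3) by auto
 show ?thesis
 proof (cases "k <= i")
  \<comment> \<open>For \<open>k <= i\<close> the translated block lies inside the original one, so
    sites only have to be removed.\<close>
  case True
  have "cmod (cont alpha c (0 + int k) (n - i)) <= (2 / tau) ^ k * cmod (cont alpha c 0 (k + (n - i)))" by (rule herglotz_remove_left[OF h])
  also have "... <= (2 / tau) ^ k * ((2 / tau) ^ (i - k) * cmod (cont alpha c 0 (k + (n - i) + (i - k))))"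
   using tau0 by (intro mult_left_mono herglotz_remove_right[OF h]) auto
  also have "k + (n - i) + (i - k) = n" using True i by simp
  also have "(2 / tau) ^ k * ((2 / tau) ^ (i - k) * cmod (cont alpha c 0 n)) = 1 * (2 / tau) ^ i * cmod (cont alpha c 0 n)"
   using True by (simp flip: power_add mult.assoc)
  also have "... <= (2 * C) ^ K * (2 / tau) ^ (K + 2) * cmod (cont alpha c 0 n)"
   using one tau0 i by (intro mult_right_mono mult_mono one_le_power power_increasing) auto
  finally show ?thesis by simp
 next
  case False
  have L: "cmod (cont alpha c (int k) (n - k)) <= (2 / tau) ^ k * cmod (cont alpha c 0 n)"
   using herglotz_remove_left[OF h, of 0 k "n - k"] k by simp
  have R: "cmod (cont alpha c (int k) (n - k - 1)) <= (2 / tau) ^ (k + 1) * cmod (cont alpha c 0 n)"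
  proof -
   have "cmod (cont alpha c (int k) (n - k - 1)) <= (2 / tau) ^ 1 * cmod (cont alpha c (int k) (n - k - 1 + 1))"
    by (rule herglotz_remove_right[OF h])
   also have "n - k - 1 + 1 = n - k" using k by simp
   also have "(2 / tau) ^ 1 * cmod (cont alpha c (int k) (n - k)) <= (2 / tau) ^ 1 * ((2 / tau) ^ k * cmod (cont alpha c 0 n))"
    using L tau0 by (intro mult_left_mono) auto
   finally show ?thesis by simp
  qed
  have "(2 / tau) ^ k * cmod (cont alpha c 0 n) <= (2 / tau) ^ (k + 1) * cmod (cont alpha c 0 n)"
   using one tau0 by (intro mult_right_mono power_increasing) auto
  hence mx: "max (cmod (cont alpha c (int k) (n - k))) (cmod (cont alpha c (int k) (n - k - 1))) <= (2 / tau) ^ (k + 1) * cmod (cont alpha c 0 n)"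
   using L R by simp
  have n1: "Suc (n - k - 1) = n - k" "n - k + (k - i) = n - i" using k False i by auto
  have "cmod (cont alpha c (int k) (n - i)) <= (2 * C) ^ (k - i) * max (cmod (cont alpha c (int k) (n - k))) (cmod (cont alpha c (int k) (n - k - 1)))"
   using cont_growth[of alpha C c "int k" "n - k - 1" "k - i", OF C] unfolding n1 .
  also have "... <= (2 * C) ^ K * ((2 / tau) ^ (K + 2) * cmod (cont alpha c 0 n))"
  proof (intro mult_mono)
   show "max (cmod (cont alpha c (int k) (n - k))) (cmod (cont alpha c (int k) (n - k - 1))) <= (2 / tau) ^ (K + 2) * cmod (cont alpha c 0 n)"
    by (rule order_trans[OF mx], rule mult_right_mono, rule power_increasing) (use one k in auto)
   show "(2 * C) ^ (k - i) <= (2 * C) ^ K" using one k by (intro power_increasing) auto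
  qed (use one in \<open>auto simp: le_max_iff_disj\<close>)
  finally show ?thesis by (simp add: mult.assoc)
 qed
qed

text \<open>Gaussian elimination from the left end: only the two values just outside the first
  \<open>m\<close> sites of the block and the one before it remain.\<close>

lemma cont_solution_left:
 assumes "\<And>k. i <= k ==> k <= i + int m ==> of_real (A k) * psi k - B (k + 1) * psi (k + 1) - cnj (B k) * psi (k - 1) = e * psi k"
 shows "cont (\<lambda>k. of_real (A k) - e) (\<lambda>k. of_real ((cmod (B k))\<^sup>2)) i (Suc m) * psi (i + int m) =
  B (i + int m + 1) * cont (\<lambda>k. of_real (A k) - e) (\<lambda>k. of_real ((cmod (B k))\<^sup>2)) i m * psi (i + int m + 1)
  + (\<Prod>j\<le>m. cnj (B (i + int j))) * psi (i - 1)" using assms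
proof (induction m)
 case 0
 from 0[of i] show ?case by (simp add: algebra_simps)
next
 case (Suc m)
 let ?f = "cont (\<lambda>k. of_real (A k) - e) (\<lambda>k. of_real ((cmod (B k))\<^sup>2)) i"
 let ?k = "i + int m + 1"
 have IH: "?f (Suc m) * psi (i + int m) = B ?k * ?f m * psi ?k + (\<Prod>j\<le>m. cnj (B (i + int j))) * psi (i - 1)"
  by (rule Suc.IH) (use Suc.prems in auto)
 have eq: "(of_real (A ?k) - e) * psi ?k = B (?k + 1) * psi (?k + 1) + cnj (B ?k) * psi (i + int m)"
  using Suc.prems[of ?k] by (simp add: algebra_simps)
 have bb: "complex_of_real ((cmod (B ?k))\<^sup>2) = cnj (B ?k) * B ?k" by (simp add: complex_norm_square mult.commute del: of_real_power)
 have "?f (Suc (Suc m)) * psi ?k = ?f (Suc m) * ((of_real (A ?k) - e) * psi ?k) - of_real ((cmod (B ?k))\<^sup>2) * ?f m * psi ?k"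
  by (simp add: algebra_simps del: of_real_power)
 also have "... = ?f (Suc m) * (B (?k + 1) * psi (?k + 1)) + cnj (B ?k) * (?f (Suc m) * psi (i + int m) - B ?k * ?f m * psi ?k)"
  unfolding eq bb by (simp add: algebra_simps)
 also have "... = B (?k + 1) * ?f (Suc m) * psi (?k + 1) + cnj (B ?k) * ((\<Prod>j\<le>m. cnj (B (i + int j))) * psi (i - 1))" unfolding IH by simp
 finally have "?f (Suc (Suc m)) * psi ?k = B (?k + 1) * ?f (Suc m) * psi (?k + 1) + (\<Prod>j\<le>Suc m. cnj (B (i + int j))) * psi (i - 1)"
  by (simp add: algebra_simps)
 moreover have "i + int (Suc m) = ?k" by simp
 ultimately show ?case by (metis (no_types, lifting))
qed

lemma cont_solution_right:
 assumes "\<And>k. i <= k ==> k <= i + int m ==> of_real (A k) * psi k - B (k + 1) * psi (k + 1) - cnj (B k) * psi (k - 1) = e * psi k"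
 shows "cont (\<lambda>k. of_real (A k) - e) (\<lambda>k. of_real ((cmod (B k))\<^sup>2)) i (Suc m) * psi i =
  cnj (B i) * cont (\<lambda>k. of_real (A k) - e) (\<lambda>k. of_real ((cmod (B k))\<^sup>2)) (i + 1) m * psi (i - 1)
  + (\<Prod>j\<le>m. B (i + int j + 1)) * psi (i + int m + 1)" using assms
proof (induction m arbitrary: i)
 case 0
 from 0[of i] show ?case by (simp add: algebra_simps)
next
 case (Suc m)
 let ?f = "cont (\<lambda>k. of_real (A k) - e) (\<lambda>k. of_real ((cmod (B k))\<^sup>2))"
 have IH: "?f (i + 1) (Suc m) * psi (i + 1) = cnj (B (i + 1)) * ?f (i + 2) m * psi i + (\<Prod>j\<le>m. B (i + 1 + int j + 1)) * psi (i + 1 + int m + 1)"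
  using Suc.IH[of "i + 1"] Suc.prems by (simp add: add.assoc)
 have eq: "(of_real (A i) - e) * psi i = B (i + 1) * psi (i + 1) + cnj (B i) * psi (i - 1)" using Suc.prems[of i] by (simp add: algebra_simps)
 have bb: "complex_of_real ((cmod (B (i + 1)))\<^sup>2) = cnj (B (i + 1)) * B (i + 1)" by (simp add: complex_norm_square mult.commute del: of_real_power)
 have "?f i (Suc (Suc m)) * psi i = ?f (i + 1) (Suc m) * ((of_real (A i) - e) * psi i) - of_real ((cmod (B (i + 1)))\<^sup>2) * ?f (i + 2) m * psi i"
  unfolding cont_left by (simp add: algebra_simps del: of_real_power)
 also have "... = ?f (i + 1) (Suc m) * (cnj (B i) * psi (i - 1)) + B (i + 1) * (?f (i + 1) (Suc m) * psi (i + 1) - cnj (B (i + 1)) * ?f (i + 2) m * psi i)"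
  unfolding eq bb by (simp add: algebra_simps)
 also have "... = cnj (B i) * ?f (i + 1) (Suc m) * psi (i - 1) + B (i + 1) * ((\<Prod>j\<le>m. B (i + 1 + int j + 1)) * psi (i + 1 + int m + 1))"
  unfolding IH by simp
 also have "B (i + 1) * ((\<Prod>j\<le>m. B (i + 1 + int j + 1)) * psi (i + 1 + int m + 1)) = (\<Prod>j\<le>Suc m. B (i + int j + 1)) * psi (i + int (Suc m) + 1)"
  unfolding prod.atMost_Suc_shift by (simp add: algebra_simps)
 finally show ?case .
qed

text \<open>Poisson's formula, or Cramer's rule for the boundary value problem on the block, in a
  form without division. The value at \<open>i + m + 1\<close> is eliminated between the two
  one-sided identities.\<close>

lemma poisson_identity:
 fixes i :: int and m n :: nat
 assumes "\<And>k. i <= k ==> k < i + int (m + 1 + n) ==> of_real (A k) * psi k - B (k + 1) * psi (k + 1) - cnj (B k) * psi (k - 1) = e * psi k"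
 defines "f \<equiv> cont (\<lambda>k. of_real (A k) - e) (\<lambda>k. of_real ((cmod (B k))\<^sup>2))"
 shows "f i (m + 1 + n) * psi (i + int m) =
  f (i + int m + 1) n * (\<Prod>j\<le>m. cnj (B (i + int j))) * psi (i - 1)
  + f i m * (\<Prod>j\<le>n. B (i + int m + int j + 1)) * psi (i + int (m + 1 + n))"
proof (cases n)
 case 0
 have "f i (Suc m) * psi (i + int m) = B (i + int m + 1) * f i m * psi (i + int m + 1) + (\<Prod>j\<le>m. cnj (B (i + int j))) * psi (i - 1)"
  unfolding f_def by (rule cont_solution_left) (use assms(1) in auto)
 thus ?thesis using 0 by (simp add: f_def algebra_simps)
next
 case (Suc r)
 let ?k = "i + int m"
 have L: "f i (Suc m) * psi ?k = B (?k + 1) * f i m * psi (?k + 1) + (\<Prod>j\<le>m. cnj (B (i + int j))) * psi (i - 1)"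
  unfolding f_def by (rule cont_solution_left) (use assms(1) Suc in auto)
 have R: "f (?k + 1) (Suc r) * psi (?k + 1) = cnj (B (?k + 1)) * f (?k + 2) r * psi ?k + (\<Prod>j\<le>r. B (?k + 1 + int j + 1)) * psi (?k + 1 + int r + 1)"
  using cont_solution_right[of "?k + 1" r A psi B e] assms(1) Suc unfolding f_def by (simp add: add.assoc)
 have bb: "complex_of_real ((cmod (B (?k + 1)))\<^sup>2) = cnj (B (?k + 1)) * B (?k + 1)" by (simp add: complex_norm_square mult.commute del: of_real_power)
 have n1: "m + 1 + n = Suc m + Suc r" using Suc by simp
 have "f i (Suc m + Suc r) * psi ?k = f (?k + 1) (Suc r) * (f i (Suc m) * psi ?k) - cnj (B (?k + 1)) * B (?k + 1) * f i m * f (?k + 2) r * psi ?k"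
  unfolding f_def cont_split bb by (simp add: algebra_simps)
 also have "... = f (?k + 1) (Suc r) * ((\<Prod>j\<le>m. cnj (B (i + int j))) * psi (i - 1))
   + B (?k + 1) * f i m * (f (?k + 1) (Suc r) * psi (?k + 1) - cnj (B (?k + 1)) * f (?k + 2) r * psi ?k)" unfolding L by (simp add: algebra_simps)
 also have "... = f (?k + 1) (Suc r) * ((\<Prod>j\<le>m. cnj (B (i + int j))) * psi (i - 1))
   + B (?k + 1) * f i m * ((\<Prod>j\<le>r. B (?k + 1 + int j + 1)) * psi (?k + 1 + int r + 1))" unfolding R by simp
 also have "B (?k + 1) * f i m * ((\<Prod>j\<le>r. B (?k + 1 + int j + 1)) * psi (?k + 1 + int r + 1)) =
   f i m * (\<Prod>j\<le>Suc r. B (?k + int j + 1)) * psi (i + int (Suc m + Suc r))" unfolding prod.atMost_Suc_shift by (simp add: algebra_simps)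
 finally show ?thesis unfolding n1 unfolding Suc by (simp only: mult.assoc)
qed

subsection \<open>Determinants of non-resonant blocks\<close>

text \<open>By Dirichlet's theorem some multiple \<open>q * w\<close> is within \<open>1 / N\<close>
  of an integer, so the multiples of \<open>q * w\<close> advance on the circle in steps
  \<open>d\<close> of at most that size. The Diophantine condition bounds the step from below, and
  thereby the number of steps in a full turn.\<close>

lemma diophantine_orbit_dense:
 assumes w: "w \<in> diophantine c alpha" and c: "0 < c" and alpha: "0 <= alpha" and N: "0 < N"
 shows "\<exists>(k::nat) (p::int). real k <= real N * (4 * real N * ln (2 * real N) powr alpha / c + 2) \<and>
  \<bar>real k * w - of_int p - y\<bar> <= 1 / real N"
proof -
 obtain p0 q0 :: int where q0: "0 < q0" "q0 <= int N" "\<bar>of_int q0 * w - of_int p0\<bar> < 1 / real N" using Dirichlet_approx[OF N, of w] by metis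
 define q where "q = nat q0"
 have q: "0 < q" "q <= N" "real q = of_int q0" using q0 by (auto simp: q_def)
 define d where "d = real q * w - of_int p0"
 have d1: "\<bar>d\<bar> < 1 / real N" using q0(3) q(3) by (simp add: d_def)
 have qN: "1 <= real q" "real q <= real N" "0 < real N" using q by auto
 define D where "D = 4 * real N * ln (2 * real N) powr alpha"
 have lnpos: "0 < ln (2 * real q)" using qN by simp
 have D0: "0 < D" unfolding D_def using qN by simp
 \<comment> \<open>The condition starts at 2 while \<open>q\<close> may be 1, so it is applied to
   \<open>2 * q\<close>.\<close>
 have "2 <= 2 * q" using q(1) by simp
 hence "c / (real (2 * q) * ln (real (2 * q)) powr alpha) <= infdist (real (2 * q) * w) \<int>" using w unfolding diophantine_def by blast
 also have "... <= dist (real (2 * q) * w) (of_int (2 * p0))" by (rule infdist_le) simp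
 also have "... = 2 * \<bar>d\<bar>"
 proof -
  have "real (2 * q) * w - of_int (2 * p0) = 2 * d" by (simp add: d_def)
  thus ?thesis by (simp add: dist_real_def abs_mult)
 qed
 finally have "c / (4 * real q * ln (2 * real q) powr alpha) <= \<bar>d\<bar>" by simp
 moreover have "c / D <= c / (4 * real q * ln (2 * real q) powr alpha)"
  unfolding D_def using c qN lnpos alpha by (intro divide_left_mono mult_mono powr_mono2) auto
 ultimately have dD: "c / D <= \<bar>d\<bar>" by linarith
 hence d0: "0 < \<bar>d\<bar>" using c D0 by (smt (verit) divide_pos_pos)
 have inv: "1 / \<bar>d\<bar> <= D / c" using dD d0 c D0 by (simp add: field_simps)
 \<comment> \<open>A representative of \<open>y\<close> modulo 1 with the sign of \<open>d\<close>,
   so that the number of steps is nonnegative.\<close>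
 define y' where "y' = (if 0 < d then frac y else frac y - 1)"
 obtain m where m: "y = y' + of_int m" using that[of "if 0 < d then \<lfloor>y\<rfloor> else \<lfloor>y\<rfloor> + 1"] by (auto simp: y'_def frac_def)
 have fr: "0 <= frac y" "frac y < 1" by (auto simp: frac_lt_1)
 define j where "j = nat \<lfloor>y' / d\<rfloor>"
 have yd: "0 <= y' / d" "y' / d <= 1 / \<bar>d\<bar>"
 proof -
  have y'_cases: "(0 < d \<and> 0 <= y' \<and> y' <= 1) \<or> (d < 0 \<and> y' <= 0 \<and> - 1 <= y')" using fr d0 by (auto simp: y'_def)
  thus "0 <= y' / d" by (auto intro: divide_nonneg_nonneg divide_nonpos_nonpos)
  have "\<bar>y' / d\<bar> <= 1 / \<bar>d\<bar>" unfolding abs_divide using y'_cases by (intro divide_right_mono) auto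
  thus "y' / d <= 1 / \<bar>d\<bar>" by linarith
 qed
 have j: "real j <= y' / d" "y' / d < real j + 1" unfolding j_def using yd(1) by linarith+
 have jd: "\<bar>real j * d - y'\<bar> <= \<bar>d\<bar>"
 proof -
  have "\<bar>real j - y' / d\<bar> <= 1" using j by linarith
  hence "\<bar>real j - y' / d\<bar> * \<bar>d\<bar> <= 1 * \<bar>d\<bar>" by (rule mult_right_mono) simp
  moreover have "\<bar>real j - y' / d\<bar> * \<bar>d\<bar> = \<bar>real j * d - y'\<bar>" unfolding abs_mult[symmetric] using d0 by (auto simp: left_diff_distrib)
  ultimately show ?thesis by simp
 qed
 have jb: "real j <= D / c" using j yd inv by linarith
 have "real (j * q) * w - of_int (int j * p0 - m) - y = real j * d - y'" unfolding d_def m by (simp add: algebra_simps)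
 hence "\<bar>real (j * q) * w - of_int (int j * p0 - m) - y\<bar> <= 1 / real N" using jd d1 by simp
 moreover have "real (j * q) <= real N * (D / c + 2)"
 proof -
  have "real (j * q) <= (D / c) * real N" unfolding of_nat_mult using jb qN c D0 by (intro mult_mono) auto
  thus ?thesis using qN by (simp add: algebra_simps)
 qed
 ultimately show ?thesis unfolding D_def by blast
qed

text \<open>\<open>ac\<close> and \<open>bb\<close> extend \<open>a\<close> and the squared modulus
  of \<open>b\<close> to a strip; the off-diagonal entries enter the determinants only through the
  latter. The single constant \<open>beta\<close> bounds all functions and their Lipschitz
  constants.\<close>

locale jacobi_data =
 fixes a :: "real => real" and b :: "real => complex" and ac bb :: "complex => complex" and y1 beta :: real
 assumes y1: "0 < y1" and beta: "1 <= beta"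
  and a_periodic: "a (x + 1) = a x" and b_periodic: "b (x + 1) = b x"
  and ac_holo: "ac holomorphic_on {z. \<bar>Im z\<bar> < y1}" and bb_holo: "bb holomorphic_on {z. \<bar>Im z\<bar> < y1}"
  and ac_periodic: "\<bar>Im z\<bar> < y1 ==> ac (z + 1) = ac z" and bb_periodic: "\<bar>Im z\<bar> < y1 ==> bb (z + 1) = bb z"
  and ac_real: "ac (of_real x) = of_real (a x)" and bb_real: "bb (of_real x) = of_real ((cmod (b x))\<^sup>2)"
  and ac_bound: "\<bar>Im z\<bar> < y1 ==> cmod (ac z) <= beta" and bb_bound: "\<bar>Im z\<bar> < y1 ==> cmod (bb z) <= beta"
  and b_bound: "cmod (b x) <= beta"
  and ac_lipschitz: "\<bar>Im z\<bar> < y1 ==> \<bar>Im z'\<bar> < y1 ==> cmod (ac z - ac z') <= beta * cmod (z - z')"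
  and bb_lipschitz: "\<bar>Im z\<bar> < y1 ==> \<bar>Im z'\<bar> < y1 ==> cmod (bb z - bb z') <= beta * cmod (z - z')"
  and b_lipschitz: "cmod (b x - b x') <= beta * \<bar>x - x'\<bar>"
begin

definition spec :: "nat => real => real => real set" where
 "spec n x w = set (jacobi_eigenvalues a b n x w)"

abbreviation hop :: "real => real => (int => complex) => int => complex" where
 "hop x w \<equiv> jacobi_op (\<lambda>k. a (x + of_int k * w)) (\<lambda>k. b (x + of_int k * w))"

lemma a_lipschitz: "\<bar>a x - a x'\<bar> <= beta * \<bar>x - x'\<bar>"
proof -
 have "cmod (ac (of_real x) - ac (of_real x')) <= beta * cmod (of_real x - of_real x')" using y1 by (intro ac_lipschitz) auto
 thus ?thesis unfolding ac_real by (simp flip: of_real_diff)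
qed

lemma a_bound: "\<bar>a x\<bar> <= beta" using ac_bound[of "of_real x"] y1 by (simp add: ac_real)

lemma spec_iff:
 "e \<in> spec n x w \<longleftrightarrow> (\<exists>psi. vanishes_off n psi \<and> 0 < norm2_n n psi \<and> (\<forall>k\<in>{0..<int n}. hop x w psi k = of_real e * psi k))"
 unfolding spec_def by (rule jacobi_seq.set_jacobi_eigenvalues_iff)

lemma approx_spec:
 assumes "vanishes_off n psi" "0 < norm2_n n psi" "0 <= t"
  and "norm2_n n (\<lambda>k. hop x w psi k - of_real E * psi k) <= t\<^sup>2 * norm2_n n psi"
 shows "\<exists>e\<in>spec n x w. \<bar>e - E\<bar> <= t"
proof -
 obtain e phi where "\<bar>e - E\<bar> <= t" "vanishes_off n phi" "0 < norm2_n n phi" "\<forall>k\<in>{0..<int n}. hop x w phi k = of_real e * phi k"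
  using approx_eigenvector[OF assms] by blast
 thus ?thesis unfolding Bex_def spec_iff by (intro exI[of _ e]) auto
qed

lemma finite_spec: "finite (spec n x w)" by (simp add: spec_def)

lemma card_spec: "card (spec n x w) <= n"
 unfolding spec_def using card_length[of "jacobi_eigenvalues a b n x w"] by (simp add: length_jacobi_eigenvalues)

lemma spec_periodic: "spec n (x + 1) w = spec n x w"
proof -
 have h: "a (x + 1 + t) = a (x + t)" "b (x + 1 + t) = b (x + t)" for t
  using a_periodic[of "x + t"] b_periodic[of "x + t"] by (simp_all add: algebra_simps)
 have "jacobi_matrix a b n (x + 1) w = jacobi_matrix a b n x w" unfolding jacobi_matrix_def h ..
 thus ?thesis by (simp add: spec_def jacobi_eigenvalues_def)
qed

lemma norm_add3_squared: "(cmod (u + v + z))\<^sup>2 <= 3 * ((cmod u)\<^sup>2 + (cmod v)\<^sup>2 + (cmod z)\<^sup>2)"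
proof -
 have "(cmod (u + v + z))\<^sup>2 <= (cmod u + cmod v + cmod z)\<^sup>2"
  by (intro power_mono order_trans[OF norm_triangle_ineq] add_right_mono norm_triangle_ineq) auto
 also have "... <= 3 * ((cmod u)\<^sup>2 + (cmod v)\<^sup>2 + (cmod z)\<^sup>2)"
  using sum_squares_ge_zero[of "cmod u - cmod v" "cmod v - cmod z"] zero_le_power2[of "cmod u - cmod z"] by (simp add: power2_eq_square algebra_simps)
 finally show ?thesis .
qed

text \<open>An eigenvector for \<open>(x, w)\<close> is an approximate eigenvector for
  \<open>(x', w')\<close>, because each of the three terms of the operator changes by at most
  \<open>D\<close> times an entry; then \<open>approx_spec\<close> applies.\<close>

lemma spec_lipschitz:
 assumes "e \<in> spec n x w"
 shows "\<exists>e'\<in>spec n x' w'. \<bar>e - e'\<bar> <= (3 * beta) * (\<bar>x - x'\<bar> + real n * \<bar>w - w'\<bar>)"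
proof -
 obtain psi where psi: "vanishes_off n psi" "0 < norm2_n n psi" "\<And>k. k\<in>{0..<int n} ==> hop x w psi k = of_real e * psi k"
  using assms unfolding spec_iff by blast
 define D where "D = beta * (\<bar>x - x'\<bar> + real n * \<bar>w - w'\<bar>)"
 have D0: "0 <= D" unfolding D_def using beta by simp
 have ph: "\<bar>(x' + of_int k * w') - (x + of_int k * w)\<bar> <= \<bar>x - x'\<bar> + real n * \<bar>w - w'\<bar>" if k: "0 <= k" "k <= int n" for k
 proof -
  have "\<bar>(x' + of_int k * w') - (x + of_int k * w)\<bar> <= \<bar>x - x'\<bar> + \<bar>of_int k * (w' - w)\<bar>" by (simp add: algebra_simps)
  also have "\<bar>of_int k * (w' - w)\<bar> = of_int k * \<bar>w - w'\<bar>" using k by (simp add: abs_mult abs_minus_commute)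
  also have "... <= real n * \<bar>w - w'\<bar>" using k by (intro mult_right_mono) auto
  finally show ?thesis by simp
 qed
 have da: "cmod (of_real (a (x' + of_int k * w')) - of_real (a (x + of_int k * w))) <= D" if "0 <= k" "k <= int n" for k
 proof -
  have "\<bar>a (x' + of_int k * w') - a (x + of_int k * w)\<bar> <= beta * \<bar>(x' + of_int k * w') - (x + of_int k * w)\<bar>" by (rule a_lipschitz)
  also have "... <= D" unfolding D_def using ph[OF that] beta by (intro mult_left_mono) auto
  finally show ?thesis by (metis norm_of_real of_real_diff)
 qed
 have db: "cmod (b (x' + of_int k * w') - b (x + of_int k * w)) <= D" if "0 <= k" "k <= int n" for k
 proof -
  have "cmod (b (x' + of_int k * w') - b (x + of_int k * w)) <= beta * \<bar>(x' + of_int k * w') - (x + of_int k * w)\<bar>" by (rule b_lipschitz)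
  also have "... <= D" unfolding D_def using ph[OF that] beta by (intro mult_left_mono) auto
  finally show ?thesis .
 qed
 have pt: "(cmod (hop x' w' psi k - of_real e * psi k))\<^sup>2 <= 3 * D\<^sup>2 * ((cmod (psi k))\<^sup>2 + (cmod (psi (k + 1)))\<^sup>2 + (cmod (psi (k - 1)))\<^sup>2)" if k: "k \<in> {0..<int n}" for k
 proof -
  let ?u = "(of_real (a (x' + of_int k * w')) - of_real (a (x + of_int k * w))) * psi k"
  let ?v = "- (b (x' + of_int (k + 1) * w') - b (x + of_int (k + 1) * w)) * psi (k + 1)"
  let ?z = "- cnj (b (x' + of_int k * w') - b (x + of_int k * w)) * psi (k - 1)"
  have "hop x' w' psi k - of_real e * psi k = hop x' w' psi k - hop x w psi k" using psi(3)[OF k] by simp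
  also have "... = ?u + ?v + ?z" unfolding jacobi_op_def by (simp add: algebra_simps)
  finally have "(cmod (hop x' w' psi k - of_real e * psi k))\<^sup>2 <= 3 * ((cmod ?u)\<^sup>2 + (cmod ?v)\<^sup>2 + (cmod ?z)\<^sup>2)"
   using norm_add3_squared[of ?u ?v ?z] by simp
  moreover have "(cmod ?u)\<^sup>2 <= D\<^sup>2 * (cmod (psi k))\<^sup>2" unfolding power_mult_distrib[symmetric] norm_mult
   using da[of k] k D0 by (intro power_mono mult_right_mono) auto
  moreover have "(cmod ?v)\<^sup>2 <= D\<^sup>2 * (cmod (psi (k + 1)))\<^sup>2" unfolding power_mult_distrib[symmetric] norm_mult norm_minus_cancel
   using db[of "k + 1"] k D0 by (intro power_mono mult_right_mono) auto
  moreover have "(cmod ?z)\<^sup>2 <= D\<^sup>2 * (cmod (psi (k - 1)))\<^sup>2" unfolding power_mult_distrib[symmetric] norm_mult norm_minus_cancel complex_mod_cnj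
   using db[of k] k D0 by (intro power_mono mult_right_mono) auto
  ultimately show ?thesis by (simp add: algebra_simps)
 qed
 have s1: "(\<Sum>k\<in>{0..<int n}. (cmod (psi (k + 1)))\<^sup>2) <= norm2_n n psi"
 proof -
  have "(\<Sum>k\<in>{0..<int n}. (cmod (psi (k + 1)))\<^sup>2) = (\<Sum>k\<in>{1..<int n + 1}. (cmod (psi k))\<^sup>2)"
   by (rule sum.reindex_bij_witness[of _ "\<lambda>k. k - 1" "\<lambda>k. k + 1"]) auto
  also have "... <= (\<Sum>k\<in>{0..<int n + 1}. (cmod (psi k))\<^sup>2)" by (rule sum_mono2) auto
  also have "... = norm2_n n psi" unfolding norm2_n_def by (rule sum.mono_neutral_right) (use psi(1) in \<open>auto simp: vanishes_off_def\<close>)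
  finally show ?thesis .
 qed
 have s2: "(\<Sum>k\<in>{0..<int n}. (cmod (psi (k - 1)))\<^sup>2) <= norm2_n n psi"
 proof -
  have "(\<Sum>k\<in>{0..<int n}. (cmod (psi (k - 1)))\<^sup>2) = (\<Sum>k\<in>{-1..<int n - 1}. (cmod (psi k))\<^sup>2)"
   by (rule sum.reindex_bij_witness[of _ "\<lambda>k. k + 1" "\<lambda>k. k - 1"]) auto
  also have "... <= (\<Sum>k\<in>{-1..<int n}. (cmod (psi k))\<^sup>2)" by (rule sum_mono2) auto
  also have "... = norm2_n n psi" unfolding norm2_n_def by (rule sum.mono_neutral_right) (use psi(1) in \<open>auto simp: vanishes_off_def\<close>)
  finally show ?thesis .
 qed
 have "norm2_n n (\<lambda>k. hop x' w' psi k - of_real e * psi k) <= (\<Sum>k\<in>{0..<int n}. 3 * D\<^sup>2 * ((cmod (psi k))\<^sup>2 + (cmod (psi (k + 1)))\<^sup>2 + (cmod (psi (k - 1)))\<^sup>2))"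
  unfolding norm2_n_def[of n "\<lambda>k. hop x' w' psi k - of_real e * psi k"] by (rule sum_mono) (rule pt)
 also have "... = 3 * D\<^sup>2 * (norm2_n n psi + (\<Sum>k\<in>{0..<int n}. (cmod (psi (k + 1)))\<^sup>2) + (\<Sum>k\<in>{0..<int n}. (cmod (psi (k - 1)))\<^sup>2))"
  by (simp add: sum_distrib_left sum.distrib norm2_n_def distrib_left)
 also have "... <= 3 * D\<^sup>2 * (3 * norm2_n n psi)" using s1 s2 by (intro mult_left_mono) auto
 also have "... = (3 * D)\<^sup>2 * norm2_n n psi" by (simp add: power2_eq_square)
 finally have "norm2_n n (\<lambda>k. hop x' w' psi k - of_real e * psi k) <= (3 * D)\<^sup>2 * norm2_n n psi" .
 from approx_spec[OF psi(1,2) _ this] D0 obtain e' where "e' \<in> spec n x' w'" "\<bar>e' - e\<bar> <= 3 * D" by auto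
 thus ?thesis unfolding D_def by (intro bexI[of _ e']) (auto simp: abs_minus_commute mult.assoc)
qed

lemma resonance_spec: "1 <= n ==> resonance (spec n) n (3 * beta)"
 using beta by unfold_locales (use finite_spec card_spec spec_periodic spec_lipschitz in auto)

definition f :: "nat => complex => real => complex => complex" where
 "f n z w e = cont (\<lambda>j. ac (z + of_int j * of_real w) - e) (\<lambda>j. bb (z + of_int j * of_real w)) 0 n"

lemma f_real:
 "f n (of_real x) w e = cont (\<lambda>j. of_real (a (x + of_int j * w)) - e) (\<lambda>j. of_real ((cmod (b (x + of_int j * w)))\<^sup>2)) 0 n"
proof -
 have "complex_of_real x + of_int j * of_real w = of_real (x + of_int j * w)" for j by simp
 thus ?thesis unfolding f_def by (simp only: ac_real bb_real)
qed

lemma f_real_prod: "f n (of_real x) w e = (\<Prod>l\<leftarrow>jacobi_eigenvalues a b n x w. of_real l - e)"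
 unfolding f_real by (rule jacobi_seq.cont_eq_prod_eigenvalues)

lemma f_shift:
 "f n (z + of_nat k * of_real w) w e = cont (\<lambda>j. ac (z + of_int j * of_real w) - e) (\<lambda>j. bb (z + of_int j * of_real w)) (int k) n"
 unfolding f_def using cont_shift[of "\<lambda>j. ac (z + of_int j * of_real w) - e" "\<lambda>j. bb (z + of_int j * of_real w)" 0 "int k" n]
 by (simp add: algebra_simps)

lemma f_holomorphic: "(\<lambda>z. f n z w e) holomorphic_on {z. \<bar>Im z\<bar> < y1}"
proof -
 have A: "(\<lambda>z. ac (z + of_int j * of_real w)) holomorphic_on {z. \<bar>Im z\<bar> < y1}" for j
 proof -
  have "ac \<circ> (\<lambda>z. z + of_int j * of_real w) holomorphic_on {z. \<bar>Im z\<bar> < y1}"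
   by (rule holomorphic_on_compose_gen[OF _ ac_holo]) (auto intro!: holomorphic_intros)
  thus ?thesis unfolding comp_def .
 qed
 have B: "(\<lambda>z. bb (z + of_int j * of_real w)) holomorphic_on {z. \<bar>Im z\<bar> < y1}" for j
 proof -
  have "bb \<circ> (\<lambda>z. z + of_int j * of_real w) holomorphic_on {z. \<bar>Im z\<bar> < y1}"
   by (rule holomorphic_on_compose_gen[OF _ bb_holo]) (auto intro!: holomorphic_intros)
  thus ?thesis unfolding comp_def .
 qed
 show ?thesis unfolding f_def
 proof (induction n rule: induct_nat_012)
  case (ge2 n)
  thus ?case unfolding cont.simps by (intro holomorphic_intros A B)
 next
  case 1
  show ?case using A[of 0] by (auto intro!: holomorphic_intros)
 qed auto
qed

lemma f_periodic:
 assumes "\<bar>Im z\<bar> < y1" shows "f n (z + 1) w e = f n z w e"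
proof -
 have "ac (z + 1 + of_int j * of_real w) = ac (z + of_int j * of_real w)" "bb (z + 1 + of_int j * of_real w) = bb (z + of_int j * of_real w)" for j
  using ac_periodic[of "z + of_int j * of_real w"] bb_periodic[of "z + of_int j * of_real w"] assms by (simp_all add: algebra_simps)
 thus ?thesis unfolding f_def by simp
qed

lemma coeff_bounds:
 assumes "\<bar>Im z\<bar> < y1" "beta + cmod e <= C"
 shows "cmod (ac (z + of_int j * of_real w) - e) <= C" "cmod (bb (z + of_int j * of_real w)) <= C"
proof -
 have "\<bar>Im (z + of_int j * of_real w)\<bar> < y1" using assms(1) by simp
 hence "cmod (ac (z + of_int j * of_real w)) <= beta" "cmod (bb (z + of_int j * of_real w)) <= beta" using ac_bound bb_bound by blast+
 thus "cmod (ac (z + of_int j * of_real w) - e) <= C" "cmod (bb (z + of_int j * of_real w)) <= C"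
  using assms(2) norm_triangle_ineq4[of "ac (z + of_int j * of_real w)" e] norm_ge_zero[of e] by linarith+
qed

lemma f_upper:
 assumes "\<bar>Im z\<bar> < y1" "beta + cmod e <= C"
 shows "cmod (f n z w e) <= (2 * C) ^ n"
proof -
 have "1 <= C" using beta assms(2) norm_ge_zero[of e] by linarith
 thus ?thesis unfolding f_def using coeff_bounds[OF assms] by (intro cont_upper)
qed

text \<open>Each factor of the determinant grows at most by \<open>1 + tau / eps\<close>: far from
  the spectrum a small imaginary part of the energy is harmless.\<close>

lemma f_add_imaginary:
 assumes "0 < eps" "\<And>l. l \<in> spec n x w ==> eps <= \<bar>l - E\<bar>" "0 <= tau"
 shows "cmod (f n (of_real x) w (Complex E tau)) <= (1 + tau / eps) ^ n * cmod (f n (of_real x) w (of_real E))"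
proof -
 have "cmod (\<Prod>l\<leftarrow>ls. of_real l - Complex E tau) <= (1 + tau / eps) ^ length ls * cmod (\<Prod>l\<leftarrow>ls. of_real l - of_real E)"
  if "\<And>l. l \<in> set ls ==> eps <= \<bar>l - E\<bar>" for ls using that
 proof (induction ls)
  case (Cons l ls)
  have le: "eps <= \<bar>l - E\<bar>" using Cons.prems by simp
  have nE: "cmod (of_real l - complex_of_real E) = \<bar>l - E\<bar>" by (metis norm_of_real of_real_diff)
  have "cmod (of_real l - Complex E tau) = cmod ((of_real l - of_real E) - \<i> * of_real tau)" by (simp add: complex_eq_iff cmod_def)
  also have "... <= \<bar>l - E\<bar> + tau" using norm_triangle_ineq4[of "of_real l - complex_of_real E" "\<i> * of_real tau"] nE assms(3) by (simp add: norm_mult)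
  also have "... <= (1 + tau / eps) * \<bar>l - E\<bar>"
  proof -
   have "tau * eps <= tau * \<bar>l - E\<bar>" using le assms(3) by (rule mult_left_mono)
   thus ?thesis using assms(1) by (simp add: field_simps)
  qed
  finally have 1: "cmod (of_real l - Complex E tau) <= (1 + tau / eps) * cmod (of_real l - complex_of_real E)" unfolding nE .
  have "cmod (\<Prod>l\<leftarrow>ls. of_real l - Complex E tau) <= (1 + tau / eps) ^ length ls * cmod (\<Prod>l\<leftarrow>ls. of_real l - of_real E)"
   using Cons by simp
  from mult_mono[OF 1 this] show ?case using assms by (simp add: norm_mult mult_ac)
 qed simp
 from this[of "jacobi_eigenvalues a b n x w"] show ?thesis using assms(2) unfolding f_real_prod spec_def by (simp add: length_jacobi_eigenvalues)
qed

lemma f_real_energy_le: "cmod (f n (of_real x) w (of_real E)) <= cmod (f n (of_real x) w (Complex E tau))"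
proof -
 have "cmod (\<Prod>l\<leftarrow>ls. of_real l - complex_of_real E) <= cmod (\<Prod>l\<leftarrow>ls. of_real l - Complex E tau)" for ls
 proof (induction ls)
  case (Cons l ls)
  have "cmod (of_real l - complex_of_real E) = \<bar>Re (of_real l - Complex E tau)\<bar>" by (metis Re_complex_of_real complex.sel(1) minus_complex.sel(1) norm_of_real of_real_diff)
  also have "... <= cmod (of_real l - Complex E tau)" by (rule abs_Re_le_cmod)
  finally show ?case using Cons by (simp add: norm_mult mult_mono)
 qed simp
 thus ?thesis unfolding f_real_prod .
qed

lemma f_nonzero: "0 < eps ==> (\<And>l. l \<in> spec n x w ==> eps <= \<bar>l - E\<bar>) ==> f n (of_real x) w (of_real E) \<noteq> 0"
 unfolding f_real_prod spec_def by (fastforce simp: prod_list_zero_iff)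

lemma herglotz_coeffs:
 assumes "\<bar>Im z\<bar> < y1" "0 < tau" "cmod (z - of_real x) <= rho" "beta * rho <= tau\<^sup>2 / 8" "beta * rho <= tau / 4"
 shows "herglotz tau (\<lambda>j. ac (z + of_int j * of_real w) - Complex E tau) (\<lambda>j. bb (z + of_int j * of_real w))"
proof -
 have sh: "cmod (ac (z + of_int j * of_real w) - of_real (a (x + of_int j * w))) <= beta * rho"
  "cmod (bb (z + of_int j * of_real w) - of_real ((cmod (b (x + of_int j * w)))\<^sup>2)) <= beta * rho" for j
 proof -
  have e: "complex_of_real (x + of_int j * w) = of_real x + of_int j * of_real w" by simp
  have "cmod (ac (z + of_int j * of_real w) - ac (of_real (x + of_int j * w))) <= beta * cmod (z - of_real x)"
   using ac_lipschitz[of "z + of_int j * of_real w" "of_real (x + of_int j * w)"] assms(1) y1 by simp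
  also have "... <= beta * rho" using assms beta by (intro mult_left_mono) auto
  finally show "cmod (ac (z + of_int j * of_real w) - of_real (a (x + of_int j * w))) <= beta * rho" unfolding ac_real .
  have "cmod (bb (z + of_int j * of_real w) - bb (of_real (x + of_int j * w))) <= beta * cmod (z - of_real x)"
   using bb_lipschitz[of "z + of_int j * of_real w" "of_real (x + of_int j * w)"] assms(1) y1 by simp
  also have "... <= beta * rho" using assms beta by (intro mult_left_mono) auto
  finally show "cmod (bb (z + of_int j * of_real w) - of_real ((cmod (b (x + of_int j * w)))\<^sup>2)) <= beta * rho" unfolding bb_real .
 qed
 have "Im (ac (z + of_int j * of_real w) - Complex E tau) <= - (3/4) * tau" for j
 proof -
  have "Im (ac (z + of_int j * of_real w)) = Im (ac (z + of_int j * of_real w) - of_real (a (x + of_int j * w)))" by simp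
  also have "... <= cmod (ac (z + of_int j * of_real w) - of_real (a (x + of_int j * w)))" using abs_Im_le_cmod abs_le_D1 by blast
  finally show ?thesis using sh(1)[of j] assms(5) by simp
 qed
 moreover have "\<exists>r\<ge>0. cmod (bb (z + of_int j * of_real w) - of_real r) <= tau\<^sup>2 / 8" for j
  using sh(2)[of j] assms(4) by (intro exI[of _ "(cmod (b (x + of_int j * w)))\<^sup>2"]) auto
 ultimately show ?thesis unfolding herglotz_def using assms(2) by blast
qed

text \<open>Three comparisons: translation by \<open>k\<close> sites at the complex phase
  \<open>z\<close> (\<open>herglotz_translate\<close>), passage from \<open>z\<close> to the real
  phase \<open>x\<close> (\<open>herglotz_perturb\<close>), and passage from the complex to the real
  energy (\<open>f_add_imaginary\<close>). Non-resonance enters in the last one.\<close>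

lemma f_shifted_upper:
 assumes eps: "0 < eps" "eps <= 1" and nonres: "\<And>l. l \<in> spec n x w ==> eps <= \<bar>l - E\<bar>"
  and rho: "rho = eps ^ 6 / (16 * beta)" "rho < y1" and z: "cmod (z - of_real x) <= rho"
  and k: "k <= K" "K < n" and i: "i <= 2" "i <= n" and C: "beta + \<bar>E\<bar> + 1 <= C"
 shows "cmod (f (n - i) (z + of_nat k * of_real w) w (Complex E (eps\<^sup>2)))
  <= (2 * C) ^ K * (2 / eps\<^sup>2) ^ (K + 2) * ((1 + eps) ^ n * ((1 + eps) ^ n * cmod (f n (of_real x) w (of_real E))))"
proof -
 \<comment> \<open>With this \<open>tau\<close> the change of energy costs
   \<open>tau / eps = eps\<close> per site, and \<open>rho\<close> is such that
   \<open>beta * rho = tau ^ 3 / 16\<close>, so that the change of phase costs at most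
   \<open>eps\<close> per site too.\<close>
 define tau where "tau = eps\<^sup>2"
 have tau: "0 < tau" "tau <= 1" "tau <= eps" unfolding tau_def using eps by (auto simp: power2_eq_square intro: mult_le_one mult_left_le)
 have betarho: "beta * rho = tau ^ 3 / 16" unfolding rho tau_def using beta by (simp flip: power_mult)
 have t3: "tau ^ 3 <= tau\<^sup>2" "tau ^ 3 <= tau" "0 <= tau\<^sup>2" using tau power_decreasing[of 2 3 tau] power_decreasing[of 1 3 tau] by auto
 have d: "beta * rho <= tau\<^sup>2 / 8" "beta * rho <= tau / 4" unfolding betarho using t3 tau by linarith+
 have rho0: "0 <= rho" using z norm_ge_zero order_trans by blast
 have Imz: "\<bar>Im z\<bar> < y1" using abs_Im_le_cmod[of "z - of_real x"] z rho(2) by simp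
 let ?e = "Complex E tau"
 have "cmod ?e <= \<bar>E\<bar> + tau" using cmod_le[of ?e] tau by simp
 hence Ce: "beta + cmod ?e <= C" using C tau by linarith
 have C1: "1 <= C" using C beta by linarith
 let ?alpha = "\<lambda>z j. ac (z + of_int j * of_real w) - ?e" and ?c = "\<lambda>z j. bb (z + of_int j * of_real w)"
 have hz: "herglotz tau (?alpha z) (?c z)" by (rule herglotz_coeffs[OF Imz tau(1) z d])
 have hx: "herglotz tau (?alpha (of_real x)) (?c (of_real x))" by (rule herglotz_coeffs[of _ _ x rho]) (use y1 tau d rho0 in auto)
 have "cmod (f (n - i) (z + of_nat k * of_real w) w ?e) <= (2 * C) ^ K * (2 / tau) ^ (K + 2) * cmod (cont (?alpha z) (?c z) 0 n)"
  unfolding f_shift by (rule herglotz_translate[OF hz _ _ _ C1 k i]) (use tau coeff_bounds[OF Imz Ce] in auto)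
 also have "... <= (2 * C) ^ K * (2 / tau) ^ (K + 2) * ((1 + eps) ^ n * ((1 + eps) ^ n * cmod (f n (of_real x) w (of_real E))))"
 proof (intro mult_left_mono)
  have "cmod (cont (?alpha z) (?c z) 0 n) <= (1 + beta * rho * (1 + 2 / tau) * (4 / tau)) ^ n * cmod (cont (?alpha (of_real x)) (?c (of_real x)) 0 n)"
  proof (rule herglotz_perturb[OF hz hx])
   have "beta * cmod (z - of_real x) <= beta * rho" using z beta by (intro mult_left_mono) auto
   thus "cmod (?alpha z j - ?alpha (of_real x) j) <= beta * rho" "cmod (?c z j - ?c (of_real x) j) <= beta * rho" for j
    using ac_lipschitz[of "z + of_int j * of_real w" "of_real x + of_int j * of_real w"]
     bb_lipschitz[of "z + of_int j * of_real w" "of_real x + of_int j * of_real w"] Imz y1 by auto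
  qed
  also have "... <= (1 + eps) ^ n * cmod (cont (?alpha (of_real x)) (?c (of_real x)) 0 n)"
  proof (intro mult_right_mono power_mono)
   have "beta * rho * (1 + 2 / tau) * (4 / tau) = tau / 4 * (tau + 2)" unfolding betarho using tau by (simp add: field_simps power3_eq_cube)
   also have "... <= tau / 4 * 3" using tau by (intro mult_left_mono) auto
   also have "... <= eps" using tau by linarith
   finally show "1 + beta * rho * (1 + 2 / tau) * (4 / tau) <= 1 + eps" by simp
  qed (use tau beta rho0 in auto)
  also have "... <= (1 + eps) ^ n * ((1 + eps) ^ n * cmod (f n (of_real x) w (of_real E)))"
  proof (rule mult_left_mono)
   have "cmod (f n (of_real x) w ?e) <= (1 + tau / eps) ^ n * cmod (f n (of_real x) w (of_real E))"
    by (rule f_add_imaginary[OF eps(1) nonres]) (use tau in auto)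
   moreover have "tau / eps = eps" unfolding tau_def using eps by (simp add: power2_eq_square)
   ultimately show "cmod (cont (?alpha (of_real x)) (?c (of_real x)) 0 n) <= (1 + eps) ^ n * cmod (f n (of_real x) w (of_real E))"
    unfolding f_def by simp
  qed (use eps in simp)
  finally show "cmod (cont (?alpha z) (?c z) 0 n) <= (1 + eps) ^ n * ((1 + eps) ^ n * cmod (f n (of_real x) w (of_real E)))" .
 qed (use C1 tau in auto)
 finally show ?thesis by (simp only: tau_def)
qed

end

text \<open>A bound for the number of translates needed for the orbit to be \<open>R / (16 M)\<close>-dense, with \<open>M\<close>
 about \<open>n\<^sup>1\<^sup>/\<^sup>5\<close>.\<close>

definition orbit_length :: "real => real => real => real => real" where
 "orbit_length c alpha R n = (16 * (n powr (1/5) + 1) / R + 1) * (4 * (16 * (n powr (1/5) + 1) / R + 1) *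
   ln (2 * (16 * (n powr (1/5) + 1) / R + 1)) powr alpha / c + 2)"

lemma eventually_parameters:
 fixes c alpha R s C beta :: real
 assumes "0 < c" "0 < R" "0 < s" "1 < C" "0 < alpha" "1 <= beta"
 shows "eventually (\<lambda>n. orbit_length c alpha R n < n \<and>
   orbit_length c alpha R n * ln (2 * C) + (orbit_length c alpha R n + 2) * (ln 2 + 2 * n powr (1/6))
     + 2 * n * exp (- (n powr (1/6))) <= s * n / 2 \<and>
   8 * (n powr (1/5) + 1) <= s * n \<and> 6 * n powr (1/6) + ln (16 * beta) <= n powr (1/5) \<and>
   exp (- (6 * n powr (1/6))) <= R / (8 * (n powr (1/5) + 1)) \<and> exp (- (6 * n powr (1/6))) < R \<and> 3 <= n) at_top"
proof -
 have "0 < beta" using assms by simp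
 have "eventually (\<lambda>n. orbit_length c alpha R n < n) at_top" unfolding orbit_length_def using assms by real_asymp
 moreover have "eventually (\<lambda>n. orbit_length c alpha R n * ln (2 * C) + (orbit_length c alpha R n + 2) * (ln 2 + 2 * n powr (1/6))
     + 2 * n * exp (- (n powr (1/6))) <= s * n / 2) at_top" unfolding orbit_length_def using assms by real_asymp
 moreover have "eventually (\<lambda>n. 8 * (n powr (1/5) + 1) <= s * n) at_top" using assms by real_asymp
 moreover have "eventually (\<lambda>n. 6 * n powr (1/6) + ln (16 * beta) <= n powr (1/5)) at_top" using \<open>0 < beta\<close> by real_asymp
 moreover have "eventually (\<lambda>n. exp (- (6 * n powr (1/6))) <= R / (8 * (n powr (1/5) + 1))) at_top" using assms by real_asymp
 moreover have "eventually (\<lambda>n. exp (- (6 * n powr (1/6))) < R) at_top" using assms by real_asymp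
 moreover have "eventually (\<lambda>n. (3::real) <= n) at_top" by real_asymp
 ultimately show ?thesis by eventually_elim auto
qed

section \<open>A determinant at a non-resonant phase against the supremum over phases\<close>

context jacobi_data
begin

text \<open>If the determinant is small at the non-resonant phase \<open>x\<close>, it is small in
  discs around the orbit points \<open>x + k * w\<close>. These come close to all nodes around the
  phase \<open>x1\<close> of the maximum, and \<open>smallness_propagates\<close> bounds the
  maximum. The term \<open>exp (- C0 * n)\<close> covers a tiny maximum, for which
  \<open>B - S\<close> would not be linear in \<open>n\<close>. The lengths \<open>n - i\<close> are
  those that occur in \<open>Phi\<close>.\<close>

theorem determinant_lower_bound:
 fixes c alpha s E0 C0 :: real
 assumes c: "0 < c" and alpha: "0 < alpha" and s: "0 < s" and E0: "0 <= E0" and C0: "0 <= C0"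
 shows "\<exists>n0. \<forall>n\<ge>n0. \<forall>w\<in>diophantine c alpha. \<forall>E x. \<bar>E\<bar> <= E0 --> (\<forall>l\<in>spec n x w. exp (- (real n powr (1/6))) <= \<bar>l - E\<bar>) -->
  (\<forall>x' i. i <= 2 --> cmod (f (n - i) (of_real x') w (of_real E)) <= max (cmod (f n (of_real x) w (of_real E))) (exp (- C0 * real n)) * exp (s * real n))"
proof -
 define C where "C = beta + E0 + 1"
 define y0 where "y0 = y1 / 2"
 define c1 where "c1 = ln (2 * C) + C0"
 define R where "R = min 1 (min y0 (s * y0 / (32 * c1)))"
 have C: "1 < C" unfolding C_def using beta E0 by simp
 have y0: "0 < y0" "y0 < y1" using y1 by (auto simp: y0_def)
 have c1: "0 < c1" unfolding c1_def using C C0 by (simp add: add_pos_nonneg)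
 have R: "0 < R" "R <= 1" "R <= y0" "R <= s * y0 / (32 * c1)" unfolding R_def using y0 s c1 by auto
 obtain n1 where n1: "\<And>n. n1 <= n ==> orbit_length c alpha R n < n \<and>
   orbit_length c alpha R n * ln (2 * C) + (orbit_length c alpha R n + 2) * (ln 2 + 2 * n powr (1/6))
     + 2 * n * exp (- (n powr (1/6))) <= s * n / 2 \<and>
   8 * (n powr (1/5) + 1) <= s * n \<and> 6 * n powr (1/6) + ln (16 * beta) <= n powr (1/5) \<and>
   exp (- (6 * n powr (1/6))) <= R / (8 * (n powr (1/5) + 1)) \<and> exp (- (6 * n powr (1/6))) < R \<and> 3 <= n"
  using eventually_parameters[OF c R(1) s C alpha beta] unfolding eventually_at_top_linorder by auto
 have main: "cmod (f (n - i) (of_real x0) w (of_real E)) <= max (cmod (f n (of_real x) w (of_real E))) (exp (- C0 * real n)) * exp (s * real n)"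
  if n: "n1 <= real n" and w: "w \<in> diophantine c alpha" and E: "\<bar>E\<bar> <= E0"
   and nonres: "\<And>l. l \<in> spec n x w ==> exp (- (real n powr (1/6))) <= \<bar>l - E\<bar>" and i: "i <= 2" for n w E x x0 i
 proof -
  define K where "K = nat \<lfloor>orbit_length c alpha R n\<rfloor>"
  \<comment> \<open>The discs have radius about \<open>exp (- 6 * n powr (1/6))\<close>, which must
    exceed \<open>exp (- M)\<close>; hence the larger exponent 1/5. Reaching the nodes takes about
    \<open>M\<^sup>2\<close> steps of the orbit, up to logarithms, each at the cost of a factor
    exponential in \<open>n powr (1/6)\<close>, together less than \<open>exp (s * n / 2)\<close>.
    The choice of \<open>q\<close> below keeps \<open>4 * q * M\<close> under
    \<open>s * n / 2\<close>.\<close>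
  define M where "M = nat \<lceil>real n powr (1/5)\<rceil>"
  define eps where "eps = exp (- (real n powr (1/6)))"
  define rho where "rho = eps ^ 6 / (16 * beta)"
  define q where "q = nat \<lfloor>s * real n / (8 * real M)\<rfloor>"
  have N: "orbit_length c alpha R n < n"
   "orbit_length c alpha R n * ln (2 * C) + (orbit_length c alpha R n + 2) * (ln 2 + 2 * n powr (1/6)) + 2 * real n * exp (- (n powr (1/6))) <= s * n / 2"
   "8 * (n powr (1/5) + 1) <= s * n" "6 * n powr (1/6) + ln (16 * beta) <= n powr (1/5)"
   "exp (- (6 * n powr (1/6))) <= R / (8 * (n powr (1/5) + 1))" "exp (- (6 * n powr (1/6))) < R" "3 <= real n" using n1[OF n] by simp_all
  have n3: "3 <= n" using N by linarith
  have M1: "real n powr (1/5) <= real M" "real M <= real n powr (1/5) + 1" unfolding M_def using powr_ge_zero[of "real n" "1/5"] by linarith+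
  have "0 < real n powr (1/5)" using n3 by simp
  hence M0: "0 < M" using M1 by (metis gr0I leD of_nat_0)
  have eps: "0 < eps" "eps <= 1" unfolding eps_def by auto
  have eps6: "eps ^ 6 = exp (- (6 * real n powr (1/6)))" unfolding eps_def by (simp flip: exp_of_nat_mult)
  have rho0: "0 < rho" unfolding rho_def using eps beta by simp
  have rho1: "rho <= eps ^ 6" unfolding rho_def using eps beta by (simp add: pos_divide_le_eq)
  have rho2: "rho < y1" using rho1 eps6 N(6) R(3) y0 by linarith
  have rho3: "rho <= R / (8 * real M)"
  proof -
   have "rho <= R / (8 * (real n powr (1/5) + 1))" using rho1 eps6 N(5) by linarith
   also have "... <= R / (8 * real M)" using M1 M0 R by (intro divide_left_mono) auto
   finally show ?thesis .
  qed
  have rho4: "exp (- real M) <= rho"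
  proof -
   have "exp (- real M) <= exp (- (6 * real n powr (1/6)) - ln (16 * beta))" using N(4) M1(1) by simp
   also have "... = rho" unfolding rho_def eps6 using beta by (simp add: exp_diff)
   finally show ?thesis .
  qed
  have sM: "1 <= s * real n / (8 * real M)"
  proof -
   have "8 * real M <= 8 * (real n powr (1/5) + 1)" using M1(2) by (rule mult_left_mono) simp
   also have "... <= s * real n" by (rule N(3))
   finally have "8 * real M <= s * real n" .
   thus ?thesis using M0 by (simp add: pos_le_divide_eq)
  qed
  have q1: "real q <= s * real n / (8 * real M)" "s * real n / (8 * real M) < real q + 1" unfolding q_def using sM by linarith+
  have q0: "0 < q" using q1 sM by (cases q) auto
  have qM1: "8 * (real q * real M) <= s * real n" using q1(1) M0 by (simp add: pos_le_divide_eq mult_ac)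
  have qM2: "s * real n < 16 * (real q * real M)"
  proof -
   have "s * real n < (real q + 1) * (8 * real M)" using q1(2) M0 by (simp add: pos_divide_less_eq)
   also have "... <= (2 * real q) * (8 * real M)" using q0 by (intro mult_right_mono) auto
   finally show ?thesis by simp
  qed
  have OL: "0 <= orbit_length c alpha R n" unfolding orbit_length_def using R c by (intro mult_nonneg_nonneg add_nonneg_nonneg divide_nonneg_pos) auto
  have K: "real K <= orbit_length c alpha R n" "K < n" unfolding K_def using N(1) OL by linarith+
  define e where "e = Complex E (eps\<^sup>2)"
  define F where "F z = f (n - i) z w e" for z
  have ce: "beta + cmod e <= C"
  proof -
   have "cmod e <= \<bar>E\<bar> + eps\<^sup>2" using cmod_le[of e] by (simp add: e_def)
   moreover have "eps\<^sup>2 <= 1" using eps by (simp add: power_le_one)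
   ultimately show ?thesis unfolding C_def using E by linarith
  qed
  have Fholo: "F holomorphic_on {z. \<bar>Im z\<bar> < y1}" unfolding F_def by (rule f_holomorphic)
  have Fper: "F (z + 1) = F z" if "\<bar>Im z\<bar> < y1" for z unfolding F_def by (rule f_periodic[OF that])
  define B where "B = real n * ln (2 * C)"
  have FB: "cmod (F z) <= exp B" if "\<bar>Im z\<bar> <= y0" for z
  proof -
   have "cmod (F z) <= (2 * C) ^ (n - i)" unfolding F_def by (rule f_upper[OF _ ce]) (use that y0 in auto)
   also have "... <= (2 * C) ^ n" using C by (intro power_increasing) auto
   also have "... = exp B" unfolding B_def using C by (simp add: exp_of_nat_mult)
   finally show ?thesis .
  qed
  have fnz: "f n (of_real x) w (of_real E) \<noteq> 0" by (rule f_nonzero[OF eps(1)]) (use nonres in \<open>auto simp: eps_def\<close>)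
  define a0 where "a0 = ln (cmod (f n (of_real x) w (of_real E)))"
  have ea0: "exp a0 = cmod (f n (of_real x) w (of_real E))" unfolding a0_def using fnz by simp
  define A where "A = a0 + s * real n / 2"
  have bdA: "(2 * C) ^ K * (2 / eps\<^sup>2) ^ (K + 2) * ((1 + eps) ^ n * ((1 + eps) ^ n * cmod (f n (of_real x) w (of_real E)))) <= exp A"
  proof -
   have p1: "(2 * C) ^ K = exp (real K * ln (2 * C))" using C by (simp add: exp_of_nat_mult)
   have "eps\<^sup>2 = exp (- (2 * real n powr (1/6)))" unfolding eps_def power2_eq_square mult_exp_exp by simp
   hence "2 / eps\<^sup>2 = exp (ln 2) / exp (- (2 * real n powr (1/6)))" by simp
   hence "2 / eps\<^sup>2 = exp (ln 2 + 2 * real n powr (1/6))" unfolding exp_diff[symmetric] by simp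
   hence p2: "(2 / eps\<^sup>2) ^ (K + 2) = exp (real (K + 2) * (ln 2 + 2 * real n powr (1/6)))" by (simp only: exp_of_nat_mult)
   have "(1 + eps) ^ n <= exp eps ^ n" using eps by (intro power_mono) auto
   also have "... = exp (real n * eps)" by (simp only: exp_of_nat_mult)
   finally have p3: "(1 + eps) ^ n <= exp (real n * eps)" .
   have "(2 * C) ^ K * (2 / eps\<^sup>2) ^ (K + 2) * ((1 + eps) ^ n * ((1 + eps) ^ n * cmod (f n (of_real x) w (of_real E)))) <=
    exp (real K * ln (2 * C)) * exp (real (K + 2) * (ln 2 + 2 * real n powr (1/6))) * (exp (real n * eps) * (exp (real n * eps) * exp a0))"
    unfolding p1 p2 ea0 using eps by (intro mult_left_mono mult_mono p3) auto
   also have "... = exp (real K * ln (2 * C) + real (K + 2) * (ln 2 + 2 * real n powr (1/6)) + 2 * real n * eps + a0)"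
    unfolding mult_exp_exp by (simp add: add_ac)
   also have "... <= exp A"
   proof -
    have "real K * ln (2 * C) <= orbit_length c alpha R n * ln (2 * C)" using K C by (intro mult_right_mono) auto
    moreover have "real (K + 2) * (ln 2 + 2 * real n powr (1/6)) <= (orbit_length c alpha R n + 2) * (ln 2 + 2 * real n powr (1/6))"
     using K by (intro mult_right_mono) auto
    ultimately show ?thesis unfolding A_def eps_def using N(2) by simp
   qed
   finally show ?thesis .
  qed
  have goal: "cmod (F (of_real x0)) <= max (exp a0) (exp (- C0 * real n)) * exp (s * real n)"
  proof -
   define I where "I = {0..1::real}"
   have "continuous_on I (\<lambda>x. cmod (F (of_real x)))"
    using y1 by (intro continuous_intros continuous_on_compose2[OF holomorphic_on_imp_continuous_on[OF Fholo]]) auto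
   then obtain x1 where x1: "x1 \<in> I" "\<And>x. x \<in> I ==> cmod (F (of_real x)) <= cmod (F (of_real x1))"
    using continuous_attains_sup[of I "\<lambda>x. cmod (F (of_real x))"] unfolding I_def by (metis atLeastAtMost_iff compact_Icc empty_iff zero_le_one order_refl)
   have top: "cmod (F (of_real x)) <= cmod (F (of_real x1))" for x
   proof -
    have "F (of_real x + of_int (- \<lfloor>x\<rfloor>)) = F (of_real x)" by (rule periodic_shift_int[where F = F, OF Fper]) (use y1 in auto)
    moreover have "complex_of_real x + of_int (- \<lfloor>x\<rfloor>) = of_real (frac x)" by (simp add: frac_def)
    moreover have "frac x \<in> I" unfolding I_def by (auto simp: less_imp_le[OF frac_lt_1])
    ultimately show ?thesis using x1(2) by metis
   qed
   show ?thesis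
   proof (cases "cmod (F (of_real x1)) <= exp (- C0 * real n)")
    case True
    have "cmod (F (of_real x0)) <= exp (- C0 * real n) * 1" using top[of x0] True by simp
    also have "... <= max (exp a0) (exp (- C0 * real n)) * exp (s * real n)" using s by (intro mult_mono) (auto simp: le_max_iff_disj)
    finally show ?thesis .
   next
    case False
    define S where "S = ln (cmod (F (of_real x1)))"
    have Fpos: "0 < cmod (F (of_real x1))" using False by (smt (verit) exp_gt_zero)
    have eS: "exp S = cmod (F (of_real x1))" unfolding S_def using Fpos by simp
    have S_low: "- C0 * real n < S" using False eS by (metis exp_less_cancel_iff not_le)
    have "exp S <= exp B" unfolding eS using FB[of "of_real x1"] y0 by simp
    hence SB: "S <= B" by simp
    define T where "T j = x1 - R / 4 + (real j + 1/2) * (R / (2 * real M))" for j :: nat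
    define NN where "NN = nat \<lceil>16 * real M / R\<rceil>"
    have NN: "16 * real M / R <= real NN" "real NN <= 16 * (real n powr (1/5) + 1) / R + 1" "0 < NN"
    proof -
     have p: "0 < 16 * real M / R" using M0 R by simp
     thus a: "16 * real M / R <= real NN" unfolding NN_def by linarith
     have "real NN <= 16 * real M / R + 1" unfolding NN_def using p by linarith
     also have "... <= 16 * (real n powr (1/5) + 1) / R + 1" using M1 R by (intro add_right_mono divide_right_mono) auto
     finally show "real NN <= 16 * (real n powr (1/5) + 1) / R + 1" .
     show "0 < NN" using a p by (metis of_nat_0_less_iff less_le_trans)
    qed
    have "\<exists>k p. k <= K \<and> \<bar>x + real k * w - of_int p - T j\<bar> <= R / (16 * real M)" for j
    proof -
     obtain k :: nat and p :: int where kp: "real k <= real NN * (4 * real NN * ln (2 * real NN) powr alpha / c + 2)"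
      "\<bar>real k * w - of_int p - (T j - x)\<bar> <= 1 / real NN"
      using diophantine_orbit_dense[OF w c _ NN(3), of "T j - x"] alpha by (metis less_imp_le)
     have NN1: "1 <= real NN" using NN(3) by simp
     have mono: "real NN * (4 * real NN * ln (2 * real NN) powr alpha / c + 2) <= t * (4 * t * ln (2 * t) powr alpha / c + 2)"
      if "real NN <= t" for t using that NN1 c alpha by (intro mult_mono add_right_mono divide_right_mono powr_mono2) auto
     have "real k <= orbit_length c alpha R n" unfolding orbit_length_def by (rule order_trans[OF kp(1) mono[OF NN(2)]])
     hence "k <= K" unfolding K_def by linarith
     moreover have "1 / real NN <= R / (16 * real M)"
     proof -
      have "16 * real M <= real NN * R" using NN(1) R by (simp add: pos_divide_le_eq)
      thus ?thesis using M0 NN(3) by (simp add: divide_simps mult_ac)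
     qed
     ultimately show ?thesis using kp(2) by (intro exI[of _ k] exI[of _ p]) (auto simp: algebra_simps)
    qed
    then obtain k p where kp: "\<And>j. k j <= K" "\<And>j. \<bar>x + real (k j) * w - of_int (p j) - T j\<bar> <= R / (16 * real M)" by metis
    define y where "y j = x + real (k j) * w - of_int (p j)" for j
    have "S <= A + 4 * real q * real M"
    proof (rule smallness_propagates[of F y1 y0 B S x1 R M q y rho A])
     show "cmod (F (of_real x)) <= exp S" for x using top eS by simp
     show "cmod (F (of_real x1)) = exp S" using eS by simp
     show "\<bar>y j - (x1 - R / 4 + (real j + 1 / 2) * (R / (2 * real M)))\<bar> <= R / (16 * real M)" if "j < M" for j
      using kp(2)[of j] by (simp add: y_def T_def)
     show "cmod (F z) <= exp A" if "j < M" and z: "cmod (z - of_real (y j)) <= rho" for j z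
     proof -
      define z' where "z' = z + of_int (p j) - of_nat (k j) * of_real w"
      have zz: "z' - of_real x = z - of_real (y j)" unfolding z'_def y_def by simp
      have Imz: "\<bar>Im z\<bar> < y1" using abs_Im_le_cmod[of "z - of_real (y j)"] z rho2 by simp
      have "F z = F (z + of_int (p j))" by (rule periodic_shift_int[where F = F, OF Fper Imz, symmetric])
      also have "... = F (z' + of_nat (k j) * of_real w)" by (simp add: z'_def)
      also have "cmod ... <= (2 * C) ^ K * (2 / eps\<^sup>2) ^ (K + 2) * ((1 + eps) ^ n * ((1 + eps) ^ n * cmod (f n (of_real x) w (of_real E))))"
       unfolding F_def e_def
      proof (rule f_shifted_upper[where rho = rho])
       show "cmod (z' - of_real x) <= rho" unfolding zz using z .
       show "beta + \<bar>E\<bar> + 1 <= C" unfolding C_def using E by simp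
       show "i <= n" using i n3 by simp
      qed (use eps nonres rho2 kp(1) K i in \<open>auto simp: eps_def rho_def\<close>)
      also have "... <= exp A" by (rule bdA)
      finally show ?thesis .
     qed
     show "(B - S) * R / y0 < real q * real M"
     proof -
      have "(B - S) * R / y0 <= (c1 * real n) * (s * y0 / (32 * c1)) / y0" using S_low SB R y0 s c1 unfolding B_def c1_def[symmetric]
       by (intro divide_right_mono mult_mono) (auto simp: c1_def algebra_simps)
      also have "... = s * real n / 32" using c1 y0 by simp
      also have "... < real q * real M"
      proof -
       have "0 < s * real n" using s n3 by simp
       thus ?thesis using qM2 by linarith
      qed
      finally show ?thesis .
     qed
    qed (use Fholo y0 Fper FB SB R M0 q0 rho0 rho3 rho4 in auto)
    hence "S <= a0 + s * real n" unfolding A_def using qM1 by linarith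
    hence "exp S <= exp (a0 + s * real n)" by simp
    hence "cmod (F (of_real x1)) <= exp a0 * exp (s * real n)" unfolding eS exp_add .
    also have "... <= max (exp a0) (exp (- C0 * real n)) * exp (s * real n)" by (intro mult_right_mono) auto
    finally show ?thesis using top[of x0] by linarith
   qed
  qed
  moreover have "cmod (f (n - i) (of_real x0) w (of_real E)) <= cmod (F (of_real x0))" unfolding F_def e_def by (rule f_real_energy_le)
  ultimately show ?thesis unfolding ea0 by linarith
 qed
 obtain n0 :: nat where "n1 <= real n0" using real_arch_simple by blast
 hence "n1 <= real n" if "n0 <= n" for n using that by linarith
 thus ?thesis using main by (intro exI[of _ n0]) blast
qed

end

subsection \<open>The Lyapunov exponent\<close>

abbreviation unit_integral :: "(real => real) => real" where
 "unit_integral F \<equiv> (LINT x:{0..1}|lborel. F x)"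

abbreviation unit_integrable :: "(real => real) => bool" where
 "unit_integrable F \<equiv> set_integrable lborel {0..1} F"

lemma AE_lborel_notin_finite: "finite X ==> AE x in lborel. x \<notin> (X :: real set)" by (rule AE_not_in) (simp add: finite_imp_null_set_lborel)

lemma periodic_unit_integral_shift_aux:
 fixes F :: "real => real"
 assumes per: "\<And>x. F (x + 1) = F x" and meas [measurable]: "F \<in> borel_measurable borel" and int: "unit_integrable F" and t: "0 <= t" "t <= 1"
 shows "unit_integrable (\<lambda>x. F (x + t)) \<and> unit_integral (\<lambda>x. F (x + t)) = unit_integral F"
proof -
 define G1 where "G1 x = indicator {t..1} x * F x" for x :: real
 define G2 where "G2 x = indicator {0..t} x * F x" for x :: real
 have G: "integrable lborel G1" "integrable lborel G2"
  unfolding G1_def G2_def using set_integrable_subset[OF int] t unfolding set_integrable_def by auto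
 have s1: "integrable lborel (\<lambda>x. G1 (t + 1 * x))" "integral\<^sup>L lborel (\<lambda>x. G1 (t + 1 * x)) = integral\<^sup>L lborel G1"
  using lborel_integrable_real_affine[OF G(1), of 1 t] lborel_integral_real_affine[of 1 G1 t] by simp_all
 have s2: "integrable lborel (\<lambda>x. G2 ((t - 1) + 1 * x))" "integral\<^sup>L lborel (\<lambda>x. G2 ((t - 1) + 1 * x)) = integral\<^sup>L lborel G2"
  using lborel_integrable_real_affine[OF G(2), of 1 "t - 1"] lborel_integral_real_affine[of 1 G2 "t - 1"] by simp_all
 have shift: "F ((t - 1) + x) = F (x + t)" for x using per[of "t - 1 + x"] by (simp add: algebra_simps)
 have ae0: "AE x in lborel. indicator {0..1} x * F x = G1 x + G2 x"
  using AE_lborel_notin_finite[of "{t}"] by (rule AE_mp) (use t in \<open>auto simp: G1_def G2_def indicator_def\<close>)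
 have eq: "indicator {0..1} x * F (x + t) = G1 (t + 1 * x) + G2 ((t - 1) + 1 * x)" if "x \<noteq> 1 - t" for x
  using that t shift[of x] by (auto simp: G1_def G2_def indicator_def add.commute)
 have ae1: "AE x in lborel. indicator {0..1} x * F (x + t) = G1 (t + 1 * x) + G2 ((t - 1) + 1 * x)"
  using AE_lborel_notin_finite[of "{1 - t}"] by (rule AE_mp) (use eq in auto)
 have Fm: "(\<lambda>x. indicator {0..1} x * F (x + t)) \<in> borel_measurable lborel" using meas by measurable
 have i1: "integrable lborel (\<lambda>x. indicator {0..1} x * F (x + t))"
  by (rule integrable_cong_AE_imp[OF Bochner_Integration.integrable_add[OF s1(1) s2(1)] Fm]) (use ae1 in auto)
 have "(LINT x|lborel. indicator {0..1} x * F (x + t)) = integral\<^sup>L lborel G1 + integral\<^sup>L lborel G2"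
  using integral_cong_AE[OF Fm _ ae1] s1 s2 by (auto simp: Bochner_Integration.integral_add)
 also have "... = (LINT x|lborel. indicator {0..1} x * F x)"
  using integral_cong_AE[OF _ _ ae0] G int unfolding set_integrable_def by (auto simp: Bochner_Integration.integral_add)
 finally show ?thesis using i1 unfolding set_integrable_def set_lebesgue_integral_def by simp
qed

lemma periodic_unit_integral_shift:
 fixes F :: "real => real"
 assumes per: "\<And>x. F (x + 1) = F x" and meas [measurable]: "F \<in> borel_measurable borel" and int: "unit_integrable F"
 shows "unit_integrable (\<lambda>x. F (x + t))" "unit_integral (\<lambda>x. F (x + t)) = unit_integral F"
proof -
 have "F (x + real n) = F x" for x n
 proof (induction n)
  case (Suc n)
  thus ?case using per[of "x + real n"] by (simp add: algebra_simps)
 qed simp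
 hence Fint: "F (x + of_int k) = F x" for x k
  by (cases "0 <= k") (metis of_nat_nat of_int_of_nat_eq, metis add.assoc add.right_neutral add.left_inverse of_int_minus of_nat_nat of_int_of_nat_eq neg_0_le_iff_le linear minus_minus add.right_inverse)
 have "F (x + t) = F (x + frac t)" for x using Fint[of "x + frac t" "\<lfloor>t\<rfloor>"] by (simp add: frac_def)
 thus "unit_integrable (\<lambda>x. F (x + t))" "unit_integral (\<lambda>x. F (x + t)) = unit_integral F"
  using periodic_unit_integral_shift_aux[OF per meas int, of "frac t"] by (simp_all add: less_imp_le[OF frac_lt_1])
qed

lemma unit_integral_mono:
 "unit_integrable F ==> unit_integrable G ==> (\<And>x. x \<in> {0..1} ==> F x <= G x) ==> unit_integral F <= unit_integral G"
 by (rule set_integral_mono)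

lemma unit_integral_const: "unit_integrable (\<lambda>x. c)" "unit_integral (\<lambda>x. c) = c"
 by (simp_all add: set_integrable_def set_lebesgue_integral_def)

lemma neg_ln_le: "0 < (t::real) ==> - ln t <= 2 * t powr (-1/2)"
 using ln_le_minus_one[of "t powr (-1/2)"] powr_gt_zero[of t "-1/2"] by (simp add: ln_powr del: powr_gt_zero)

text \<open>By \<open>neg_ln_le\<close> an integrable majorant, up to the factor 2, of a logarithmic
  singularity.\<close>

definition inv_sqrt :: "real => real" where
 "inv_sqrt x = indicator {0<..1} x * x powr (-1/2)"

lemma inv_sqrt_integrable: "integrable lborel inv_sqrt"
proof -
 have m: "inv_sqrt \<in> borel_measurable borel" unfolding inv_sqrt_def by measurable
 have "(\<lambda>x::real. x powr (-1/2)) integrable_on {0<..1}" by (rule integrable_on_powr_from_0') auto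
 hence "set_integrable lebesgue {0<..1} (\<lambda>x::real. x powr (-1/2))" by (rule nonnegative_absolutely_integrable_1) auto
 hence "integrable lebesgue inv_sqrt" unfolding set_integrable_def inv_sqrt_def by simp
 thus ?thesis using m by (subst (asm) integrable_completion) auto
qed

lemma inv_sqrt_nonneg: "0 <= inv_sqrt x" unfolding inv_sqrt_def by simp

text \<open>The finiteness of the zeros of \<open>b\<close> in quantitative form: \<open>X\<close>
  contains all zeros in the unit interval, possibly with further points, and \<open>kb\<close>
  bounds their orders.\<close>

locale jacobi_data_zeros = jacobi_data +
 fixes X :: "real set" and cb :: real and kb :: nat
 assumes finite_X: "finite X" and X_unit: "X \<subseteq> {0..1}" and cb: "0 < cb"
  and b_lower: "x \<in> {0..1} ==> \<exists>z\<in>X. cb * \<bar>x - z\<bar> ^ kb <= cmod (b x)"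
begin

definition log_dom :: "real => real" where
 "log_dom x = ln beta + \<bar>ln cb\<bar> + 2 * real kb * (\<Sum>z\<in>X. inv_sqrt (x - z) + inv_sqrt (z - x))"

lemma log_dom: "unit_integrable log_dom"
proof -
 have i: "integrable lborel (\<lambda>x. inv_sqrt (x - z))" "integrable lborel (\<lambda>x. inv_sqrt (z - x))" for z
  using lborel_integrable_real_affine[OF inv_sqrt_integrable, of 1 "- z"] lborel_integrable_real_affine[OF inv_sqrt_integrable, of "-1" z]
  by (simp_all add: algebra_simps)
 have "integrable lborel (\<lambda>x. 2 * real kb * (\<Sum>z\<in>X. inv_sqrt (x - z) + inv_sqrt (z - x)))"
  by (intro Bochner_Integration.integrable_mult_right Bochner_Integration.integrable_sum Bochner_Integration.integrable_add i)
 hence "unit_integrable (\<lambda>x. 2 * real kb * (\<Sum>z\<in>X. inv_sqrt (x - z) + inv_sqrt (z - x)))"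
  unfolding set_integrable_def by (intro integrable_mult_indicator) auto
 thus ?thesis unfolding log_dom_def by (intro set_integral_add unit_integral_const)
qed

lemma abs_ln_b_le:
 assumes x: "x \<in> {0..1}" "x \<notin> X"
 shows "\<bar>ln (cmod (b x))\<bar> <= log_dom x" "b x \<noteq> 0"
proof -
 obtain z where z: "z \<in> X" "cb * \<bar>x - z\<bar> ^ kb <= cmod (b x)" using b_lower[OF x(1)] by blast
 define t where "t = \<bar>x - z\<bar>"
 have t: "0 < t" "t <= 1" using x z(1) X_unit by (auto simp: t_def abs_le_iff dest: subsetD)
 have pos: "0 < cb * t ^ kb" using cb t by simp
 thus nz: "b x \<noteq> 0" using z(2) unfolding t_def by (metis norm_zero not_le)
 have up: "ln (cmod (b x)) <= ln beta" using b_bound[of x] nz beta by simp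
 have "ln (cb * t ^ kb) <= ln (cmod (b x))" using z(2) pos nz unfolding t_def by (subst ln_le_cancel_iff) auto
 hence "- ln (cmod (b x)) <= - ln cb + real kb * (- ln t)" using cb t by (simp add: ln_mult ln_realpow)
 also have "... <= \<bar>ln cb\<bar> + real kb * (2 * t powr (-1/2))" by (intro add_mono mult_left_mono neg_ln_le t) auto
 also have "... <= \<bar>ln cb\<bar> + real kb * (2 * (\<Sum>z\<in>X. inv_sqrt (x - z) + inv_sqrt (z - x)))"
 proof (intro add_left_mono mult_left_mono)
  have "t powr (-1/2) = inv_sqrt (x - z) + inv_sqrt (z - x)" using t by (auto simp: inv_sqrt_def t_def indicator_def)
  also have "... <= (\<Sum>z\<in>X. inv_sqrt (x - z) + inv_sqrt (z - x))"
   by (rule member_le_sum[OF z(1)]) (auto simp: finite_X intro: add_nonneg_nonneg inv_sqrt_nonneg)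
  finally show "t powr (-1/2) <= (\<Sum>z\<in>X. inv_sqrt (x - z) + inv_sqrt (z - x))" .
 qed auto
 finally have "- ln (cmod (b x)) <= \<bar>ln cb\<bar> + 2 * real kb * (\<Sum>z\<in>X. inv_sqrt (x - z) + inv_sqrt (z - x))"
  by (simp only: mult.assoc mult.left_commute[of 2])
 moreover have "0 <= 2 * real kb * (\<Sum>z\<in>X. inv_sqrt (x - z) + inv_sqrt (z - x))"
  by (intro mult_nonneg_nonneg sum_nonneg add_nonneg_nonneg inv_sqrt_nonneg) auto
 moreover have "0 <= ln beta" "0 <= \<bar>ln cb\<bar>" using beta by simp_all
 ultimately show "\<bar>ln (cmod (b x))\<bar> <= log_dom x" using up unfolding log_dom_def by (intro abs_leI) linarith+
qed

lemma continuous_b: "continuous_on S b"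
 by (rule lipschitz_on_continuous_on[of beta]) (use b_lipschitz beta in \<open>auto simp: lipschitz_on_def dist_norm\<close>)

lemma b_measurable [measurable]: "b \<in> borel_measurable borel" by (rule borel_measurable_continuous_onI[OF continuous_b])

lemma a_measurable [measurable]: "a \<in> borel_measurable borel"
 by (rule borel_measurable_continuous_onI, rule lipschitz_on_continuous_on[of beta])
   (use a_lipschitz beta in \<open>auto simp: lipschitz_on_def dist_real_def\<close>)

lemma AE_unit_generic: "AE x in lborel. x \<in> {0..1} --> b x \<noteq> 0 \<and> \<bar>ln (cmod (b x))\<bar> <= log_dom x"
 using AE_lborel_notin_finite[OF finite_X] by (rule AE_mp) (use abs_ln_b_le in auto)

lemma unit_integrable_bound:
 assumes "F \<in> borel_measurable borel" "unit_integrable G" "AE x in lborel. x \<in> {0..1} --> \<bar>F x\<bar> <= G x"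
 shows "unit_integrable F" unfolding set_integrable_def
 by (rule Bochner_Integration.integrable_bound[of _ "\<lambda>x. indicat_real {0..1} x *\<^sub>R G x"])
   (use assms in \<open>auto simp: set_integrable_def indicator_def elim!: AE_mp\<close>)

lemma ln_b_integrable: "unit_integrable (\<lambda>x. ln (cmod (b x)))"
 by (rule unit_integrable_bound[OF _ log_dom]) (use AE_unit_generic in \<open>auto elim: AE_mp\<close>)

section \<open>The mean of ln |b| and products of b along orbits\<close>

definition log_mean :: real where "log_mean = unit_integral (\<lambda>x. ln (cmod (b x)))"

definition trunc :: "real => real => real" where "trunc T x = ln (max (cmod (b x)) (exp (- T)))"

lemma trunc_measurable [measurable]: "trunc T \<in> borel_measurable borel" unfolding trunc_def by measurable

lemma trunc_bound: "0 <= T ==> \<bar>trunc T x\<bar> <= T + ln beta"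
proof -
 assume T: "0 <= T"
 have "- T <= trunc T x" unfolding trunc_def by (metis ln_exp ln_mono max.cobounded2 exp_gt_zero)
 moreover have "max (cmod (b x)) (exp (- T)) <= beta" using b_bound[of x] T beta by (simp add: order_trans[of _ 1])
 hence "trunc T x <= ln beta" unfolding trunc_def by (intro ln_mono) (auto simp: less_max_iff_disj)
 moreover have "0 <= ln beta" using beta by simp
 ultimately show ?thesis using T by (auto simp: abs_le_iff)
qed

lemma trunc_lipschitz: "\<bar>trunc T x - trunc T y\<bar> <= beta * exp T * \<bar>x - y\<bar>"
proof -
 have ln_diff: "ln u - ln v <= exp T * \<bar>u - v\<bar>" if "exp (- T) <= u" "exp (- T) <= v" for u v :: real
 proof -
  have p: "0 < u" "0 < v" using that by (meson exp_gt_zero less_le_trans)+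
  have "ln u - ln v = ln (u / v)" using p by (simp add: ln_div)
  also have "... <= u / v - 1" using p by (intro ln_le_minus_one) auto
  also have "... = (u - v) / v" using p by (simp add: field_simps)
  also have "... <= \<bar>u - v\<bar> / exp (- T)" using that p by (intro frac_le) auto
  finally show ?thesis by (simp add: exp_minus field_simps)
 qed
 define u v where "u = max (cmod (b x)) (exp (- T))" and "v = max (cmod (b y)) (exp (- T))"
 have "\<bar>u - v\<bar> <= \<bar>cmod (b x) - cmod (b y)\<bar>" unfolding u_def v_def by (simp add: max_def abs_if)
 also have "... <= cmod (b x - b y)" by (rule norm_triangle_ineq3)
 also have "... <= beta * \<bar>x - y\<bar>" by (rule b_lipschitz)
 finally have uv: "exp T * \<bar>u - v\<bar> <= beta * exp T * \<bar>x - y\<bar>" by (simp add: mult_ac)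
 have "\<bar>ln u - ln v\<bar> <= exp T * \<bar>u - v\<bar>"
  using ln_diff[of u v] ln_diff[of v u] unfolding u_def v_def by (auto simp: abs_minus_commute abs_le_iff)
 thus ?thesis using uv unfolding trunc_def u_def v_def by linarith
qed

lemma trunc_integrable: "0 <= T ==> unit_integrable (trunc T)"
 by (rule unit_integrable_bound[OF _ unit_integral_const(1)[of "T + ln beta"]]) (use trunc_bound in auto)

text \<open>Dominated convergence with majorant \<open>log_dom\<close>: the truncations agree with
  the logarithm from some index on, at almost every phase.\<close>

lemma trunc_mean: assumes "0 < s" shows "\<exists>T\<ge>0. unit_integral (trunc T) <= log_mean + s"
proof -
 have "(\<lambda>i. LINT x|lborel. indicat_real {0..1} x *\<^sub>R trunc (real i) x) \<longlonglongrightarrow> (LINT x|lborel. indicat_real {0..1} x *\<^sub>R ln (cmod (b x)))"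
 proof (rule integral_dominated_convergence[where w = "\<lambda>x. indicat_real {0..1} x *\<^sub>R log_dom x"])
  show "integrable lborel (\<lambda>x. indicat_real {0..1} x *\<^sub>R log_dom x)" using log_dom unfolding set_integrable_def .
  show "(\<lambda>x. indicat_real {0..1} x *\<^sub>R trunc (real i) x) \<in> borel_measurable lborel" for i by measurable
  show "AE x in lborel. (\<lambda>i. indicat_real {0..1} x *\<^sub>R trunc (real i) x) \<longlonglongrightarrow> indicat_real {0..1} x *\<^sub>R ln (cmod (b x))"
   using AE_unit_generic
  proof (rule AE_mp, intro AE_I2 impI)
   fix x assume *: "x \<in> {0..1} --> b x \<noteq> 0 \<and> \<bar>ln (cmod (b x))\<bar> <= log_dom x"
   show "(\<lambda>i. indicat_real {0..1} x *\<^sub>R trunc (real i) x) \<longlonglongrightarrow> indicat_real {0..1} x *\<^sub>R ln (cmod (b x))"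
   proof (cases "x \<in> {0..1}")
    case True
    hence nz: "0 < cmod (b x)" using * by simp
    obtain i0 :: nat where i0: "- ln (cmod (b x)) <= real i0" using real_arch_simple by blast
    have "trunc (real i) x = ln (cmod (b x))" if "i0 <= i" for i
    proof -
     have "exp (- real i) <= exp (ln (cmod (b x)))" using i0 that by simp
     also have "... = cmod (b x)" using nz by simp
     finally show ?thesis unfolding trunc_def by (simp add: max_absorb1)
    qed
    hence "eventually (\<lambda>i. indicat_real {0..1} x *\<^sub>R trunc (real i) x = indicat_real {0..1} x *\<^sub>R ln (cmod (b x))) sequentially"
     unfolding eventually_sequentially by (intro exI[of _ i0]) auto
    thus ?thesis by (rule tendsto_eventually)
   qed simp
  qed
  show "AE x in lborel. norm (indicat_real {0..1} x *\<^sub>R trunc (real i) x) <= indicat_real {0..1} x *\<^sub>R log_dom x" for i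
   using AE_unit_generic
  proof (rule AE_mp, intro AE_I2 impI)
   fix x assume *: "x \<in> {0..1} --> b x \<noteq> 0 \<and> \<bar>ln (cmod (b x))\<bar> <= log_dom x"
   have "\<bar>trunc (real i) x\<bar> <= \<bar>ln (cmod (b x))\<bar>" if nz: "b x \<noteq> 0"
   proof (cases "exp (- real i) <= cmod (b x)")
    case False
    hence "ln (cmod (b x)) <= - real i" using nz by (metis ln_exp ln_mono less_imp_le not_le zero_less_norm_iff)
    thus ?thesis using False by (simp add: trunc_def max_def)
   qed (simp add: trunc_def max_def)
   thus "norm (indicat_real {0..1} x *\<^sub>R trunc (real i) x) <= indicat_real {0..1} x *\<^sub>R log_dom x" using * by (auto simp: indicator_def)
  qed
 qed (auto simp: set_borel_measurable_def)
 hence "(\<lambda>i. unit_integral (trunc (real i))) \<longlonglongrightarrow> log_mean" unfolding set_lebesgue_integral_def log_mean_def .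
 hence "eventually (\<lambda>i. unit_integral (trunc (real i)) < log_mean + s) sequentially" using assms by (intro order_tendstoD(2)) auto
 then obtain i where "unit_integral (trunc (real i)) < log_mean + s" by (auto dest: eventually_happens)
 thus ?thesis by (intro exI[of _ "real i"]) auto
qed

text \<open>The orbit of a Diophantine rotation becomes dense at a uniform rate, so ergodic averages of a
 Lipschitz function converge uniformly; truncating \<open>ln |b|\<close> from below is harmless for an upper bound.\<close>

theorem prod_b_upper:
 fixes c alpha s :: real
 assumes c: "0 < c" and alpha: "0 < alpha" and s: "0 < s"
 shows "\<exists>n0. \<forall>n\<ge>n0. \<forall>w\<in>diophantine c alpha. \<forall>x. (\<Prod>j<n. cmod (b (x + real j * w))) <= exp (real n * (log_mean + s))"
proof -
 obtain T where T: "0 <= T" "unit_integral (trunc T) <= log_mean + s / 3" using trunc_mean[of "s / 3"] s by auto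
 define Q where "Q = T + ln beta"
 have Q: "0 <= Q" "\<And>x. \<bar>trunc T x\<bar> <= Q" unfolding Q_def using T beta trunc_bound[of T] by auto
 define N where "N = nat \<lceil>3 * (beta * exp T) / s\<rceil>"
 have NN: "3 * (beta * exp T) / s <= real N" unfolding N_def by linarith
 have "0 < 3 * (beta * exp T) / s" using beta s by simp
 hence N: "0 < N" using NN by (cases N) auto
 define K where "K = real N * (4 * real N * ln (2 * real N) powr alpha / c + 2)"
 have bN: "beta * exp T * (1 / real N) <= s / 3" using NN N s by (simp add: field_simps)
 obtain n0 :: nat where n0: "6 * K * Q / s <= real n0" using real_arch_simple by blast
 have per: "trunc T (x + 1) = trunc T x" for x by (simp add: trunc_def b_periodic)
 have "(\<Prod>j<n. cmod (b (x + real j * w))) <= exp (real n * (log_mean + s))" if n: "n0 <= n" and w: "w \<in> diophantine c alpha" for n w x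
 proof -
  define \<Sigma> where "\<Sigma> y = (\<Sum>j<n. trunc T (y + real j * w))" for y
  \<comment> \<open>Moving the start by one site exchanges one term for another, both of modulus at
    most \<open>Q\<close>.\<close>
  have shift: "\<Sigma> x <= \<Sigma> (x + real k * w) + 2 * real k * Q" for k
  proof (induction k)
   case (Suc k)
   have "\<Sigma> (x + real k * w) <= \<Sigma> (x + real (Suc k) * w) + 2 * Q"
   proof -
    have "(\<Sum>j<Suc n. trunc T (x + real k * w + real j * w)) = trunc T (x + real k * w) + \<Sigma> (x + real (Suc k) * w)"
     unfolding \<Sigma>_def by (subst sum.lessThan_Suc_shift) (simp add: algebra_simps)
    moreover have "(\<Sum>j<Suc n. trunc T (x + real k * w + real j * w)) = \<Sigma> (x + real k * w) + trunc T (x + real k * w + real n * w)"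
     unfolding \<Sigma>_def by simp
    ultimately show ?thesis using Q(2)[of "x + real k * w"] Q(2)[of "x + real k * w + real n * w"] by (auto simp: abs_le_iff)
   qed
   thus ?case using Suc by (simp add: algebra_simps)
  qed simp
  have "\<Sigma> x <= \<Sigma> y + real n * (s / 3) + 2 * K * Q" for y
  proof -
   obtain k :: nat and p :: int where kp: "real k <= K" "\<bar>real k * w - of_int p - (y - x)\<bar> <= 1 / real N"
    using diophantine_orbit_dense[OF w c _ N, of "y - x"] alpha unfolding K_def by (metis less_imp_le)
   \<comment> \<open>The real function is read as a complex one, so that the lemma on integer shifts
     in a strip applies.\<close>
   have perp: "trunc T (z + of_int p) = trunc T z" for z
    using periodic_shift_int[of 1 "\<lambda>z. complex_of_real (trunc T (Re z))" "of_real z" p] per by simp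
   have "\<Sigma> (x + real k * w) <= (\<Sum>j<n. trunc T (y + real j * w) + s / 3)" unfolding \<Sigma>_def
   proof (rule sum_mono)
    fix j
    have "trunc T (x + real k * w + real j * w) = trunc T (x + real k * w - of_int p + real j * w)"
     using perp[of "x + real k * w - of_int p + real j * w"] by (simp add: algebra_simps)
    moreover have "\<bar>trunc T (x + real k * w - of_int p + real j * w) - trunc T (y + real j * w)\<bar> <= beta * exp T * \<bar>(x + real k * w - of_int p + real j * w) - (y + real j * w)\<bar>"
     by (rule trunc_lipschitz)
    moreover have "beta * exp T * \<bar>(x + real k * w - of_int p + real j * w) - (y + real j * w)\<bar> <= beta * exp T * (1 / real N)"
     using kp(2) beta by (intro mult_left_mono) (auto simp: algebra_simps)
    ultimately show "trunc T (x + real k * w + real j * w) <= trunc T (y + real j * w) + s / 3" using bN by linarith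
   qed
   also have "... = \<Sigma> y + real n * (s / 3)" unfolding \<Sigma>_def by (simp add: sum.distrib)
   finally show ?thesis using shift[of k] mult_right_mono[OF kp(1) Q(1)] by linarith
  qed
  \<comment> \<open>The comparison holds with every starting point \<open>y\<close>; integrating
    over \<open>y\<close> turns its right side into the mean.\<close>
  note pw = this
  have i: "unit_integrable (\<lambda>y. trunc T (y + real j * w))" "unit_integral (\<lambda>y. trunc T (y + real j * w)) = unit_integral (trunc T)" for j
   using periodic_unit_integral_shift[OF per trunc_measurable trunc_integrable[OF T(1)]] by auto
  have iS: "unit_integrable \<Sigma>" "unit_integral \<Sigma> = real n * unit_integral (trunc T)"
   proof -
   show "unit_integrable \<Sigma>" using i(1) unfolding \<Sigma>_def set_integrable_def scaleR_sum_right by (rule Bochner_Integration.integrable_sum)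
   show "unit_integral \<Sigma> = real n * unit_integral (trunc T)"
    using i unfolding \<Sigma>_def set_integrable_def set_lebesgue_integral_def scaleR_sum_right by (subst Bochner_Integration.integral_sum) auto
  qed
  have "\<Sigma> x = unit_integral (\<lambda>y. \<Sigma> x)" by (simp add: unit_integral_const)
  also have "... <= unit_integral (\<lambda>y. \<Sigma> y + (real n * (s / 3) + 2 * K * Q))"
   by (intro unit_integral_mono unit_integral_const set_integral_add iS) (use pw in \<open>auto simp: add.assoc\<close>)
  also have "... = real n * unit_integral (trunc T) + (real n * (s / 3) + 2 * K * Q)" by (subst set_integral_add) (auto simp: iS unit_integral_const)
  also have "... <= real n * (log_mean + s)"
  proof -
   have "6 * K * Q / s <= real n" using n0 n by linarith
   hence "2 * K * Q <= real n * (s / 3)" using s by (simp add: field_simps)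
   moreover have "real n * unit_integral (trunc T) <= real n * (log_mean + s / 3)" using T(2) by (intro mult_left_mono) auto
   ultimately show ?thesis by (simp add: algebra_simps)
  qed
  finally have S: "\<Sigma> x <= real n * (log_mean + s)" .
  have "(\<Prod>j<n. cmod (b (x + real j * w))) <= (\<Prod>j<n. exp (trunc T (x + real j * w)))"
  proof (rule prod_mono)
   fix j
   have "exp (trunc T (x + real j * w)) = max (cmod (b (x + real j * w))) (exp (- T))"
    unfolding trunc_def by (rule exp_ln) (simp add: less_max_iff_disj)
   thus "0 <= cmod (b (x + real j * w)) \<and> cmod (b (x + real j * w)) <= exp (trunc T (x + real j * w))" by simp
  qed
  also have "... = exp (\<Sigma> x)" unfolding \<Sigma>_def by (simp add: exp_sum)
  also have "... <= exp (real n * (log_mean + s))" using S by simp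
  finally show ?thesis .
 qed
 thus ?thesis by blast
qed

end

text \<open>Fekete's subadditive lemma. Convergence is what gives the \<open>lim\<close> in
  \<open>lyapunov\<close> its meaning.\<close>

lemma fekete:
 fixes u :: "nat => real"
 assumes sub: "\<And>m n. 1 <= m ==> 1 <= n ==> u (m + n) <= u m + u n" and low: "\<And>n. 1 <= n ==> - K <= u n"
 shows "convergent (\<lambda>n. u n / real n)"
proof -
 define L where "L = (INF n\<in>{1..}. u n / real n)"
 have K0: "- \<bar>K\<bar> <= u n / real n" if "1 <= n" for n
 proof -
  have "\<bar>K\<bar> <= \<bar>K\<bar> * real n" using that by (simp add: mult_le_cancel_left1)
  hence "- \<bar>K\<bar> * real n <= u n" using low[OF that] by linarith
  thus ?thesis using that by (simp add: pos_le_divide_eq)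
 qed
 have bdd: "bdd_below ((\<lambda>n. u n / real n) ` {1..})" using K0 by (intro bdd_belowI2[where m = "- \<bar>K\<bar>"]) auto
 have L: "L <= u n / real n" if "1 <= n" for n unfolding L_def using that by (intro cINF_lower bdd) auto
 have mult: "u (q * n) <= real q * u n" if "1 <= n" "1 <= q" for q n using that(2)
 proof (induction q rule: nat_induct_at_least)
  case (Suc q)
  have "u (Suc q * n) <= u n + u (q * n)" using sub[of n "q * n"] that Suc by simp
  thus ?case using Suc by (simp add: algebra_simps)
 qed simp
 have "(\<lambda>n. u n / real n) \<longlonglongrightarrow> L"
 proof (rule LIMSEQ_I)
  fix e :: real assume e: "0 < e"
  obtain n where n: "1 <= n" "u n / real n < L + e / 2"
  proof -
   have "\<exists>y\<in>(\<lambda>n. u n / real n) ` {1..}. y < L + e / 2"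
    using cInf_lessD[of "(\<lambda>n. u n / real n) ` {1..}" "L + e / 2"] e unfolding L_def by auto
   thus ?thesis using that by auto
  qed
  define Q where "Q = (\<Sum>r<n. \<bar>u r\<bar>) + real n * \<bar>L + e / 2\<bar>"
  have Q0: "0 <= Q" unfolding Q_def by (intro add_nonneg_nonneg sum_nonneg) auto
  obtain N0 :: nat where N0: "2 * Q / e + 1 <= real N0" using real_arch_simple by blast
  have "norm (u N / real N - L) < e" if N: "max N0 n <= N" for N
  proof -
   define q r where "q = N div n" and "r = N mod n"
   have qr: "N = q * n + r" "r < n" "1 <= q" using n(1) N by (auto simp: q_def r_def div_greater_zero_iff Suc_le_eq)
   have ur: "\<bar>u r\<bar> <= (\<Sum>r<n. \<bar>u r\<bar>)" by (rule member_le_sum) (use qr in auto)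
   have "u N <= real q * u n + \<bar>u r\<bar>"
   proof (cases "r = 0")
    case True
    thus ?thesis using mult[OF n(1) qr(3)] qr(1) by simp
   next
    case False
    hence "u N <= u (q * n) + u r" unfolding qr(1) using sub[of "q * n" r] n(1) qr(3) by simp
    thus ?thesis using mult[OF n(1) qr(3)] by linarith
   qed
   moreover have "real q * u n <= real q * (real n * (L + e / 2))" using n by (intro mult_left_mono) (auto simp: pos_divide_less_eq mult.commute)
   moreover have "real q * (real n * (L + e / 2)) = (real N - real r) * (L + e / 2)" using qr(1) by simp
   moreover have "- (real r * (L + e / 2)) <= real n * \<bar>L + e / 2\<bar>"
   proof -
    have "- (real r * (L + e / 2)) <= real r * \<bar>L + e / 2\<bar>" by (metis abs_ge_minus_self abs_mult abs_of_nat)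
    also have "... <= real n * \<bar>L + e / 2\<bar>" using qr(2) by (intro mult_right_mono) auto
    finally show ?thesis .
   qed
   ultimately have "u N <= real N * (L + e / 2) + Q" using ur unfolding Q_def by (simp add: left_diff_distrib)
   moreover have "Q < real N * (e / 2)"
   proof -
    have "2 * Q / e < real N" using N0 N by linarith
    thus ?thesis using e by (simp add: pos_divide_less_eq mult_ac)
   qed
   ultimately have "u N < real N * (L + e)" by (simp add: algebra_simps)
   moreover have Np: "0 < real N" "1 <= N" using N n(1) by auto
   ultimately have "u N / real N < L + e" by (simp add: pos_divide_less_eq mult.commute)
   thus ?thesis using L[OF Np(2)] e by (simp add: abs_less_iff)
  qed
  thus "\<exists>no. \<forall>n\<ge>no. norm (u n / real n - L) < e" by blast
 qed
 thus ?thesis by (rule convergentI)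
qed

section \<open>Norm and determinant of 2 by 2 matrices\<close>

abbreviation entry :: "complex^2^2 => 2 => 2 => complex" where "entry M i j \<equiv> vec_nth (vec_nth M i) j"

definition opnorm :: "complex^2^2 => real" where "opnorm M = onorm (\<lambda>v. M *v v)"

definition det2 :: "complex^2^2 => complex" where "det2 M = entry M 1 1 * entry M 2 2 - entry M 1 2 * entry M 2 1"

lemma opnorm_le: "opnorm M <= cmod (entry M 1 1) + cmod (entry M 1 2) + cmod (entry M 2 1) + cmod (entry M 2 2)" unfolding opnorm_def
proof (rule onorm_le)
 fix v :: "complex^2"
 have c: "cmod (vec_nth v 1) <= norm v" "cmod (vec_nth v 2) <= norm v" by (rule Finite_Cartesian_Product.norm_nth_le)+
 have "norm (M *v v) <= (\<Sum>i\<in>UNIV. norm (vec_nth (M *v v) i))" unfolding norm_vec_def by (rule L2_set_le_sum) simp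
 also have "... = cmod (entry M 1 1 * vec_nth v 1 + entry M 1 2 * vec_nth v 2) + cmod (entry M 2 1 * vec_nth v 1 + entry M 2 2 * vec_nth v 2)"
  by (simp add: sum_2 matrix_vector_mult_def)
 also have "... <= (cmod (entry M 1 1) * norm v + cmod (entry M 1 2) * norm v) + (cmod (entry M 2 1) * norm v + cmod (entry M 2 2) * norm v)"
  by (intro add_mono order_trans[OF norm_triangle_ineq]) (auto simp: norm_mult intro!: mult_left_mono c)
 finally show "norm (M *v v) <= (cmod (entry M 1 1) + cmod (entry M 1 2) + cmod (entry M 2 1) + cmod (entry M 2 2)) * norm v" by (simp add: algebra_simps)
qed

lemma entry_le_opnorm: "cmod (entry M i j) <= opnorm M"
proof -
 have "entry M i j = vec_nth (M *v axis j 1) i" by (simp add: matrix_vector_mult_def axis_def if_distrib sum.If_cases cong: if_cong)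
 hence "cmod (entry M i j) <= norm (M *v axis j 1)" by (metis Finite_Cartesian_Product.norm_nth_le)
 also have "... <= opnorm M * norm (axis j (1::complex) :: complex^2)" unfolding opnorm_def by (rule onorm[OF matrix_vector_mul_bounded_linear])
 also have "norm (axis j (1::complex) :: complex^2) = 1" by simp
 finally show ?thesis by simp
qed

lemma opnorm_mult: "opnorm (A ** B) <= opnorm A * opnorm B"
proof -
 have "(\<lambda>v. (A ** B) *v v) = (\<lambda>v. A *v v) \<circ> (\<lambda>v. B *v v)" by (rule ext) (simp add: matrix_vector_mul_assoc)
 thus ?thesis unfolding opnorm_def
  using onorm_compose[OF matrix_vector_mul_bounded_linear[of A] matrix_vector_mul_bounded_linear[of B]] by (simp only:)
qed

lemma det2_mult: "det2 (A ** B) = det2 A * det2 B"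
proof -
 have "entry (A ** B) i j = entry A i 1 * entry B 1 j + entry A i 2 * entry B 2 j" for i j by (simp add: matrix_matrix_mult_def sum_2)
 thus ?thesis unfolding det2_def by (simp only:) (simp add: algebra_simps)
qed

lemma det2_le: "cmod (det2 M) <= 2 * (opnorm M)\<^sup>2"
proof -
 have "cmod (det2 M) <= cmod (entry M 1 1) * cmod (entry M 2 2) + cmod (entry M 1 2) * cmod (entry M 2 1)"
  unfolding det2_def using norm_triangle_ineq4[of "entry M 1 1 * entry M 2 2" "entry M 1 2 * entry M 2 1"] by (simp only: norm_mult)
 also have "... <= opnorm M * opnorm M + opnorm M * opnorm M"
  by (intro add_mono mult_mono entry_le_opnorm) (rule norm_ge_zero order_trans[OF norm_ge_zero entry_le_opnorm])+
 finally show ?thesis by (simp add: power2_eq_square)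
qed

text \<open>By the triangle inequality and \<open>opnorm_le\<close> the norm is a Lipschitz function
  of the four entries, hence continuous.\<close>

lemma opnorm_measurable:
 assumes "\<And>i j. (\<lambda>x. entry (M x) i j) \<in> borel_measurable borel"
 shows "(\<lambda>x. opnorm (M x)) \<in> borel_measurable borel"
proof -
 define mk where "mk = (\<lambda>(p, q, r, s). vector [vector [p, q], vector [r, s]] :: complex^2^2)"
 have mk: "mk (entry M 1 1, entry M 1 2, entry M 2 1, entry M 2 2) = M" for M by (simp add: mk_def Finite_Cartesian_Product.vec_eq_iff forall_2)
 have diff: "mk u - mk v = mk (u - v)" for u v by (cases u; cases v) (simp add: mk_def Finite_Cartesian_Product.vec_eq_iff forall_2)
 have lip: "opnorm (mk u) - opnorm (mk v) <= 4 * norm (u - v)" for u v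
 proof -
  have "opnorm (mk u) = onorm (\<lambda>x. mk v *v x + mk (u - v) *v x)"
   unfolding opnorm_def diff[symmetric] by (simp add: matrix_vector_mult_add_rdistrib[symmetric])
  also have "... <= opnorm (mk v) + opnorm (mk (u - v))" unfolding opnorm_def
   by (rule onorm_triangle[OF matrix_vector_mul_bounded_linear matrix_vector_mul_bounded_linear])
  also have "opnorm (mk (u - v)) <= 4 * norm (u - v)"
  proof -
   obtain p q r s where u: "u - v = (p, q, r, s)" by (metis surj_pair)
   have "norm p <= norm (p, q, r, s)" by (rule norm_fst_le)
   moreover have "norm (q, r, s) <= norm (p, q, r, s)" "norm q <= norm (q, r, s)" "norm (r, s) <= norm (q, r, s)"
    "norm r <= norm (r, s)" "norm s <= norm (r, s)" by (rule norm_fst_le norm_snd_le)+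
   ultimately have "cmod p + cmod q + cmod r + cmod s <= 4 * norm (p, q, r, s)" by linarith
   thus ?thesis using opnorm_le[of "mk (u - v)"] unfolding u by (simp add: mk_def)
  qed
  finally show ?thesis by simp
 qed
 have "\<bar>opnorm (mk u) - opnorm (mk v)\<bar> <= 4 * norm (u - v)" for u v
  using lip[of u v] lip[of v u] by (simp add: norm_minus_commute abs_le_iff)
 hence "4-lipschitz_on UNIV (\<lambda>u. opnorm (mk u))" by (auto simp: lipschitz_on_def dist_norm)
 hence m: "(\<lambda>u. opnorm (mk u)) \<in> borel_measurable borel" by (intro borel_measurable_continuous_onI lipschitz_on_continuous_on)
 have "(\<lambda>x. (entry (M x) 1 1, entry (M x) 1 2, entry (M x) 2 1, entry (M x) 2 2)) \<in> borel_measurable borel"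
  by (intro borel_measurable_Pair assms)
 hence "(\<lambda>u. opnorm (mk u)) \<circ> (\<lambda>x. (entry (M x) 1 1, entry (M x) 1 2, entry (M x) 2 1, entry (M x) 2 2)) \<in> borel_measurable borel" using m by (rule measurable_comp)
 thus ?thesis by (simp add: comp_def mk)
qed

section \<open>Suprema of determinants, and the entries of transfer matrices\<close>

context jacobi_data
begin

lemma f_split_le:
 assumes "1 <= m" "1 <= n"
 shows "cmod (f (m + n) (of_real x) w e) <= cmod (f m (of_real x) w e) * cmod (f n (of_real (x + real m * w)) w e)
  + beta\<^sup>2 * (cmod (f (m - 1) (of_real x) w e) * cmod (f (n - 1) (of_real (x + real (m + 1) * w)) w e))"
proof -
 obtain k l where kl: "m = Suc k" "n = Suc l" using assms by (metis Suc_le_D One_nat_def)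
 let ?g = "cont (\<lambda>j. ac (of_real x + of_int j * of_real w) - e) (\<lambda>j. bb (of_real x + of_int j * of_real w))"
 have sh: "f r (of_real (x + real j * w)) w e = ?g (int j) r" for r j using f_shift[of r "of_real x" j w e] by simp
 have eq: "complex_of_real x + of_int (int k + 1) * of_real w = of_real (x + of_int (int k + 1) * w)" by simp
 have cb: "cmod (bb (of_real x + of_int (int k + 1) * of_real w)) <= beta\<^sup>2"
  unfolding eq bb_real norm_of_real using b_bound[of "x + of_int (int k + 1) * w"] by (simp add: power_mono)
 have "f (m + n) (of_real x) w e = ?g 0 (Suc k) * ?g (int k + 1) (Suc l) - bb (of_real x + of_int (int k + 1) * of_real w) * ?g 0 k * ?g (int k + 2) l"
  unfolding f_def kl using cont_split[of "\<lambda>j. ac (of_real x + of_int j * of_real w) - e" "\<lambda>j. bb (of_real x + of_int j * of_real w)" 0 k l]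
  by (simp only: add_0)
 hence "cmod (f (m + n) (of_real x) w e) <= cmod (?g 0 (Suc k)) * cmod (?g (int k + 1) (Suc l)) +
  cmod (bb (of_real x + of_int (int k + 1) * of_real w)) * cmod (?g 0 k) * cmod (?g (int k + 2) l)"
  by (simp only: norm_mult[symmetric] norm_triangle_ineq4)
 also have "cmod (bb (of_real x + of_int (int k + 1) * of_real w)) * cmod (?g 0 k) * cmod (?g (int k + 2) l)
   <= beta\<^sup>2 * (cmod (?g 0 k) * cmod (?g (int k + 2) l))" unfolding mult.assoc by (rule mult_right_mono[OF cb]) simp
 finally have main: "cmod (f (m + n) (of_real x) w e) <= cmod (?g 0 (Suc k)) * cmod (?g (int k + 1) (Suc l)) +
  beta\<^sup>2 * (cmod (?g 0 k) * cmod (?g (int k + 2) l))" by simp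
 have "f m (of_real x) w e = ?g 0 (Suc k)" "f (m - 1) (of_real x) w e = ?g 0 k" unfolding f_def kl by simp_all
 moreover have "int m = int k + 1" "int (m + 1) = int k + 2" "n = Suc l" "n - 1 = l" using kl by simp_all
 ultimately show ?thesis using main unfolding sh by (simp only:)
qed

text \<open>The numerators in a transfer matrix are determinants of length \<open>n\<close>,
  \<open>n - 1\<close> and \<open>n - 2\<close> times none, one or two values of \<open>b\<close>.
  The powers of \<open>beta\<close> account for these, and they make the supremum submultiplicative
  up to the factor 2.\<close>

definition phi :: "nat => real => real => real => real" where
 "phi n w E x = max (cmod (f n (of_real x) w (of_real E))) (max (beta * cmod (f (n - 1) (of_real x) w (of_real E))) (beta\<^sup>2 * cmod (f (n - 2) (of_real x) w (of_real E))))"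

definition Phi :: "nat => real => real => real" where
 "Phi n w E = (SUP x. phi n w E x)"

lemma f_upper_real:
 assumes "beta + \<bar>E\<bar> <= C" shows "cmod (f n (of_real x) w (of_real E)) <= (2 * C) ^ n" by (rule f_upper) (use y1 assms in auto)

lemma phi_upper:
 assumes C: "beta + \<bar>E\<bar> <= C" shows "phi n w E x <= beta\<^sup>2 * (2 * C) ^ n"
proof -
 have C1: "1 <= 2 * C" using C beta by linarith
 have le: "cmod (f k (of_real x) w (of_real E)) <= (2 * C) ^ n" if "k <= n" for k
  using f_upper_real[OF C, of k x w] power_increasing[OF that C1] by linarith
 have beta2: "1 <= beta\<^sup>2" "beta <= beta\<^sup>2" using beta by (auto simp: power2_eq_square mult_le_cancel_left1 intro: order_trans)
 have p: "0 <= (2 * C) ^ n" using C1 by simp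
 have "1 * cmod (f n (of_real x) w (of_real E)) <= beta\<^sup>2 * (2 * C) ^ n" by (intro mult_mono le beta2) auto
 moreover have "beta * cmod (f (n - 1) (of_real x) w (of_real E)) <= beta\<^sup>2 * (2 * C) ^ n" using beta by (intro mult_mono le beta2) auto
 moreover have "beta\<^sup>2 * cmod (f (n - 2) (of_real x) w (of_real E)) <= beta\<^sup>2 * (2 * C) ^ n" by (intro mult_left_mono le) auto
 ultimately show ?thesis unfolding phi_def by simp
qed

lemma phi_le_Phi: "phi n w E x <= Phi n w E"
 unfolding Phi_def by (rule cSUP_upper) (use phi_upper[OF order_refl] in \<open>auto intro!: bdd_aboveI2\<close>)

lemma f_le_Phi:
 "cmod (f n (of_real x) w (of_real E)) <= Phi n w E" "beta * cmod (f (n - 1) (of_real x) w (of_real E)) <= Phi n w E"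
 "beta\<^sup>2 * cmod (f (n - 2) (of_real x) w (of_real E)) <= Phi n w E" using phi_le_Phi[of n w E x] unfolding phi_def by auto

lemma Phi_nonneg: "0 <= Phi n w E" using f_le_Phi(1)[of n 0 w E] norm_ge_zero order_trans by blast

lemma Phi_leI: "(\<And>x. cmod (f n (of_real x) w (of_real E)) <= B) ==> (\<And>x. beta * cmod (f (n - 1) (of_real x) w (of_real E)) <= B) ==>
  (\<And>x. beta\<^sup>2 * cmod (f (n - 2) (of_real x) w (of_real E)) <= B) ==> Phi n w E <= B"
 unfolding Phi_def by (rule cSUP_least) (auto simp: phi_def)

lemma Phi_upper: "beta + \<bar>E\<bar> <= C ==> Phi n w E <= beta\<^sup>2 * (2 * C) ^ n"
 unfolding Phi_def by (rule cSUP_least) (simp, rule phi_upper)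

text \<open>Blocks of \<open>m + n\<close>, \<open>m + n - 1\<close> and \<open>m + n - 2\<close>
  sites are cut as \<open>(m, n)\<close>, \<open>(m, n - 1)\<close> and
  \<open>(m - 1, n - 1)\<close>. The cut costs \<open>beta\<^sup>2\<close> and shortens both pieces
  by one site; the powers of \<open>beta\<close>, shared between the pieces, are exactly those in
  \<open>phi\<close>.\<close>

lemma Phi_add:
 assumes m: "2 <= m" and n: "2 <= n"
 shows "Phi (m + n) w E <= 2 * (Phi m w E * Phi n w E)"
proof -
 let ?F = "\<lambda>k x. cmod (f k (of_real x) w (of_real E))"
 have pr: "u * v <= Phi m w E * Phi n w E" if "u <= Phi m w E" "v <= Phi n w E" "0 <= v" for u v using that Phi_nonneg by (intro mult_mono) auto
 have beta0: "0 <= beta" using beta by simp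
 have add_le_2: "u + v <= 2 * t" if "u <= t" "v <= t" for u v t :: real using that by simp
 show ?thesis
 proof (rule Phi_leI)
  fix x
  have "?F (m + n) x <= ?F m x * ?F n (x + real m * w) + beta\<^sup>2 * (?F (m - 1) x * ?F (n - 1) (x + real (m + 1) * w))"
   by (rule f_split_le) (use m n in auto)
  also have "beta\<^sup>2 * (?F (m - 1) x * ?F (n - 1) (x + real (m + 1) * w)) = (beta * ?F (m - 1) x) * (beta * ?F (n - 1) (x + real (m + 1) * w))"
   by (simp add: power2_eq_square)
  also have "?F m x * ?F n (x + real m * w) + ... <= 2 * (Phi m w E * Phi n w E)"
   by (rule add_le_2[OF pr[OF f_le_Phi(1,1)] pr[OF f_le_Phi(2,2)]]) (use beta0 in auto)
  finally show "?F (m + n) x <= 2 * (Phi m w E * Phi n w E)" .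
 next
  fix x
  have "?F (m + n - 1) x <= ?F m x * ?F (n - 1) (x + real m * w) + beta\<^sup>2 * (?F (m - 1) x * ?F (n - 2) (x + real (m + 1) * w))"
  proof -
   have "m + (n - 1) = m + n - 1" "n - 1 - 1 = n - 2" using n by auto
   thus ?thesis using f_split_le[of m "n - 1" x w "of_real E"] m n by (simp del: of_nat_add of_nat_Suc)
  qed
  hence "beta * ?F (m + n - 1) x <= beta * (?F m x * ?F (n - 1) (x + real m * w) + beta\<^sup>2 * (?F (m - 1) x * ?F (n - 2) (x + real (m + 1) * w)))"
   using beta0 by (rule mult_left_mono)
  also have "... = ?F m x * (beta * ?F (n - 1) (x + real m * w)) + (beta * ?F (m - 1) x) * (beta\<^sup>2 * ?F (n - 2) (x + real (m + 1) * w))"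
   by (simp add: algebra_simps)
  also have "... <= 2 * (Phi m w E * Phi n w E)" by (rule add_le_2[OF pr[OF f_le_Phi(1,2)] pr[OF f_le_Phi(2,3)]]) (use beta0 in auto)
  finally show "beta * ?F (m + n - 1) x <= 2 * (Phi m w E * Phi n w E)" .
 next
  fix x
  have "?F (m + n - 2) x <= ?F (m - 1) x * ?F (n - 1) (x + real (m - 1) * w) + beta\<^sup>2 * (?F (m - 2) x * ?F (n - 2) (x + real (m - 1 + 1) * w))"
  proof -
   have "(m - 1) + (n - 1) = m + n - 2" "n - 1 - 1 = n - 2" "m - 1 - 1 = m - 2" using m n by auto
   moreover have "1 <= m - 1" "1 <= n - 1" using m n by auto
   ultimately show ?thesis using f_split_le[of "m - 1" "n - 1" x w "of_real E"] by metis
  qed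
  hence "beta\<^sup>2 * ?F (m + n - 2) x <= beta\<^sup>2 * (?F (m - 1) x * ?F (n - 1) (x + real (m - 1) * w) + beta\<^sup>2 * (?F (m - 2) x * ?F (n - 2) (x + real (m - 1 + 1) * w)))"
   by (rule mult_left_mono) simp
  also have "... = (beta * ?F (m - 1) x) * (beta * ?F (n - 1) (x + real (m - 1) * w)) + (beta\<^sup>2 * ?F (m - 2) x) * (beta\<^sup>2 * ?F (n - 2) (x + real (m - 1 + 1) * w))"
   by (simp add: algebra_simps power2_eq_square)
  also have "... <= 2 * (Phi m w E * Phi n w E)" by (rule add_le_2[OF pr[OF f_le_Phi(2,2)] pr[OF f_le_Phi(3,3)]]) (use beta0 in auto)
  finally show "beta\<^sup>2 * ?F (m + n - 2) x <= 2 * (Phi m w E * Phi n w E)" .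
 qed
qed

lemma Phi_mult:
 assumes n: "2 <= n" and q: "1 <= q"
 shows "Phi (q * n) w E <= 2 ^ (q - 1) * Phi n w E ^ q" using q
proof (induction q rule: nat_induct_at_least)
 case (Suc q)
 have "Phi (n + q * n) w E <= 2 * (Phi n w E * Phi (q * n) w E)" by (rule Phi_add[OF n]) (use n Suc in \<open>simp add: order_trans[OF n]\<close>)
 also have "... <= 2 * (Phi n w E * (2 ^ (q - 1) * Phi n w E ^ q))" using Suc Phi_nonneg by (intro mult_left_mono) auto
 also have "... = 2 ^ (Suc q - 1) * Phi n w E ^ Suc q" using Suc by (cases q) (auto simp: algebra_simps)
 finally show ?case by simp
qed simp

text \<open>Freed of denominators, the four entries are determinants of the block with the first
  site, the last site, both or none removed, times boundary values of \<open>b\<close>.\<close>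

lemma transfer_entries:
 fixes x w E :: real
 assumes nz: "\<And>j. j <= Suc m ==> b (x + real j * w) \<noteq> 0"
 defines "g \<equiv> cont (\<lambda>k. of_real (a (x + of_int k * w)) - of_real E) (\<lambda>k. of_real ((cmod (b (x + of_int k * w)))\<^sup>2))"
 defines "P \<equiv> \<lambda>n. \<Prod>j<n. b (x + real (j + 1) * w)"
 defines "M \<equiv> \<lambda>n. transfer_matrix a b n x w E"
 shows "entry (M (Suc m)) 1 1 * P (Suc m) = g 0 (Suc m)" "entry (M (Suc m)) 1 2 * P (Suc m) = - cnj (b x) * g 1 m"
  "entry (M (Suc m)) 2 1 * P (Suc m) = b (x + real (Suc m) * w) * g 0 m"
  "entry (M (Suc m)) 2 2 * P (Suc m) = (if m = 0 then 0 else - cnj (b x) * b (x + real (Suc m) * w) * g 1 (m - 1))"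
proof -
 have step: "entry (M (Suc n)) 1 i * b (x + real (Suc n) * w) = (of_real (a (x + real n * w)) - of_real E) * entry (M n) 1 i - cnj (b (x + real n * w)) * entry (M n) 2 i"
  "entry (M (Suc n)) 2 i = entry (M n) 1 i" if "n <= m" for n i using nz[of "Suc n"] that unfolding M_def
  by (simp_all add: transfer_step_def matrix_matrix_mult_def sum_2 Finite_Cartesian_Product.mat_def field_simps)
 have PS: "P (Suc n) = P n * b (x + real (Suc n) * w)" for n unfolding P_def by simp
 have "n <= m ==> entry (M (Suc n)) 1 1 * P (Suc n) = g 0 (Suc n) \<and> entry (M (Suc n)) 1 2 * P (Suc n) = - cnj (b x) * g 1 n \<and>
  entry (M (Suc n)) 2 1 * P (Suc n) = b (x + real (Suc n) * w) * g 0 n \<and>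
  entry (M (Suc n)) 2 2 * P (Suc n) = (if n = 0 then 0 else - cnj (b x) * b (x + real (Suc n) * w) * g 1 (n - 1))" for n
 proof (induction n)
  case 0
  have M0: "M 0 = Finite_Cartesian_Product.mat 1" by (simp add: M_def)
  have P1: "P (Suc 0) = b (x + real (Suc 0) * w)" by (simp add: P_def)
  show ?case using step[of 0 1] step[of 0 2] unfolding M0 P1 by (simp add: Finite_Cartesian_Product.mat_def g_def mult.commute)
 next
  case (Suc n)
  hence IH: "entry (M (Suc n)) 1 1 * P (Suc n) = g 0 (Suc n)" "entry (M (Suc n)) 1 2 * P (Suc n) = - cnj (b x) * g 1 n"
   "entry (M (Suc n)) 2 1 * P (Suc n) = b (x + real (Suc n) * w) * g 0 n"
   "entry (M (Suc n)) 2 2 * P (Suc n) = (if n = 0 then 0 else - cnj (b x) * b (x + real (Suc n) * w) * g 1 (n - 1))" by auto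
  let ?bn = "b (x + real (Suc n) * w)" and ?bn' = "b (x + real (Suc (Suc n)) * w)"
  let ?al = "of_real (a (x + real (Suc n) * w)) - complex_of_real E"
  have bb2: "complex_of_real ((cmod ?bn)\<^sup>2) = cnj ?bn * ?bn" by (simp add: complex_norm_square mult.commute del: of_real_power)
  have first: "entry (M (Suc (Suc n))) 1 i * P (Suc (Suc n)) = ?al * (entry (M (Suc n)) 1 i * P (Suc n)) - cnj ?bn * (entry (M (Suc n)) 2 i * P (Suc n))" for i
  proof -
   have "entry (M (Suc (Suc n))) 1 i * P (Suc (Suc n)) = (entry (M (Suc (Suc n))) 1 i * ?bn') * P (Suc n)" unfolding PS[of "Suc n"] by (simp only: mult_ac)
   thus ?thesis unfolding step(1)[OF Suc.prems] by (simp add: algebra_simps)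
  qed
  have second: "entry (M (Suc (Suc n))) 2 i * P (Suc (Suc n)) = ?bn' * (entry (M (Suc n)) 1 i * P (Suc n))" for i
   unfolding PS[of "Suc n"] step(2)[OF Suc.prems] by (simp only: mult_ac)
  have g0: "g 0 (Suc (Suc n)) = ?al * g 0 (Suc n) - (cnj ?bn * ?bn) * g 0 n" unfolding g_def bb2[symmetric] by (simp add: add.commute)
  have g1: "g 1 (Suc n) = ?al * g 1 n - (if n = 0 then 0 else (cnj ?bn * ?bn) * g 1 (n - 1))"
   unfolding g_def bb2[symmetric] by (cases n) (simp_all add: add.commute)
  show ?case unfolding first second IH g0 g1 by (simp add: algebra_simps)
 qed
 thus "entry (M (Suc m)) 1 1 * P (Suc m) = g 0 (Suc m)" "entry (M (Suc m)) 1 2 * P (Suc m) = - cnj (b x) * g 1 m"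
  "entry (M (Suc m)) 2 1 * P (Suc m) = b (x + real (Suc m) * w) * g 0 m"
  "entry (M (Suc m)) 2 2 * P (Suc m) = (if m = 0 then 0 else - cnj (b x) * b (x + real (Suc m) * w) * g 1 (m - 1))" by auto
qed

end

lemma transfer_step_entries:
 "entry (transfer_step a b n x w E) 1 1 = of_real (a (x + real n * w) - E) / b (x + real (n + 1) * w)"
 "entry (transfer_step a b n x w E) 1 2 = - cnj (b (x + real n * w)) / b (x + real (n + 1) * w)"
 "entry (transfer_step a b n x w E) 2 1 = b (x + real (n + 1) * w) / b (x + real (n + 1) * w)"
 "entry (transfer_step a b n x w E) 2 2 = 0" by (simp_all add: transfer_step_def matrix_matrix_mult_def sum_2 Finite_Cartesian_Product.mat_def)

lemma entry_mult: "entry (A ** B) i j = entry A i 1 * entry B 1 j + entry A i 2 * entry B 2 j" by (simp add: matrix_matrix_mult_def sum_2)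

lemma transfer_matrix_add:
 "transfer_matrix a b (m + n) x w E = transfer_matrix a b n (x + real m * w) w E ** transfer_matrix a b m x w E"
proof (induction n)
 case (Suc n)
 have "x + real (m + n) * w = x + real m * w + real n * w" "x + real (m + n + 1) * w = x + real m * w + real (n + 1) * w"
  by (simp_all add: algebra_simps)
 hence "transfer_step a b (m + n) x w E = transfer_step a b n (x + real m * w) w E" unfolding transfer_step_def by (simp only:)
 with Suc show ?case by (simp add: matrix_mul_assoc)
qed simp

lemma unit_integral_sum:
 assumes "finite J" "\<And>j. j \<in> J ==> unit_integrable (F j)"
 shows "unit_integrable (\<lambda>x. \<Sum>j\<in>J. F j x)" "unit_integral (\<lambda>x. \<Sum>j\<in>J. F j x) = (\<Sum>j\<in>J. unit_integral (F j))"
proof -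
 have "unit_integrable (\<lambda>x. \<Sum>j\<in>J. F j x) \<and> unit_integral (\<lambda>x. \<Sum>j\<in>J. F j x) = (\<Sum>j\<in>J. unit_integral (F j))"
  using assms by (induction J rule: finite_induct) (auto simp: unit_integral_const(1)[of 0])
 thus "unit_integrable (\<lambda>x. \<Sum>j\<in>J. F j x)" "unit_integral (\<lambda>x. \<Sum>j\<in>J. F j x) = (\<Sum>j\<in>J. unit_integral (F j))" by auto
qed

lemma unit_integrable_minus: "unit_integrable F ==> unit_integrable (\<lambda>x. - F x)"
 using set_integrable_mult_right[of "-1" lborel "{0..1}" F] by simp

section \<open>Integrability of the logarithm of the norm, and a bound for the Lyapunov
  exponent\<close>

context jacobi_data_zeros
begin

definition zero_free_orbit :: "real => real set" where
 "zero_free_orbit w = {x. \<forall>j::nat. b (x + real j * w) \<noteq> 0}"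

lemma b_frac: "b (frac x) = b x"
proof -
 have n: "b (x + real n) = b x" for x n
 proof (induction n)
  case (Suc n)
  thus ?case using b_periodic[of "x + real n"] by (simp add: add_ac)
 qed simp
 show ?thesis
 proof (cases "0 <= \<lfloor>x\<rfloor>")
  case True
  thus ?thesis using n[of "frac x" "nat \<lfloor>x\<rfloor>"] by (simp add: frac_def)
 next
  case False
  thus ?thesis using n[of x "nat (- \<lfloor>x\<rfloor>)"] by (simp add: frac_def)
 qed
qed

lemma b_lower_frac: "\<exists>z\<in>X. cb * \<bar>frac x - z\<bar> ^ kb <= cmod (b x)"
 using b_lower[of "frac x"] by (auto simp: b_frac less_imp_le[OF frac_lt_1])

lemma AE_zero_free_orbit: "AE x in lborel. x \<in> zero_free_orbit w"
proof -
 let ?Z = "\<Union>j::nat. \<Union>k::int. \<Union>z\<in>X. {z + of_int k - real j * w}"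
 have "countable ?Z" using finite_X by (intro countable_UN) (auto intro: countable_finite)
 hence "?Z \<in> null_sets lborel" by (rule countable_imp_null_set_lborel)
 moreover have "x \<in> zero_free_orbit w" if x: "x \<notin> ?Z" for x
 proof (rule ccontr)
  assume "x \<notin> zero_free_orbit w"
  then obtain j :: nat where j: "b (x + real j * w) = 0" by (auto simp: zero_free_orbit_def)
  obtain z where z: "z \<in> X" "cb * \<bar>frac (x + real j * w) - z\<bar> ^ kb <= 0" using b_lower_frac[of "x + real j * w"] j by auto
  hence "\<bar>frac (x + real j * w) - z\<bar> ^ kb <= 0" using cb by (simp add: mult_le_0_iff)
  hence "frac (x + real j * w) = z" by (metis abs_eq_0 eq_iff_diff_eq_0 abs_ge_zero zero_less_power not_less less_le)
  hence "x = z + of_int \<lfloor>x + real j * w\<rfloor> - real j * w" by (simp add: frac_def)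
  thus False using x z(1) by blast
 qed
 hence "{x \<in> space lborel. x \<notin> zero_free_orbit w} \<subseteq> ?Z" by blast
 ultimately show ?thesis by (rule AE_I')
qed

lemma transfer_entry_measurable: "(\<lambda>x. entry (transfer_matrix a b n x w E) i j) \<in> borel_measurable borel"
proof (induction n arbitrary: i j)
 case 0
 show ?case by (simp add: Finite_Cartesian_Product.mat_def)
next
 case (Suc n)
 have [measurable]: "cnj \<in> borel_measurable borel" by (intro borel_measurable_continuous_onI continuous_intros)
 note [measurable] = Suc b_measurable a_measurable
 have "(\<lambda>x. entry (transfer_step a b n x w E) i k) \<in> borel_measurable borel" for k
  using exhaust_2[of i] exhaust_2[of k] by (elim disjE) (simp_all only: transfer_step_entries, measurable)
 note [measurable] = this
 show ?case unfolding transfer_matrix.simps entry_mult by measurable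
qed

lemma transfer_opnorm_measurable: "(\<lambda>x. ln (opnorm (transfer_matrix a b n x w E))) \<in> borel_measurable borel"
proof -
 have [measurable]: "(\<lambda>x. opnorm (transfer_matrix a b n x w E)) \<in> borel_measurable borel"
  by (rule opnorm_measurable) (rule transfer_entry_measurable)
 show ?thesis by measurable
qed

lemma transfer_periodic: "transfer_matrix a b n (x + 1) w E = transfer_matrix a b n x w E"
proof (induction n)
 case (Suc n)
 have "a (x + 1 + t) = a (x + t)" "b (x + 1 + t) = b (x + t)" for t
  using a_periodic[of "x + t"] b_periodic[of "x + t"] by (simp_all add: algebra_simps)
 thus ?case using Suc by (simp add: transfer_step_def)
qed simp

lemma opnorm_nonneg: "0 <= opnorm M" unfolding opnorm_def by (rule onorm_pos_le[OF matrix_vector_mul_bounded_linear])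

text \<open>Each factor contributes the quotient of the moduli of \<open>b\<close> at neighbouring
  sites, and the product telescopes. With \<open>det2_le\<close> this bounds the norm from below by
  a quantity whose logarithm has a mean independent of \<open>n\<close>.\<close>

lemma transfer_det:
 assumes "x \<in> zero_free_orbit w"
 shows "cmod (det2 (transfer_matrix a b n x w E)) = cmod (b x) / cmod (b (x + real n * w))"
proof (induction n)
 case 0
 have "b x \<noteq> 0" using assms[unfolded zero_free_orbit_def, simplified, rule_format, of 0] by simp
 thus ?case by (simp add: det2_def Finite_Cartesian_Product.mat_def)
next
 case (Suc n)
 have nz: "b (x + real n * w) \<noteq> 0" "b (x + real (n + 1) * w) \<noteq> 0" using assms unfolding zero_free_orbit_def by blast+
 have "cmod (det2 (transfer_step a b n x w E)) = cmod (b (x + real n * w)) / cmod (b (x + real (n + 1) * w))"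
  unfolding det2_def transfer_step_entries using nz by (simp add: norm_divide norm_mult)
 thus ?case using nz by (simp add: det2_mult norm_mult Suc)
qed

lemma transfer_lower:
 assumes x: "x \<in> zero_free_orbit w"
 shows "0 < opnorm (transfer_matrix a b n x w E)"
  and "(ln (cmod (b x)) - ln (cmod (b (x + real n * w))) - ln 2) / 2 <= ln (opnorm (transfer_matrix a b n x w E))"
proof -
 let ?o = "opnorm (transfer_matrix a b n x w E)"
 have "b (x + real 0 * w) \<noteq> 0" "b (x + real n * w) \<noteq> 0" using x unfolding zero_free_orbit_def by blast+
 hence nz: "0 < cmod (b x)" "0 < cmod (b (x + real n * w))" by auto
 have le: "cmod (b x) / cmod (b (x + real n * w)) <= 2 * ?o\<^sup>2" using det2_le transfer_det[OF x, of n E] by metis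
 have "0 < cmod (b x) / cmod (b (x + real n * w))" using nz by simp
 with le have "0 < ?o\<^sup>2" by linarith
 thus pos: "0 < ?o" using opnorm_nonneg[of "transfer_matrix a b n x w E"] by (cases "?o = 0") auto
 have "ln (cmod (b x) / cmod (b (x + real n * w))) <= ln (2 * ?o\<^sup>2)" using le nz pos by (subst ln_le_cancel_iff) auto
 thus "(ln (cmod (b x)) - ln (cmod (b (x + real n * w))) - ln 2) / 2 <= ln ?o" using nz pos by (simp add: ln_div ln_mult ln_realpow)
qed

lemma transfer_upper:
 assumes x: "x \<in> zero_free_orbit w" and n: "1 <= n"
 shows "0 < Phi n w E" and "ln (opnorm (transfer_matrix a b n x w E)) <= ln (4 * Phi n w E) - (\<Sum>j<n. ln (cmod (b (x + real (j + 1) * w))))"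
proof -
 obtain m where m: "n = Suc m" using n by (cases n) auto
 let ?M = "transfer_matrix a b n x w E" and ?P = "\<Prod>j<n. b (x + real (j + 1) * w)"
 let ?g = "cont (\<lambda>k. of_real (a (x + of_int k * w)) - of_real E) (\<lambda>k. of_real ((cmod (b (x + of_int k * w)))\<^sup>2))"
 have nz: "b (x + real j * w) \<noteq> 0" for j using x unfolding zero_free_orbit_def by blast
 have Ppos: "0 < cmod ?P" using nz unfolding zero_less_norm_iff prod_zero_iff[OF finite_lessThan] by blast
 note te = transfer_entries[of m x w E, OF nz, folded m]
 have g0: "?g 0 k = f k (of_real x) w (of_real E)" for k unfolding f_real ..
 have g1: "?g 1 k = f k (of_real (x + w)) w (of_real E)" for k
 proof -
  have "?g (0 + 1) k = cont (\<lambda>j. of_real (a (x + of_int (j + 1) * w)) - of_real E) (\<lambda>j. of_real ((cmod (b (x + of_int (j + 1) * w)))\<^sup>2)) 0 k"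
   by (rule cont_shift)
  moreover have "x + of_int (j + 1) * w = x + w + of_int j * w" for j by (simp add: algebra_simps)
  ultimately show ?thesis unfolding f_real by (simp only: add_0)
 qed
 have beta0: "0 <= beta" using beta by simp
 have bx: "cmod (b x) <= beta" "cmod (b (x + real n * w)) <= beta" by (rule b_bound)+
 have nm: "n - 1 = m" "n - 2 = m - 1" using m by auto
 note fl = f_le_Phi[of n _ w E, unfolded nm]
 have e1: "cmod (entry ?M 1 1) * cmod ?P <= Phi n w E" unfolding norm_mult[symmetric] te(1) g0 by (rule fl(1))
 have e2: "cmod (entry ?M 1 2) * cmod ?P <= Phi n w E"
 proof -
  have "cmod (entry ?M 1 2) * cmod ?P = cmod (b x) * cmod (f m (of_real (x + w)) w (of_real E))"
   unfolding norm_mult[symmetric] te(2) g1 by (simp add: norm_mult)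
  also have "... <= beta * cmod (f m (of_real (x + w)) w (of_real E))" by (intro mult_right_mono bx) simp
  also have "... <= Phi n w E" by (rule fl(2))
  finally show ?thesis .
 qed
 have e3: "cmod (entry ?M 2 1) * cmod ?P <= Phi n w E"
 proof -
  have "cmod (entry ?M 2 1) * cmod ?P = cmod (b (x + real n * w)) * cmod (f m (of_real x) w (of_real E))" unfolding norm_mult[symmetric] te(3) g0 ..
  also have "... <= beta * cmod (f m (of_real x) w (of_real E))" by (intro mult_right_mono bx) simp
  also have "... <= Phi n w E" by (rule fl(2))
  finally show ?thesis .
 qed
 have e4: "cmod (entry ?M 2 2) * cmod ?P <= Phi n w E"
 proof (cases "m = 0")
  case True
  thus ?thesis unfolding norm_mult[symmetric] te(4) using Phi_nonneg by simp
 next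
  case False
  have "cmod (entry ?M 2 2) * cmod ?P = (cmod (b x) * cmod (b (x + real n * w))) * cmod (f (m - 1) (of_real (x + w)) w (of_real E))"
   unfolding norm_mult[symmetric] te(4) g1 using False by (simp add: norm_mult)
  also have "... <= beta\<^sup>2 * cmod (f (m - 1) (of_real (x + w)) w (of_real E))"
   unfolding power2_eq_square by (intro mult_right_mono mult_mono bx beta0) auto
  also have "... <= Phi n w E" by (rule fl(3))
  finally show ?thesis .
 qed
 have "opnorm ?M * cmod ?P <= (cmod (entry ?M 1 1) + cmod (entry ?M 1 2) + cmod (entry ?M 2 1) + cmod (entry ?M 2 2)) * cmod ?P"
  by (intro mult_right_mono opnorm_le) simp
 also have "... <= 4 * Phi n w E" using e1 e2 e3 e4 by (simp add: distrib_right)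
 finally have le: "opnorm ?M * cmod ?P <= 4 * Phi n w E" .
 have pos: "0 < opnorm ?M" by (rule transfer_lower[OF x])
 have opos: "0 < opnorm ?M * cmod ?P" using pos Ppos by simp
 thus Phi: "0 < Phi n w E" using le by linarith
 have "ln (opnorm ?M * cmod ?P) <= ln (4 * Phi n w E)" using le opos Phi by (subst ln_le_cancel_iff) auto
 moreover have "ln (opnorm ?M * cmod ?P) = ln (opnorm ?M) + (\<Sum>j<n. ln (cmod (b (x + real (j + 1) * w))))"
 proof -
  have "ln (cmod ?P) = (\<Sum>j<n. ln (cmod (b (x + real (j + 1) * w))))"
  proof -
   have h: "cmod (b (x + real (j + 1) * w)) \<noteq> 0" for j using nz[of "j + 1"] unfolding norm_eq_zero .
   show ?thesis unfolding prod_norm[symmetric] by (rule ln_prod[OF finite_lessThan]) (rule h)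
  qed
  thus ?thesis using pos Ppos by (simp add: ln_mult)
 qed
 ultimately show "ln (opnorm ?M) <= ln (4 * Phi n w E) - (\<Sum>j<n. ln (cmod (b (x + real (j + 1) * w))))" by linarith
qed

lemma Phi_pos: assumes "1 <= n" shows "0 < Phi n w E"
proof -
 have "\<exists>x. x \<in> zero_free_orbit w"
 proof (rule ccontr)
  assume "\<nexists>x. x \<in> zero_free_orbit w"
  hence "AE x::real in lborel. False" using AE_zero_free_orbit[of w] by simp
  then obtain N where N: "{x \<in> space lborel. \<not> False} \<subseteq> N" "emeasure lborel N = 0" "N \<in> sets (lborel :: real measure)" by (rule AE_E)
  hence "N = UNIV" by auto
  thus False using N(2) by simp
 qed
 thus ?thesis using transfer_upper(1)[OF _ assms] by blast
qed

lemma ln_b_shift: "unit_integrable (\<lambda>x. ln (cmod (b (x + t))))" "unit_integral (\<lambda>x. ln (cmod (b (x + t)))) = log_mean"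
 using periodic_unit_integral_shift[of "\<lambda>x. ln (cmod (b x))" t] ln_b_integrable by (simp_all add: b_periodic log_mean_def)

definition lnop :: "real => real => nat => real => real" where
 "lnop w E n x = ln (opnorm (transfer_matrix a b n x w E))"

lemma lnop_measurable: "lnop w E n \<in> borel_measurable borel" using transfer_opnorm_measurable unfolding lnop_def .

lemma unit_integral_mono_AE:
 assumes "unit_integrable F" "unit_integrable G" "AE x in lborel. F x <= G x"
 shows "unit_integral F <= unit_integral G" unfolding set_lebesgue_integral_def
 by (rule integral_mono_AE) (use assms in \<open>auto simp: set_integrable_def indicator_def elim: eventually_mono\<close>)

lemma sum_ln_b:
 "unit_integrable (\<lambda>x. c + (\<Sum>j\<in>J. ln (cmod (b (x + h j)))))" "unit_integral (\<lambda>x. c + (\<Sum>j\<in>J. ln (cmod (b (x + h j))))) = c + real (card J) * log_mean"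
 if "finite J" for J :: "nat set" and c :: real
proof -
 have s: "unit_integrable (\<lambda>x. \<Sum>j\<in>J. ln (cmod (b (x + h j))))" by (rule unit_integral_sum(1)[OF that]) (rule ln_b_shift)
 have "unit_integral (\<lambda>x. \<Sum>j\<in>J. ln (cmod (b (x + h j)))) = real (card J) * log_mean"
  using that by (subst unit_integral_sum(2)) (auto simp: ln_b_shift)
 thus "unit_integral (\<lambda>x. c + (\<Sum>j\<in>J. ln (cmod (b (x + h j))))) = c + real (card J) * log_mean"
  using set_integral_add(2)[OF unit_integral_const(1)[of c] s] unit_integral_const(2)[of c] by simp
 show "unit_integrable (\<lambda>x. c + (\<Sum>j\<in>J. ln (cmod (b (x + h j)))))" by (rule set_integral_add(1)[OF unit_integral_const(1)[of c] s])
qed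

lemma lnop_integrable:
 assumes n: "1 <= n" shows "unit_integrable (lnop w E n)"
proof (rule unit_integrable_bound[OF lnop_measurable])
 let ?K = "\<bar>ln (4 * Phi n w E)\<bar> + ln 2" and ?G = "\<lambda>x. \<Sum>j\<le>n. \<bar>ln (cmod (b (x + real j * w)))\<bar>"
 show "unit_integrable (\<lambda>x. ?K + ?G x)"
  by (intro set_integral_add(1) unit_integral_const unit_integral_sum(1)) (auto intro!: set_integrable_abs ln_b_shift)
 show "AE x in lborel. x \<in> {0..1} --> \<bar>lnop w E n x\<bar> <= ?K + ?G x" using AE_zero_free_orbit[of w]
 proof eventually_elim
  case (elim x)
  let ?t = "\<lambda>j. \<bar>ln (cmod (b (x + real j * w)))\<bar>"
  have m: "?t j <= ?G x" if "j <= n" for j using that by (intro member_le_sum) auto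
  have l2: "0 <= ln (2::real)" by simp
  have m0: "\<bar>ln (cmod (b x))\<bar> <= ?G x" using m[of 0] by simp
  have s: "(\<Sum>j<n. ?t (j + 1)) <= ?G x"
  proof -
   have "(\<Sum>j<n. ?t (j + 1)) = (\<Sum>j\<in>{1..n}. ?t j)" by (rule sum.reindex_bij_witness[of _ "\<lambda>j. j - 1" "\<lambda>j. j + 1"]) auto
   also have "... <= ?G x" by (rule sum_mono2) auto
   finally show ?thesis .
  qed
  have "- (\<Sum>j<n. ln (cmod (b (x + real (j + 1) * w)))) <= (\<Sum>j<n. ?t (j + 1))" unfolding sum_negf[symmetric] by (intro sum_mono) auto
  hence "lnop w E n x <= ?K + ?G x" using transfer_upper(2)[OF elim n, of E] s abs_ge_self[of "ln (4 * Phi n w E)"] l2 unfolding lnop_def by linarith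
  moreover have "- (?K + ?G x) <= lnop w E n x"
  proof -
   have "- ?G x <= ln (cmod (b x))" "ln (cmod (b (x + real n * w))) <= ?G x" using abs_le_D2[OF m0] abs_le_D1[OF m[OF order_refl]] by auto
   hence "(- ?G x - ?G x - ln 2) / 2 <= lnop w E n x" using transfer_lower(2)[OF elim, of n E] unfolding lnop_def by argo
   moreover have "- (?K + ?G x) <= (- ?G x - ?G x - ln 2) / 2" using l2 abs_ge_zero[of "ln (4 * Phi n w E)"] by argo
   ultimately show ?thesis by (rule order_trans[rotated])
  qed
  ultimately show ?case by (auto simp: abs_le_iff)
 qed
qed

text \<open>The integrals \<open>u\<close> are subadditive and bounded below, so the limit exists
  and can be taken along the multiples of \<open>n\<close>. There \<open>Phi_mult\<close> controls
  the numerators, and each denominator contributes \<open>log_mean\<close>.\<close>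

theorem lyapunov_le:
 assumes n: "2 <= n"
 shows "lyapunov a b w E <= (ln (Phi n w E) + ln 2) / real n - log_mean"
proof -
 define u where "u m = unit_integral (lnop w E m)" for m
 have up: "u m <= ln (4 * Phi m w E) - real m * log_mean" if m: "1 <= m" for m
 proof -
  have "u m <= unit_integral (\<lambda>x. ln (4 * Phi m w E) + - (\<Sum>j<m. ln (cmod (b (x + real (j + 1) * w)))))" unfolding u_def
  proof (rule unit_integral_mono_AE[OF lnop_integrable[OF m]])
   show "unit_integrable (\<lambda>x. ln (4 * Phi m w E) + - (\<Sum>j<m. ln (cmod (b (x + real (j + 1) * w)))))"
    by (intro set_integral_add(1) unit_integral_const unit_integrable_minus unit_integral_sum(1) ln_b_shift) auto
   show "AE x in lborel. lnop w E m x <= ln (4 * Phi m w E) + - (\<Sum>j<m. ln (cmod (b (x + real (j + 1) * w))))"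
    using AE_zero_free_orbit[of w] by eventually_elim (use transfer_upper(2)[OF _ m] in \<open>auto simp: lnop_def\<close>)
  qed
  also have "... = ln (4 * Phi m w E) + - unit_integral (\<lambda>x. 0 + (\<Sum>j<m. ln (cmod (b (x + real (j + 1) * w)))))"
  proof -
   have i: "unit_integrable (\<lambda>x. \<Sum>j<m. ln (cmod (b (x + real (j + 1) * w))))" by (intro unit_integral_sum(1) ln_b_shift) auto
   show ?thesis using set_integral_add(2)[OF unit_integral_const(1)[of "ln (4 * Phi m w E)"] unit_integrable_minus[OF i]]
     unit_integral_const(2)[of "ln (4 * Phi m w E)"] set_integral_uminus[OF i] by simp
  qed
  also have "... = ln (4 * Phi m w E) - real m * log_mean" by (subst sum_ln_b(2)) auto
  finally show ?thesis .
 qed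
 have low: "- (ln 2 / 2) <= u m" if m: "1 <= m" for m
 proof -
  let ?F = "\<lambda>x. (ln (cmod (b x)) - ln (cmod (b (x + real m * w))) - ln 2) / 2"
  have i: "unit_integrable (\<lambda>x. ln (cmod (b x)) - ln (cmod (b (x + real m * w))))" by (intro set_integral_diff(1) ln_b_integrable ln_b_shift)
  have iF: "unit_integrable ?F" by (intro set_integrable_divide set_integral_diff(1) ln_b_integrable ln_b_shift unit_integral_const)
  have "unit_integral ?F = (unit_integral (\<lambda>x. ln (cmod (b x)) - ln (cmod (b (x + real m * w)))) - ln 2) / 2"
   using set_integral_diff(2)[OF i unit_integral_const(1)[of "ln 2"]] unit_integral_const(2)[of "ln 2"] by simp
  also have "unit_integral (\<lambda>x. ln (cmod (b x)) - ln (cmod (b (x + real m * w)))) = 0"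
   using set_integral_diff(2)[OF ln_b_integrable ln_b_shift(1)[of "real m * w"]] ln_b_shift(2)[of "real m * w"] by (simp add: log_mean_def)
  finally have "unit_integral ?F = - (ln 2 / 2)" by simp
  moreover have "AE x in lborel. ?F x <= lnop w E m x" using AE_zero_free_orbit[of w] by eventually_elim (unfold lnop_def, rule transfer_lower(2))
  hence "unit_integral ?F <= u m" unfolding u_def by (rule unit_integral_mono_AE[OF iF lnop_integrable[OF m]])
  ultimately show ?thesis by simp
 qed
 have sub: "u (m + k) <= u m + u k" if mk: "1 <= m" "1 <= k" for m k
 proof -
  have sh: "unit_integrable (\<lambda>x. lnop w E k (x + real m * w))" "unit_integral (\<lambda>x. lnop w E k (x + real m * w)) = u k"
  proof -
   have p: "lnop w E k (x + 1) = lnop w E k x" for x by (simp add: lnop_def transfer_periodic)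
   show "unit_integrable (\<lambda>x. lnop w E k (x + real m * w))" "unit_integral (\<lambda>x. lnop w E k (x + real m * w)) = u k"
    unfolding u_def by (rule periodic_unit_integral_shift[OF p lnop_measurable lnop_integrable[OF mk(2)]])+
  qed
  have "u (m + k) <= unit_integral (\<lambda>x. lnop w E k (x + real m * w) + lnop w E m x)" unfolding u_def
  proof (rule unit_integral_mono_AE)
   show "unit_integrable (lnop w E (m + k))" using mk by (intro lnop_integrable) simp
   show "unit_integrable (\<lambda>x. lnop w E k (x + real m * w) + lnop w E m x)" using mk by (intro set_integral_add(1) sh lnop_integrable)
   show "AE x in lborel. lnop w E (m + k) x <= lnop w E k (x + real m * w) + lnop w E m x" using AE_zero_free_orbit[of w]
   proof eventually_elim
    case (elim x)
    have "x + real m * w \<in> zero_free_orbit w" unfolding zero_free_orbit_def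
    proof (intro CollectI allI)
     fix j :: nat
     have "b (x + real (m + j) * w) \<noteq> 0" using elim unfolding zero_free_orbit_def by blast
     thus "b (x + real m * w + real j * w) \<noteq> 0" by (simp add: algebra_simps)
    qed
    hence p: "0 < opnorm (transfer_matrix a b k (x + real m * w) w E)" "0 < opnorm (transfer_matrix a b m x w E)"
     "0 < opnorm (transfer_matrix a b (m + k) x w E)" using elim by (auto intro: transfer_lower(1))
    have "ln (opnorm (transfer_matrix a b (m + k) x w E)) <=
     ln (opnorm (transfer_matrix a b k (x + real m * w) w E) * opnorm (transfer_matrix a b m x w E))"
     using p opnorm_mult unfolding transfer_matrix_add by (subst ln_le_cancel_iff) auto
    also have "... = ln (opnorm (transfer_matrix a b k (x + real m * w) w E)) + ln (opnorm (transfer_matrix a b m x w E))"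
     using p by (simp add: ln_mult)
    finally show ?case unfolding lnop_def .
   qed
  qed
  also have "... = u k + u m" using set_integral_add(2)[OF sh(1) lnop_integrable[OF mk(1), of w E]] sh(2) unfolding u_def by simp
  finally show ?thesis by simp
 qed
 have "convergent (\<lambda>m. u m / real m)" by (rule fekete[OF sub low]) auto
 hence lim: "(\<lambda>m. u m / real m) \<longlonglongrightarrow> lyapunov a b w E"
  unfolding lyapunov_def convergent_LIMSEQ_iff u_def lnop_def opnorm_def by simp
 have "strict_mono (\<lambda>k. (k + 1) * n)" using n by (intro strict_monoI) simp
 from LIMSEQ_subseq_LIMSEQ[OF lim this]
 have lim': "(\<lambda>k. u ((k + 1) * n) / real ((k + 1) * n)) \<longlonglongrightarrow> lyapunov a b w E" by (simp add: comp_def)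
 define R where "R = (ln (Phi n w E) + ln 2) / real n - log_mean"
 have Pn: "0 < Phi n w E" using n by (intro Phi_pos) simp
 have bd: "u (k * n) / real (k * n) <= ln 4 * inverse (real k) + R" if k: "1 <= k" for k
 proof -
  have kn: "0 < real (k * n)" "1 <= k * n" using k n by auto
  have "Phi (k * n) w E <= 2 ^ (k - 1) * Phi n w E ^ k" by (rule Phi_mult[OF n k])
  also have "... <= 2 ^ k * Phi n w E ^ k" using Pn by (intro mult_right_mono power_increasing) auto
  finally have le: "Phi (k * n) w E <= (2 * Phi n w E) ^ k" by (simp only: power_mult_distrib)
  have "ln (Phi (k * n) w E) <= ln ((2 * Phi n w E) ^ k)" using le Pn Phi_pos[OF kn(2), of w E] by (subst ln_le_cancel_iff) auto
  also have "... = real k * (ln 2 + ln (Phi n w E))" using Pn by (simp add: ln_realpow ln_mult algebra_simps)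
  finally have l1: "ln (Phi (k * n) w E) <= real k * (ln 2 + ln (Phi n w E))" .
  have "u (k * n) <= ln 4 + ln (Phi (k * n) w E) - real (k * n) * log_mean" using up[OF kn(2)] Phi_pos[OF kn(2), of w E] by (simp add: ln_mult)
  also have "... <= ln 4 + real k * (ln 2 + ln (Phi n w E)) - real (k * n) * log_mean" using l1 by simp
  finally have "u (k * n) / real (k * n) <= (ln 4 + real k * (ln 2 + ln (Phi n w E)) - real (k * n) * log_mean) / real (k * n)"
   using kn by (intro divide_right_mono) auto
  also have "... = ln 4 / (real k * real n) + R" unfolding R_def using k n by (simp add: field_simps)
  also have "ln 4 / (real k * real n) <= ln 4 * inverse (real k)" using k n by (simp add: field_simps)
  finally show ?thesis by simp
 qed
 have "(\<lambda>k. ln 4 * inverse (real (Suc k)) + R) \<longlonglongrightarrow> ln 4 * 0 + R" by (intro tendsto_intros LIMSEQ_inverse_real_of_nat)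
 moreover have "u ((k + 1) * n) / real ((k + 1) * n) <= ln 4 * inverse (real (Suc k)) + R" for k using bd[of "k + 1"] unfolding Suc_eq_plus1 by simp
 ultimately have "lyapunov a b w E <= ln 4 * 0 + R" by (intro LIMSEQ_le[OF lim']) blast+
 thus ?thesis unfolding R_def by simp
qed

end

subsection \<open>Decay and localization of eigenvectors\<close>

text \<open>A crude additive bound, exponential in \<open>n\<close>. It is applied to energies at
  distance \<open>exp (- kappa * l)\<close> with \<open>kappa\<close> large enough to beat that
  exponential.\<close>

lemma cont_perturb:
 assumes C: "1 <= C" and alpha: "\<And>k. cmod (alpha k) <= C" "\<And>k. cmod (alpha' k) <= C" "\<And>k. cmod (alpha k - alpha' k) <= d" and c: "\<And>k. cmod (c k) <= C"
 shows "cmod (cont alpha c i n - cont alpha' c i n) <= d * (4 * C) ^ n"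
proof (induction n rule: induct_nat_012)
 case 0
 have "0 <= d" using alpha(3)[of 0] norm_ge_zero order_trans by blast
 thus ?case by simp
next
 case 1
 have d: "0 <= d" using alpha(3)[of 0] norm_ge_zero order_trans by blast
 have "d * 1 <= d * (4 * C)" using C d by (intro mult_left_mono) auto
 thus ?case using alpha(3)[of i] by simp
next
 case (ge2 n)
 have d: "0 <= d" using alpha(3)[of 0] norm_ge_zero order_trans by blast
 let ?k = "i + int n + 1"
 let ?D = "\<lambda>n. cont alpha c i n - cont alpha' c i n"
 have eq: "?D (Suc (Suc n)) = (alpha ?k - alpha' ?k) * cont alpha' c i (Suc n) + (alpha ?k * ?D (Suc n) + - c ?k * ?D n)"
  by (simp add: algebra_simps)
 have "cmod (?D (Suc (Suc n))) <= cmod ((alpha ?k - alpha' ?k) * cont alpha' c i (Suc n)) + (cmod (alpha ?k * ?D (Suc n)) + cmod (- c ?k * ?D n))"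
  unfolding eq by (rule order_trans[OF norm_triangle_ineq add_left_mono[OF norm_triangle_ineq]])
 also have "... <= d * (4 * C) ^ Suc (Suc n)"
 proof -
  have C0: "0 <= C" using C by simp
  define t where "t = (4 * C) ^ Suc n"
  have t0: "0 <= t" unfolding t_def using C by simp
  have p: "(2 * C) ^ Suc n <= t" "(4 * C) ^ n <= t" unfolding t_def using C by (intro power_mono power_increasing; simp)+
  have 1: "cmod ((alpha ?k - alpha' ?k) * cont alpha' c i (Suc n)) <= d * t"
   unfolding norm_mult by (rule mult_mono[OF alpha(3) order_trans[OF cont_upper[OF alpha(2) c C] p(1)] d norm_ge_zero])
  have 2: "cmod (alpha ?k * ?D (Suc n)) <= C * (d * t)" unfolding norm_mult t_def by (rule mult_mono[OF alpha(1) ge2(2) C0 norm_ge_zero])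
  have 3: "cmod (- c ?k * ?D n) <= C * (d * t)"
   unfolding norm_mult norm_minus_cancel by (rule mult_mono[OF c order_trans[OF ge2(1) mult_left_mono[OF p(2) d]] C0 norm_ge_zero])
  have "1 * (d * t) <= C * (d * t)" using C d t0 by (intro mult_right_mono) auto
  hence "cmod ((alpha ?k - alpha' ?k) * cont alpha' c i (Suc n)) + (cmod (alpha ?k * ?D (Suc n)) + cmod (- c ?k * ?D n)) <= 4 * (C * (d * t))"
   using 1 2 3 mult_nonneg_nonneg[OF C0 mult_nonneg_nonneg[OF d t0]] by linarith
  thus ?thesis unfolding t_def by (simp add: mult_ac)
 qed
 finally show ?case .
qed

lemma prod_list_perturb:
 fixes E E2 :: real
 assumes "\<And>l. l \<in> set ls ==> eps <= \<bar>l - E\<bar>" "0 < eps" "\<bar>E2 - E\<bar> <= d" "d <= eps"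
 shows "(1 - d / eps) ^ length ls * cmod (\<Prod>l\<leftarrow>ls. of_real l - of_real E) <= cmod (\<Prod>l\<leftarrow>ls. of_real l - of_real E2)"
 using assms(1)
proof (induction ls)
 case (Cons l ls)
 have l: "eps <= \<bar>l - E\<bar>" using Cons by simp
 have "d <= d / eps * \<bar>l - E\<bar>"
 proof -
  have "d / eps * eps <= d / eps * \<bar>l - E\<bar>" using l assms by (intro mult_left_mono) auto
  thus ?thesis using assms by simp
 qed
 hence le: "(1 - d / eps) * \<bar>l - E\<bar> <= \<bar>l - E2\<bar>"
 proof -
  assume "d <= d / eps * \<bar>l - E\<bar>"
  hence "(1 - d / eps) * \<bar>l - E\<bar> <= \<bar>l - E\<bar> - d" by (simp add: left_diff_distrib)
  also have "... <= \<bar>l - E2\<bar>" using assms(3) by linarith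
  finally show ?thesis .
 qed
 have "(1 - d / eps) ^ length (l # ls) * cmod (\<Prod>l\<leftarrow>l # ls. of_real l - of_real E) =
   ((1 - d / eps) * \<bar>l - E\<bar>) * ((1 - d / eps) ^ length ls * cmod (\<Prod>l\<leftarrow>ls. of_real l - of_real E))"
  by (simp add: norm_mult flip: of_real_diff)
 also have "... <= \<bar>l - E2\<bar> * cmod (\<Prod>l\<leftarrow>ls. of_real l - of_real E2)" using Cons le assms by (intro mult_mono) auto
 also have "... = cmod (\<Prod>l\<leftarrow>l # ls. of_real l - of_real E2)" by (simp add: norm_mult flip: of_real_diff)
 finally show ?case .
qed simp

section \<open>Decay of solutions across a non-resonant block\<close>

context jacobi_data_zeros
begin

text \<open>The site \<open>k\<close> must be about a third of the block away from each end, unless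
  the solution vanishes just outside that end: then the boundary term is absent, as happens at the
  ends of the whole operator. The solution may belong to an energy \<open>E2\<close> different from
  the energy \<open>E\<close> at which non-resonance is known.\<close>

definition decay_scale :: "real => real => nat => real => real => bool" where
 "decay_scale kappa gamma l w E \<longleftrightarrow> (\<forall>x. (\<forall>e\<in>spec l x w. exp (- (real l powr (1/6))) <= \<bar>e - E\<bar>) -->
   (\<forall>E2 psi k. \<bar>E2 - E\<bar> <= exp (- kappa * real l) \<and> (\<forall>j\<in>{0..<int l}. hop x w psi j = of_real E2 * psi j) \<and> k < l \<and>
    (l <= 3 * (k + 1) \<or> psi (- 1) = 0) \<and> (l <= 3 * (l - k) \<or> psi (int l) = 0) -->
    cmod (psi (int k)) <= exp (- gamma * real l / 5) * (cmod (psi (- 1)) + cmod (psi (int l)))))"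

text \<open>The \<open>j\<close> sites are split into blocks of length \<open>m\<close> and a
  remainder shorter than \<open>m\<close>, for which there is only the crude bound by
  \<open>(2 * C) ^ m\<close>.\<close>

lemma f_le_power:
 assumes C: "beta + \<bar>E\<bar> <= C" and m: "2 <= m" and P: "1 <= B" and j: "j <= m * B"
 shows "cmod (f j (of_real x) w (of_real E)) <= (2 * C) ^ m * (2 ^ B * Phi m w E ^ (j div m))"
proof -
 define q r where "q = j div m" and "r = j mod m"
 have qr: "j = q * m + r" "r < m" unfolding q_def r_def using m by auto
 have C1: "1 <= C" using C beta by linarith
 have qB: "q <= B" unfolding q_def using j m by (metis div_le_mono nonzero_mult_div_cancel_left not_numeral_le_zero)
 have rm: "(2 * C) ^ r <= (2 * C) ^ m" using C1 qr by (intro power_increasing) auto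
 show ?thesis
 proof (cases "q = 0")
  case True
  have "cmod (f j (of_real x) w (of_real E)) <= (2 * C) ^ r" using f_upper_real[OF C, of j] True qr by simp
  also have "... <= (2 * C) ^ m * 1" using rm by simp
  also have "... <= (2 * C) ^ m * (2 ^ B * Phi m w E ^ q)" using True C1 by (intro mult_left_mono) auto
  finally show ?thesis unfolding q_def .
 next
  case False
  obtain t where t: "q * m = Suc t" using False m by (metis mult_is_0 not_numeral_le_zero old.nat.exhaust)
  let ?F = "\<lambda>k. cmod (f k (of_real x) w (of_real E))"
  have "?F j <= (2 * C) ^ r * max (?F (q * m)) (?F (q * m - 1))"
  proof -
   have "cmod (cont (\<lambda>k. ac (of_real x + of_int k * of_real w) - of_real E) (\<lambda>k. bb (of_real x + of_int k * of_real w)) 0 (Suc t + r))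
    <= (2 * C) ^ r * max (cmod (cont (\<lambda>k. ac (of_real x + of_int k * of_real w) - of_real E) (\<lambda>k. bb (of_real x + of_int k * of_real w)) 0 (Suc t)))
      (cmod (cont (\<lambda>k. ac (of_real x + of_int k * of_real w) - of_real E) (\<lambda>k. bb (of_real x + of_int k * of_real w)) 0 t))"
    
   proof (rule cont_growth[OF _ _ C1])
    have im: "\<bar>Im (complex_of_real x)\<bar> < y1" and CE: "beta + cmod (of_real E) <= C" using y1 C by auto
    show "cmod (ac (of_real x + of_int k * of_real w) - of_real E) <= C" "cmod (bb (of_real x + of_int k * of_real w)) <= C" for k
     by (rule coeff_bounds[OF im CE])+
   qed
   thus ?thesis unfolding f_def[symmetric] qr(1) t by simp
  qed
  also have "... <= (2 * C) ^ m * Phi (q * m) w E"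
  proof (intro mult_mono rm)
   have "?F (q * m - 1) <= beta * ?F (q * m - 1)" using beta by (simp add: mult_le_cancel_right1)
   thus "max (?F (q * m)) (?F (q * m - 1)) <= Phi (q * m) w E" using f_le_Phi(1,2)[of "q * m" x w E] by simp
  qed (use C1 in \<open>auto simp: le_max_iff_disj\<close>)
  also have "... <= (2 * C) ^ m * (2 ^ B * Phi m w E ^ q)"
  proof (intro mult_left_mono)
   have "Phi (q * m) w E <= 2 ^ (q - 1) * Phi m w E ^ q" using False by (intro Phi_mult[OF m]) simp
   also have "... <= 2 ^ B * Phi m w E ^ q" using qB Phi_nonneg by (intro mult_right_mono power_increasing) auto
   finally show "Phi (q * m) w E <= 2 ^ B * Phi m w E ^ q" .
  qed (use C1 in auto)
  finally show ?thesis unfolding q_def .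
 qed
qed

lemma f_le_exp:
 assumes C: "beta + \<bar>E\<bar> <= C" and m: "2 <= m" and B: "1 <= B" and j: "j <= m * B"
  and \<mu>: "\<bar>ln (Phi m w E) / real m\<bar> <= C0" and \<sigma>: "ln (2 * C) + C0 <= \<sigma> * real B" "ln 2 <= \<sigma> * real m"
 shows "cmod (f j (of_real x) w (of_real E)) <= exp (real j * (ln (Phi m w E) / real m) + 2 * \<sigma> * real (m * B))"
proof -
 define q where "q = j div m"
 have C1: "1 <= C" using C beta by linarith
 have Pp: "0 < Phi m w E" using m by (intro Phi_pos) simp
 define \<mu>m where "\<mu>m = ln (Phi m w E) / real m"
 have l: "ln (Phi m w E) = real m * \<mu>m" unfolding \<mu>m_def using m by simp
 have "cmod (f j (of_real x) w (of_real E)) <= (2 * C) ^ m * (2 ^ B * Phi m w E ^ q)" unfolding q_def by (rule f_le_power[OF C m B j])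
 also have "... = exp (real m * ln (2 * C) + (real B * ln 2 + real q * (real m * \<mu>m)))"
 proof -
  have "(2 * C) ^ m = exp (real m * ln (2 * C))" using C1 by (simp add: exp_of_nat_mult)
  moreover have "(2::real) ^ B = exp (real B * ln 2)" by (simp add: exp_of_nat_mult)
  moreover have "Phi m w E ^ q = exp (real q * (real m * \<mu>m))" using Pp by (simp add: exp_of_nat_mult flip: l)
  ultimately show ?thesis by (simp only: mult_exp_exp)
 qed
 also have "... <= exp (real j * \<mu>m + 2 * \<sigma> * real (m * B))"
 proof -
  have jq: "real j - real q * real m \<ge> 0" "real j - real q * real m <= real m"
  proof -
   have "j = q * m + j mod m" unfolding q_def by simp
   hence e: "real j = real q * real m + real (j mod m)" by (metis of_nat_add of_nat_mult)
   have "j mod m < m" using m by simp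
   thus "real j - real q * real m \<ge> 0" "real j - real q * real m <= real m" using e by auto
  qed
  have "- ((real j - real q * real m) * \<mu>m) <= (real j - real q * real m) * C0"
   using mult_left_mono[OF abs_le_D2[OF \<mu>[folded \<mu>m_def]] jq(1)] by simp
  also have "... <= real m * C0" using jq \<mu> abs_ge_zero order_trans by (intro mult_right_mono) blast+
  finally have 1: "real q * (real m * \<mu>m) <= real j * \<mu>m + real m * C0" by (simp add: algebra_simps)
  have 2: "real m * (ln (2 * C) + C0) <= real m * (\<sigma> * real B)" using \<sigma>(1) by (intro mult_left_mono) auto
  have 3: "real B * ln 2 <= real B * (\<sigma> * real m)" using \<sigma>(2) by (intro mult_left_mono) auto
  have "real m * ln (2 * C) + (real B * ln 2 + real q * (real m * \<mu>m)) <= real j * \<mu>m + real m * (ln (2 * C) + C0) + real B * ln 2"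
   using 1 by (simp add: algebra_simps)
  also have "... <= real j * \<mu>m + 2 * \<sigma> * real (m * B)" using 2 3 by (simp add: algebra_simps)
  finally show ?thesis by simp
 qed
 finally show ?thesis unfolding \<mu>m_def .
qed

end

context jacobi_data_zeros
begin

text \<open>In Poisson's formula the denominator is a determinant of length \<open>l\<close>, while
  the numerators have arbitrary smaller lengths, which are controlled through the rate
  \<open>\<mu> m\<close> of a smaller scale \<open>m\<close>. So \<open>\<mu> l\<close> must not be
  much below \<open>\<mu> m\<close>; since \<open>\<mu>\<close> stays in a bounded range, it drops
  by \<open>gamma / 20\<close> only boundedly often. The third of the block beyond the site gains
  about \<open>gamma * l / 3\<close> by \<open>lyapunov_le\<close>. Against
  \<open>gamma * l / 20\<close> and small multiples of \<open>\<sigma> * l\<close> this leaves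
  \<open>gamma * l / 5\<close>.\<close>

theorem decay:
 fixes c alpha gamma E0 :: real
 assumes c: "0 < c" and alpha: "0 < alpha" and gamma: "0 < gamma" and E0: "0 <= E0"
 shows "\<exists>B::nat. 1 <= B \<and> (\<exists>I kappa n0. 1 <= kappa \<and> (\<forall>n\<ge>n0. \<forall>w\<in>diophantine c alpha. \<forall>E. \<bar>E\<bar> <= E0 --> gamma < lyapunov a b w E -->
  (\<exists>i<I. decay_scale kappa gamma (n * B ^ (i + 1)) w E)))"
proof -
 define C D \<sigma> where "C = beta + E0 + 1" and "D = log_mean" and "\<sigma> = gamma / 100"
 \<comment> \<open>\<open>C0\<close> bounds the rates \<open>\<mu>\<close>; \<open>B\<close> makes
   the remainder after division by \<open>m\<close> negligible in a block of length
   \<open>m * B\<close>; \<open>I\<close> exceeds the number of drops by \<open>gamma / 20\<close>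
   in a range of width \<open>2 * C0\<close>; \<open>kappa\<close> absorbs the factor
   \<open>(4 * C) ^ l\<close> from \<open>cont_perturb\<close>.\<close>
 define C0 where "C0 = 2 * ln beta + ln (2 * C) + \<bar>D\<bar> + gamma + 1"
 define B where "B = nat \<lceil>(ln (2 * C) + C0) / \<sigma>\<rceil> + 1"
 define I where "I = nat \<lceil>40 * C0 / gamma\<rceil> + 1"
 define kappa where "kappa = ln (4 * C) + C0 + 1"
 have C2: "2 <= C" unfolding C_def using beta E0 by linarith
 have \<sigma>: "0 < \<sigma>" unfolding \<sigma>_def using gamma by simp
 have lnbeta: "0 <= ln beta" using beta by simp
 have ln2C: "1 <= ln (2 * C)"
 proof -
  have "exp 1 <= 2 * C" using exp_le C2 by linarith
  thus ?thesis using C2 by (subst ln_ge_iff) auto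
 qed
 have C0: "2 <= C0" "ln (2 * C) <= C0" unfolding C0_def using ln2C lnbeta gamma by auto
 have ln4C: "1 <= ln (4 * C)"
 proof -
  have "ln (2 * C) <= ln (4 * C)" using C2 by (subst ln_le_cancel_iff) auto
  thus ?thesis using ln2C by linarith
 qed
 have kappa: "4 <= kappa" unfolding kappa_def using ln4C C0 by linarith
 have B1: "1 <= B" unfolding B_def by simp
 have Bs: "ln (2 * C) + C0 <= \<sigma> * real B"
 proof -
  have "(ln (2 * C) + C0) / \<sigma> <= real B" unfolding B_def by linarith
  thus ?thesis using \<sigma> by (simp add: pos_divide_le_eq mult.commute)
 qed
 have Is: "2 * C0 < real I * (gamma / 20)"
 proof -
  have "40 * C0 / gamma < real I" unfolding I_def by linarith
  thus ?thesis using gamma by (simp add: pos_divide_less_eq)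
 qed
 \<comment> \<open>The exponent is so low that the second alternative of the maximum will contradict
   \<open>- C0 <= \<mu> l\<close>.\<close>
 obtain n1 where n1: "\<And>n w E x x' i. n1 <= n ==> w \<in> diophantine c alpha ==> \<bar>E\<bar> <= E0 ==> (\<forall>l\<in>spec n x w. exp (- (real n powr (1/6))) <= \<bar>l - E\<bar>) ==> i <= 2 ==>
   cmod (f (n - i) (of_real x') w (of_real E)) <= max (cmod (f n (of_real x) w (of_real E))) (exp (- (C0 + 2 * \<sigma> + 1) * real n)) * exp (\<sigma> * real n)"
 proof -
  have "0 <= C0 + 2 * \<sigma> + 1" using C0 \<sigma> by simp
  from determinant_lower_bound[OF c alpha \<sigma> E0 this] show ?thesis using that by blast
 qed
 obtain n2 where n2: "\<And>n w x. n2 <= n ==> w \<in> diophantine c alpha ==> (\<Prod>j<n. cmod (b (x + real j * w))) <= exp (real n * (D + \<sigma>))"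
  using prod_b_upper[OF c alpha \<sigma>] unfolding D_def by blast
 \<comment> \<open>Products of \<open>b\<close> are taken over at least a third of a block; this is
   the reason for \<open>3 * n2\<close>.\<close>
 define n0 where "n0 = n1 + 3 * n2 + 2 + nat \<lceil>ln 4 / \<sigma>\<rceil> + nat \<lceil>2 * ln beta / \<sigma>\<rceil>"
 have "\<exists>i<I. decay_scale kappa gamma (n * B ^ (i + 1)) w E"
  if n: "n0 <= n" and w: "w \<in> diophantine c alpha" and E: "\<bar>E\<bar> <= E0" and ly: "gamma < lyapunov a b w E" for n w E
 proof -
  define \<mu> where "\<mu> m = ln (Phi m w E) / real m" for m
  have CE: "beta + \<bar>E\<bar> <= C" unfolding C_def using E by linarith
  have big: "2 <= m" "ln 4 <= \<sigma> * real m" "ln 2 <= \<sigma> * real m" "2 * ln beta <= \<sigma> * real m" if "n0 <= m" for m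
  proof -
   show "2 <= m" using that unfolding n0_def by simp
   have "ln 4 / \<sigma> <= real m" "2 * ln beta / \<sigma> <= real m" using that unfolding n0_def by linarith+
   thus "ln 4 <= \<sigma> * real m" "2 * ln beta <= \<sigma> * real m" using \<sigma> by (simp_all add: pos_divide_le_eq mult.commute)
   moreover have "ln 2 <= ln (4::real)" by simp
   ultimately show "ln 2 <= \<sigma> * real m" by linarith
  qed
  have \<mu>_low: "D + gamma - ln 2 / real m <= \<mu> m" if "n0 <= m" for m
   using lyapunov_le[OF big(1)[OF that], of w E] ly unfolding \<mu>_def D_def by (simp add: add_divide_distrib)
  have \<mu>_low': "D + gamma - \<sigma> <= \<mu> m" if "n0 <= m" for m
  proof -
   have "ln 2 / real m <= \<sigma>" using big(1,3)[OF that] by (simp add: pos_divide_le_eq)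
   thus ?thesis using \<mu>_low[OF that] by linarith
  qed
  have \<mu>_abs: "\<bar>\<mu> m\<bar> <= C0" if m: "n0 <= m" for m
  proof -
   have m2: "2 <= m" by (rule big(1)[OF m])
   have Pp: "0 < Phi m w E" using m2 by (intro Phi_pos) simp
   have "ln (Phi m w E) <= ln (beta\<^sup>2 * (2 * C) ^ m)" using Phi_upper[OF CE] Pp C2 beta by (subst ln_le_cancel_iff) auto
   also have "... = 2 * ln beta + real m * ln (2 * C)" using beta C2 by (simp add: ln_mult ln_realpow algebra_simps)
   also have "... <= real m * (2 * ln beta) + real m * ln (2 * C)" using lnbeta m2 by (intro add_right_mono) (simp add: mult_le_cancel_right1)
   finally have "\<mu> m <= 2 * ln beta + ln (2 * C)" unfolding \<mu>_def using m2 by (simp add: pos_divide_le_eq algebra_simps)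
   moreover have "- (\<bar>D\<bar> + 1) <= \<mu> m" using \<mu>_low'[OF m] gamma unfolding \<sigma>_def by linarith
   ultimately show ?thesis unfolding C0_def using ln2C lnbeta gamma by linarith
  qed
  have nBi: "n0 <= n * B ^ i" for i
  proof -
   have "n * 1 <= n * B ^ i" using B1 by (intro mult_left_mono) auto
   thus ?thesis using n by (metis mult_1_right order_trans)
  qed
  have "\<exists>i<I. \<mu> (n * B ^ i) - gamma / 20 <= \<mu> (n * B ^ Suc i)"
  proof (rule ccontr)
   assume neg: "\<not> ?thesis"
   have "\<mu> (n * B ^ i) <= \<mu> n - real i * (gamma / 20)" if "i <= I" for i using that
   proof (induction i)
    case (Suc i)
    hence "\<mu> (n * B ^ Suc i) < \<mu> (n * B ^ i) - gamma / 20" using neg by (meson Suc_le_eq not_le)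
    moreover have "real (Suc i) * (gamma / 20) = real i * (gamma / 20) + gamma / 20" by (simp add: distrib_right)
    ultimately show ?case using Suc by linarith
   qed simp
   from this[of I] have "\<mu> (n * B ^ I) <= \<mu> n - real I * (gamma / 20)" by simp
   thus False using \<mu>_abs[OF n] \<mu>_abs[OF nBi[of I]] Is by linarith
  qed
  then obtain i where i: "i < I" "\<mu> (n * B ^ i) - gamma / 20 <= \<mu> (n * B ^ Suc i)" by blast
  define m l where "m = n * B ^ i" and "l = m * B"
  have l: "l = n * B ^ (i + 1)" by (simp add: l_def m_def)
  have m0: "n0 <= m" "n0 <= l" unfolding m_def l using nBi[of i] nBi[of "i + 1"] by simp_all
  have drop: "\<mu> m - gamma / 20 <= \<mu> l" using i(2) unfolding l by (simp add: m_def)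
  define T where "T j = real j * \<mu> m + 2 * \<sigma> * real l" for j
  have fup: "cmod (f j (of_real x) w (of_real E)) <= exp (T j)" if "j <= l" for j x unfolding T_def l_def \<mu>_def
   by (rule f_le_exp[OF CE big(1)[OF m0(1)] B1 that[unfolded l_def] \<mu>_abs[OF m0(1), unfolded \<mu>_def] Bs big(3)[OF m0(1)]])
  have Pl: "Phi l w E = exp (real l * \<mu> l)" unfolding \<mu>_def using Phi_pos[of l w E] big(1)[OF m0(2)] by simp
  have "decay_scale kappa gamma l w E" unfolding decay_scale_def
  proof (intro allI impI, elim conjE)
   fix x E2 psi k
   assume nonres: "\<forall>e\<in>spec l x w. exp (- (real l powr (1/6))) <= \<bar>e - E\<bar>" and E2: "\<bar>E2 - E\<bar> <= exp (- kappa * real l)"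
    and ev: "\<forall>j\<in>{0..<int l}. hop x w psi j = of_real E2 * psi j" and k: "k < l"
    and left: "l <= 3 * (k + 1) \<or> psi (- 1) = 0" and right: "l <= 3 * (l - k) \<or> psi (int l) = 0"
   let ?F = "\<lambda>j x. cmod (f j (of_real x) w (of_real E))" and ?F2 = "\<lambda>j x. cmod (f j (of_real x) w (of_real E2))"
   have l1: "1 <= real l" using big(1)[OF m0(2)] by linarith
   have lowE: "exp (real l * \<mu> l - 2 * \<sigma> * real l) <= ?F l x"
   proof -
    define Q where "Q = max (?F l x) (exp (- (C0 + 2 * \<sigma> + 1) * real l)) * exp (\<sigma> * real l)"
    have Q: "?F (l - j) x' <= Q" if "j <= 2" for x' j
     unfolding Q_def by (rule n1[OF _ w E nonres that]) (use m0(2) in \<open>simp add: n0_def\<close>)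
    have Q0: "0 <= Q" unfolding Q_def by (intro mult_nonneg_nonneg) (auto simp: le_max_iff_disj)
    have b2: "1 <= beta\<^sup>2" "beta <= beta\<^sup>2" using beta by (auto simp: power2_eq_square mult_le_cancel_left1 intro: order_trans)
    have "Phi l w E <= beta\<^sup>2 * Q"
    proof (rule Phi_leI)
     show "?F l x' <= beta\<^sup>2 * Q" for x' using mult_mono[OF b2(1) Q[of 0 x']] by simp
     show "beta * ?F (l - 1) x' <= beta\<^sup>2 * Q" for x' using b2 beta by (intro mult_mono Q) auto
     show "beta\<^sup>2 * ?F (l - 2) x' <= beta\<^sup>2 * Q" for x' by (intro mult_left_mono Q) auto
    qed
    also have "beta\<^sup>2 <= exp (\<sigma> * real l)"
    proof -
     have "beta\<^sup>2 = exp (2 * ln beta)" using beta by (simp add: exp_double)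
     thus ?thesis using big(4)[OF m0(2)] by simp
    qed
    hence "beta\<^sup>2 * Q <= exp (\<sigma> * real l) * Q" using Q0 by (rule mult_right_mono)
    finally have main: "exp (real l * \<mu> l) <= exp (\<sigma> * real l) * Q" unfolding Pl .
    have "exp (- (C0 + 2 * \<sigma> + 1) * real l) < ?F l x"
    proof (rule ccontr)
     assume "\<not> ?thesis"
     hence "Q = exp (- (C0 + 2 * \<sigma> + 1) * real l) * exp (\<sigma> * real l)" unfolding Q_def by (simp add: max_def)
     hence "exp (real l * \<mu> l) <= exp (\<sigma> * real l + (- (C0 + 2 * \<sigma> + 1) * real l + \<sigma> * real l))" using main by (simp only: mult_exp_exp)
     hence "real l * \<mu> l <= - (C0 + 1) * real l" by (simp add: algebra_simps)
     moreover have "real l * (- C0) <= real l * \<mu> l" using \<mu>_abs[OF m0(2)] by (intro mult_left_mono) auto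
     ultimately show False using l1 by (simp add: algebra_simps)
    qed
    hence "exp (\<sigma> * real l) * Q = exp (2 * \<sigma> * real l) * ?F l x" unfolding Q_def by (simp add: max_def mult_exp_exp flip: mult.assoc)
    hence "exp (real l * \<mu> l) <= exp (2 * \<sigma> * real l) * ?F l x" using main by simp
    thus ?thesis by (simp add: exp_diff pos_divide_le_eq mult.commute)
   qed
   have low2: "exp (real l * \<mu> l - 2 * \<sigma> * real l) / 2 <= ?F2 l x"
   proof -
    define eps where "eps = exp (- (real l powr (1/6)))"
    define d where "d = exp (- kappa * real l)"
    have "real l powr (1/6) <= real l powr 1" using l1 by (intro powr_mono) auto
    hence eps: "exp (- real l) <= eps" "0 < eps" unfolding eps_def using l1 by auto
    have d1: "d <= exp (- real l) * exp (- real l)" unfolding d_def mult_exp_exp using mult_right_mono[OF kappa, of "real l"] by simp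
    have "d / eps <= exp (- real l)"
    proof -
     have "d <= exp (- real l) * eps" using d1 eps by (meson mult_left_mono exp_ge_zero order_trans)
     thus ?thesis using eps by (simp add: pos_divide_le_eq)
    qed
    moreover have half: "2 * real l * exp (- real l) <= 1"
    proof -
     have "1 + real l + (real l)\<^sup>2 / 2 <= exp (real l)" using exp_lower_Taylor_quadratic[of "real l"] l1 by simp
     moreover have "2 * real l <= 1 + real l + (real l)\<^sup>2 / 2" using zero_le_power2[of "real l - 1"] by (simp add: power2_eq_square algebra_simps)
     ultimately have "2 * real l <= exp (real l)" by linarith
     thus ?thesis by (simp add: exp_minus field_simps)
    qed
    ultimately have dl: "real l * (d / eps) <= 1 / 2" using mult_left_mono[of "d / eps" "exp (- real l)" "real l"] l1 by argo
    have de: "d / eps <= 1"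
    proof -
     have "0 <= d / eps" using eps unfolding d_def by simp
     hence "1 * (d / eps) <= real l * (d / eps)" using l1 by (intro mult_right_mono) auto
     thus ?thesis using dl by linarith
    qed
    have "1 - real l * (d / eps) <= (1 - d / eps) ^ l" using Bernoulli_inequality[of "- (d / eps)" l] de by (simp add: algebra_simps)
    hence "1 / 2 <= (1 - d / eps) ^ l" using dl by linarith
    hence "1 / 2 * ?F l x <= (1 - d / eps) ^ l * ?F l x" by (rule mult_right_mono) simp
    also have "... <= ?F2 l x" unfolding f_real_prod
    proof -
     have "d <= eps" using de eps by (simp add: pos_divide_le_eq)
     thus "(1 - d / eps) ^ l * cmod (\<Prod>l\<leftarrow>jacobi_eigenvalues a b l x w. of_real l - of_real E) <= cmod (\<Prod>l\<leftarrow>jacobi_eigenvalues a b l x w. of_real l - of_real E2)"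
      using prod_list_perturb[of "jacobi_eigenvalues a b l x w" eps E E2 d] nonres eps E2
      unfolding spec_def eps_def[symmetric] d_def[symmetric] length_jacobi_eigenvalues by blast
    qed
    finally show ?thesis using lowE by linarith
   qed
   have up2: "?F2 j x' <= 2 * exp (T j)" if j: "j <= l" for j x'
   proof -
    have C1: "1 <= C" using C2 by simp
    have E2b: "\<bar>E2\<bar> <= E0 + 1"
    proof -
     have "exp (- kappa * real l) <= 1" using kappa l1 by simp
     thus ?thesis using E2 E by linarith
    qed
    have im: "\<bar>Im (complex_of_real x')\<bar> < y1" using y1 by simp
    have CE2: "beta + cmod (of_real E2) <= C" "beta + cmod (of_real E) <= C" using E2b CE unfolding C_def by auto
    have "cmod (f j (of_real x') w (of_real E2) - f j (of_real x') w (of_real E)) <= \<bar>E2 - E\<bar> * (4 * C) ^ j" unfolding f_def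
    proof (rule cont_perturb[OF C1 coeff_bounds(1)[OF im CE2(1)] coeff_bounds(1)[OF im CE2(2)] _ coeff_bounds(2)[OF im CE2(1)]])
     have "cmod (complex_of_real E - of_real E2) = \<bar>E2 - E\<bar>" by (metis abs_minus_commute norm_of_real of_real_diff)
     thus "cmod (ac (of_real x' + of_int k * of_real w) - of_real E2 - (ac (of_real x' + of_int k * of_real w) - of_real E)) <= \<bar>E2 - E\<bar>" for k
      by (simp add: algebra_simps)
    qed
    also have "... <= exp (- kappa * real l) * (4 * C) ^ l" using E2 j C1 by (intro mult_mono power_increasing) auto
    also have "(4 * C) ^ l = exp (real l * ln (4 * C))" using C1 by (simp add: exp_of_nat_mult)
    also have "exp (- kappa * real l) * exp (real l * ln (4 * C)) = exp (- (C0 + 1) * real l)" unfolding kappa_def mult_exp_exp by (simp add: algebra_simps)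
    also have "... <= exp (T j)"
    proof -
     have "real j * (- C0) <= real j * \<mu> m" using \<mu>_abs[OF m0(1)] by (intro mult_left_mono) auto
     moreover have "real j * C0 <= real l * C0" using j C0 by (intro mult_right_mono) auto
     moreover have "0 <= 2 * \<sigma> * real l" using \<sigma> by simp
     ultimately show ?thesis unfolding T_def using l1 by (simp add: algebra_simps)
    qed
    finally have "cmod (f j (of_real x') w (of_real E2) - f j (of_real x') w (of_real E)) <= exp (T j)" .
    thus ?thesis using fup[OF j, of x'] norm_triangle_sub[of "f j (of_real x') w (of_real E2)" "f j (of_real x') w (of_real E)"] by linarith
   qed
   have prod_up: "(\<Prod>j<r. cmod (b (x' + real j * w))) <= exp (real r * (D + \<sigma>))" if "l <= 3 * r" for r x'
    by (rule n2[OF _ w]) (use that m0(2) in \<open>simp add: n0_def\<close>)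
   have coef: "2 * exp (T (l - r)) * exp (real r * (D + \<sigma>)) <= exp (- gamma * real l / 5) * (exp (real l * \<mu> l - 2 * \<sigma> * real l) / 2)"
    if r: "l <= 3 * r" "r <= l" for r
   proof -
    have 1: "real r * (D + \<sigma> - \<mu> m) <= (real l / 3) * (- gamma + 2 * \<sigma>)"
    proof -
     have "D + \<sigma> - \<mu> m <= - gamma + 2 * \<sigma>" using \<mu>_low'[OF m0(1)] by linarith
     hence "real r * (D + \<sigma> - \<mu> m) <= real r * (- gamma + 2 * \<sigma>)" by (intro mult_left_mono) auto
     also have "... <= (real l / 3) * (- gamma + 2 * \<sigma>)" using r(1) gamma unfolding \<sigma>_def by (intro mult_right_mono_neg) auto
     finally show ?thesis .
    qed
    have 2: "real l * (\<mu> m - gamma / 20) <= real l * \<mu> l" using drop by (intro mult_left_mono) auto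
    have rl: "real (l - r) = real l - real r" using r by simp
    have "T (l - r) + real r * (D + \<sigma>) = real r * (D + \<sigma> - \<mu> m) + (real l * \<mu> m + 2 * \<sigma> * real l)"
     unfolding T_def rl by (simp add: algebra_simps)
    also have "... <= (real l / 3) * (- gamma + 2 * \<sigma>) + (real l * \<mu> l + real l * (gamma / 20) + 2 * \<sigma> * real l)"
     using 1 2 by (simp add: algebra_simps)
    also have "... <= - gamma * real l / 5 + (real l * \<mu> l - 2 * \<sigma> * real l) - \<sigma> * real l"
    proof -
     have "0 <= gamma * real l" using gamma by simp
     thus ?thesis unfolding \<sigma>_def by (simp add: algebra_simps)
    qed
    also have "... <= - gamma * real l / 5 + (real l * \<mu> l - 2 * \<sigma> * real l) - ln 4" using big(2)[OF m0(2)] by linarith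
    finally have le: "exp (T (l - r) + real r * (D + \<sigma>)) <= exp (- gamma * real l / 5 + (real l * \<mu> l - 2 * \<sigma> * real l) - ln 4)" by simp
    have "exp (- gamma * real l / 5 + (real l * \<mu> l - 2 * \<sigma> * real l) - ln 4) = exp (- gamma * real l / 5) * exp (real l * \<mu> l - 2 * \<sigma> * real l) / 4"
     unfolding exp_diff[of _ "ln 4"] exp_add[of "- gamma * real l / 5"] by simp
    thus ?thesis using le unfolding exp_add[of "T (l - r)"] by simp
   qed
   \<comment> \<open>From here \<open>n\<close> counts the sites of the block to the right of
     \<open>k\<close>.\<close>
   define n where "n = l - 1 - k"
   have kn: "l = k + 1 + n" "n <= l" "k <= l" "l - (k + 1) = n" "l - (n + 1) = k" "l - k = n + 1" unfolding n_def using k by auto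
   let ?A = "\<lambda>k. a (x + of_int k * w)" and ?B = "\<lambda>k. b (x + of_int k * w)"
   let ?f = "cont (\<lambda>k. of_real (?A k) - of_real E2) (\<lambda>k. of_real ((cmod (?B k))\<^sup>2))"
   have ff: "?f (int i) j = f j (of_real (x + real i * w)) w (of_real E2)" for i j
   proof -
    have "?f (0 + int i) j = cont (\<lambda>k. of_real (?A (k + int i)) - of_real E2) (\<lambda>k. of_real ((cmod (?B (k + int i)))\<^sup>2)) 0 j" by (rule cont_shift)
    moreover have "x + of_int (k + int i) * w = x + real i * w + of_int k * w" for k by (simp add: algebra_simps)
    ultimately show ?thesis unfolding f_real by (simp only: add_0)
   qed
   have pois: "?f 0 (k + 1 + n) * psi (0 + int k) =
    ?f (0 + int k + 1) n * (\<Prod>j\<le>k. cnj (?B (0 + int j))) * psi (0 - 1) + ?f 0 k * (\<Prod>j\<le>n. ?B (0 + int k + int j + 1)) * psi (0 + int (k + 1 + n))"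
    by (rule poisson_identity) (use ev kn(1) in \<open>auto simp: jacobi_op_def\<close>)
   have f1: "?f (0 + int k + 1) n = f n (of_real (x + real (k + 1) * w)) w (of_real E2)" using ff[of "k + 1" n] by (simp add: add.commute)
   have p1: "cmod (\<Prod>j\<le>k. cnj (?B (0 + int j))) = (\<Prod>j<k + 1. cmod (b (x + real j * w)))"
    unfolding prod_norm[symmetric] by (simp add: lessThan_Suc_atMost)
   have p2: "cmod (\<Prod>j\<le>n. ?B (0 + int k + int j + 1)) = (\<Prod>j<n + 1. cmod (b ((x + real (k + 1) * w) + real j * w)))"
    unfolding prod_norm[symmetric] by (rule prod.cong) (auto simp: algebra_simps)
   define X where "X = exp (- gamma * real l / 5) * (exp (real l * \<mu> l - 2 * \<sigma> * real l) / 2)"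
   have cl: "?F2 n (x + real (k + 1) * w) * (\<Prod>j<k + 1. cmod (b (x + real j * w))) * cmod (psi (- 1)) <= X * cmod (psi (- 1))"
   proof (cases "psi (- 1) = 0")
    case False
    hence r: "l <= 3 * (k + 1)" using left by blast
    have "?F2 n (x + real (k + 1) * w) * (\<Prod>j<k + 1. cmod (b (x + real j * w))) <= 2 * exp (T n) * exp (real (k + 1) * (D + \<sigma>))"
     by (intro mult_mono up2 prod_up r kn prod_nonneg) auto
    also have "... <= X" unfolding X_def using coef[OF r] k kn by simp
    finally show ?thesis by (intro mult_right_mono) auto
   qed simp
   have cr: "?F2 k x * (\<Prod>j<n + 1. cmod (b ((x + real (k + 1) * w) + real j * w))) * cmod (psi (int l)) <= X * cmod (psi (int l))"
   proof (cases "psi (int l) = 0")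
    case False
    hence r: "l <= 3 * (n + 1)" using right kn by simp
    have "?F2 k x * (\<Prod>j<n + 1. cmod (b ((x + real (k + 1) * w) + real j * w))) <= 2 * exp (T k) * exp (real (n + 1) * (D + \<sigma>))"
     by (intro mult_mono up2 prod_up r kn prod_nonneg) auto
    also have "... <= X" unfolding X_def using coef[OF r] kn by simp
    finally show ?thesis by (intro mult_right_mono) auto
   qed simp
   have "?F2 l x * cmod (psi (int k)) = cmod (?f 0 (k + 1 + n) * psi (0 + int k))" using ff[of 0 "k + 1 + n"] kn(1) by (simp add: norm_mult)
   also have "... <= ?F2 n (x + real (k + 1) * w) * (\<Prod>j<k + 1. cmod (b (x + real j * w))) * cmod (psi (- 1)) +
    ?F2 k x * (\<Prod>j<n + 1. cmod (b ((x + real (k + 1) * w) + real j * w))) * cmod (psi (int l))"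
    unfolding pois p1[symmetric] p2[symmetric] f1 using ff[of 0 k] kn(1) by (intro order_trans[OF norm_triangle_ineq]) (simp add: norm_mult)
   also have "... <= X * (cmod (psi (- 1)) + cmod (psi (int l)))" using cl cr by (simp add: distrib_left)
   finally have fin: "?F2 l x * cmod (psi (int k)) <= X * (cmod (psi (- 1)) + cmod (psi (int l)))" .
   define Y where "Y = exp (real l * \<mu> l - 2 * \<sigma> * real l) / 2"
   have Y: "0 < Y" unfolding Y_def by simp
   have "Y * cmod (psi (int k)) <= ?F2 l x * cmod (psi (int k))" using low2 unfolding Y_def by (rule mult_right_mono) simp
   also note fin
   also have "X * (cmod (psi (- 1)) + cmod (psi (int l))) = Y * (exp (- gamma * real l / 5) * (cmod (psi (- 1)) + cmod (psi (int l))))"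
    unfolding X_def Y_def by simp
   finally show "cmod (psi (int k)) <= exp (- gamma * real l / 5) * (cmod (psi (- 1)) + cmod (psi (int l)))"
    using Y by (simp only: mult_le_cancel_left_pos)
  qed
  thus ?thesis using i(1) l by blast
 qed
 thus ?thesis using B1 kappa by (intro exI[of _ B] conjI exI[of _ I] exI[of _ kappa] exI[of _ n0]) auto
qed

end

text \<open>The block is centred at \<open>k\<close> and pushed back inside near the ends of the
  operator. There \<open>decay_scale\<close> admits sites close to the end, because eigenvectors
  vanish beyond it.\<close>

definition block_start :: "nat => nat => int => int" where
 "block_start N l k = max 0 (min (k - int (l div 2)) (int N - int l))"

lemma block_start:
 assumes "1 <= l" "l <= N" "0 <= k" "k < int N"
 shows "0 <= block_start N l k" "block_start N l k + int l <= int N" "block_start N l k <= k" "k < block_start N l k + int l"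
  "block_start N l k = 0 \<or> int (l div 2) <= k - block_start N l k"
  "block_start N l k + int l = int N \<or> k - block_start N l k <= int (l div 2)"
 using assms unfolding block_start_def by (auto simp: max_def min_def)

text \<open>The estimate in \<open>step\<close> is applied to its own right side: within distance
  \<open>i * l\<close> of \<open>k\<close> nothing of \<open>V\<close> is met, so \<open>i\<close>
  applications are possible, each with a gain of \<open>2 * \<theta>\<close>.\<close>

lemma decay_iterate:
 fixes psi :: "int => complex"
 assumes van: "vanishes_off N psi" and \<theta>: "0 <= \<theta>" and bd: "\<And>k. cmod (psi k) <= 1"
  and step: "\<And>k. k \<in> {0..<int N} ==> k \<notin> V ==> \<exists>p q. \<bar>p - k\<bar> <= int l \<and> \<bar>q - k\<bar> <= int l \<and> cmod (psi k) <= \<theta> * (cmod (psi p) + cmod (psi q))"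
 shows "(\<And>j. \<bar>j - k\<bar> <= int (i * l) ==> j \<notin> V) ==> cmod (psi k) <= (2 * \<theta>) ^ i"
proof (induction i arbitrary: k)
 case 0
 thus ?case using bd by simp
next
 case (Suc i)
 show ?case
 proof (cases "k \<in> {0..<int N}")
  case True
  obtain p q where pq: "\<bar>p - k\<bar> <= int l" "\<bar>q - k\<bar> <= int l" "cmod (psi k) <= \<theta> * (cmod (psi p) + cmod (psi q))"
   using step[OF True] Suc.prems[of k] by auto
  have "cmod (psi t) <= (2 * \<theta>) ^ i" if "\<bar>t - k\<bar> <= int l" for t
  proof (rule Suc.IH)
   fix j assume "\<bar>j - t\<bar> <= int (i * l)"
   hence "\<bar>j - k\<bar> <= int (Suc i * l)" using that by simp
   thus "j \<notin> V" by (rule Suc.prems)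
  qed
  hence "cmod (psi p) + cmod (psi q) <= (2 * \<theta>) ^ i + (2 * \<theta>) ^ i" using pq by (intro add_mono) auto
  hence "\<theta> * (cmod (psi p) + cmod (psi q)) <= \<theta> * ((2 * \<theta>) ^ i + (2 * \<theta>) ^ i)" using \<theta> by (rule mult_left_mono)
  thus ?thesis using pq(3) by (simp add: mult_ac)
 next
  case False
  hence "psi k = 0" using van by (simp add: vanishes_off_def)
  thus ?thesis using \<theta> by simp
 qed
qed

text \<open>The sum of the squared 2 by 2 minors is twice the Gram determinant, which measures how
  far two vectors are from being parallel.\<close>

lemma lagrange_identity:
 fixes u v :: "'i => complex"
 shows "(\<Sum>m\<in>S. \<Sum>n\<in>S. (cmod (u m * v n - u n * v m))\<^sup>2) =
  2 * ((\<Sum>n\<in>S. (cmod (u n))\<^sup>2) * (\<Sum>n\<in>S. (cmod (v n))\<^sup>2) - (cmod (\<Sum>n\<in>S. cnj (u n) * v n))\<^sup>2)"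
proof -
 let ?s = "\<Sum>n\<in>S. cnj (u n) * v n"
 have pt: "complex_of_real ((cmod (u m * v n - u n * v m))\<^sup>2) =
   (cnj (u m) * u m) * (cnj (v n) * v n) + (cnj (v m) * v m) * (cnj (u n) * u n)
   - (cnj (u n) * v n) * cnj (cnj (u m) * v m) - (cnj (u m) * v m) * cnj (cnj (u n) * v n)" for m n
  unfolding complex_norm_square by (simp add: algebra_simps)
 have "complex_of_real (\<Sum>m\<in>S. \<Sum>n\<in>S. (cmod (u m * v n - u n * v m))\<^sup>2) =
   (\<Sum>m\<in>S. cnj (u m) * u m) * (\<Sum>n\<in>S. cnj (v n) * v n) + (\<Sum>m\<in>S. cnj (v m) * v m) * (\<Sum>n\<in>S. cnj (u n) * u n)
   - cnj ?s * ?s - ?s * cnj ?s" unfolding of_real_sum pt sum.distrib sum_subtractf cnj_sum sum_product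
  by (simp add: sum_distrib_left sum_distrib_right mult_ac)
 also have "... = of_real (2 * ((\<Sum>n\<in>S. (cmod (u n))\<^sup>2) * (\<Sum>n\<in>S. (cmod (v n))\<^sup>2) - (cmod ?s)\<^sup>2))"
 proof -
  have sq: "(\<Sum>n\<in>S. cnj (t n) * t n) = of_real (\<Sum>n\<in>S. (cmod (t n))\<^sup>2)" for t :: "'i => complex"
   unfolding of_real_sum complex_norm_square by (simp add: mult.commute)
  have ss: "cnj ?s * ?s = of_real ((cmod ?s)\<^sup>2)" "?s * cnj ?s = of_real ((cmod ?s)\<^sup>2)"
   unfolding complex_norm_square by (rule mult.commute refl)+
  show ?thesis unfolding sq ss by (simp add: algebra_simps)
 qed
 finally have "complex_of_real (\<Sum>m\<in>S. \<Sum>n\<in>S. (cmod (u m * v n - u n * v m))\<^sup>2) =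
  of_real (2 * ((\<Sum>n\<in>S. (cmod (u n))\<^sup>2) * (\<Sum>n\<in>S. (cmod (v n))\<^sup>2) - (cmod ?s)\<^sup>2))" .
 thus ?thesis by (simp only: of_real_eq_iff)
qed

section \<open>Resonant sites, and eigenvectors of the whole operator near them\<close>

context jacobi_data_zeros
begin

text \<open>The predicate \<open>res\<close> of the locale \<open>resonance\<close>, for the spectra
  \<open>spec l\<close>.\<close>

definition near :: "nat => real => real => real => real => bool" where
 "near l t x w E \<longleftrightarrow> (\<exists>e\<in>spec l x w. \<bar>e - E\<bar> <= t)"

definition resonant_sites :: "nat => nat => real => real => real => real => int set" where
 "resonant_sites N l t x w E = {k\<in>{0..<int N}. near l t (x + of_int (block_start N l k) * w) w E}"

lemma hop_shift: "hop (x + of_int s * w) w (\<lambda>j. psi (s + j)) j = hop x w psi (s + j)" unfolding jacobi_op_def by (simp add: algebra_simps)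

lemma decay_off_resonant_sites:
 assumes ds: "decay_scale kappa gamma l w E1" and eps: "exp (- (real l powr (1/6))) <= t" and l: "1 <= l" "l <= N"
  and van: "vanishes_off N psi" and ev: "\<And>k. k \<in> {0..<int N} ==> hop x w psi k = of_real E2 * psi k"
  and E2: "\<bar>E2 - E1\<bar> <= exp (- kappa * real l)" and k: "k \<in> {0..<int N}" "k \<notin> resonant_sites N l t x w E1"
 shows "\<exists>p q. \<bar>p - k\<bar> <= int l \<and> \<bar>q - k\<bar> <= int l \<and> cmod (psi k) <= exp (- gamma * real l / 5) * (cmod (psi p) + cmod (psi q))"
proof -
 define s where "s = block_start N l k"
 have s: "0 <= s" "s + int l <= int N" "s <= k" "k < s + int l" "s = 0 \<or> int (l div 2) <= k - s" "s + int l = int N \<or> k - s <= int (l div 2)"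
  using block_start[OF l, of k] k unfolding s_def by auto
 define \<phi> where "\<phi> = (\<lambda>j. psi (s + j))"
 define i where "i = nat (k - s)"
 have i: "k = s + int i" "i < l" using s unfolding i_def by auto
 have nonres: "\<forall>e\<in>spec l (x + of_int s * w) w. exp (- (real l powr (1/6))) <= \<bar>e - E1\<bar>"
 proof
  fix e assume e: "e \<in> spec l (x + of_int s * w) w"
  have "\<not> near l t (x + of_int s * w) w E1" using k unfolding resonant_sites_def s_def by simp
  hence "t < \<bar>e - E1\<bar>" using e by (auto simp: near_def not_le)
  thus "exp (- (real l powr (1/6))) <= \<bar>e - E1\<bar>" using eps by linarith
 qed
 have "\<forall>j\<in>{0..<int l}. hop (x + of_int s * w) w \<phi> j = of_real E2 * \<phi> j"
  unfolding \<phi>_def hop_shift using s by (auto intro: ev)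
 moreover have "l <= 3 * (i + 1) \<or> \<phi> (- 1) = 0"
 proof (cases "s = 0")
  case True
  thus ?thesis using van by (simp add: \<phi>_def vanishes_off_def)
 next
  case False
  hence "l div 2 <= i" using s(5) i(1) by auto
  hence "l <= 3 * (i + 1)" by presburger
  thus ?thesis ..
 qed
 moreover have "l <= 3 * (l - i) \<or> \<phi> (int l) = 0"
 proof (cases "s + int l = int N")
  case True
  thus ?thesis using van by (simp add: \<phi>_def vanishes_off_def)
 next
  case False
  hence "i <= l div 2" using s(6) i(1) by auto
  hence "l <= 3 * (l - i)" using i by linarith
  thus ?thesis ..
 qed
 ultimately have "cmod (\<phi> (int i)) <= exp (- gamma * real l / 5) * (cmod (\<phi> (- 1)) + cmod (\<phi> (int l)))"
  using ds nonres E2 i(2) unfolding decay_scale_def by blast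
 thus ?thesis unfolding \<phi>_def i(1)[symmetric] using s by (intro exI[of _ "s - 1"] exI[of _ "s + int l"]) (auto simp: i(1)[symmetric])
qed

text \<open>Cut off where \<open>psi\<close> is at most \<open>\<eta>\<close> at two consecutive
  sites, or where the block ends at a zero of \<open>psi\<close>, the eigenvector becomes a vector
  on the block with a residual of order \<open>beta * \<eta>\<close>. By \<open>approx_spec\<close>
  a value at \<open>k\<close> above the stated bound would make the block resonant.\<close>

lemma cut_off_bound:
 fixes n p1 p2 k :: int
 assumes van: "vanishes_off N psi" and ev: "\<And>k. k \<in> {0..<int N} ==> hop x w psi k = of_real E2 * psi k"
  and n: "0 <= n" "n + int l <= int N" and p: "n - 1 <= p1" "p1 < k" "k < p2" "p2 <= n + int l"
  and \<eta>: "0 <= \<eta>" and left: "(p1 = n - 1 \<and> psi p1 = 0) \<or> (cmod (psi p1) <= \<eta> \<and> cmod (psi (p1 + 1)) <= \<eta>)"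
  and right: "(p2 = n + int l \<and> psi p2 = 0) \<or> (cmod (psi p2) <= \<eta> \<and> cmod (psi (p2 - 1)) <= \<eta>)"
  and nonres: "\<not> near l eps (x + of_int n * w) w E1" and eps: "0 < eps" and E2: "\<bar>E2 - E1\<bar> <= eps / 2"
 shows "cmod (psi k) <= 8 * beta * \<eta> / eps"
proof (cases "psi k = 0")
 case True
 thus ?thesis using beta \<eta> eps by simp
next
 case False
 define \<phi> where "\<phi> j = (if p1 < n + j \<and> n + j < p2 then psi (n + j) else 0)" for j
 have vphi: "vanishes_off l \<phi>" unfolding vanishes_off_def \<phi>_def using p by auto
 have \<phi>k: "\<phi> (k - n) = psi k" unfolding \<phi>_def using p by simp
 have kn: "k - n \<in> {0..<int l}" using p by auto
 have pos: "0 < norm2_n l \<phi>" by (rule norm2_n_pos[OF _ kn]) (use False \<phi>k in simp)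
 let ?y = "x + of_int n * w"
 let ?g = "\<lambda>j. hop ?y w \<phi> j - of_real E1 * \<phi> j"
 define I where "I P = (if P then 1 else 0 :: real)" for P
 define err where "err j = hop ?y w \<phi> j - of_real E2 * \<phi> j" for j
 \<comment> \<open>Cutting changes the equation only at the two sites next to each cut.\<close>
 have errb: "(cmod (err j))\<^sup>2 <= 4 * (beta * \<eta>)\<^sup>2 * (I (n + j = p1) + I (n + j = p1 + 1) + I (n + j = p2 - 1) + I (n + j = p2))"
  if j: "j \<in> {0..<int l}" for j
 proof -
  define s where "s = n + j"
  define J where "J q = (if p1 < q \<and> q < p2 then 1 else 0 :: complex)" for q
  have sN: "s \<in> {0..<int N}" using j n unfolding s_def by auto
  have ph: "x + of_int n * w + of_int j * w = x + of_int s * w" "x + of_int n * w + of_int (j + 1) * w = x + of_int (s + 1) * w" unfolding s_def by (simp_all add: algebra_simps)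
  have \<phi>J: "\<phi> j = J s * psi s" "\<phi> (j + 1) = J (s + 1) * psi (s + 1)" "\<phi> (j - 1) = J (s - 1) * psi (s - 1)"
   unfolding \<phi>_def J_def s_def by (simp_all add: add.assoc add_diff_eq)
  have "J s * hop x w psi s = J s * (of_real E2 * psi s)" using ev[OF sN] by simp
  hence err: "err j = (J s - J (s + 1)) * (b (x + of_int (s + 1) * w) * psi (s + 1)) + (J s - J (s - 1)) * (cnj (b (x + of_int s * w)) * psi (s - 1))"
   unfolding err_def jacobi_op_def ph \<phi>J by (simp add: algebra_simps)
  define u where "u = cmod (J s - J (s + 1)) * (beta * cmod (psi (s + 1)))"
  define v where "v = cmod (J s - J (s - 1)) * (beta * cmod (psi (s - 1)))"
  have uv: "cmod (err j) <= u + v" unfolding err u_def v_def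
   by (rule order_trans[OF norm_triangle_ineq]) (auto simp: norm_mult intro!: add_mono mult_left_mono mult_right_mono b_bound)
  have beta\<eta>: "0 <= beta * \<eta>" using beta \<eta> by simp
  have nn: "n <= s" "s < n + int l" using j unfolding s_def by auto
  have u: "u <= beta * \<eta> * (I (s = p1) + I (s = p2 - 1))"
  proof -
   have "J s = J (s + 1)" if "s \<noteq> p1" "s \<noteq> p2 - 1"
   proof -
    have "(p1 < s + 1) = (p1 < s)" "(s + 1 < p2) = (s < p2)" using that by auto
    thus ?thesis unfolding J_def by simp
   qed
   moreover have "p1 \<noteq> p2 - 1" using p by simp
   ultimately consider "s = p1" "s \<noteq> p2 - 1" | "s = p2 - 1" "s \<noteq> p1" | "J s = J (s + 1)" by blast
   thus ?thesis
   proof cases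
    case 1
    hence "cmod (psi (s + 1)) <= \<eta>" using left nn by auto
    hence "beta * cmod (psi (s + 1)) <= beta * \<eta>" using beta by (intro mult_left_mono) auto
    thus ?thesis using 1 p unfolding u_def by (simp add: J_def I_def)
   next
    case 2
    hence "cmod (psi (s + 1)) <= \<eta>" using right \<eta> by auto
    hence "beta * cmod (psi (s + 1)) <= beta * \<eta>" using beta by (intro mult_left_mono) auto
    thus ?thesis using 2 p unfolding u_def by (auto simp: J_def I_def)
   next
    case 3
    thus ?thesis using beta\<eta> unfolding u_def by (simp add: I_def)
   qed
  qed
  have v: "v <= beta * \<eta> * (I (s = p1 + 1) + I (s = p2))"
  proof -
   have "J s = J (s - 1)" if "s \<noteq> p1 + 1" "s \<noteq> p2"
   proof -
    have "(p1 < s - 1) = (p1 < s)" "(s - 1 < p2) = (s < p2)" using that by auto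
    thus ?thesis unfolding J_def by simp
   qed
   moreover have "p1 + 1 \<noteq> p2" using p by simp
   ultimately consider "s = p1 + 1" "s \<noteq> p2" | "s = p2" "s \<noteq> p1 + 1" | "J s = J (s - 1)" by blast
   thus ?thesis
   proof cases
    case 1
    hence "cmod (psi (s - 1)) <= \<eta>" using left \<eta> by auto
    hence "beta * cmod (psi (s - 1)) <= beta * \<eta>" using beta by (intro mult_left_mono) auto
    thus ?thesis using 1 p unfolding v_def by (auto simp: J_def I_def)
   next
    case 2
    hence "cmod (psi (s - 1)) <= \<eta>" using right nn by auto
    hence "beta * cmod (psi (s - 1)) <= beta * \<eta>" using beta by (intro mult_left_mono) auto
    thus ?thesis using 2 p unfolding v_def by (auto simp: J_def I_def)
   next
    case 3
    thus ?thesis using beta\<eta> unfolding v_def by (simp add: I_def)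
   qed
  qed
  let ?c = "I (s = p1) + I (s = p1 + 1) + I (s = p2 - 1) + I (s = p2)"
  have "cmod (err j) <= beta * \<eta> * ?c" using uv u v by (simp add: algebra_simps)
  hence "(cmod (err j))\<^sup>2 <= (beta * \<eta> * ?c)\<^sup>2" by (intro power_mono) auto
  also have "... = (beta * \<eta>)\<^sup>2 * ?c\<^sup>2" by (rule power_mult_distrib)
  also have "... <= (beta * \<eta>)\<^sup>2 * (4 * ?c)" by (intro mult_left_mono) (auto simp: I_def)
  finally show ?thesis unfolding s_def by (simp only: mult.assoc mult.left_commute)
 qed
 have "norm2_n l err <= (\<Sum>j\<in>{0..<int l}. 4 * (beta * \<eta>)\<^sup>2 * (I (n + j = p1) + I (n + j = p1 + 1) + I (n + j = p2 - 1) + I (n + j = p2)))"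
  unfolding norm2_n_def by (rule sum_mono) (rule errb)
 also have "... = 4 * (beta * \<eta>)\<^sup>2 * ((\<Sum>j\<in>{0..<int l}. I (n + j = p1)) + (\<Sum>j\<in>{0..<int l}. I (n + j = p1 + 1)) + (\<Sum>j\<in>{0..<int l}. I (n + j = p2 - 1)) + (\<Sum>j\<in>{0..<int l}. I (n + j = p2)))"
  by (simp only: sum_distrib_left[symmetric] sum.distrib)
 also have "... <= 4 * (beta * \<eta>)\<^sup>2 * (1 + 1 + 1 + 1)"
 proof (intro mult_left_mono add_mono)
  have "(\<Sum>j\<in>{0..<int l}. I (n + j = q)) <= 1" for q
  proof -
   have "(\<Sum>j\<in>{0..<int l}. I (n + j = q)) = (\<Sum>j\<in>{0..<int l}. if q - n = j then 1 else 0)" unfolding I_def by (rule sum.cong) auto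
   thus ?thesis by (simp add: sum.delta')
  qed
  thus "(\<Sum>j\<in>{0..<int l}. I (n + j = p1)) <= 1" "(\<Sum>j\<in>{0..<int l}. I (n + j = p1 + 1)) <= 1"
   "(\<Sum>j\<in>{0..<int l}. I (n + j = p2 - 1)) <= 1" "(\<Sum>j\<in>{0..<int l}. I (n + j = p2)) <= 1" by auto
 qed auto
 finally have nerr: "norm2_n l err <= 16 * (beta * \<eta>)\<^sup>2" by simp
 have "norm2_n l ?g <= 2 * norm2_n l err + 2 * (eps / 2)\<^sup>2 * norm2_n l \<phi>"
 proof -
  have pt: "(cmod (?g j))\<^sup>2 <= 2 * (cmod (err j))\<^sup>2 + 2 * (eps / 2)\<^sup>2 * (cmod (\<phi> j))\<^sup>2" for j
  proof -
   have "?g j = err j + of_real (E2 - E1) * \<phi> j" unfolding err_def by (simp add: algebra_simps)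
   hence "cmod (?g j) <= cmod (err j) + \<bar>E2 - E1\<bar> * cmod (\<phi> j)" by (metis norm_mult norm_of_real norm_triangle_ineq)
   also have "... <= cmod (err j) + eps / 2 * cmod (\<phi> j)" using E2 by (intro add_left_mono mult_right_mono) auto
   finally have "(cmod (?g j))\<^sup>2 <= (cmod (err j) + eps / 2 * cmod (\<phi> j))\<^sup>2" by (intro power_mono) auto
   also have "... <= 2 * (cmod (err j))\<^sup>2 + 2 * (eps / 2 * cmod (\<phi> j))\<^sup>2"
    using zero_le_power2[of "cmod (err j) - eps / 2 * cmod (\<phi> j)"] by (simp add: power2_diff power2_sum)
   finally show ?thesis by (simp only: power_mult_distrib mult.assoc)
  qed
  show ?thesis unfolding norm2_n_def sum_distrib_left sum.distrib[symmetric] by (rule sum_mono) (rule pt)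
 qed
 moreover have "eps\<^sup>2 * norm2_n l \<phi> < norm2_n l ?g"
 proof (rule ccontr)
  assume "\<not> ?thesis"
  hence "norm2_n l ?g <= eps\<^sup>2 * norm2_n l \<phi>" by simp
  from approx_spec[OF vphi pos _ this] eps nonres show False unfolding near_def by auto
 qed
 ultimately have "eps\<^sup>2 / 2 * norm2_n l \<phi> < 32 * (beta * \<eta>)\<^sup>2" using nerr by (simp add: power_divide)
 moreover have "(cmod (psi k))\<^sup>2 <= norm2_n l \<phi>" unfolding norm2_n_def \<phi>k[symmetric] by (rule member_le_sum) (use kn in auto)
 hence "eps\<^sup>2 / 2 * (cmod (psi k))\<^sup>2 <= eps\<^sup>2 / 2 * norm2_n l \<phi>" by (intro mult_left_mono) auto
 ultimately have "(eps * cmod (psi k))\<^sup>2 < (8 * (beta * \<eta>))\<^sup>2" by (simp add: power_mult_distrib)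
 hence "eps * cmod (psi k) < 8 * (beta * \<eta>)" by (rule power2_less_imp_less) (use beta \<eta> in simp)
 thus ?thesis using eps by (simp add: pos_le_divide_eq mult_ac)
qed

end

text \<open>Short blocks of length \<open>l\<close> have no double resonance at distances from
  \<open>m1\<close> to \<open>wm\<close>, long blocks of length \<open>L\<close> none from
  \<open>m0\<close> to \<open>N\<close>. So the sites of resonant long blocks form one cluster,
  whose size is below \<open>wm\<close>, and within it the sites of resonant short blocks form a
  cluster of size \<open>m1 + l\<close>. \<open>i\<close> is the number of decay steps, and
  \<open>d\<close> the gap to be proved.\<close>

locale localization = jacobi_data_zeros +
 fixes x w E1 eps eps1 kappad gamma kappa C d :: real and N l L m0 m1 wm i :: nat
 assumes decay_scale: "decay_scale kappad gamma l w E1" and eps1: "exp (- (real l powr (1/6))) <= eps1"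
  and no_double_short: "\<And>m y. m1 <= m ==> m <= wm ==> near l eps1 y w E1 ==> \<not> near l eps1 (y + real m * w) w E1"
  and no_double_long: "\<And>m y. m0 <= m ==> m <= N ==> near L eps y w E1 ==> \<not> near L eps (y + real m * w) w E1"
  and b_large: "\<And>y j. near l eps1 y w E1 ==> j <= 2 * (m1 + l) ==> kappa <= cmod (b (y + real j * w))"
  and sizes: "1 <= l" "l <= N" "L <= N" "m1 + l + 2 * (i * l) + 3 <= L div 2" "L + 2 * (i * l) + l <= wm" "m0 + L + l <= wm"
  and eps: "0 < eps" and kappa: "0 < kappa" "kappa <= 1" and C: "beta + \<bar>E1\<bar> + 1 <= C"
  and d: "0 < d" "d <= exp (- kappad * real l)" "d <= eps / 2" "d <= 1"
  and small_mass: "real N * (8 * beta * (2 * exp (- gamma * real l / 5)) ^ i / eps)\<^sup>2 + real (m0 + L) * (2 * exp (- gamma * real l / 5))\<^sup>2 <= 1 / 100"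
  and small_wronskian: "real (m1 + l + 1) * (d / kappa * (3 * C / kappa) ^ (m1 + l)) <= 1"
begin

abbreviation "V \<equiv> resonant_sites N l eps1 x w E1"
abbreviation "V0 \<equiv> resonant_sites N L eps x w E1"

text \<open>The distance of the starts of two blocks differs by less than \<open>n\<close> from that
  of their sites; resonant sites farther apart would have blocks at an excluded distance.\<close>

lemma cluster:
 assumes F: "\<And>m y. mlo <= m ==> m <= mhi ==> near n t y w E1 ==> \<not> near n t (y + real m * w) w E1"
  and n: "1 <= n" "n <= N" and j: "j \<in> resonant_sites N n t x w E1" and k: "k \<in> resonant_sites N n t x w E1"
  and near: "\<bar>j - k\<bar> + int n <= int mhi \<or> N <= mhi"
 shows "\<bar>j - k\<bar> < int (mlo + n)"
proof -
 have main: "k - j < int (mlo + n)" if j: "j \<in> resonant_sites N n t x w E1" and k: "k \<in> resonant_sites N n t x w E1"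
  and near: "\<bar>j - k\<bar> + int n <= int mhi \<or> N <= mhi" for j k
 proof (rule ccontr)
  assume neg: "\<not> ?thesis"
  define s t' where "s = block_start N n j" and "t' = block_start N n k"
  have jk: "0 <= j" "j < int N" "0 <= k" "k < int N" using j k by (auto simp: resonant_sites_def)
  have s: "0 <= s" "s + int n <= int N" "s <= j" "j < s + int n" unfolding s_def using block_start[OF n jk(1,2)] by auto
  have t': "0 <= t'" "t' + int n <= int N" "t' <= k" "k < t' + int n" unfolding t'_def using block_start[OF n jk(3,4)] by auto
  define m where "m = nat (t' - s)"
  have m: "t' = s + int m" unfolding m_def using neg s t' by simp
  have "mlo <= m" "m <= mhi" using neg s t' near unfolding m by auto
  moreover have "near n t (x + of_int s * w) w E1" "near n t (x + of_int s * w + real m * w) w E1"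
  proof -
   show "near n t (x + of_int s * w) w E1" using j unfolding resonant_sites_def s_def by simp
   have "x + of_int s * w + real m * w = x + of_int t' * w" unfolding m by (simp add: algebra_simps)
   moreover have "near n t (x + of_int t' * w) w E1" using k unfolding resonant_sites_def t'_def by simp
   ultimately show "near n t (x + of_int s * w + real m * w) w E1" by (simp add: add.assoc)
  qed
  ultimately show False using F by blast
 qed
 show ?thesis using main[OF j k near] main[OF k j] near by (auto simp: abs_minus_commute)
qed

lemma V_cluster: "j \<in> V ==> k \<in> V ==> \<bar>j - k\<bar> + int l <= int wm ==> \<bar>j - k\<bar> < int (m1 + l)"
 by (rule cluster[OF no_double_short sizes(1,2)]) auto

lemma L1: "1 <= L" using sizes(4) by presburger

lemma V0_cluster: "j \<in> V0 ==> k \<in> V0 ==> \<bar>j - k\<bar> < int (m0 + L)" by (rule cluster[OF no_double_long L1 sizes(3)]) auto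

definition state :: "(int => complex) => real => bool" where
 "state psi E2 \<longleftrightarrow> vanishes_off N psi \<and> norm2_n N psi = 1 \<and> (\<forall>k\<in>{0..<int N}. hop x w psi k = of_real E2 * psi k) \<and> \<bar>E2 - E1\<bar> <= d"

lemma state_le_1: assumes "state psi E2" shows "cmod (psi k) <= 1"
proof (cases "k \<in> {0..<int N}")
 case True
 have "(cmod (psi k))\<^sup>2 <= norm2_n N psi" unfolding norm2_n_def by (rule member_le_sum) (use True in auto)
 hence "(cmod (psi k))\<^sup>2 <= 1\<^sup>2" using assms by (simp add: state_def)
 thus ?thesis by (rule power2_le_imp_le) simp
next
 case False
 thus ?thesis using assms by (simp add: state_def vanishes_off_def)
qed

abbreviation "\<theta> \<equiv> exp (- gamma * real l / 5)"

lemma off_V: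
 assumes st: "state psi E2" and k: "k \<in> {0..<int N}" "k \<notin> V"
 shows "\<exists>p q. \<bar>p - k\<bar> <= int l \<and> \<bar>q - k\<bar> <= int l \<and> cmod (psi k) <= \<theta> * (cmod (psi p) + cmod (psi q))"
proof (rule decay_off_resonant_sites[OF decay_scale eps1 sizes(1,2) _ _ _ k])
 show "vanishes_off N psi" using st unfolding state_def by blast
 show "\<And>j. j \<in> {0..<int N} ==> hop x w psi j = of_real E2 * psi j" using st unfolding state_def by blast
 show "\<bar>E2 - E1\<bar> <= exp (- kappad * real l)" using st d(2) unfolding state_def by linarith
qed

lemma off_V_bound: assumes "state psi E2" "k \<in> {0..<int N}" "k \<notin> V" shows "cmod (psi k) <= 2 * \<theta>"
proof -
 obtain p q where pq: "cmod (psi k) <= \<theta> * (cmod (psi p) + cmod (psi q))" using off_V[OF assms] by blast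
 also have "... <= \<theta> * 2" using state_le_1[OF assms(1), of p] state_le_1[OF assms(1), of q] by (intro mult_left_mono) auto
 finally show ?thesis by simp
qed

lemma far_from_V:
 assumes st: "state psi E2" and far: "\<And>j. \<bar>j - k\<bar> <= int (i * l) ==> j \<notin> V"
 shows "cmod (psi k) <= (2 * \<theta>) ^ i"
 by (rule decay_iterate[where V = V and l = l]) (use st far off_V[OF st] state_le_1[OF st] in \<open>auto simp: state_def\<close>)

text \<open>The long block around \<open>k\<close> is not resonant, so \<open>cut_off_bound\<close>
  applies once there are cuts. On each side there are two candidates, next to the end of the block
  and next to \<open>k\<close>. They are so far apart that the clustered set \<open>V\<close> comes
  within \<open>i * l\<close> of at most one of them; at the other one \<open>psi\<close> is tiny by
  \<open>far_from_V\<close>.\<close>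

lemma off_V0:
 assumes st: "state psi E2" and k: "k \<in> {0..<int N}" "k \<notin> V0"
 shows "cmod (psi k) <= 8 * beta * (2 * \<theta>) ^ i / eps"
proof -
 define n D where "n = block_start N L k" and "D = int (i * l)"
 have n: "0 <= n" "n + int L <= int N" "n <= k" "k < n + int L" "n = 0 \<or> int (L div 2) <= k - n" "n + int L = int N \<or> k - n <= int (L div 2)"
  using block_start[OF L1 sizes(3), of k] k unfolding n_def by auto
 have sz: "int (m1 + l) + 2 * D + 3 <= int (L div 2)" "int L + 2 * D + int l <= int wm"
 proof -
  have "int (m1 + l) + 2 * D + 3 = int (m1 + l + 2 * (i * l) + 3)" "int L + 2 * D + int l = int (L + 2 * (i * l) + l)" unfolding D_def by simp_all
  thus "int (m1 + l) + 2 * D + 3 <= int (L div 2)" "int L + 2 * D + int l <= int wm" using sizes(4,5) by (simp_all only: of_nat_le_iff)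
 qed
 have D0: "0 <= D" unfolding D_def by simp
 have L2: "2 * int (L div 2) <= int L" by simp
 have van: "vanishes_off N psi" and ev: "\<And>j. j \<in> {0..<int N} ==> hop x w psi j = of_real E2 * psi j" using st unfolding state_def by auto
 have pair: "cmod (psi q) <= (2 * \<theta>) ^ i \<and> cmod (psi (q + 1)) <= (2 * \<theta>) ^ i" if "\<And>j. q - D <= j ==> j <= q + 1 + D ==> j \<notin> V" for q
  using that unfolding D_def by (intro conjI far_from_V[OF st]) auto
 have one_far: "(\<forall>j. q - D <= j --> j <= q + 1 + D --> j \<notin> V) \<or> (\<forall>j. q' - D <= j --> j <= q' + 1 + D --> j \<notin> V)"
  if q: "int (m1 + l) + 2 * D + 1 <= q' - q" "q' - q <= int L - 1" for q q'
 proof (rule ccontr)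
  assume "\<not> ?thesis"
  then obtain j j' where j: "q - D <= j" "j <= q + 1 + D" "j \<in> V" "q' - D <= j'" "j' <= q' + 1 + D" "j' \<in> V" by blast
  have a: "\<bar>j - j'\<bar> = j' - j" using j q by simp
  have "\<bar>j - j'\<bar> < int (m1 + l)" by (rule V_cluster[OF j(3,6)]) (use a j q sz in linarith)
  thus False using a j q by linarith
 qed
 have "\<exists>p1. n - 1 <= p1 \<and> p1 < k \<and> ((p1 = n - 1 \<and> psi p1 = 0) \<or> (cmod (psi p1) <= (2 * \<theta>) ^ i \<and> cmod (psi (p1 + 1)) <= (2 * \<theta>) ^ i))"
 proof (cases "n = 0")
  case True
  thus ?thesis using van n by (intro exI[of _ "- 1"]) (auto simp: vanishes_off_def)
 next
  case False
  hence kn: "int (L div 2) <= k - n" using n by blast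
  have "(\<forall>j. n - D <= j --> j <= n + 1 + D --> j \<notin> V) \<or> (\<forall>j. (k - 1) - D <= j --> j <= (k - 1) + 1 + D --> j \<notin> V)"
   by (rule one_far) (use kn n sz in linarith)+
  thus ?thesis
  proof
   assume h: "\<forall>j. n - D <= j --> j <= n + 1 + D --> j \<notin> V"
   have "n < k" using kn sz D0 by linarith
   thus ?thesis using pair[of n] h by (intro exI[of _ n]) auto
  next
   assume h: "\<forall>j. (k - 1) - D <= j --> j <= (k - 1) + 1 + D --> j \<notin> V"
   thus ?thesis using pair[of "k - 1"] n by (intro exI[of _ "k - 1"]) auto
  qed
 qed
 then obtain p1 where p1: "n - 1 <= p1" "p1 < k" "(p1 = n - 1 \<and> psi p1 = 0) \<or> (cmod (psi p1) <= (2 * \<theta>) ^ i \<and> cmod (psi (p1 + 1)) <= (2 * \<theta>) ^ i)" by blast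
 have "\<exists>p2. k < p2 \<and> p2 <= n + int L \<and> ((p2 = n + int L \<and> psi p2 = 0) \<or> (cmod (psi p2) <= (2 * \<theta>) ^ i \<and> cmod (psi (p2 - 1)) <= (2 * \<theta>) ^ i))"
 proof (cases "n + int L = int N")
  case True
  thus ?thesis using van n by (intro exI[of _ "int N"]) (auto simp: vanishes_off_def)
 next
  case False
  hence kn: "k - n <= int (L div 2)" using n by blast
  have "(\<forall>j. k - D <= j --> j <= k + 1 + D --> j \<notin> V) \<or> (\<forall>j. (n + int L - 2) - D <= j --> j <= (n + int L - 2) + 1 + D --> j \<notin> V)"
   by (rule one_far) (use kn n sz L2 D0 in linarith)+
  thus ?thesis
  proof
   assume h: "\<forall>j. k - D <= j --> j <= k + 1 + D --> j \<notin> V"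
   thus ?thesis using pair[of k] n by (intro exI[of _ "k + 1"]) auto
  next
   assume h: "\<forall>j. (n + int L - 2) - D <= j --> j <= (n + int L - 2) + 1 + D --> j \<notin> V"
   have "k < n + int L - 1" using kn sz L2 D0 by linarith
   moreover have "n + int L - 2 + 1 = n + int L - 1" "n + int L - 1 - 1 = n + int L - 2" by auto
   ultimately show ?thesis using pair[of "n + int L - 2"] h by (intro exI[of _ "n + int L - 1"]) auto
  qed
 qed
 then obtain p2 where p2: "k < p2" "p2 <= n + int L" "(p2 = n + int L \<and> psi p2 = 0) \<or> (cmod (psi p2) <= (2 * \<theta>) ^ i \<and> cmod (psi (p2 - 1)) <= (2 * \<theta>) ^ i)" by blast
 show ?thesis
 proof (rule cut_off_bound[OF van ev n(1,2) p1(1,2) p2(1,2) _ p1(3) p2(3) _ eps])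
  show "\<not> near L eps (x + of_int n * w) w E1" using k unfolding resonant_sites_def n_def by simp
  show "\<bar>E2 - E1\<bar> <= eps / 2" using st d(3) unfolding state_def by linarith
 qed auto
qed

text \<open>The window carrying the mass: it starts at the first site that is resonant for both
  block lengths, and its length is the cluster size of the short blocks.\<close>

definition W :: "int set" where
 "W = {k\<in>{0..<int N}. Min (V \<inter> V0) <= k \<and> k <= Min (V \<inter> V0) + int (m1 + l)}"

lemma finite_V: "finite V" by (rule finite_subset[of _ "{0..<int N}"]) (auto simp: resonant_sites_def)

lemma card_V0: "card V0 <= m0 + L"
proof (cases "V0 = {}")
 case False
 have f: "finite V0" by (rule finite_subset[of _ "{0..<int N}"]) (auto simp: resonant_sites_def)
 have "V0 \<subseteq> {Min V0..<Min V0 + int (m0 + L)}"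
 proof
  fix k assume k: "k \<in> V0"
  have "Min V0 <= k" using f k by simp
  moreover have "\<bar>k - Min V0\<bar> < int (m0 + L)" by (rule V0_cluster[OF k Min_in[OF f False]])
  ultimately show "k \<in> {Min V0..<Min V0 + int (m0 + L)}" by auto
 qed
 from card_mono[OF _ this] show ?thesis by simp
qed simp

text \<open>Off \<open>V0\<close> the eigenvector is tiny, at up to \<open>N\<close> sites; on
  \<open>V0\<close> but off \<open>V\<close> it is merely small, but there are at most
  \<open>m0 + L\<close> such sites. Nearly all the mass is on \<open>V \<inter> V0\<close>, which
  both cluster bounds together place in \<open>W\<close>.\<close>

lemma mass_window:
 assumes st: "state psi E2"
 shows "(\<Sum>k\<in>W. (cmod (psi k))\<^sup>2) \<ge> 99 / 100" and "V \<inter> V0 \<noteq> {}"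
proof -
 let ?S = "\<lambda>A. \<Sum>k\<in>A. (cmod (psi k))\<^sup>2"
 let ?I = "{0..<int N}"
 have sub: "V \<subseteq> ?I" "V0 \<subseteq> ?I" by (auto simp: resonant_sites_def)
 have tot: "?S ?I = 1" using st by (simp add: state_def norm2_n_def)
 have "?S (?I - (V \<inter> V0)) <= ?S ((?I - V0) \<union> (V0 - V))" by (rule sum_mono2) (use sub in \<open>auto intro: finite_subset\<close>)
 also have "... = ?S (?I - V0) + ?S (V0 - V)" by (rule sum.union_disjoint) (use sub in \<open>auto intro: finite_subset\<close>)
 also have "?S (?I - V0) <= real (card (?I - V0)) * (8 * beta * (2 * \<theta>) ^ i / eps)\<^sup>2"
  using off_V0[OF st] by (intro sum_bounded_above power_mono) auto
 also have "... <= real N * (8 * beta * (2 * \<theta>) ^ i / eps)\<^sup>2" using card_mono[of ?I "?I - V0"] by (intro mult_right_mono) auto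
 also have "?S (V0 - V) <= real (card (V0 - V)) * (2 * \<theta>)\<^sup>2" using off_V_bound[OF st] sub by (intro sum_bounded_above power_mono) auto
 also have "... <= real (m0 + L) * (2 * \<theta>)\<^sup>2"
  using card_V0 card_mono[of V0 "V0 - V"] sub finite_subset[OF sub(2)] by (intro mult_right_mono) auto
 finally have out: "?S (?I - (V \<inter> V0)) <= 1 / 100" using small_mass by linarith
 have spl: "?S ?I = ?S (?I - (V \<inter> V0)) + ?S (V \<inter> V0)" by (rule sum.subset_diff) (use sub in auto)
 hence A: "?S (V \<inter> V0) \<ge> 99 / 100" using out tot by linarith
 thus ne: "V \<inter> V0 \<noteq> {}" by auto
 have "V \<inter> V0 \<subseteq> W"
 proof
  fix k assume k: "k \<in> V \<inter> V0"
  have m: "Min (V \<inter> V0) \<in> V \<inter> V0" using ne finite_V by (intro Min_in) auto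
  have "\<bar>k - Min (V \<inter> V0)\<bar> < int (m0 + L)" using k m by (intro V0_cluster) auto
  hence "\<bar>k - Min (V \<inter> V0)\<bar> + int l <= int wm" using sizes(6) by linarith
  hence "\<bar>k - Min (V \<inter> V0)\<bar> < int (m1 + l)" using k m by (intro V_cluster) auto
  moreover have "Min (V \<inter> V0) <= k" using k finite_V by auto
  ultimately show "k \<in> W" unfolding W_def using k sub by auto
 qed
 hence "?S (V \<inter> V0) <= ?S W" by (intro sum_mono2) (auto simp: W_def)
 thus "?S W \<ge> 99 / 100" using A by linarith
qed

text \<open>Green's formula: the Wronskian weighted by \<open>b\<close> starts from zero at the left
  end, and each site adds the energy difference times the product of the two solutions. By the
  normalisation these products sum to at most 1.\<close>

lemma wronskian:
 assumes s1: "state psi1 E1" and s2: "state psi2 E2" and n: "0 <= n" "n < int N"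
 shows "cmod (b (x + of_int (n + 1) * w) * (psi1 n * psi2 (n + 1) - psi1 (n + 1) * psi2 n)) <= d"
proof -
 let ?om = "\<lambda>n. psi1 n * psi2 (n + 1) - psi1 (n + 1) * psi2 n" and ?b = "\<lambda>n. b (x + of_int n * w)"
 have dE: "\<bar>E1 - E2\<bar> <= d" using s2 by (simp add: state_def abs_minus_commute)
 have rec: "?b (n + 1) * ?om n = of_real (E1 - E2) * (psi1 n * psi2 n) + cnj (?b n) * ?om (n - 1)" if "n \<in> {0..<int N}" for n
 proof -
  have "hop x w psi1 n = of_real E1 * psi1 n" "hop x w psi2 n = of_real E2 * psi2 n" using s1 s2 that unfolding state_def by auto
  hence e: "?b (n + 1) * psi1 (n + 1) = of_real (a (x + of_int n * w)) * psi1 n - cnj (?b n) * psi1 (n - 1) - of_real E1 * psi1 n"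
   "?b (n + 1) * psi2 (n + 1) = of_real (a (x + of_int n * w)) * psi2 n - cnj (?b n) * psi2 (n - 1) - of_real E2 * psi2 n"
   unfolding jacobi_op_def by (simp_all add: algebra_simps)
  have "?b (n + 1) * ?om n = psi1 n * (?b (n + 1) * psi2 (n + 1)) - psi2 n * (?b (n + 1) * psi1 (n + 1))" by (simp add: algebra_simps)
  thus ?thesis unfolding e by (simp add: algebra_simps)
 qed
 have "cmod (?b (int m + 1) * ?om (int m)) <= d * (\<Sum>k\<in>{0..int m}. cmod (psi1 k) * cmod (psi2 k))" if "int m < int N" for m using that
 proof (induction m)
  case 0
  have "psi1 (- 1) = 0" "psi2 (- 1) = 0" using s1 s2 by (auto simp: state_def vanishes_off_def)
  hence "?b (0 + 1) * ?om 0 = of_real (E1 - E2) * (psi1 0 * psi2 0)" using rec[of 0] 0 by simp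
  hence "cmod (?b (0 + 1) * ?om 0) = \<bar>E1 - E2\<bar> * (cmod (psi1 0) * cmod (psi2 0))" by (metis norm_mult norm_of_real)
  also have "... <= d * (cmod (psi1 0) * cmod (psi2 0))" using dE by (intro mult_right_mono) auto
  finally show ?case by simp
 next
  case (Suc m)
  have "?b (int (Suc m) + 1) * ?om (int (Suc m)) = of_real (E1 - E2) * (psi1 (int (Suc m)) * psi2 (int (Suc m))) + cnj (?b (int m + 1)) * ?om (int m)"
   using rec[of "int (Suc m)"] Suc.prems by (simp add: add.commute)
  hence "cmod (?b (int (Suc m) + 1) * ?om (int (Suc m))) <= \<bar>E1 - E2\<bar> * (cmod (psi1 (int (Suc m))) * cmod (psi2 (int (Suc m)))) + cmod (?b (int m + 1) * ?om (int m))"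
   by (metis norm_mult norm_of_real norm_triangle_ineq complex_mod_cnj)
  also have "... <= d * (cmod (psi1 (int (Suc m))) * cmod (psi2 (int (Suc m)))) + d * (\<Sum>k\<in>{0..int m}. cmod (psi1 k) * cmod (psi2 k))"
   using Suc dE by (intro add_mono mult_right_mono) auto
  also have "... = d * (\<Sum>k\<in>{0..int (Suc m)}. cmod (psi1 k) * cmod (psi2 k))"
  proof -
   have "{0..int (Suc m)} = insert (int (Suc m)) {0..int m}" by auto
   thus ?thesis by (simp add: distrib_left)
  qed
  finally show ?case .
 qed
 from this[of "nat n"] have "cmod (?b (n + 1) * ?om n) <= d * (\<Sum>k\<in>{0..n}. cmod (psi1 k) * cmod (psi2 k))" using n by simp
 also have "... <= d * 1"
 proof (intro mult_left_mono)
  have "(\<Sum>k\<in>{0..n}. cmod (psi1 k) * cmod (psi2 k)) <= (\<Sum>k\<in>{0..<int N}. cmod (psi1 k) * cmod (psi2 k))" using n by (intro sum_mono2) auto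
  also have "... <= (\<Sum>k\<in>{0..<int N}. ((cmod (psi1 k))\<^sup>2 + (cmod (psi2 k))\<^sup>2) / 2)"
  proof (rule sum_mono)
   fix k show "cmod (psi1 k) * cmod (psi2 k) <= ((cmod (psi1 k))\<^sup>2 + (cmod (psi2 k))\<^sup>2) / 2"
    using zero_le_power2[of "cmod (psi1 k) - cmod (psi2 k)"] by (simp add: power2_diff)
  qed
  also have "... = 1" using s1 s2 by (simp add: state_def norm2_n_def sum.distrib flip: sum_divide_distrib)
  finally show "(\<Sum>k\<in>{0..n}. cmod (psi1 k) * cmod (psi2 k)) <= 1" .
 qed (use d in simp)
 finally show ?thesis by simp
qed

text \<open>For fixed \<open>m\<close> the minor solves the eigenvalue equation in \<open>n\<close>
  up to a source of size \<open>d\<close>, and \<open>wronskian\<close> bounds its first value.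
  Solving forward divides by \<open>b\<close>, which is at least \<open>kappa\<close> on the window,
  so each step costs a factor \<open>3 * C / kappa\<close>.\<close>

lemma cross_small:
 assumes s1: "state psi1 E1" and s2: "state psi2 E2" and m: "m \<in> W" and n: "n \<in> W"
 shows "cmod (psi1 m * psi2 n - psi1 n * psi2 m) <= d / kappa * (3 * C / kappa) ^ (m1 + l)"
proof -
 define p where "p = Min (V \<inter> V0)"
 let ?b = "\<lambda>n. b (x + of_int n * w)"
 have ne: "V \<inter> V0 \<noteq> {}" by (rule mass_window(2)[OF s1])
 have pV: "p \<in> V" unfolding p_def using Min_in[OF _ ne] finite_V by auto
 have WI: "q \<in> W \<longleftrightarrow> 0 <= q \<and> q < int N \<and> p <= q \<and> q <= p + int (m1 + l)" for q unfolding W_def p_def by auto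
 have bl: "kappa <= cmod (?b q)" if q: "p <= q" "q <= p + int (m1 + l)" for q
 proof -
  define s where "s = block_start N l p"
  have pI: "0 <= p" "p < int N" using pV by (auto simp: resonant_sites_def)
  have s: "s <= p" "p < s + int l" using block_start[OF sizes(1,2) pI] unfolding s_def by auto
  have "near l eps1 (x + of_int s * w) w E1" using pV unfolding resonant_sites_def s_def by simp
  hence "kappa <= cmod (b (x + of_int s * w + real (nat (q - s)) * w))" by (rule b_large) (use s q in auto)
  moreover have "x + of_int s * w + real (nat (q - s)) * w = x + of_int q * w" using s q by (simp add: algebra_simps)
  ultimately show ?thesis by simp
 qed
 have C1: "1 <= C" "beta <= C" using C beta by linarith+
 have K: "1 <= 3 * C / kappa" "0 <= d / kappa" using kappa C1 d by (auto simp: pos_le_divide_eq)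
 have dE: "\<bar>E1 - E2\<bar> <= d" using s2 by (simp add: state_def abs_minus_commute)
 have main: "cmod (psi1 m * psi2 n - psi1 n * psi2 m) <= d / kappa * (3 * C / kappa) ^ (m1 + l)" if m: "m \<in> W" and n: "n \<in> W" and mn: "m <= n" for m n
 proof -
  define xi where "xi n = psi1 m * psi2 n - psi1 n * psi2 m" for n
  have bnd: "cmod (xi (m + int r)) <= d / kappa * (3 * C / kappa) ^ r \<and> cmod (xi (m + int r + 1)) <= d / kappa * (3 * C / kappa) ^ Suc r"
   if "m + int r + 1 \<in> W" for r using that
  proof (induction r)
   case 0
   have "kappa * cmod (xi (m + 1)) <= cmod (?b (m + 1)) * cmod (xi (m + 1))" using 0 m by (intro mult_right_mono bl) (auto simp: WI)
   also have "... <= d" using wronskian[OF s1 s2, of m] m by (simp add: xi_def norm_mult WI)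
   finally have "cmod (xi (m + 1)) <= d / kappa * 1" using kappa by (simp add: pos_le_divide_eq mult.commute)
   also have "... <= d / kappa * (3 * C / kappa) ^ Suc 0" using K by (intro mult_left_mono) auto
   finally show ?case using K by (simp add: xi_def)
  next
   case (Suc r)
   define q where "q = m + int r + 1"
   have qe: "m + int (Suc r) = q" "m + int (Suc r) + 1 = q + 1" "m + int r = q - 1" unfolding q_def by auto
   have q1W: "q + 1 \<in> W" using Suc.prems by (simp only: qe)
   have qW: "q \<in> W" using q1W m unfolding WI q_def by auto
   define X where "X = d / kappa * (3 * C / kappa) ^ Suc r"
   have IH: "cmod (xi (q - 1)) <= d / kappa * (3 * C / kappa) ^ r" "cmod (xi q) <= X"
    using Suc.IH[folded q_def, OF qW] qe unfolding X_def by simp_all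
   have "d / kappa * (3 * C / kappa) ^ r <= X" unfolding X_def using K by (intro mult_left_mono power_increasing) auto
   with IH have IH': "cmod (xi (q - 1)) <= X" by linarith
   have dX: "d <= X"
   proof -
    have "d <= d / kappa" using d kappa by (simp add: pos_le_divide_eq mult_le_cancel_left2)
    also have "d / kappa * 1 <= X" unfolding X_def using K by (intro mult_left_mono one_le_power) auto
    finally show ?thesis by simp
   qed
   have qI: "q \<in> {0..<int N}" using qW WI by auto
   have "hop x w psi1 q = of_real E1 * psi1 q" "hop x w psi2 q = of_real E2 * psi2 q" using s1 s2 qI unfolding state_def by auto
   hence e: "?b (q + 1) * psi1 (q + 1) = of_real (a (x + of_int q * w)) * psi1 q - cnj (?b q) * psi1 (q - 1) - of_real E1 * psi1 q"
    "?b (q + 1) * psi2 (q + 1) = of_real (a (x + of_int q * w)) * psi2 q - cnj (?b q) * psi2 (q - 1) - of_real E2 * psi2 q"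
    unfolding jacobi_op_def by (simp_all add: algebra_simps)
   have "?b (q + 1) * xi (q + 1) = psi1 m * (?b (q + 1) * psi2 (q + 1)) - psi2 m * (?b (q + 1) * psi1 (q + 1))" unfolding xi_def by (simp add: algebra_simps)
   hence eq: "?b (q + 1) * xi (q + 1) = of_real (a (x + of_int q * w) - E1) * xi q + (- cnj (?b q) * xi (q - 1) + of_real (E1 - E2) * (psi1 m * psi2 q))"
    unfolding e xi_def by (simp add: algebra_simps)
   have "kappa * cmod (xi (q + 1)) <= cmod (?b (q + 1)) * cmod (xi (q + 1))" using q1W by (intro mult_right_mono bl) (auto simp: WI)
   also have "... = cmod (of_real (a (x + of_int q * w) - E1) * xi q + (- cnj (?b q) * xi (q - 1) + of_real (E1 - E2) * (psi1 m * psi2 q)))"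
    unfolding eq[symmetric] by (simp add: norm_mult)
   also have "... <= cmod (of_real (a (x + of_int q * w) - E1) * xi q) + (cmod (- cnj (?b q) * xi (q - 1)) + cmod (of_real (E1 - E2) * (psi1 m * psi2 q)))"
    by (rule order_trans[OF norm_triangle_ineq add_left_mono[OF norm_triangle_ineq]])
   also have "... = \<bar>a (x + of_int q * w) - E1\<bar> * cmod (xi q) + (cmod (?b q) * cmod (xi (q - 1)) + \<bar>E1 - E2\<bar> * (cmod (psi1 m) * cmod (psi2 q)))"
    by (simp only: norm_mult norm_of_real norm_minus_cancel complex_mod_cnj)
   also have "... <= C * X + (C * X + d * (1 * 1))"
   proof (intro add_mono mult_mono IH IH' dE state_le_1[OF s1] state_le_1[OF s2])
    show "\<bar>a (x + of_int q * w) - E1\<bar> <= C" using a_bound[of "x + of_int q * w"] C by linarith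
    show "cmod (?b q) <= C" using b_bound[of "x + of_int q * w"] C1 by linarith
   qed (use C1 d in auto)
   also have "... <= C * X + (C * X + C * X)"
   proof -
    have "0 <= X" using dX d by linarith
    hence "1 * X <= C * X" by (intro mult_right_mono C1)
    thus ?thesis using dX by simp
   qed
   finally have "cmod (xi (q + 1)) <= X * (3 * C / kappa)" using kappa by (simp add: field_simps)
   hence "cmod (xi (q + 1)) <= d / kappa * (3 * C / kappa) ^ Suc (Suc r)" unfolding X_def by (simp add: mult_ac)
   thus ?case unfolding qe using IH(2) by (simp only: X_def)
  qed
  show ?thesis
  proof (cases "m = n")
   case True
   have "0 <= d / kappa * (3 * C / kappa) ^ (m1 + l)" using K by (intro mult_nonneg_nonneg zero_le_power) auto
   thus ?thesis using True by simp
  next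
   case False
   define r where "r = nat (n - m - 1)"
   have r: "n = m + int r + 1" using False mn unfolding r_def by simp
   have "cmod (xi n) <= d / kappa * (3 * C / kappa) ^ Suc r" using bnd[of r] n unfolding r by blast
   also have "... <= d / kappa * (3 * C / kappa) ^ (m1 + l)" using K m n unfolding r by (intro mult_left_mono power_increasing) (auto simp: WI)
   finally show ?thesis unfolding xi_def .
  qed
 qed
 show ?thesis
 proof (cases "m <= n")
  case True
  thus ?thesis by (rule main[OF m n])
 next
  case False
  hence "cmod (psi1 n * psi2 m - psi1 m * psi2 n) <= d / kappa * (3 * C / kappa) ^ (m1 + l)" using main[OF n m] by simp
  thus ?thesis by (simp add: norm_minus_commute)
 qed
qed

text \<open>Both states have mass at least 99/100 in \<open>W\<close>, and by orthogonality their
  inner product over \<open>W\<close> is as small as the one outside, at most 1/100. Twice the Gram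
  determinant is therefore at least 3/2, while \<open>lagrange_identity\<close> and
  \<open>cross_small\<close> bound it by 1.\<close>

lemma not_both_states:
 assumes s1: "state psi1 E1" and s2: "state psi2 E2" and orth: "inner_n N psi1 psi2 = 0"
 shows False
proof -
 let ?I = "{0..<int N}"
 define X where "X = d / kappa * (3 * C / kappa) ^ (m1 + l)"
 have WI: "W \<subseteq> ?I" "finite W" unfolding W_def by auto
 define A B s where "A = (\<Sum>n\<in>W. (cmod (psi1 n))\<^sup>2)" and "B = (\<Sum>n\<in>W. (cmod (psi2 n))\<^sup>2)" and "s = (\<Sum>n\<in>W. cnj (psi1 n) * psi2 n)"
 have AB: "99 / 100 <= A" "99 / 100 <= B" unfolding A_def B_def using mass_window(1) s1 s2 by blast+
 have out: "(\<Sum>n\<in>?I - W. (cmod (psi n))\<^sup>2) <= 1 / 100" if "state psi E" for psi E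
 proof -
  have "(\<Sum>n\<in>?I. (cmod (psi n))\<^sup>2) = (\<Sum>n\<in>?I - W. (cmod (psi n))\<^sup>2) + (\<Sum>n\<in>W. (cmod (psi n))\<^sup>2)" by (rule sum.subset_diff) (use WI in auto)
  thus ?thesis using mass_window(1)[OF that] that by (simp add: state_def norm2_n_def)
 qed
 have "inner_n N psi1 psi2 = (\<Sum>n\<in>?I - W. cnj (psi1 n) * psi2 n) + s" unfolding inner_n_def s_def by (rule sum.subset_diff) (use WI in auto)
 hence "cmod s = cmod (\<Sum>n\<in>?I - W. cnj (psi1 n) * psi2 n)" using orth by (metis add_eq_0_iff norm_minus_cancel)
 also have "... <= (\<Sum>n\<in>?I - W. cmod (psi1 n) * cmod (psi2 n))" by (rule order_trans[OF norm_sum]) (simp add: norm_mult)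
 also have "... <= (\<Sum>n\<in>?I - W. ((cmod (psi1 n))\<^sup>2 + (cmod (psi2 n))\<^sup>2) / 2)"
 proof (rule sum_mono)
  fix k show "cmod (psi1 k) * cmod (psi2 k) <= ((cmod (psi1 k))\<^sup>2 + (cmod (psi2 k))\<^sup>2) / 2"
   using zero_le_power2[of "cmod (psi1 k) - cmod (psi2 k)"] by (simp add: power2_diff)
 qed
 also have "... <= 1 / 100" using out[OF s1] out[OF s2] by (simp add: sum.distrib flip: sum_divide_distrib)
 finally have s: "cmod s <= 1 / 100" .
 have "(cmod s)\<^sup>2 <= (1 / 100)\<^sup>2" using s by (intro power_mono) auto
 moreover have "(99 / 100) * (99 / 100) <= A * B" using AB by (intro mult_mono) auto
 ultimately have low: "3 / 2 <= 2 * (A * B - (cmod s)\<^sup>2)" by (simp add: power2_eq_square)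
 have "2 * (A * B - (cmod s)\<^sup>2) = (\<Sum>m\<in>W. \<Sum>n\<in>W. (cmod (psi1 m * psi2 n - psi1 n * psi2 m))\<^sup>2)"
  unfolding A_def B_def s_def by (rule lagrange_identity[symmetric])
 also have "... <= (\<Sum>m\<in>W. \<Sum>n\<in>W. X\<^sup>2)" unfolding X_def by (intro sum_mono power_mono cross_small[OF s1 s2]) auto
 also have "... = (real (card W) * X)\<^sup>2" by (simp add: power2_eq_square)
 also have "... <= 1\<^sup>2"
 proof (intro power_mono)
  have "card W <= card {Min (V \<inter> V0)..Min (V \<inter> V0) + int (m1 + l)}" unfolding W_def by (intro card_mono) auto
  hence "card W <= m1 + l + 1" by simp
  moreover have X0: "0 <= X" unfolding X_def using d kappa C beta by simp
  ultimately have "real (card W) * X <= real (m1 + l + 1) * X" by (intro mult_right_mono) auto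
  thus "real (card W) * X <= 1" using small_wronskian unfolding X_def by linarith
  show "0 <= real (card W) * X" using X0 by simp
 qed
 finally show False using low by simp
qed

theorem eigenvalue_gap:
 assumes j: "j < N" "k < N" "j \<noteq> k" and E1: "jacobi_eigenvalues a b N x w ! j = E1"
 shows "d < \<bar>E1 - jacobi_eigenvalues a b N x w ! k\<bar>"
proof (rule ccontr)
 assume neg: "\<not> ?thesis"
 define E2 where "E2 = jacobi_eigenvalues a b N x w ! k"
 obtain psi1 psi2 where psi: "vanishes_off N psi1" "vanishes_off N psi2" "0 < norm2_n N psi1" "0 < norm2_n N psi2" "inner_n N psi1 psi2 = 0"
  "\<And>k. k \<in> {0..<int N} ==> hop x w psi1 k = of_real E1 * psi1 k" "\<And>k. k \<in> {0..<int N} ==> hop x w psi2 k = of_real E2 * psi2 k"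
  using jacobi_seq.two_orthogonal_eigenvectors[OF j, where a = a and b = b and x = x and w = w] unfolding E1 E2_def by blast
 define \<phi> where "\<phi> psi = (\<lambda>k. of_real (1 / sqrt (norm2_n N psi)) * psi k)" for psi :: "int => complex"
 have st: "state (\<phi> psi) E" if "vanishes_off N psi" "0 < norm2_n N psi" "\<And>k. k \<in> {0..<int N} ==> hop x w psi k = of_real E * psi k" "\<bar>E - E1\<bar> <= d" for psi E
  unfolding state_def
 proof (intro conjI ballI)
  show "vanishes_off N (\<phi> psi)" using that(1) by (simp add: vanishes_off_def \<phi>_def)
  show "norm2_n N (\<phi> psi) = 1" unfolding \<phi>_def norm2_n_scale using that(2) by (simp add: norm_divide power_divide)
  show "hop x w (\<phi> psi) k = of_real E * \<phi> psi k" if "k \<in> {0..<int N}" for k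
   unfolding \<phi>_def jacobi_op_scale using \<open>\<And>k. k \<in> {0..<int N} ==> hop x w psi k = of_real E * psi k\<close>[OF that] by simp
 qed (fact that(4))
 have "state (\<phi> psi1) E1" by (rule st) (use psi d in auto)
 moreover have "state (\<phi> psi2) E2" by (rule st) (use psi neg in \<open>auto simp: E2_def abs_minus_commute\<close>)
 moreover have "inner_n N (\<phi> psi1) (\<phi> psi2) = 0"
 proof -
  have "inner_n N (\<phi> psi1) (\<phi> psi2) = of_real (1 / sqrt (norm2_n N psi1)) * of_real (1 / sqrt (norm2_n N psi2)) * inner_n N psi1 psi2"
   unfolding inner_n_def \<phi>_def sum_distrib_left by (rule sum.cong) auto
  thus ?thesis using psi(5) by simp
 qed
 ultimately show False by (rule not_both_states)
qed

end

subsection \<open>Choice of parameters\<close>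

lemma mes_compl_le_mono:
 assumes "mes_compl_le S u C" "S' \<subseteq> S" "u <= u'" "C <= C'" shows "mes_compl_le S' u' C'"
proof -
 obtain \<I> where \<I>: "finite \<I>" "real (card \<I>) <= C" "\<forall>I\<in>\<I>. is_interval I" "S \<subseteq> \<Union>\<I>" "emeasure lborel (\<Union>\<I>) <= ennreal u"
  using assms(1) unfolding mes_compl_le_def by blast
 have "ennreal u <= ennreal u'" using assms(3) by (rule ennreal_leI)
 thus ?thesis unfolding mes_compl_le_def using \<I> assms by (intro exI[of _ \<I>]) (auto intro: order_trans)
qed

lemma is_interval_lborel: "is_interval (I :: real set) ==> I \<in> sets lborel" using real_interval_borel_measurable by simp

lemma mes_compl_le_Un:
 assumes "mes_compl_le S u C" "mes_compl_le S' u' C'" "0 <= u" "0 <= u'"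
 shows "mes_compl_le (S \<union> S') (u + u') (C + C')"
proof -
 obtain \<I> where \<I>: "finite \<I>" "real (card \<I>) <= C" "\<forall>I\<in>\<I>. is_interval I" "S \<subseteq> \<Union>\<I>" "emeasure lborel (\<Union>\<I>) <= ennreal u"
  using assms(1) unfolding mes_compl_le_def by blast
 obtain \<J> where \<J>: "finite \<J>" "real (card \<J>) <= C'" "\<forall>I\<in>\<J>. is_interval I" "S' \<subseteq> \<Union>\<J>" "emeasure lborel (\<Union>\<J>) <= ennreal u'"
  using assms(2) unfolding mes_compl_le_def by blast
 have "emeasure lborel (\<Union>(\<I> \<union> \<J>)) <= emeasure lborel (\<Union>\<I>) + emeasure lborel (\<Union>\<J>)"
  unfolding Union_Un_distrib using \<I> \<J> by (intro emeasure_subadditive sets.finite_Union) (auto intro: is_interval_lborel simp del: sets_lborel)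
 also have "... <= ennreal u + ennreal u'" using \<I> \<J> by (intro add_mono)
 also have "... = ennreal (u + u')" using assms by (simp add: ennreal_plus)
 finally have "emeasure lborel (\<Union>(\<I> \<union> \<J>)) <= ennreal (u + u')" .
 moreover have "real (card (\<I> \<union> \<J>)) <= C + C'" using card_Un_le[of \<I> \<J>] \<I>(2) \<J>(2) by linarith
 ultimately show ?thesis unfolding mes_compl_le_def using \<I> \<J> by (intro exI[of _ "\<I> \<union> \<J>"]) auto
qed

lemma mes_compl_le_empty: "0 <= u ==> 0 <= C ==> mes_compl_le {} u C" unfolding mes_compl_le_def by (intro exI[of _ "{}"]) auto

lemma mes_compl_le_UN:
 assumes "finite F" "\<And>i. i \<in> F ==> mes_compl_le (S i) u C" "0 <= u" "0 <= C"
 shows "mes_compl_le (\<Union>i\<in>F. S i) (real (card F) * u) (real (card F) * C)" using assms(1,2)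
proof (induction F rule: finite_induct)
 case (insert i F)
 have "mes_compl_le (S i \<union> (\<Union>i\<in>F. S i)) (u + real (card F) * u) (C + real (card F) * C)"
  by (rule mes_compl_le_Un) (use insert assms in auto)
 thus ?case using insert by (simp add: algebra_simps)
qed (simp add: mes_compl_le_empty)

text \<open>Exceptional sets stay implicit, their bounds add up under conjunction, and the predicate
  can be nested: frequencies outside, energies inside.\<close>

definition "holds_off u C P \<longleftrightarrow> (\<exists>S. mes_compl_le S u C \<and> (\<forall>x. x \<notin> S --> P x))"

lemma holds_off_mono:
 "holds_off u C P ==> u <= u' ==> C <= C' ==> (\<And>x. P x ==> P' x) ==> holds_off u' C' P'"
 unfolding holds_off_def using mes_compl_le_mono[OF _ order_refl] by meson

lemma holds_off_conj:
 "holds_off u C P ==> holds_off u' C' P' ==> 0 <= u ==> 0 <= u' ==> holds_off (u + u') (C + C') (\<lambda>x. P x \<and> P' x)"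
 unfolding holds_off_def using mes_compl_le_Un by (metis Un_iff)

lemma holds_off_ball:
 assumes "finite F" "\<And>i. i \<in> F ==> holds_off u C (P i)" "0 <= u" "0 <= C"
 shows "holds_off (real (card F) * u) (real (card F) * C) (\<lambda>x. \<forall>i\<in>F. P i x)"
proof -
 obtain S where "\<forall>i\<in>F. mes_compl_le (S i) u C \<and> (\<forall>x. x \<notin> S i --> P i x)"
  using assms(2) unfolding holds_off_def by metis
 thus ?thesis unfolding holds_off_def using mes_compl_le_UN[OF assms(1) _ assms(3,4), of S] by blast
qed

lemma mes_compl_le_interval: "0 <= d ==> mes_compl_le {u..u + d} d 1"
 unfolding mes_compl_le_def by (intro exI[of _ "{{u..u + d}}"]) (auto simp: is_interval_cc)

lemma mes_compl_le_intervals: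
 assumes "finite F" "0 <= d" shows "mes_compl_le (\<Union>u\<in>F. {h u..h u + d}) (real (card F) * d) (real (card F))"
 using mes_compl_le_UN[OF assms(1), of "\<lambda>u. {h u..h u + d}" d 1] mes_compl_le_interval[OF assms(2)] assms(2) by simp

lemma sum_inverse_le_ln: "1 <= n ==> (\<Sum>m\<in>{1..n}. 1 / real m) <= 1 + ln (real n)"
proof (induction n rule: nat_induct_at_least)
 case (Suc n)
 have n: "0 < real n" using Suc by simp
 have "1 / real (Suc n) <= - ln (1 - 1 / real (Suc n))" using ln_add_one_self_le_self2[of "- (1 / real (Suc n))"] Suc by simp
 also have "1 - 1 / real (Suc n) = real n / real (Suc n)" by (simp add: field_simps)
 also have "- ln (real n / real (Suc n)) = ln (real (Suc n)) - ln (real n)" using n by (simp add: ln_div)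
 finally show ?case using Suc by simp
qed simp

context resonance
begin

text \<open>The distances are grouped into levels from \<open>r i\<close> to
  \<open>r i powr (3/2)\<close>. Unless capped, \<open>J2\<close> is about the square of
  \<open>r i / l\<close>, and \<open>(r i)\<^sup>2\<close> is at least \<open>m powr (4/3)\<close>,
  so the sum of \<open>1 / J2\<close> gains the factor \<open>r0 powr (-1/3)\<close> over a harmonic
  sum. Levels that grow doubly exponentially number only about \<open>ln (ln mhi)\<close>, which
  matters because each level excludes energies of its own.\<close>

theorem elimination_range:
 fixes eps \<nu> M r0 E' E'' :: real and mhi H :: nat
 assumes eps: "0 < eps" and \<nu>: "0 < \<nu>" and M: "0 < M" and r0: "3 <= r0" "2 * real l <= r0" and E: "E' < E''"
  and mhi: "1 <= mhi" "4 * eps * real mhi <= 1" and H: "0 < H" "A * real (l + mhi) <= eps * real H"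
 shows "holds_off (40 * M ^ 4 * (8 * eps * real mhi + 4 * (real l)\<^sup>2 * (1 + ln (real mhi)) / r0 powr (1/3)) / \<nu>) (real H)
  (\<lambda>w. w \<in> {0..1} --> holds_off (\<nu> * (E'' - E' + eps) + (3 * \<bar>ln (ln (real mhi))\<bar> + 1) * (2 * real l * (10 * A + 1) / M)) ((E'' - E') / eps + 1)
    (\<lambda>E. E \<in> {E'<..<E''} --> (\<forall>m. r0 <= real m \<and> m <= mhi --> \<not> double_res m eps w E)))"
 (is "holds_off ?u _ (\<lambda>w. _ --> holds_off ?v _ (?P w))")
proof -
 define r where "r i = r0 powr ((3/2) ^ i)" for i :: nat
 have lr0: "1 <= ln r0"
 proof -
  have "exp 1 <= r0" using exp_le r0 by linarith
  thus ?thesis using r0 by (subst ln_ge_iff) auto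
 qed
 have l1: "1 <= real l" using l_pos by simp
 have r_ge: "r0 <= r i" for i
 proof -
  have "r0 powr 1 <= r i" unfolding r_def using r0 by (intro powr_mono one_le_power) auto
  thus ?thesis using r0 by simp
 qed
 have r_Suc: "r (Suc i) = r i powr (3/2)" for i unfolding r_def by (simp add: powr_powr mult.commute)
 have r_ln: "ln (r i) = (3/2) ^ i * ln r0" for i unfolding r_def using r0 by (simp add: ln_powr)
 define Ms where "Ms = {m. r0 <= real m \<and> m <= mhi}"
 have Ms: "finite Ms" "Ms \<subseteq> {1..mhi}" unfolding Ms_def using r0 by (auto intro: finite_subset[of _ "{..mhi}"])
 have "\<exists>i. r i <= real m \<and> real m < r (Suc i)" if m: "m \<in> Ms" for m
 proof -
  have m0: "r0 <= real m" using m by (simp add: Ms_def)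
  obtain n where n: "ln (real m) < (3/2) ^ n" using real_arch_pow[of "3/2" "ln (real m)"] by auto
  have "ln (real m) < ln (r n)"
  proof -
   have "(3/2) ^ n * 1 <= (3/2) ^ n * ln r0" using lr0 by (intro mult_left_mono) auto
   thus ?thesis using n unfolding r_ln by linarith
  qed
  hence mn: "real m < r n" using r_ge[of n] r0 m0 by (subst (asm) ln_less_cancel_iff) auto
  define k where "k = (LEAST i. real m < r i)"
  have k: "real m < r k" unfolding k_def by (rule LeastI[of _ n]) (rule mn)
  have "k \<noteq> 0"
  proof
   assume "k = 0"
   hence "r k = r0" using r0 by (simp add: r_def)
   thus False using k m0 by simp
  qed
  then obtain i where i: "k = Suc i" by (cases k) auto
  have "\<not> real m < r i" using not_less_Least[of i "\<lambda>i. real m < r i"] i unfolding k_def by simp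
  hence "r i <= real m" by simp
  thus ?thesis using k unfolding i by blast
 qed
 hence "\<forall>m\<in>Ms. \<exists>i. r i <= real m \<and> real m < r (Suc i)" by blast
 from bchoice[OF this] obtain lev where lev': "\<forall>m\<in>Ms. r (lev m) <= real m \<and> real m < r (Suc (lev m))" by blast
 have lev: "\<And>m. m \<in> Ms ==> r (lev m) <= real m" "\<And>m. m \<in> Ms ==> real m < r (Suc (lev m))" using lev' by blast+
 define Ls where "Ls = lev ` Ms"
 have Ls_le: "r i <= real mhi" if "i \<in> Ls" for i
 proof -
  have "\<exists>m\<in>Ms. i = lev m" using that unfolding Ls_def by blast
  then obtain m where m: "m \<in> Ms" "i = lev m" by blast
  thus ?thesis using lev(1)[OF m(1)] unfolding Ms_def by simp
 qed
 have card_Ls: "real (card Ls) <= 3 * \<bar>ln (ln (real mhi))\<bar> + 1"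
 proof -
  \<comment> \<open>The factor 3 comes from \<open>1 / 3 <= ln (3 / 2)\<close>.\<close>
  have "real i <= 3 * \<bar>ln (ln (real mhi))\<bar>" if i: "i \<in> Ls" for i
  proof -
   have "(3/2) ^ i * 1 <= (3/2) ^ i * ln r0" using lr0 by (intro mult_left_mono) auto
   also have "... = ln (r i)" by (rule r_ln[symmetric])
   also have "... <= ln (real mhi)" using Ls_le[OF i] r_ge[of i] r0 by (subst ln_le_cancel_iff) auto
   finally have le: "(3/2) ^ i <= ln (real mhi)" by simp
   have "1 / 3 <= ln (3 / 2 :: real)"
   proof -
    have "exp (1 / 3 :: real) ^ 3 = exp 1" unfolding exp_of_nat_mult[symmetric] by simp
    hence "\<not> (3 / 2) ^ 3 < exp (1 / 3 :: real) ^ 3" using exp_le by (simp add: power3_eq_cube)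
    hence "exp (1 / 3 :: real) <= 3 / 2" using power_strict_mono[of "3 / 2" "exp (1 / 3 :: real)" 3] by linarith
    thus ?thesis by (subst ln_ge_iff) auto
   qed
   hence "real i * (1/3) <= real i * ln (3/2)" by (intro mult_left_mono) auto
   also have "... = ln ((3/2) ^ i)" by (simp add: ln_realpow)
   also have "... <= ln (ln (real mhi))" using le by (subst ln_le_cancel_iff) (auto intro: less_le_trans[of _ "(3/2) ^ i"])
   finally show ?thesis by linarith
  qed
  hence "Ls \<subseteq> {..nat \<lfloor>3 * \<bar>ln (ln (real mhi))\<bar>\<rfloor>}" by (fastforce intro: le_nat_floor)
  from card_mono[OF _ this] have "card Ls <= nat \<lfloor>3 * \<bar>ln (ln (real mhi))\<bar>\<rfloor> + 1" by simp
  thus ?thesis by linarith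
 qed
 define J1 where "J1 i = nat \<lfloor>r i / real l\<rfloor>" for i
 \<comment> \<open>The cap keeps the grid step above the energy resolution, and it causes the term
   \<open>8 * eps * mhi\<close> in the bound.\<close>
 define J2 where "J2 i = min (nat \<lfloor>1 / (4 * eps)\<rfloor>) (nat \<lfloor>r i * real (J1 i) / real l\<rfloor>)" for i
 have half: "x / 2 <= real (nat \<lfloor>x\<rfloor>)" "real (nat \<lfloor>x\<rfloor>) <= x" "0 < nat \<lfloor>x\<rfloor>" if "1 <= x" for x :: real
 proof -
  have "1 <= \<lfloor>x\<rfloor>" using that by simp
  hence "1 <= real_of_int \<lfloor>x\<rfloor>" "real (nat \<lfloor>x\<rfloor>) = real_of_int \<lfloor>x\<rfloor>" by simp_all
  thus "x / 2 <= real (nat \<lfloor>x\<rfloor>)" by linarith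
  show "real (nat \<lfloor>x\<rfloor>) <= x" using that by linarith
  show "0 < nat \<lfloor>x\<rfloor>" using that by linarith
 qed
 have e4: "1 <= 1 / (4 * eps)"
 proof -
  have "4 * eps * 1 <= 4 * eps * real mhi" using mhi eps by (intro mult_left_mono) auto
  hence "4 * eps <= 1" using mhi by linarith
  thus ?thesis using eps by (simp add: pos_le_divide_eq)
 qed
 have rl: "1 <= r i / real l" for i using r_ge[of i] r0 l1 by (simp add: pos_le_divide_eq)
 have J1: "r i / (2 * real l) <= real (J1 i)" "real l * real (J1 i) <= r i" "0 < J1 i" for i
  using half[OF rl, of i] l1 unfolding J1_def by (simp_all add: pos_le_divide_eq mult.commute)
 have rJ: "(r i)\<^sup>2 / (2 * (real l)\<^sup>2) <= r i * real (J1 i) / real l" for i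
 proof -
  have "r i * (r i / (2 * real l)) / real l <= r i * real (J1 i) / real l" using J1(1) r_ge[of i] r0 by (intro divide_right_mono mult_left_mono) auto
  thus ?thesis by (simp add: power2_eq_square)
 qed
 have rJ1: "1 <= r i * real (J1 i) / real l" for i
 proof -
  have "2 * real l <= r i" using r_ge[of i] r0 by linarith
  hence "(2 * real l)\<^sup>2 <= (r i)\<^sup>2" using l1 by (intro power_mono) auto
  hence "2 * (real l)\<^sup>2 <= (r i)\<^sup>2" using zero_le_power2[of "real l"] by (simp add: power_mult_distrib) (use zero_le_power2[of "real l"] in linarith)
  hence "1 <= (r i)\<^sup>2 / (2 * (real l)\<^sup>2)" using l1 by (simp add: pos_le_divide_eq)
  thus ?thesis using rJ[of i] by linarith
 qed
 have J2: "0 < J2 i" "real (J2 i) <= 1 / (4 * eps)" "real (J2 i) <= r i * real (J1 i) / real l" for i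
 proof -
  show "0 < J2 i" using half(3)[OF e4] half(3)[OF rJ1, of i] unfolding J2_def by simp
  have "real (J2 i) <= real (nat \<lfloor>1 / (4 * eps)\<rfloor>)" "real (J2 i) <= real (nat \<lfloor>r i * real (J1 i) / real l\<rfloor>)"
   unfolding J2_def by (simp_all only: of_nat_le_iff min.cobounded1 min.cobounded2)
  thus "real (J2 i) <= 1 / (4 * eps)" "real (J2 i) <= r i * real (J1 i) / real l" using half(2)[OF e4] half(2)[OF rJ1, of i] by linarith+
 qed
 have J2inv: "1 / real (J2 i) <= 8 * eps + 4 * (real l)\<^sup>2 / (r i)\<^sup>2" for i
 proof (cases "nat \<lfloor>1 / (4 * eps)\<rfloor> <= nat \<lfloor>r i * real (J1 i) / real l\<rfloor>")
  case True
  hence "1 / (4 * eps) / 2 <= real (J2 i)" using half(1)[OF e4] unfolding J2_def by simp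
  hence "1 / real (J2 i) <= 1 / (1 / (4 * eps) / 2)" using eps J2(1)[of i] by (intro divide_left_mono) auto
  also have "... = 8 * eps" by simp
  also have "... <= 8 * eps + 4 * (real l)\<^sup>2 / (r i)\<^sup>2" by simp
  finally show ?thesis .
 next
  case False
  hence "r i * real (J1 i) / real l / 2 <= real (J2 i)" using half(1)[OF rJ1[of i]] unfolding J2_def by simp
  hence "(r i)\<^sup>2 / (4 * (real l)\<^sup>2) <= real (J2 i)" using rJ[of i] by (simp add: field_simps)
  moreover have "0 < (r i)\<^sup>2 / (4 * (real l)\<^sup>2)" using r_ge[of i] r0 l1 by simp
  ultimately have "1 / real (J2 i) <= 1 / ((r i)\<^sup>2 / (4 * (real l)\<^sup>2))" using J2(1)[of i] by (intro divide_left_mono mult_pos_pos) auto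
  also have "... = 4 * (real l)\<^sup>2 / (r i)\<^sup>2" by simp
  also have "... <= 8 * eps + 4 * (real l)\<^sup>2 / (r i)\<^sup>2" using eps by simp
  finally show ?thesis .
 qed
 have r2: "real m * r0 powr (1/3) <= (r (lev m))\<^sup>2" if m: "m \<in> Ms" for m
 proof -
  have m0: "r0 <= real m" "0 < real m" using m r0 by (auto simp: Ms_def)
  have rp: "0 < r (lev m)" using r_ge[of "lev m"] r0 by linarith
  have "real m * r0 powr (1/3) <= real m powr 1 * real m powr (1/3)" using m0 r0 by (intro mult_mono powr_mono2) auto
  also have "... = real m powr (4/3)" unfolding powr_add[symmetric] by simp
  also have "... <= (r (lev m) powr (3/2)) powr (4/3)" using lev(2)[OF m] unfolding r_Suc by (intro powr_mono2) auto
  also have "... = (r (lev m))\<^sup>2" using rp by (simp add: powr_powr)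
  finally show ?thesis .
 qed
 define G where "G = nat \<lceil>(E'' - E') / eps\<rceil>"
 have Gq: "0 < (E'' - E') / eps" using E eps by simp
 have G: "0 < G" "(E'' - E') / eps <= real G" "real G <= (E'' - E') / eps + 1" unfolding G_def using Gq by linarith+
 have Geps: "E'' <= E' + real G * eps" "real G * eps <= E'' - E' + eps"
 proof -
  show "E'' <= E' + real G * eps" using G(2) eps by (simp add: pos_divide_le_eq)
  have "real G * eps <= ((E'' - E') / eps + 1) * eps" using G(3) eps by (intro mult_right_mono) auto
  thus "real G * eps <= E'' - E' + eps" using eps by (simp add: distrib_right)
 qed
 obtain C where C: "finite C" "card C <= H"
  "emeasure lborel (\<Union>u\<in>C. {u..u + 1 / real H}) <= ennreal ((\<Sum>m\<in>Ms. 40 * M ^ 4 / real (J2 (lev m))) / \<nu>)"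
  "\<forall>w\<in>{0..1} - (\<Union>u\<in>C. {u..u + 1 / real H}). \<exists>Bad \<subseteq> {..<G}.
    real (card Bad) <= \<nu> * real G + real (card Ls) * (2 * real l * (10 * A + 1) / (M * eps)) \<and>
    (\<forall>E. E' <= E \<and> E < E' + real G * eps \<and> (\<forall>g\<in>Bad. E \<notin> {E' + real g * eps..E' + real g * eps + eps}) -->
     (\<forall>m\<in>Ms. \<not> double_res m eps w E))"
 proof -
  have Jeps: "4 * eps * real (J1 i) <= 1 \<and> 4 * eps * real (J2 i) <= 1" if i: "i \<in> Ls" for i
  proof
   have "1 * real (J1 i) <= real l * real (J1 i)" using l1 by (intro mult_right_mono) auto
   hence "real (J1 i) <= real mhi" using J1(2)[of i] Ls_le[OF i] by linarith
   hence "4 * eps * real (J1 i) <= 4 * eps * real mhi" using eps by (intro mult_left_mono) auto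
   thus "4 * eps * real (J1 i) <= 1" using mhi by linarith
   show "4 * eps * real (J2 i) <= 1" using J2(2)[of i] eps by (simp add: pos_le_divide_eq mult.commute)
  qed
  have Jm: "l * J1 (lev m) <= m \<and> l * J2 (lev m) <= m * J1 (lev m) \<and> m <= mhi" if m: "m \<in> Ms" for m
  proof (intro conjI)
   have a: "real l * real (J1 (lev m)) <= real m" using J1(2)[of "lev m"] lev(1)[OF m] by linarith
   thus "l * J1 (lev m) <= m" by (simp flip: of_nat_mult)
   have "real l * real (J2 (lev m)) <= r (lev m) * real (J1 (lev m))" using J2(3)[of "lev m"] l1 by (simp add: pos_le_divide_eq mult.commute)
   also have "... <= real m * real (J1 (lev m))" using lev(1)[OF m] by (intro mult_right_mono) auto
   finally show "l * J2 (lev m) <= m * J1 (lev m)" by (simp flip: of_nat_mult)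
   show "m <= mhi" using m by (simp add: Ms_def)
  qed
  have lv: "\<And>m. m \<in> Ms ==> lev m \<in> Ls" unfolding Ls_def by blast
  have fL: "finite Ls" unfolding Ls_def using Ms by simp
  have Jpos: "\<And>i. i \<in> Ls ==> 0 < J1 i \<and> 0 < J2 i" using J1(3) J2(1) by blast
  show ?thesis
   by (rule exE[OF elimination[OF eps G(1) \<nu> M fL Ms(1) lv Jpos Jeps Jm H, of E']]; (assumption | (elim conjE, rule that, assumption+)))
 qed
 define \<Omega> where "\<Omega> = (\<Union>u\<in>C. {u..u + 1 / real H})"
 have sumb: "(\<Sum>m\<in>Ms. 40 * M ^ 4 / real (J2 (lev m))) <= 40 * M ^ 4 * (8 * eps * real mhi + 4 * (real l)\<^sup>2 * (1 + ln (real mhi)) / r0 powr (1/3))"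
 proof -
  have "1 / real (J2 (lev m)) <= 8 * eps + 4 * (real l)\<^sup>2 / r0 powr (1/3) * (1 / real m)" if m: "m \<in> Ms" for m
  proof -
   have m0: "0 < real m" using m r0 by (auto simp: Ms_def)
   have "4 * (real l)\<^sup>2 / (r (lev m))\<^sup>2 <= 4 * (real l)\<^sup>2 / (real m * r0 powr (1/3))"
   proof (rule divide_left_mono[OF r2[OF m]])
    have rp: "0 < r (lev m)" using r_ge[of "lev m"] r0 by linarith
    show "0 < (r (lev m))\<^sup>2 * (real m * r0 powr (1/3))" using rp m0 r0 by simp
   qed simp
   also have "... = 4 * (real l)\<^sup>2 / r0 powr (1/3) * (1 / real m)" by simp
   finally show ?thesis using J2inv[of "lev m"] by linarith
  qed
  hence "(\<Sum>m\<in>Ms. 1 / real (J2 (lev m))) <= (\<Sum>m\<in>Ms. 8 * eps + 4 * (real l)\<^sup>2 / r0 powr (1/3) * (1 / real m))" by (rule sum_mono)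
  also have "... <= (\<Sum>m\<in>{1..mhi}. 8 * eps + 4 * (real l)\<^sup>2 / r0 powr (1/3) * (1 / real m))" by (rule sum_mono2) (use Ms eps in auto)
  also have "... = 8 * eps * real mhi + 4 * (real l)\<^sup>2 / r0 powr (1/3) * (\<Sum>m\<in>{1..mhi}. 1 / real m)"
   by (simp add: sum.distrib sum_distrib_left)
  also have "... <= 8 * eps * real mhi + 4 * (real l)\<^sup>2 / r0 powr (1/3) * (1 + ln (real mhi))"
   by (intro add_left_mono mult_left_mono sum_inverse_le_ln mhi) auto
  finally have "40 * M ^ 4 * (\<Sum>m\<in>Ms. 1 / real (J2 (lev m))) <= 40 * M ^ 4 * (8 * eps * real mhi + 4 * (real l)\<^sup>2 / r0 powr (1/3) * (1 + ln (real mhi)))"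
   using M by (intro mult_left_mono) auto
  thus ?thesis by (simp add: sum_distrib_left)
 qed
 have "mes_compl_le \<Omega> ?u (real H)" unfolding mes_compl_le_def
 proof (intro exI[of _ "(\<lambda>u. {u..u + 1 / real H}) ` C"] conjI)
  show "real (card ((\<lambda>u. {u..u + 1 / real H}) ` C)) <= real H" using card_image_le[OF C(1), of "\<lambda>u. {u..u + 1 / real H}"] C(2) by linarith
  show "emeasure lborel (\<Union> ((\<lambda>u. {u..u + 1 / real H}) ` C)) <= ennreal ?u"
   using sumb \<nu> by (intro order_trans[OF C(3)] ennreal_leI divide_right_mono) auto
 qed (auto simp: C(1) \<Omega>_def is_interval_cc)
 moreover have "holds_off ?v ((E'' - E') / eps + 1) (?P w)" if w: "w \<notin> \<Omega>" "w \<in> {0..1}" for w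
 proof -
  obtain Bad where Bad: "Bad \<subseteq> {..<G}" "real (card Bad) <= \<nu> * real G + real (card Ls) * (2 * real l * (10 * A + 1) / (M * eps))"
   "\<forall>E. E' <= E \<and> E < E' + real G * eps \<and> (\<forall>g\<in>Bad. E \<notin> {E' + real g * eps..E' + real g * eps + eps}) --> (\<forall>m\<in>Ms. \<not> double_res m eps w E)"
   using bspec[OF C(4), folded \<Omega>_def] w by (metis (no_types, lifting) DiffI)
  define \<E> where "\<E> = (\<Union>g\<in>Bad. {E' + real g * eps..E' + real g * eps + eps})"
  have fB: "finite Bad" using Bad(1) finite_subset by blast
  have m1: "mes_compl_le \<E> (real (card Bad) * eps) (real (card Bad))" unfolding \<E>_def using mes_compl_le_intervals[OF fB] eps by simp
  have m2: "real (card Bad) <= (E'' - E') / eps + 1" using card_mono[OF _ Bad(1)] G(3) by simp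
  have m3: "real (card Bad) * eps <= ?v"
  proof -
   have q0: "0 <= 2 * real l * (10 * A + 1) / M" using A_ge M by simp
   have "real (card Bad) * eps <= (\<nu> * real G + real (card Ls) * (2 * real l * (10 * A + 1) / (M * eps))) * eps" using Bad(2) eps by (intro mult_right_mono) auto
   also have "... = \<nu> * (real G * eps) + real (card Ls) * (2 * real l * (10 * A + 1) / M)" using eps by (simp add: distrib_right)
   also have "... <= ?v" using Geps(2) \<nu> card_Ls q0 by (intro add_mono mult_left_mono mult_right_mono) auto
   finally show ?thesis .
  qed
  have "mes_compl_le \<E> ?v ((E'' - E') / eps + 1)" by (rule mes_compl_le_mono[OF m1 order_refl m3 m2])
  moreover have "?P w E" if "E \<notin> \<E>" for E
  proof (intro allI impI)
   fix m assume E: "E \<in> {E'<..<E''}" and m: "r0 <= real m \<and> m <= mhi"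
   have "E' <= E" "E < E' + real G * eps" using E Geps(1) by auto
   moreover have "\<forall>g\<in>Bad. E \<notin> {E' + real g * eps..E' + real g * eps + eps}" using that unfolding \<E>_def by blast
   ultimately have "\<forall>m\<in>Ms. \<not> double_res m eps w E" using Bad(3) by blast
   thus "\<not> double_res m eps w E" using m unfolding Ms_def by blast
  qed
  ultimately show ?thesis unfolding holds_off_def by blast
 qed
 ultimately show ?thesis unfolding holds_off_def by blast
qed

end

text \<open>
 Here \<open>T = ln N\<close>. Short blocks have length between \<open>T powr (1/100) / 2\<close> and \<open>Q * T powr (1/100)\<close>, and their
 double resonances are excluded up to distance \<open>T ^ 30\<close>; long blocks have length about \<open>cL * T\<close> and their
 double resonances at resolution \<open>1 / (N * T powr 5.5)\<close> are excluded at distances from \<open>T ^ 27\<close> to \<open>N\<close>.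
\<close>

definition
 "assembly_ok Q gamma beta kappad cX \<Delta> Ir C c' k1 n0 cL (T::real) \<longleftrightarrow>
   3 <= T \<and> 6 <= T powr (1/100) \<and> n0 <= T powr (1/100) \<and> 20 * ln 2 <= gamma * T powr (1/100) \<and>
   4 * exp (- ((T powr (1/100) / 2) powr (1/6))) * (2 * T ^ 30) <= 1 \<and> 3 * beta / T + exp (- ((T powr (1/100) / 2) powr (1/6))) <= T powr (-1/2) \<and>
   320 * (Q * T powr (1/100)) ^ 9 * exp (- ((T powr (1/100) / 2) powr (1/6))) * (2 * T ^ 30) + 320 * (1 + ln (2 * T ^ 30)) / T powr (1/100) <= T powr (-1/200) \<and>
   (2 * (\<Delta> + 1) + (3 * ln (ln (2 * T ^ 30)) + 1) * (4 * (30 * beta + 1))) / T powr (1/100) <= T powr (-1/200) \<and>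
   cX * (10 * (Q * T powr (1/100)) ^ 37) * (2 * T powr (-1/2)) <= T powr (-1/200) \<and>
   40 * T powr (44/10) * (8 * T powr (-55/10) + 4 * (cL * T)\<^sup>2 * (1 + T) / T ^ 9) / T powr (-1/20) <= T powr (-1/200) \<and>
   T powr (-1/20) * (\<Delta> + 1) + (3 * ln T + 1) * (2 * (cL * T) * (30 * beta + 1) / T powr (11/10)) <= T powr (-1/200) \<and>
   Ir * (3 * beta * (Q * T powr (1/100) + 2 * T ^ 30) * exp ((T powr (1/100)) powr (1/6)) + 1) + (3 * beta * (cL * T + exp T) * (exp T * T powr (55/10)) + 1) <= exp T ^ 2 * T powr 6 \<and>
   Ir * (\<Delta> * exp ((T powr (1/100)) powr (1/6)) + 1) + Ir * (cX * (10 * (Q * T powr (1/100)) ^ 37)) + (\<Delta> * (exp T * T powr (55/10)) + 1) <= exp T * T ^ 6 \<and>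
   2 * Ir * T powr (-1/200) <= ln T powr (- (1/2)) \<and>
   2 * (Q * T powr (1/100)) ^ 36 + (60 * T / gamma + 2 * (Q * T powr (1/100))) + 3 <= 200 * T / gamma / 2 - 1 \<and>
   cL * T + (60 * T / gamma + 2 * (Q * T powr (1/100))) + Q * T powr (1/100) <= T ^ 30 \<and> T ^ 27 + 1 + cL * T + Q * T powr (1/100) <= T ^ 30 \<and>
   Q * T powr (1/100) <= exp T \<and> cL * T <= exp T \<and>
   64 * beta\<^sup>2 * T ^ 11 * exp (- 3 * T) + (T ^ 27 + 1 + cL * T) * exp (- (gamma * T powr (1/100) / 10)) <= 1 / 100 \<and>
   ln (2 * (Q * T powr (1/100)) ^ 36 + 1) + (2 * (Q * T powr (1/100)) ^ 36 + 1) * (ln (3 * C / c') + k1 * ln T) <= T \<and>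
   kappad * (Q * T powr (1/100)) <= T \<and> 2 * T powr (55/10) <= T powr 6 \<and> 4 * T powr (-55/10) <= 1 \<and> 2 * (cL * T) <= T ^ 27"

lemma eventually_assembly_ok:
 assumes pos: "1 <= Q" "0 < gamma" "1 <= beta" "1 <= kappad" "0 < cX" "0 < \<Delta>" "0 < Ir" "1 < C" "0 < c'" "0 < k1" "0 < n0" and cL: "cL = 200 / gamma + 1"
 shows "eventually (assembly_ok Q gamma beta kappad cX \<Delta> Ir C c' k1 n0 cL) at_top"
proof -
 have "0 < Q" "0 < beta" "0 < kappad" "0 < cL" using pos cL by (auto intro: add_pos_pos)
 note p = this pos
 show ?thesis unfolding assembly_ok_def by (intro eventually_conj) (use p in real_asymp)+
qed

text \<open>The conclusion for one \<open>N\<close>, with exponent 1/2 and list indices from 0. The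
  Lyapunov exponent is bounded below at each frequency separately, so that a threshold for
  \<open>N\<close> need not depend on the interval of frequencies.\<close>

definition
 "separated a b c alpha gamma E' E'' p N \<longleftrightarrow> holds_off (ln (ln (real N)) powr (- (1/2))) (real N ^ 2 * ln (real N) powr p)
  (\<lambda>w. w \<in> diophantine c alpha --> (\<forall>E\<in>{E'<..<E''}. gamma < lyapunov a b w E) -->
   holds_off (ln (ln (real N)) powr (- (1/2))) (real N * ln (real N) ^ 6)
    (\<lambda>E. E \<in> {E'<..<E''} --> (\<forall>x j k. j < N \<and> k < N \<and> k \<noteq> j \<and> jacobi_eigenvalues a b N x w ! j = E -->
     1 / (real N * ln (real N) powr p) <= \<bar>E - jacobi_eigenvalues a b N x w ! k\<bar>)))"

context jacobi_data_zeros
begin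

lemma near_add_int: "near l t (x + of_int k) w E = near l t x w E" if "1 <= l"
 using resonance.res_add_int[OF resonance_spec[OF that]] unfolding near_def resonance.res_def[OF resonance_spec[OF that]] .

text \<open>If \<open>b\<close> is small at \<open>y + j * w\<close>, this phase is close to some
  \<open>z\<close> in \<open>X\<close> modulo 1, and the block at \<open>y\<close> has nearly the
  spectrum of the block at \<open>z - j * w\<close>. So it suffices to exclude the energies near the
  finitely many eigenvalues of the latter blocks.\<close>

lemma zeros_avoided:
 assumes l: "1 <= l" and rho: "0 < rho" "3 * beta * rho + eps1 <= t" and eps1: "0 <= eps1"
 shows "holds_off (real (card X * ((v + 1) * l)) * (2 * t)) (real (card X * ((v + 1) * l)))
  (\<lambda>E. \<forall>y j. near l eps1 y w E --> j <= v --> min 1 cb * rho ^ kb <= cmod (b (y + real j * w)))"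
proof -
 define F where "F = (\<Union>z\<in>X. \<Union>j\<in>{..v}. spec l (z - real j * w) w)"
 have fF: "finite F" unfolding F_def using finite_X finite_spec by blast
 have inner: "card (\<Union>j\<in>{..v}. spec l (z - real j * w) w) <= (v + 1) * l" for z
  using card_UN_le_bound[of "{..v}" "\<lambda>j. spec l (z - real j * w) w" "real l"] card_spec by (simp flip: of_nat_mult of_nat_Suc add: mult.commute)
 have cF: "card F <= card X * ((v + 1) * l)" unfolding F_def
  using card_UN_le_bound[OF finite_X, of "\<lambda>z. \<Union>j\<in>{..v}. spec l (z - real j * w) w" "real ((v + 1) * l)"] inner by (simp only: of_nat_le_iff flip: of_nat_mult)
 define \<E> where "\<E> = (\<Union>e\<in>F. {(e - t)..(e - t) + 2 * t})"
 have t0: "0 <= 2 * t" using rho eps1 beta mult_nonneg_nonneg[of "3 * beta" rho] by linarith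
 have "mes_compl_le \<E> (real (card F) * (2 * t)) (real (card F))" unfolding \<E>_def by (rule mes_compl_le_intervals[OF fF t0])
 moreover have "real (card F) * (2 * t) <= real (card X * ((v + 1) * l)) * (2 * t)"
  by (rule mult_right_mono[OF _ t0]) (use cF in \<open>simp only: of_nat_le_iff\<close>)
 ultimately have m: "mes_compl_le \<E> (real (card X * ((v + 1) * l)) * (2 * t)) (real (card X * ((v + 1) * l)))"
  using cF by - (rule mes_compl_le_mono[OF _ order_refl], assumption+, simp only: of_nat_le_iff)
 have "E \<in> \<E>" if nr: "near l eps1 y w E" and j: "j <= v" and small: "cmod (b (y + real j * w)) < min 1 cb * rho ^ kb" for E y j
 proof -
  define u where "u = frac (y + real j * w)"
  obtain z where z: "z \<in> X" "cb * \<bar>u - z\<bar> ^ kb <= cmod (b (y + real j * w))" unfolding u_def using b_lower_frac by blast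
  have "min 1 cb * rho ^ kb <= cb * rho ^ kb" using rho by (intro mult_right_mono) auto
  hence "cb * \<bar>u - z\<bar> ^ kb < cb * rho ^ kb" using z(2) small by linarith
  hence "\<bar>u - z\<bar> ^ kb < rho ^ kb" using cb by simp
  hence uz: "\<bar>u - z\<bar> < rho" by (rule power_less_imp_less_base) (use rho in simp)
  have "y = (u - real j * w) + of_int \<lfloor>y + real j * w\<rfloor>" unfolding u_def frac_def by simp
  hence "near l eps1 (u - real j * w) w E" using nr near_add_int[OF l] by metis
  then obtain e where e: "e \<in> spec l (u - real j * w) w" "\<bar>e - E\<bar> <= eps1" unfolding near_def by blast
  obtain e' where e': "e' \<in> spec l (z - real j * w) w" "\<bar>e - e'\<bar> <= 3 * beta * (\<bar>(u - real j * w) - (z - real j * w)\<bar> + real l * \<bar>w - w\<bar>)"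
   using spec_lipschitz[OF e(1)] by blast
  have "3 * beta * \<bar>u - z\<bar> <= 3 * beta * rho" using uz beta by (intro mult_left_mono) auto
  hence "\<bar>e' - E\<bar> <= t" using e(2) e'(2) rho(2) by simp
  hence "E \<in> {(e' - t)..(e' - t) + 2 * t}" by auto
  moreover have "e' \<in> F" unfolding F_def using z(1) j e'(1) by blast
  ultimately show ?thesis unfolding \<E>_def by blast
 qed
 with m show ?thesis unfolding holds_off_def by (meson not_le)
qed

lemma short_range_identity:
 fixes L :: real
 assumes "0 < L"
 shows "40 * (L ^ 2) ^ 4 * (8 * e * w + 4 * L\<^sup>2 * K / L ^ 12) / (1 / L) = 320 * L ^ 9 * e * w + 160 * K / L"
proof -
 define X where "X = L ^ 8"
 have X: "(L ^ 2) ^ 4 = X" "L ^ 9 = X * L" "L ^ 12 = X * L ^ 2 * L ^ 2" "0 < X" unfolding X_def using assms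
  by (simp_all add: power_add[of L 8 1, simplified] power_add[of L 8 4, simplified] power_add[of L 2 2, simplified] flip: power_mult)
 show ?thesis unfolding X(1-3) using X(4) assms by (simp add: field_simps power2_eq_square)
qed

text \<open>For short blocks \<open>M = l ^ 2\<close>, \<open>\<nu> = 1 / l\<close> and distances
  from \<open>l ^ 36\<close> make the excluded sets of order \<open>1 / l\<close> up to logarithms
  of \<open>T\<close>; and as \<open>l\<close> is about \<open>T powr (1/100)\<close>, the window
  has far fewer than \<open>T\<close> sites. For long blocks \<open>M\<close> must exceed their
  length, of order \<open>T\<close>: with \<open>T powr (11/10)\<close> and
  \<open>\<nu> = T powr (-1/20)\<close> the term \<open>M ^ 4 * eps * N / \<nu>\<close> requires
  \<open>eps * N\<close> well below \<open>T powr (-445/100)\<close>. The value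
  \<open>T powr (-55/10)\<close> also keeps the energy intervals below \<open>N * T ^ 6\<close>, the
  frequency intervals below \<open>N ^ 2 * T powr 6\<close> and, as \<open>p\<close> is at least 6,
  the gap below \<open>eps / 2\<close>.\<close>

theorem spectral_separation:
 fixes c alpha gamma E' E'' p :: real
 assumes c: "0 < c" and alpha: "0 < alpha" and gamma: "0 < gamma" and E: "E' < E''" and p: "6 <= p"
 shows "\<exists>N0::nat. \<forall>N\<ge>N0. separated a b c alpha gamma E' E'' p N"
proof -
 define E0 where "E0 = max \<bar>E'\<bar> \<bar>E''\<bar>"
 have E0: "0 <= E0" unfolding E0_def by simp
 obtain B I kappad n0 where B: "1 <= B" and kappad: "1 <= kappad"
  and dec: "\<And>n w E. n0 <= n ==> w \<in> diophantine c alpha ==> \<bar>E\<bar> <= E0 ==> gamma < lyapunov a b w E ==> \<exists>i<I. decay_scale kappad gamma (n * B ^ (i + 1)) w E"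
  using decay[OF c alpha gamma E0] by blast
 define Q cX \<Delta> Ir C c' k1 where "Q = real (B ^ (I + 1))" and "cX = real (card X) + 1" and "\<Delta> = E'' - E'" and "Ir = real I + 1"
  and "C = beta + E0 + 2" and "c' = min 1 cb" and "k1 = real kb + 1"
 define cL where "cL = 200 / gamma + 1"
 have pos: "1 <= Q" "0 < gamma" "1 <= beta" "1 <= kappad" "0 < cX" "0 < \<Delta>" "0 < Ir" "1 < C" "0 < c'" "0 < k1"
 proof -
  have "1 <= B ^ (I + 1)" using B by (rule one_le_power)
  thus "1 <= Q" unfolding Q_def by linarith
 qed (use gamma beta kappad E E0 cb in \<open>auto simp: cX_def \<Delta>_def Ir_def C_def c'_def k1_def\<close>)
 obtain T0 where T0: "\<And>T. T0 <= T ==> assembly_ok Q gamma beta kappad cX \<Delta> Ir C c' k1 (real n0 + 1) cL T"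
  using eventually_assembly_ok[OF pos _ cL_def, of "real n0 + 1"] unfolding eventually_at_top_linorder by auto
 have "separated a b c alpha gamma E' E'' p N"
  if N: "nat \<lceil>exp T0\<rceil> + 1 <= N" for N
 proof -
  define T q where "T = ln (real N)" and "q = T powr (1/100)"
  have Np: "0 < real N" "1 <= N" "exp T0 <= real N" using N by linarith+
  have eT: "exp T = real N" unfolding T_def using Np by simp
  have "T0 <= T" unfolding T_def using Np by (subst ln_ge_iff) auto
  note H = T0[OF this, unfolded assembly_ok_def, folded q_def, unfolded eT]
  have T3: "3 <= T" and q6: "6 <= q" "real n0 + 1 <= q" "20 * ln 2 <= gamma * q" using H by blast+
  define n where "n = nat \<lfloor>q\<rfloor>"
  have n: "q / 2 <= real n" "real n <= q" "n0 <= n" "3 <= n" unfolding n_def using q6 by linarith+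
  define l where "l s = n * B ^ (s + 1)" for s
  have l: "n <= l s" for s
  proof -
   have "n * 1 <= n * B ^ (s + 1)" using B by (intro mult_left_mono one_le_power) auto
   thus ?thesis unfolding l_def by simp
  qed
  have lQ: "real (l s) <= Q * q" if "s < I" for s
  proof -
   have "B ^ (s + 1) <= B ^ (I + 1)" using that B by (intro power_increasing) auto
   hence "real (B ^ (s + 1)) <= Q" unfolding Q_def by (simp only: of_nat_le_iff)
   hence "real (B ^ (s + 1)) * real n <= Q * q" using n pos by (intro mult_mono) auto
   thus ?thesis unfolding l_def by (simp add: mult.commute)
  qed
  have lq: "q / 2 <= real (l s)" "3 <= l s" "1 <= l s" for s using l[of s] n by linarith+
  \<comment> \<open>One tolerance, taken from the length \<open>n\<close>, serves all scales
    \<open>l s\<close>: which of them has the decay depends on the frequency and the energy.\<close>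
  define eps1 where "eps1 = exp (- (real n powr (1/6)))"
  have eps1: "0 < eps1" "eps1 <= exp (- ((q / 2) powr (1/6)))" "1 / eps1 <= exp (q powr (1/6))" "eps1 <= 1"
  proof -
   have "(q / 2) powr (1/6) <= real n powr (1/6)" "real n powr (1/6) <= q powr (1/6)" using n q6 by (auto intro: powr_mono2)
   moreover have "1 / eps1 = exp (real n powr (1/6))" unfolding eps1_def by (simp add: exp_minus inverse_eq_divide)
   ultimately show "0 < eps1" "eps1 <= exp (- ((q / 2) powr (1/6)))" "1 / eps1 <= exp (q powr (1/6))" "eps1 <= 1" unfolding eps1_def by simp_all
  qed
  have eps1l: "exp (- (real (l s) powr (1/6))) <= eps1" for s unfolding eps1_def using l[of s] by (auto intro: powr_mono2)
  define wm where "wm = nat \<lceil>T ^ 30\<rceil>"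
  have T30: "1 <= T ^ 30" using T3 by (intro one_le_power) simp
  have wm: "T ^ 30 <= real wm" "real wm <= 2 * T ^ 30" "1 <= wm" unfolding wm_def using T30 by linarith+
  \<comment> \<open>A common bound for the exceptional sets. A bounded number of them still fits
    below the square root of \<open>1 / ln T\<close>.\<close>
  define delta where "delta = T powr (-1/200)"
  define hS gS where "hS = 3 * beta * (Q * q + 2 * T ^ 30) * exp (q powr (1/6)) + 1" and "gS = \<Delta> * exp (q powr (1/6)) + 1"
  define PS where "PS s w = (\<lambda>E. E \<in> {E'<..<E''} --> (\<forall>m. real (l s ^ 36) <= real m \<and> m <= wm --> \<not> resonance.double_res (spec (l s)) m eps1 w E))" for s w
  have short: "holds_off delta hS (\<lambda>w. w \<in> {0..1} --> holds_off delta gS (PS s w))" if s: "s < I" for s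
  proof -
   let ?l = "l s"
   have l0: "3 <= real ?l" "1 <= real ?l" "real ?l <= Q * q" "q / 2 <= real ?l" using lq[of s] lQ[OF s] by auto
   define Hn where "Hn = nat \<lceil>3 * beta * real (?l + wm) / eps1\<rceil>"
   have hp: "0 < 3 * beta * real (?l + wm) / eps1" using beta wm eps1 by simp
   have Hn: "0 < Hn" "3 * beta * real (?l + wm) / eps1 <= real Hn" "real Hn <= 3 * beta * real (?l + wm) / eps1 + 1" unfolding Hn_def using hp by linarith+
   have Hn2: "3 * beta * real (?l + wm) <= eps1 * real Hn" using Hn(2) eps1 by (simp add: pos_divide_le_eq mult.commute)
   have l36: "3 <= real (?l ^ 36)" "2 * real ?l <= real (?l ^ 36)"
   proof -
    have "real ?l ^ 2 <= real ?l ^ 36" using l0 by (intro power_increasing) auto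
    moreover have "2 * real ?l <= real ?l ^ 2" using l0 unfolding power2_eq_square by (intro mult_right_mono) auto
    ultimately show "3 <= real (?l ^ 36)" "2 * real ?l <= real (?l ^ 36)" using l0(1) unfolding of_nat_power by linarith+
   qed
   have 4: "4 * eps1 * real wm <= 1"
   proof -
    have "4 * eps1 * real wm <= 4 * exp (- ((q / 2) powr (1/6))) * (2 * T ^ 30)" using eps1 wm by (intro mult_mono) auto
    also have "... <= 1" using H by blast
    finally show ?thesis .
   qed
   have lp: "0 < 1 / real ?l" "0 < real ?l ^ 2" using l0 by simp_all
   note el = resonance.elimination_range[OF resonance_spec[OF lq(3)[of s]] eps1(1) lp l36 E wm(3) 4 Hn(1) Hn2]
   have lnwm: "0 <= ln (real wm)" "ln (real wm) <= ln (2 * T ^ 30)"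
   proof -
    show "0 <= ln (real wm)" using wm by simp
    show "ln (real wm) <= ln (2 * T ^ 30)" using wm T30 by (subst ln_le_cancel_iff) linarith+
   qed
   have u1: "40 * (real ?l ^ 2) ^ 4 * (8 * eps1 * real wm + 4 * (real ?l)\<^sup>2 * (1 + ln (real wm)) / real (?l ^ 36) powr (1/3)) / (1 / real ?l) <= delta"
   proof -
    have pw: "real (?l ^ 36) powr (1/3) = real ?l ^ 12"
    proof -
     have "real (?l ^ 36) = real ?l powr 36" using l0 by (simp add: powr_realpow)
     hence "real (?l ^ 36) powr (1/3) = (real ?l powr 36) powr (1/3)" by (simp only:)
     also have "... = real ?l powr 12" unfolding powr_powr by simp
     also have "real ?l powr 12 = real ?l ^ 12" using l0 powr_realpow[of "real ?l" 12] by simp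
     finally show ?thesis .
    qed
    have "40 * (real ?l ^ 2) ^ 4 * (8 * eps1 * real wm + 4 * (real ?l)\<^sup>2 * (1 + ln (real wm)) / real ?l ^ 12) / (1 / real ?l) =
     320 * real ?l ^ 9 * eps1 * real wm + 160 * (1 + ln (real wm)) / real ?l" by (rule short_range_identity) (use l0 in simp)
    also have "... <= 320 * (Q * q) ^ 9 * exp (- ((q / 2) powr (1/6))) * (2 * T ^ 30) + 320 * (1 + ln (2 * T ^ 30)) / q"
    proof (rule add_mono)
     show "320 * real ?l ^ 9 * eps1 * real wm <= 320 * (Q * q) ^ 9 * exp (- ((q / 2) powr (1/6))) * (2 * T ^ 30)"
      using l0 eps1 wm pos q6 by (intro mult_mono power_mono) auto
     have "160 * (1 + ln (real wm)) / real ?l <= 160 * (1 + ln (2 * T ^ 30)) / (q / 2)" using lnwm l0 q6 by (intro frac_le) auto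
     thus "160 * (1 + ln (real wm)) / real ?l <= 320 * (1 + ln (2 * T ^ 30)) / q" by simp
    qed
    also have "... <= delta" using H unfolding delta_def by blast
    finally show ?thesis unfolding pw .
   qed
   have u2: "1 / real ?l * (E'' - E' + eps1) + (3 * \<bar>ln (ln (real wm))\<bar> + 1) * (2 * real ?l * (10 * (3 * beta) + 1) / real ?l ^ 2) <= delta"
   proof -
    have lw1: "1 <= ln (real wm)"
    proof -
     have "exp 1 <= T" using exp_le T3 by linarith
     also have "T <= T ^ 30" using T3 power_increasing[of 1 30 T] by simp
     finally show ?thesis using wm by (subst ln_ge_iff) auto
    qed
    have ll: "\<bar>ln (ln (real wm))\<bar> <= ln (ln (2 * T ^ 30))"
    proof -
     have "0 <= ln (ln (real wm))" using lw1 by simp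
     moreover have "ln (ln (real wm)) <= ln (ln (2 * T ^ 30))" using lw1 lnwm by (subst ln_le_cancel_iff) auto
     ultimately show ?thesis by simp
    qed
    have "1 / real ?l * (E'' - E' + eps1) + (3 * \<bar>ln (ln (real wm))\<bar> + 1) * (2 * real ?l * (10 * (3 * beta) + 1) / real ?l ^ 2) =
      ((\<Delta> + eps1) + (3 * \<bar>ln (ln (real wm))\<bar> + 1) * (2 * (30 * beta + 1))) / real ?l"
     unfolding \<Delta>_def using l0 by (simp add: field_simps power2_eq_square)
    also have "... <= ((\<Delta> + 1) + (3 * ln (ln (2 * T ^ 30)) + 1) * (2 * (30 * beta + 1))) / (q / 2)"
     using ll eps1 pos l0 q6 by (intro frac_le add_mono mult_right_mono) auto
    also have "... = (2 * (\<Delta> + 1) + (3 * ln (ln (2 * T ^ 30)) + 1) * (4 * (30 * beta + 1))) / q" by (simp add: algebra_simps)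
    also have "... <= delta" using H unfolding delta_def by blast
    finally show ?thesis .
   qed
   have u3: "real Hn <= hS"
   proof -
    have "3 * beta * real (?l + wm) / eps1 = 3 * beta * (real ?l + real wm) * (1 / eps1)" by simp
    also have "... <= 3 * beta * (Q * q + 2 * T ^ 30) * exp (q powr (1/6))" using beta l0 wm eps1 by (intro mult_mono add_mono) auto
    finally show ?thesis using Hn(3) unfolding hS_def by linarith
   qed
   have u4: "(E'' - E') / eps1 + 1 <= gS" using mult_left_mono[OF eps1(3), of \<Delta>] pos unfolding gS_def \<Delta>_def by simp
   show ?thesis by (rule holds_off_mono[OF el u1 u3]) (unfold PS_def, rule impI, erule impE, assumption, rule holds_off_mono[OF _ u2 u4], assumption+)
  qed
  have w01: "w \<in> {0..1}" if "w \<in> diophantine c alpha" for w using that by (auto simp: diophantine_def)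
  have nd: "\<not> near n' t (y + real m * w) w E1" if "1 <= n'" "\<not> resonance.double_res (spec n') m t w E1" "near n' t y w E1" for n' t y m w E1
   using that(2,3) unfolding resonance.double_res_def[OF resonance_spec[OF that(1)]] resonance.res_def[OF resonance_spec[OF that(1)]] near_def[symmetric] by blast
  \<comment> \<open>Half a long block has to hold \<open>2 * (i * l)\<close> sites, about
    \<open>60 * T / gamma\<close>, besides a cluster of short resonant sites.\<close>
  define L where "L = nat \<lceil>200 * T / gamma\<rceil>"
  have "0 < 200 * T / gamma" using T3 gamma by simp
  hence L: "200 * T / gamma <= real L" "real L <= 200 * T / gamma + 1" "1 <= L" unfolding L_def by linarith+
  have LcL: "real L <= cL * T" using L(2) T3 unfolding cL_def by (simp add: distrib_right)
  have T55: "0 < T powr (55/10)" using T3 by simp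
  define eps where "eps = 1 / (real N * T powr (55/10))"
  have eps: "0 < eps" "eps * real N = T powr (-55/10)" "1 / eps = real N * T powr (55/10)"
   unfolding eps_def using Np T55 powr_minus_divide[of T "55/10"] by simp_all
  define hL gL where "hL = 3 * beta * (cL * T + real N) * (real N * T powr (55/10)) + 1" and "gL = \<Delta> * (real N * T powr (55/10)) + 1"
  define PL where "PL w = (\<lambda>E. E \<in> {E'<..<E''} --> (\<forall>m. T ^ 27 <= real m \<and> m <= N --> \<not> resonance.double_res (spec L) m eps w E))" for w
  have long: "holds_off delta hL (\<lambda>w. w \<in> {0..1} --> holds_off delta gL (PL w))"
  proof -
   define Hn where "Hn = nat \<lceil>3 * beta * real (L + N) / eps\<rceil>"
   have hp: "0 < 3 * beta * real (L + N) / eps" using beta Np eps by simp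
   have Hn: "0 < Hn" "3 * beta * real (L + N) / eps <= real Hn" "real Hn <= 3 * beta * real (L + N) / eps + 1" unfolding Hn_def using hp by linarith+
   have Hn2: "3 * beta * real (L + N) <= eps * real Hn" using Hn(2) eps by (simp add: pos_divide_le_eq mult.commute)
   have r0: "3 <= T ^ 27" "2 * real L <= T ^ 27"
   proof -
    show "3 <= T ^ 27" using T3 power_increasing[of 1 27 T] by simp
    have "2 * (cL * T) <= T ^ 27" using H by blast
    thus "2 * real L <= T ^ 27" using LcL by linarith
   qed
   have 4: "4 * eps * real N <= 1"
   proof -
    have "4 * T powr (-55/10) <= 1" using H by blast
    thus ?thesis using eps(2) by simp
   qed
   have lp: "0 < T powr (-1/20)" "0 < T powr (11/10)" using T3 by simp_all
   note el = resonance.elimination_range[OF resonance_spec[OF L(3)] eps(1) lp r0 E Np(2) 4 Hn(1) Hn2]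
   have M4: "(T powr (11/10)) ^ 4 = T powr (44/10)" using T3 by (simp add: powr_power)
   have T9: "(T ^ 27) powr (1/3) = T ^ 9"
   proof -
    have "(T ^ 27) powr (1/3) = (T powr 27) powr (1/3)" using T3 by (simp add: powr_realpow)
    also have "... = T powr 9" unfolding powr_powr by simp
    also have "... = T ^ 9" using T3 powr_realpow[of T 9] by simp
    finally show ?thesis .
   qed
   have u1: "40 * (T powr (11/10)) ^ 4 * (8 * eps * real N + 4 * (real L)\<^sup>2 * (1 + ln (real N)) / (T ^ 27) powr (1/3)) / T powr (-1/20) <= delta"
   proof -
    have "40 * T powr (44/10) * (8 * (eps * real N) + 4 * (real L)\<^sup>2 * (1 + T) / T ^ 9) / T powr (-1/20)
     <= 40 * T powr (44/10) * (8 * T powr (-55/10) + 4 * (cL * T)\<^sup>2 * (1 + T) / T ^ 9) / T powr (-1/20)"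
     unfolding eps(2) using T3 LcL by (intro divide_right_mono mult_left_mono add_left_mono mult_right_mono power_mono) auto
    also have "... <= delta" using H unfolding delta_def by blast
    finally show ?thesis unfolding M4 T9 T_def[symmetric] by (simp add: mult.assoc)
   qed
   have u2: "T powr (-1/20) * (E'' - E' + eps) + (3 * \<bar>ln (ln (real N))\<bar> + 1) * (2 * real L * (10 * (3 * beta) + 1) / T powr (11/10)) <= delta"
   proof -
    have e1: "eps <= 1"
    proof -
     have "eps * 1 <= eps * real N" using eps(1) Np by (intro mult_left_mono) auto
     thus ?thesis using 4 by linarith
    qed
    have A: "T powr (-1/20) * (E'' - E' + eps) <= T powr (-1/20) * (\<Delta> + 1)" unfolding \<Delta>_def using e1 by (intro mult_left_mono) auto
    have "2 * real L * (30 * beta + 1) <= 2 * (cL * T) * (30 * beta + 1)" using LcL beta by (intro mult_right_mono) auto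
    hence B: "(3 * ln T + 1) * (2 * real L * (30 * beta + 1) / T powr (11/10)) <= (3 * ln T + 1) * (2 * (cL * T) * (30 * beta + 1) / T powr (11/10))"
     using T3 by (intro mult_left_mono divide_right_mono) auto
    have "T powr (-1/20) * (E'' - E' + eps) + (3 * \<bar>ln (ln (real N))\<bar> + 1) * (2 * real L * (10 * (3 * beta) + 1) / T powr (11/10))
     <= T powr (-1/20) * (\<Delta> + 1) + (3 * ln T + 1) * (2 * (cL * T) * (30 * beta + 1) / T powr (11/10))"
    proof -
     have "\<bar>ln T\<bar> = ln T" "10 * (3 * beta) = 30 * beta" using T3 by simp_all
     thus ?thesis unfolding T_def[symmetric] using add_mono[OF A B] by (simp only:)
    qed
    also have "... <= delta" using H unfolding delta_def by blast
    finally show ?thesis .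
   qed
   have u3: "real Hn <= hL"
   proof -
    have "3 * beta * real (L + N) / eps = 3 * beta * (real L + real N) * (1 / eps)" by simp
    also have "... <= 3 * beta * (cL * T + real N) * (real N * T powr (55/10))"
     unfolding eps(3) using beta LcL by (intro mult_right_mono mult_left_mono add_mono) auto
    finally show ?thesis using Hn(3) unfolding hL_def by linarith
   qed
   have u4: "(E'' - E') / eps + 1 <= gL"
   proof -
    have "(E'' - E') / eps = \<Delta> * (1 / eps)" unfolding \<Delta>_def by simp
    thus ?thesis unfolding gL_def eps(3) by simp
   qed
   show ?thesis by (rule holds_off_mono[OF el u1 u3]) (unfold PL_def, rule impI, erule impE, assumption, rule holds_off_mono[OF _ u2 u4], assumption+)
  qed
  have delta0: "0 <= delta" unfolding delta_def by simp
  have nn: "0 <= hS" "0 <= gS" "0 <= hL" "0 <= gL"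
   unfolding hS_def gS_def hL_def gL_def using pos q6 T3 by (auto intro!: add_nonneg_nonneg mult_nonneg_nonneg simp: cL_def)
  have sumdelta: "2 * Ir * delta <= ln (ln (real N)) powr (- (1/2))" using H unfolding delta_def T_def[symmetric] by blast
  have Idelta: "real I * delta + real I * delta + delta <= 2 * Ir * delta" using delta0 unfolding Ir_def by (simp add: algebra_simps)
  have T6p: "T powr 6 <= T powr p" using T3 p by (intro powr_mono) auto
  have "holds_off (ln (ln (real N)) powr (- (1/2))) (real N ^ 2 * ln (real N) powr p)
   (\<lambda>w. (\<forall>s\<in>{..<I}. w \<in> {0..1} --> holds_off delta gS (PS s w)) \<and> (w \<in> {0..1} --> holds_off delta gL (PL w)))"
  proof (rule holds_off_mono[OF holds_off_conj[OF holds_off_ball[of "{..<I}", unfolded card_lessThan, OF _ short] long]])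
   show "real I * delta + delta <= ln (ln (real N)) powr (- (1/2))" using sumdelta Idelta delta0 mult_nonneg_nonneg[of "real I" delta] by linarith
   have "real I * hS <= Ir * hS" unfolding Ir_def using nn by (intro mult_right_mono) auto
   moreover have "Ir * hS + hL <= real N ^ 2 * T powr 6" using H unfolding hS_def hL_def by blast
   moreover have "real N ^ 2 * T powr 6 <= real N ^ 2 * T powr p" using T6p by (intro mult_left_mono) auto
   ultimately show "real I * hS + hL <= real N ^ 2 * ln (real N) powr p" unfolding T_def[symmetric] by linarith
  qed (use delta0 nn in auto)
  moreover have "holds_off (ln (ln (real N)) powr (- (1/2))) (real N * ln (real N) ^ 6)
    (\<lambda>E. E \<in> {E'<..<E''} --> (\<forall>x j k. j < N \<and> k < N \<and> k \<noteq> j \<and> jacobi_eigenvalues a b N x w ! j = E -->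
     1 / (real N * ln (real N) powr p) <= \<bar>E - jacobi_eigenvalues a b N x w ! k\<bar>))"
   if S: "\<And>s. s \<in> {..<I} ==> holds_off delta gS (PS s w)" and L': "holds_off delta gL (PL w)"
    and wd: "w \<in> diophantine c alpha" and ly: "\<forall>E\<in>{E'<..<E''}. gamma < lyapunov a b w E" for w
  proof -
   define t gZ where "t = T powr (-1/2)" and "gZ = cX * (10 * (Q * q) ^ 37)"
   \<comment> \<open>The lower bound for \<open>b\<close> at distance at least \<open>1 / T\<close>
     from \<open>X\<close>.\<close>
   define kappa where "kappa = min 1 cb * (1 / T) ^ kb"
   have t: "3 * beta * (1 / T) + eps1 <= t"
   proof -
    have "3 * beta / T + exp (- ((q / 2) powr (1/6))) <= t" using H unfolding t_def by blast
    thus ?thesis using eps1(2) by simp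
   qed
   have t0: "0 <= t" unfolding t_def by simp
   define PZ where "PZ s = (\<lambda>E. \<forall>y j. near (l s) eps1 y w E --> j <= 2 * (l s ^ 36 + l s) --> kappa <= cmod (b (y + real j * w)))" for s
   have Z: "holds_off delta gZ (PZ s)" if s: "s < I" for s
   proof -
    have l1: "1 <= real (l s)" "0 < real (l s)" using lq(3)[of s] by simp_all
    have T1: "0 < 1 / T" using T3 by simp
    have cnt: "real (card X * ((2 * (l s ^ 36 + l s) + 1) * l s)) <= gZ"
    proof -
     have "real (l s) <= real (l s) ^ 36" "1 <= real (l s) ^ 36" using l1(1) by (rule self_le_power one_le_power; simp)+
     moreover have "2 * (y + z) + 1 <= 10 * y" if "z <= y" "1 <= y" for y z :: real
     proof -
      have "2 * (y + z) <= 4 * y" "1 <= 6 * y" using that by auto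
      thus ?thesis by simp
     qed
     ultimately have "2 * (real (l s) ^ 36 + real (l s)) + 1 <= 10 * real (l s) ^ 36" by blast
     hence "(2 * (real (l s) ^ 36 + real (l s)) + 1) * real (l s) <= 10 * real (l s) ^ 36 * real (l s)" using l1 by (intro mult_right_mono) auto
     also have "... = 10 * real (l s) ^ 37" using power_Suc2[of "real (l s)" 36] by simp
     also have "... <= 10 * (Q * q) ^ 37" using lQ[OF s] by (intro mult_left_mono power_mono) auto
     finally have h: "(2 * (real (l s) ^ 36 + real (l s)) + 1) * real (l s) <= 10 * (Q * q) ^ 37" .
     have "real (card X) * ((2 * (real (l s) ^ 36 + real (l s)) + 1) * real (l s)) <= cX * (10 * (Q * q) ^ 37)"
      unfolding cX_def by (rule mult_mono[OF _ h]) auto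
     thus ?thesis unfolding gZ_def by (simp only: of_nat_mult of_nat_add of_nat_power of_nat_numeral of_nat_1)
    qed
    have "real (card X * ((2 * (l s ^ 36 + l s) + 1) * l s)) * (2 * t) <= gZ * (2 * t)" using t0 by (intro mult_right_mono cnt) auto
    also have "... <= delta" using H unfolding gZ_def t_def delta_def by blast
    finally have z: "real (card X * ((2 * (l s ^ 36 + l s) + 1) * l s)) * (2 * t) <= delta" .
    show ?thesis unfolding PZ_def kappa_def by (rule holds_off_mono[OF zeros_avoided[OF lq(3)[of s] T1 t less_imp_le[OF eps1(1)]] z cnt])
   qed
   have gZ0: "0 <= gZ" unfolding gZ_def using pos q6 by simp
   show ?thesis
   proof (rule holds_off_mono[OF holds_off_conj[OF holds_off_conj[OF
      holds_off_ball[of "{..<I}", unfolded card_lessThan, OF _ S] holds_off_ball[of "{..<I}", unfolded card_lessThan, OF _ Z]] L']])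
    show "real I * delta + real I * delta + delta <= ln (ln (real N)) powr (- (1/2))" using sumdelta Idelta by linarith
    have "real I * gS <= Ir * gS" "real I * gZ <= Ir * gZ" unfolding Ir_def using nn gZ0 by (auto intro: mult_right_mono)
    moreover have "Ir * gS + Ir * gZ + gL <= real N * T ^ 6" using H unfolding gS_def gZ_def gL_def by blast
    ultimately show "real I * gS + real I * gZ + gL <= real N * ln (real N) ^ 6" unfolding T_def[symmetric] by linarith
    fix E1 assume P: "((\<forall>s\<in>{..<I}. PS s w E1) \<and> (\<forall>s\<in>{..<I}. PZ s E1)) \<and> PL w E1"
    show "E1 \<in> {E'<..<E''} --> (\<forall>x j k. j < N \<and> k < N \<and> k \<noteq> j \<and> jacobi_eigenvalues a b N x w ! j = E1 -->
     1 / (real N * ln (real N) powr p) <= \<bar>E1 - jacobi_eigenvalues a b N x w ! k\<bar>)"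
    proof (intro impI allI, elim conjE)
     fix x j k assume E1: "E1 \<in> {E'<..<E''}" and jk: "j < N" "k < N" "k \<noteq> j" "jacobi_eigenvalues a b N x w ! j = E1"
     hence E1b: "\<bar>E1\<bar> <= E0" unfolding E0_def by auto
     obtain s where s: "s < I" and ds: "decay_scale kappad gamma (l s) w E1" using dec[OF n(3) wd E1b bspec[OF ly E1]] unfolding l_def by blast
     \<comment> \<open>\<open>2 * \<theta>\<close> is at most \<open>exp (- gamma * l / 10)\<close>,
       so \<open>i\<close> steps give \<open>exp (- 3 * T)\<close>, the inverse cube of
       \<open>N\<close>. This survives the division by \<open>eps\<close> and the sum of squares
       over \<open>N\<close> sites.\<close>
     define i m0 d where "i = nat \<lceil>30 * T / (gamma * real (l s))\<rceil>" and "m0 = nat \<lceil>T ^ 27\<rceil>" and "d = 1 / (real N * T powr p)"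
     have l0: "3 <= real (l s)" "real (l s) <= Q * q" "q / 2 <= real (l s)" using lq[of s] lQ[OF s] by auto
     have i: "30 * T <= gamma * real (l s) * real i" "real (i * l s) <= 30 * T / gamma + Q * q"
     proof -
      have gl: "0 < gamma * real (l s)" using gamma l0 by simp
      have "0 <= 30 * T / (gamma * real (l s))" using gl T3 by simp
      hence ii: "30 * T / (gamma * real (l s)) <= real i" "real i <= 30 * T / (gamma * real (l s)) + 1" unfolding i_def by linarith+
      show "30 * T <= gamma * real (l s) * real i" using ii(1) gl by (simp add: pos_divide_le_eq mult.commute)
      have "real i * real (l s) <= (30 * T / (gamma * real (l s)) + 1) * real (l s)" using ii(2) by (rule mult_right_mono) simp
      also have "... = 30 * T / gamma + real (l s)" using l0 gamma by (simp add: field_simps)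
      finally show "real (i * l s) <= 30 * T / gamma + Q * q" using l0 by simp
     qed
     have T27: "1 <= T ^ 27" using T3 by (intro one_le_power) simp
     hence m0: "T ^ 27 <= real m0" "real m0 <= T ^ 27 + 1" unfolding m0_def by linarith+
     have m1l: "real (l s ^ 36 + l s) <= 2 * (Q * q) ^ 36"
     proof -
      have "real (l s) <= real (l s) ^ 36" using l0 by (intro self_le_power) auto
      moreover have "real (l s) ^ 36 <= (Q * q) ^ 36" using l0 by (intro power_mono) auto
      ultimately show ?thesis unfolding of_nat_add of_nat_power by linarith
     qed
     have dp: "0 < real N * T powr p" using Np T3 by simp
     have Tp: "real N * T powr 6 <= real N * T powr p" using T6p by (intro mult_left_mono) auto
     have T1p: "1 <= T powr p" using T3 p ge_one_powr_ge_zero[of T p] by simp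
     have dT: "d <= exp (- T)"
     proof -
      have "real N * 1 <= real N * T powr p" using T1p by (intro mult_left_mono) auto
      hence "1 / (real N * T powr p) <= 1 / real N" using Np T1p by (intro divide_left_mono mult_pos_pos) linarith+
      thus ?thesis unfolding d_def by (simp add: exp_minus eT inverse_eq_divide)
     qed
     have \<theta>: "2 * exp (- gamma * real (l s) / 5) <= exp (- (gamma * real (l s) / 10))"
     proof -
      have "gamma * q <= gamma * (2 * real (l s))" using gamma l0 by (intro mult_left_mono) auto
      hence "ln 2 + - gamma * real (l s) / 5 <= - (gamma * real (l s) / 10)" using q6(3) by simp
      hence "exp (ln 2 + - gamma * real (l s) / 5) <= exp (- (gamma * real (l s) / 10))" by simp
      thus ?thesis unfolding exp_add by simp
     qed
     have sm: "real N * (8 * beta * (2 * exp (- gamma * real (l s) / 5)) ^ i / eps)\<^sup>2 + real (m0 + L) * (2 * exp (- gamma * real (l s) / 5))\<^sup>2 <= 1 / 100"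
     proof -
      let ?u = "2 * exp (- gamma * real (l s) / 5)"
      have "?u ^ i <= exp (- (gamma * real (l s) / 10)) ^ i" using \<theta> by (intro power_mono) auto
      also have "... = exp (- (gamma * real (l s) * real i) / 10)" by (simp add: mult_ac flip: exp_of_nat_mult)
      also have "... <= exp (- 3 * T)" using i(1) by simp
      finally have ui: "?u ^ i <= exp (- 3 * T)" .
      have "8 * beta * ?u ^ i / eps <= 8 * beta * exp (- 3 * T) / eps" using ui beta eps by (intro divide_right_mono mult_left_mono) auto
      also have "... = 8 * beta * (exp (- 3 * T) * exp T) * T powr (55/10)"
      proof -
       have "8 * beta * exp (- 3 * T) / eps = 8 * beta * exp (- 3 * T) * (1 / eps)" by simp
       thus ?thesis unfolding eps(3) eT by simp
      qed
      also have "exp (- 3 * T) * exp T = exp (- 2 * T)" unfolding mult_exp_exp by simp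
      finally have "(8 * beta * ?u ^ i / eps)\<^sup>2 <= (8 * beta * exp (- 2 * T) * T powr (55/10))\<^sup>2" using beta eps by (intro power_mono) auto
      hence "real N * (8 * beta * ?u ^ i / eps)\<^sup>2 <= exp T * (8 * beta * exp (- 2 * T) * T powr (55/10))\<^sup>2" unfolding eT by (rule mult_left_mono) simp
      also have "... = 64 * beta\<^sup>2 * (T powr (55/10) * T powr (55/10)) * (exp T * exp (- 2 * T) * exp (- 2 * T))" by (simp add: power2_eq_square)
      also have "T powr (55/10) * T powr (55/10) = T ^ 11" using T3 powr_realpow[of T 11] by (simp flip: powr_add)
      also have "exp T * exp (- 2 * T) * exp (- 2 * T) = exp (- 3 * T)" unfolding mult_exp_exp by simp
      finally have 1: "real N * (8 * beta * ?u ^ i / eps)\<^sup>2 <= 64 * beta\<^sup>2 * T ^ 11 * exp (- 3 * T)" .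
      have "?u\<^sup>2 <= (exp (- (gamma * real (l s) / 10)))\<^sup>2" using \<theta> by (intro power_mono) auto
      also have "... = exp (- (gamma * (2 * real (l s)) / 10))" unfolding power2_eq_square mult_exp_exp by simp
      also have "... <= exp (- (gamma * q / 10))" using gamma l0 mult_left_mono[of q "2 * real (l s)" gamma] by simp
      finally have u2: "?u\<^sup>2 <= exp (- (gamma * q / 10))" .
      have "real (m0 + L) * ?u\<^sup>2 <= (T ^ 27 + 1 + cL * T) * exp (- (gamma * q / 10))" using m0 LcL T27 by (intro mult_mono u2) auto
      moreover have "64 * beta\<^sup>2 * T ^ 11 * exp (- 3 * T) + (T ^ 27 + 1 + cL * T) * exp (- (gamma * q / 10)) <= 1 / 100" using H by blast
      ultimately show ?thesis using 1 by linarith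
     qed
     have kappa: "0 < kappa" "kappa <= 1"
     proof -
      show "0 < kappa" unfolding kappa_def using cb T3 by simp
      have "min 1 cb * (1 / T) ^ kb <= 1 * 1" using cb T3 by (intro mult_mono power_le_one) auto
      thus "kappa <= 1" unfolding kappa_def by simp
     qed
     \<comment> \<open>The growth over the window is the exponential of order
       \<open>T powr (36/100) * ln T\<close>, which \<open>d <= exp (- T)\<close> outweighs.\<close>
     have sw: "real (l s ^ 36 + l s + 1) * (d / kappa * (3 * C / kappa) ^ (l s ^ 36 + l s)) <= 1"
     proof -
      define Y V where "Y = 3 * C / c' * T powr k1" and "V = l s ^ 36 + l s"
      have c'1: "c' <= 1" "0 < c'" unfolding c'_def using cb by auto
      have Ck: "1 / kappa <= Y" "3 * C / kappa <= Y"
      proof -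
       have "1 / kappa = 1 / c' * T ^ kb" unfolding kappa_def c'_def by (simp add: power_one_over divide_inverse power_inverse)
       also have "... <= 1 / c' * T powr k1" unfolding k1_def using T3 c'1 powr_mono[of "real kb" "real kb + 1" T] by (intro mult_left_mono) (auto simp: powr_realpow)
       finally have a: "1 / kappa <= 1 / c' * T powr k1" .
       have "3 * C * (1 / kappa) <= 3 * C * (1 / c' * T powr k1)" using pos by (intro mult_left_mono a) auto
       thus b: "3 * C / kappa <= Y" unfolding Y_def by simp
       have "1 * (1 / kappa) <= 3 * C * (1 / kappa)" using pos kappa by (intro mult_right_mono) auto
       thus "1 / kappa <= Y" using b by simp
      qed
      have lnY: "ln Y = ln (3 * C / c') + k1 * ln T" "0 <= ln Y" "0 < Y"
      proof -
       show "0 < Y" unfolding Y_def using pos c'1 T3 by simp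
       show l: "ln Y = ln (3 * C / c') + k1 * ln T"
       proof -
        have "3 * C / c' \<noteq> 0" "T powr k1 \<noteq> 0" using pos c'1 T3 by auto
        hence "ln (3 * C / c' * T powr k1) = ln (3 * C / c') + ln (T powr k1)" using ln_mult[of "3 * C / c'" "T powr k1"] by presburger
        thus ?thesis unfolding Y_def using T3 by (simp only: ln_powr)
       qed
       have "1 <= 3 * C / c'" using pos c'1 by (simp add: pos_le_divide_eq)
       thus "0 <= ln Y" unfolding l using pos T3 by simp
      qed
      have V: "real V <= 2 * (Q * q) ^ 36" using m1l unfolding V_def .
      have "d / kappa * (3 * C / kappa) ^ V = d * (1 / kappa * (3 * C / kappa) ^ V)" by simp
      also have "... <= exp (- T) * (Y * Y ^ V)" using dT Ck kappa pos lnY(3) unfolding d_def by (intro mult_mono power_mono) auto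
      also have "Y * Y ^ V = exp (real (V + 1) * ln Y)" using lnY(3) by (simp add: exp_of_nat_mult del: of_nat_Suc of_nat_add)
      finally have "real (V + 1) * (d / kappa * (3 * C / kappa) ^ V) <= real (V + 1) * (exp (- T) * exp (real (V + 1) * ln Y))"
       by (rule mult_left_mono) simp
      also have "... = exp (ln (real (V + 1))) * (exp (- T) * exp (real (V + 1) * ln Y))" by simp
      also have "... = exp (ln (real (V + 1)) + (- T + real (V + 1) * ln Y))" by (simp only: mult_exp_exp)
      also have "... <= exp 0"
      proof -
       have "ln (real (V + 1)) <= ln (2 * (Q * q) ^ 36 + 1)" using V by (subst ln_le_cancel_iff) auto
       moreover have "real (V + 1) * ln Y <= (2 * (Q * q) ^ 36 + 1) * ln Y" using V lnY by (intro mult_right_mono) auto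
       moreover have "ln (2 * (Q * q) ^ 36 + 1) + (2 * (Q * q) ^ 36 + 1) * (ln (3 * C / c') + k1 * ln T) <= T" using H by blast
       ultimately show ?thesis unfolding lnY(1) by simp
      qed
      finally show ?thesis unfolding V_def by simp
     qed
     have loc: "localization a b ac bb y1 beta X cb kb w E1 eps eps1 kappad gamma kappa C d N (l s) L m0 (l s ^ 36) wm i"
     proof (rule localization.intro[OF jacobi_data_zeros_axioms], rule localization_axioms.intro)
      show "decay_scale kappad gamma (l s) w E1" by (rule ds)
      show "exp (- (real (l s) powr (1 / 6))) <= eps1" by (rule eps1l)
      have "PS s w E1" "PZ s E1" "PL w E1" using P s by auto
      note P = this[unfolded PS_def PZ_def PL_def, rule_format]
      show "\<And>m y. l s ^ 36 <= m ==> m <= wm ==> near (l s) eps1 y w E1 ==> \<not> near (l s) eps1 (y + real m * w) w E1"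
       using nd[OF lq(3) P(1)[OF E1]] by simp
      show "\<And>y j. near (l s) eps1 y w E1 ==> j <= 2 * (l s ^ 36 + l s) ==> kappa <= cmod (b (y + real j * w))" by (rule P(2))
      have "T ^ 27 <= real m" if "m0 <= m" for m using m0(1) that by (meson of_nat_le_iff order_trans)
      thus "\<And>m y. m0 <= m ==> m <= N ==> near L eps y w E1 ==> \<not> near L eps (y + real m * w) w E1" using nd[OF L(3) P(3)[OF E1]] by simp
      show "1 <= l s" by (rule lq)
      have "Q * q <= real N" "cL * T <= real N" using H by blast+
      thus "l s <= N" "L <= N" using l0 LcL by linarith+
      have h: "2 * (Q * q) ^ 36 + (60 * T / gamma + 2 * (Q * q)) + 3 <= 200 * T / gamma / 2 - 1"
       "cL * T + (60 * T / gamma + 2 * (Q * q)) + Q * q <= T ^ 30" "T ^ 27 + 1 + cL * T + Q * q <= T ^ 30" using H by blast+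
      have i2: "2 * real (i * l s) <= 60 * T / gamma + 2 * (Q * q)" using i(2) by simp
      have Ld: "real L <= 2 * real (L div 2) + 1" by linarith
      have "real (l s ^ 36 + l s) + 2 * real (i * l s) + 3 <= real (L div 2)" using h(1) i2 m1l Ld L(1) by argo
      thus "l s ^ 36 + l s + 2 * (i * l s) + 3 <= L div 2" by linarith
      have "real L + 2 * real (i * l s) + real (l s) <= real wm" using h(2) i2 l0 LcL wm(1) by linarith
      thus "L + 2 * (i * l s) + l s <= wm" by linarith
      have "real m0 + real L + real (l s) <= real wm" using h(3) m0 l0 LcL wm(1) by linarith
      thus "m0 + L + l s <= wm" by linarith
      show "0 < eps" by (rule eps)
      show "0 < kappa" "kappa <= 1" by (fact kappa)+
      show "beta + \<bar>E1\<bar> + 1 <= C" unfolding C_def using E1b by simp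
      show "0 < d" unfolding d_def using dp by simp
      have "kappad * real (l s) <= kappad * (Q * q)" using l0 pos by (intro mult_left_mono) auto
      moreover have "kappad * (Q * q) <= T" using H by blast
      ultimately have "exp (- T) <= exp (- kappad * real (l s))" by simp
      thus "d <= exp (- kappad * real (l s))" using dT by linarith
      have "2 * T powr (55/10) <= T powr 6" using H by blast
      hence "real N * (2 * T powr (55/10)) <= real N * T powr 6" by (intro mult_left_mono) auto
      hence le: "2 * (real N * T powr (55/10)) <= real N * T powr p" using Tp by linarith
      have "d <= 1 / (2 * (real N * T powr (55/10)))" unfolding d_def using le Np T55 by (intro divide_left_mono) auto
      thus "d <= eps / 2" unfolding eps_def by simp
      have "exp (- T) <= 1" using T3 by simp
      thus "d <= 1" using dT by linarith
     qed (fact sm sw)+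
     have "d < \<bar>E1 - jacobi_eigenvalues a b N x w ! k\<bar>" by (rule localization.eigenvalue_gap[OF loc jk(1,2)]) (use jk in auto)
     thus "1 / (real N * ln (real N) powr p) <= \<bar>E1 - jacobi_eigenvalues a b N x w ! k\<bar>" unfolding d_def T_def by simp
    qed
   qed (use delta0 nn gZ0 in auto)
  qed
  ultimately show ?thesis unfolding separated_def using w01 by (elim holds_off_mono) auto
 qed
 thus ?thesis by blast
qed

end

section \<open>Constants extracted from analyticity\<close>

lemma periodic_strip_bounds:
 fixes g :: "complex => complex" and y1 rho :: real
 assumes holo: "g holomorphic_on strip rho" and per: "\<And>z. z \<in> strip rho ==> g (z + 1) = g z" and y1: "0 < y1" "y1 < rho"
 shows "\<exists>K. 0 <= K \<and> (\<forall>z. \<bar>Im z\<bar> < y1 --> cmod (g z) <= K) \<and>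
  (\<forall>z z'. \<bar>Im z\<bar> < y1 --> \<bar>Im z'\<bar> < y1 --> cmod (g z - g z') <= K * cmod (z - z'))"
proof -
 have op: "open (strip rho)" unfolding strip_def by (intro open_Collect_less continuous_intros)
 define R where "R = cbox (Complex 0 (- y1)) (Complex 1 y1)"
 have RS: "R \<subseteq> strip rho" using y1 unfolding R_def strip_def by (auto simp: in_cbox_complex_iff)
 have comp: "compact R" unfolding R_def by simp
 have "bounded (g ` R)" "bounded (deriv g ` R)"
  by (intro compact_imp_bounded compact_continuous_image comp holomorphic_on_imp_continuous_on holomorphic_on_subset[OF holo RS]
    holomorphic_on_subset[OF holomorphic_deriv[OF holo op] RS])+
 then obtain K1 K2 where K: "\<And>z. z \<in> R ==> cmod (g z) <= K1" "\<And>z. z \<in> R ==> cmod (deriv g z) <= K2" unfolding bounded_iff by blast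
 define u where "u z = z - of_int \<lfloor>Re z\<rfloor>" for z :: complex
 have uR: "u z \<in> R" if "\<bar>Im z\<bar> < y1" for z
 proof -
  have "real_of_int \<lfloor>Re z\<rfloor> <= Re z" "Re z <= real_of_int \<lfloor>Re z\<rfloor> + 1" by linarith+
  hence "0 <= Re (u z)" "Re (u z) <= 1" "Im (u z) = Im z" unfolding u_def by (simp_all add: diff_le_eq add.commute)
  thus ?thesis using that unfolding R_def by (auto simp: in_cbox_complex_iff)
 qed
 have shift: "g (z + of_int k) = g z" if "z \<in> strip rho" for z k
  by (rule periodic_shift_int[of rho]) (use per that in \<open>auto simp: strip_def\<close>)
 have gu: "g z = g (u z)" if "z \<in> strip rho" for z using shift[OF that, of "- \<lfloor>Re z\<rfloor>"] unfolding u_def by simp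
 define T where "T = {z. \<bar>Im z\<bar> < y1}"
 have TS: "T \<subseteq> strip rho" using y1 unfolding T_def strip_def by auto
 have cT: "convex T"
 proof -
  have "T = {z. Im z < y1} \<inter> {z. - y1 < Im z}" unfolding T_def by auto
  thus ?thesis by (simp add: convex_Int convex_halfspace_Im_lt convex_halfspace_Im_gt)
 qed
 \<comment> \<open>The derivative at \<open>z\<close> equals the one at the representative
   \<open>u z\<close> in a single period, where compactness bounds it.\<close>
 have der: "(g has_field_derivative deriv g (u z)) (at z within T)" if z: "z \<in> T" for z
 proof -
  define k where "k = \<lfloor>Re z\<rfloor>"
  have "u z \<in> R" using z uR unfolding T_def by blast
  hence "u z \<in> strip rho" using RS by blast
  hence "(g has_field_derivative deriv g (u z)) (at (u z))" by (rule holomorphic_derivI[OF holo op])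
  hence "((\<lambda>x. g (x + - of_int k)) has_field_derivative deriv g (u z)) (at z)"
   using DERIV_shift[of g "deriv g (u z)" z "- of_int k"] by (simp add: u_def k_def)
  hence "(g has_field_derivative deriv g (u z)) (at z)"
  proof (rule has_field_derivative_transform_within_open[OF _ op])
   show "z \<in> strip rho" using z TS by blast
   show "g (x + - of_int k) = g x" if "x \<in> strip rho" for x using shift[OF that, of "- k"] by simp
  qed
  thus ?thesis by (rule has_field_derivative_at_within)
 qed
 have lip: "cmod (g z - g z') <= K2 * cmod (z - z')" if "\<bar>Im z\<bar> < y1" "\<bar>Im z'\<bar> < y1" for z z'
  by (rule field_differentiable_bound[OF cT der]) (use that uR K(2) in \<open>auto simp: T_def\<close>)
 have bd: "cmod (g z) <= K1" if "\<bar>Im z\<bar> < y1" for z using gu[of z] K(1)[OF uR[OF that]] that TS unfolding T_def by auto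
 show ?thesis
 proof (intro exI[of _ "max K1 K2"] conjI allI impI)
  have "cmod (g 0) <= K1" using bd[of 0] y1 by simp
  thus "0 <= max K1 K2" using norm_ge_zero[of "g 0"] by linarith
  show "\<bar>Im z\<bar> < y1 ==> cmod (g z) <= max K1 K2" for z using bd by force
  fix z z' assume "\<bar>Im z\<bar> < y1" "\<bar>Im z'\<bar> < y1"
  hence "cmod (g z - g z') <= K2 * cmod (z - z')" by (rule lip)
  also have "... <= max K1 K2 * cmod (z - z')" by (intro mult_right_mono) auto
  finally show "cmod (g z - g z') <= max K1 K2 * cmod (z - z')" .
 qed
qed

text \<open>The zero at \<open>xi\<close> is factored out to its order; the remaining factor does
  not vanish at \<open>xi\<close> and stays away from 0 nearby.\<close>

lemma holomorphic_local_lower_bound: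
 fixes F :: "complex => complex"
 assumes holo: "F holomorphic_on S" and S: "open S" "connected S" and xi: "xi \<in> S" and nz: "\<exists>z\<in>S. F z \<noteq> 0"
 shows "\<exists>eps>0. \<exists>c>0. \<exists>n. \<forall>z. cmod (z - xi) < eps --> c * cmod (z - xi) ^ n <= cmod (F z)"
proof -
 have near: "\<exists>eps>0. \<forall>z. cmod (z - xi) < eps --> cmod (g xi) / 2 <= cmod (g z)"
  if g: "continuous_on (ball xi r) g" and r: "0 < r" and nz: "g xi \<noteq> 0" for g :: "complex => complex" and r
 proof -
  have "isCont g xi" using g r by (simp add: continuous_on_eq_continuous_at)
  then obtain d where d: "0 < d" "\<And>z. dist z xi < d ==> dist (g z) (g xi) < cmod (g xi) / 2"
   unfolding continuous_at using nz by (metis LIM_def[of g "g xi" xi] dist_self half_gt_zero isCont_def[symmetric] zero_less_norm_iff dist_nz)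
  have "cmod (g xi) / 2 <= cmod (g z)" if "cmod (z - xi) < d" for z
  proof -
   have "cmod (g z - g xi) < cmod (g xi) / 2" using d(2)[of z] that by (simp add: dist_norm)
   thus ?thesis using norm_triangle_ineq2[of "g xi" "g z"] by (simp add: norm_minus_commute)
  qed
  thus ?thesis using d(1) by blast
 qed
 show ?thesis
 proof (cases "F xi = 0")
  case False
  obtain r where r: "0 < r" "ball xi r \<subseteq> S" using S(1) xi open_contains_ball by blast
  have "continuous_on (ball xi r) F" using holomorphic_on_imp_continuous_on[OF holo] r(2) continuous_on_subset by blast
  from near[OF this r(1) False] obtain d where d: "0 < d" "\<And>z. cmod (z - xi) < d ==> cmod (F xi) / 2 <= cmod (F z)" by blast
  show ?thesis using d False by (intro exI[of _ d] conjI exI[of _ "cmod (F xi) / 2"] exI[of _ 0]) auto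
 next
  case True
  have "\<not> F constant_on S"
  proof
   assume "F constant_on S"
   then obtain v where "\<And>z. z \<in> S ==> F z = v" unfolding constant_on_def by blast
   thus False using True xi nz by metis
  qed
  from holomorphic_factor_zero_nonconstant[OF holo S xi True this] obtain g r n where g: "0 < r" "ball xi r \<subseteq> S" "g holomorphic_on ball xi r"
   "\<And>w. w \<in> ball xi r ==> F w = (w - xi) ^ n * g w" "\<And>w. w \<in> ball xi r ==> g w \<noteq> 0" by metis
  have g0: "g xi \<noteq> 0" using g(1,5) by simp
  from near[OF holomorphic_on_imp_continuous_on[OF g(3)] g(1) g0] obtain d where d: "0 < d" "\<And>z. cmod (z - xi) < d ==> cmod (g xi) / 2 <= cmod (g z)" by blast
  have "cmod (g xi) / 2 * cmod (z - xi) ^ n <= cmod (F z)" if z: "cmod (z - xi) < min d r" for z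
  proof -
   have "z \<in> ball xi r" using z by (simp add: dist_norm norm_minus_commute)
   hence "cmod (F z) = cmod (z - xi) ^ n * cmod (g z)" using g(4) by (simp add: norm_mult norm_power)
   moreover have "cmod (z - xi) ^ n * (cmod (g xi) / 2) <= cmod (z - xi) ^ n * cmod (g z)" using d(2)[of z] z by (intro mult_left_mono) auto
   ultimately show ?thesis by (simp add: mult.commute)
  qed
  thus ?thesis using d(1) g(1) g0 by (intro exI[of _ "min d r"] conjI exI[of _ "cmod (g xi) / 2"] exI[of _ n]) auto
 qed
qed

text \<open>On the real line the squared modulus of \<open>b\<close> is \<open>Fb\<close> times its
  reflection in the real axis, which is again holomorphic. The local lower bounds at single points
  become uniform through a finite cover, and its centres form \<open>X\<close>.\<close>

theorem admissible_imp_jacobi_data_zeros: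
 assumes "admissible a b rho0"
 shows "\<exists>ac bb y1 beta X cb kb. jacobi_data_zeros a b ac bb y1 beta X cb kb"
proof -
 have rho: "0 < rho0" and per: "\<And>x. a (x + 1) = a x" "\<And>x. b (x + 1) = b x" and nz: "\<exists>x. b x \<noteq> 0"
  and ext: "extends_analytically rho0 (\<lambda>x. complex_of_real (a x))" "extends_analytically rho0 b" using assms unfolding admissible_def by auto
 let ?S = "strip rho0"
 have op: "open ?S" unfolding strip_def by (intro open_Collect_less continuous_intros)
 have con: "connected ?S"
 proof -
  have "?S = {z. Im z < rho0} \<inter> {z. - rho0 < Im z}" unfolding strip_def by auto
  hence "convex ?S" by (simp add: convex_Int convex_halfspace_Im_lt convex_halfspace_Im_gt)
  thus ?thesis by (rule convex_connected)
 qed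
 have ext': "\<exists>F. F holomorphic_on ?S \<and> (\<forall>z\<in>?S. F (z + 1) = F z) \<and> (\<forall>x. F (complex_of_real x) = h x)" if "extends_analytically rho0 h" for h
 proof -
  obtain F where F: "F analytic_on closure ?S" "\<And>z. z \<in> closure ?S ==> F (z + 1) = F z" "\<And>x. F (complex_of_real x) = h x"
   using \<open>extends_analytically rho0 h\<close> unfolding extends_analytically_def by blast
  have "F analytic_on ?S" using F(1) closure_subset analytic_on_subset by blast
  hence "F holomorphic_on ?S" by (rule analytic_imp_holomorphic)
  moreover have "\<forall>z\<in>?S. F (z + 1) = F z" using F(2) closure_subset by blast
  ultimately show ?thesis using F(3) by blast
 qed
 obtain Fa where Fa: "Fa holomorphic_on ?S" "\<And>z. z \<in> ?S ==> Fa (z + 1) = Fa z" "\<And>x. Fa (complex_of_real x) = of_real (a x)" using ext'[OF ext(1)] by blast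
 obtain Fb where Fb: "Fb holomorphic_on ?S" "\<And>z. z \<in> ?S ==> Fb (z + 1) = Fb z" "\<And>x. Fb (complex_of_real x) = b x" using ext'[OF ext(2)] by blast
 define bb where "bb = (\<lambda>z. Fb z * (cnj \<circ> Fb \<circ> cnj) z)"
 have cS: "cnj ` ?S = ?S" unfolding image_cnj_conv_vimage_cnj strip_def by auto
 have bb_holo: "bb holomorphic_on ?S" unfolding bb_def by (intro holomorphic_intros Fb(1) holomorphic_on_compose_cnj_cnj op) (simp add: cS Fb(1))
 have bb_per: "bb (z + 1) = bb z" if "z \<in> ?S" for z
 proof -
  have "cnj z \<in> ?S" using that unfolding strip_def by simp
  hence "Fb (cnj z + 1) = Fb (cnj z)" by (rule Fb(2))
  thus ?thesis unfolding bb_def using Fb(2)[OF that] by simp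
 qed
 define y1 where "y1 = rho0 / 2"
 have y1: "0 < y1" "y1 < rho0" unfolding y1_def using rho by auto
 have sub: "z \<in> ?S" if "\<bar>Im z\<bar> < y1" for z using that y1 unfolding strip_def by simp
 obtain Ka where Ka: "0 <= Ka" "\<And>z. \<bar>Im z\<bar> < y1 ==> cmod (Fa z) <= Ka" "\<And>z z'. \<bar>Im z\<bar> < y1 ==> \<bar>Im z'\<bar> < y1 ==> cmod (Fa z - Fa z') <= Ka * cmod (z - z')"
  using periodic_strip_bounds[OF Fa(1,2) y1] by blast
 obtain Kb where Kb: "0 <= Kb" "\<And>z. \<bar>Im z\<bar> < y1 ==> cmod (Fb z) <= Kb" "\<And>z z'. \<bar>Im z\<bar> < y1 ==> \<bar>Im z'\<bar> < y1 ==> cmod (Fb z - Fb z') <= Kb * cmod (z - z')"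
  using periodic_strip_bounds[OF Fb(1,2) y1] by blast
 obtain Kc where Kc: "0 <= Kc" "\<And>z. \<bar>Im z\<bar> < y1 ==> cmod (bb z) <= Kc" "\<And>z z'. \<bar>Im z\<bar> < y1 ==> \<bar>Im z'\<bar> < y1 ==> cmod (bb z - bb z') <= Kc * cmod (z - z')"
  using periodic_strip_bounds[OF bb_holo bb_per y1] by blast
 define beta where "beta = 1 + Ka + Kb + Kc"
 have beta: "Ka <= beta" "Kb <= beta" "Kc <= beta" "1 <= beta" unfolding beta_def using Ka(1) Kb(1) Kc(1) by auto
 have up: "u <= beta * t" if "u <= K * t" "K <= beta" "0 <= t" for u K t using that mult_right_mono[of K beta t] by linarith
 have nz': "\<exists>z\<in>?S. Fb z \<noteq> 0"
 proof -
  obtain x where "b x \<noteq> 0" using nz by blast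
  thus ?thesis using rho Fb(3)[of x] by (intro bexI[of _ "of_real x"]) (auto simp: strip_def)
 qed
 have loc: "\<exists>eps>0. \<exists>c>0. \<exists>n. \<forall>x. \<bar>x - x0\<bar> < eps --> c * \<bar>x - x0\<bar> ^ n <= cmod (b x)" for x0
 proof -
  have "complex_of_real x0 \<in> ?S" using rho by (simp add: strip_def)
  from holomorphic_local_lower_bound[OF Fb(1) op con this nz'] obtain eps c n where h: "0 < eps" "0 < c"
   "\<And>z. cmod (z - of_real x0) < eps ==> c * cmod (z - of_real x0) ^ n <= cmod (Fb z)" by blast
  have "c * \<bar>x - x0\<bar> ^ n <= cmod (b x)" if "\<bar>x - x0\<bar> < eps" for x
  proof -
   have "cmod (complex_of_real x - of_real x0) = \<bar>x - x0\<bar>" by (metis norm_of_real of_real_diff)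
   thus ?thesis using h(3)[of "of_real x"] that Fb(3) by metis
  qed
  thus ?thesis using h(1,2) by blast
 qed
 then obtain e c n where e: "\<And>x0. 0 < e x0" "\<And>x0. 0 < c x0" "\<And>x x0. \<bar>x - x0\<bar> < e x0 ==> c x0 * \<bar>x - x0\<bar> ^ n x0 <= cmod (b x)" by metis
 have "{0..1::real} \<subseteq> (\<Union>x0\<in>{0..1}. ball x0 (e x0))" using e(1) by force
 then obtain X where X: "X \<subseteq> {0..1}" "finite X" "{0..1::real} \<subseteq> (\<Union>x0\<in>X. ball x0 (e x0))"
  using compactE_image[OF compact_Icc, of "{0..1::real}" "\<lambda>x0. ball x0 (e x0)"] by (metis open_ball)
 have Xne: "X \<noteq> {}" using X(3) by force
 define cb kb where "cb = Min (c ` X)" and "kb = Max (n ` X)"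
 have lower: "\<exists>z\<in>X. cb * \<bar>x - z\<bar> ^ kb <= cmod (b x)" if x: "x \<in> {0..1}" for x
 proof -
  obtain z where z: "z \<in> X" "\<bar>x - z\<bar> < e z" using X(3) x by (force simp: dist_real_def)
  have "\<bar>x - z\<bar> <= 1" using x z(1) X(1) by force
  hence "\<bar>x - z\<bar> ^ kb <= \<bar>x - z\<bar> ^ n z" using z(1) X(2) unfolding kb_def by (intro power_decreasing) auto
  moreover have "cb <= c z" unfolding cb_def using z(1) X(2) by simp
  ultimately have "cb * \<bar>x - z\<bar> ^ kb <= c z * \<bar>x - z\<bar> ^ n z" using e(2)[of z] by (intro mult_mono) auto
  thus ?thesis using e(3)[OF z(2)] z(1) by force
 qed
 have "jacobi_data_zeros a b Fa bb y1 beta X cb kb"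
 proof (intro jacobi_data_zeros.intro jacobi_data.intro jacobi_data_zeros_axioms.intro)
  show "Fa holomorphic_on {z. \<bar>Im z\<bar> < y1}" "bb holomorphic_on {z. \<bar>Im z\<bar> < y1}"
   using sub by (auto intro: holomorphic_on_subset[OF Fa(1)] holomorphic_on_subset[OF bb_holo])
  show "bb (complex_of_real x) = complex_of_real ((cmod (b x))\<^sup>2)" for x
   unfolding bb_def using Fb(3)[of x] by (simp add: complex_norm_square del: of_real_power)
  show "cmod (b x) <= beta" for x using Kb(2)[of "of_real x"] y1 Fb(3)[of x] beta by simp
  show "cmod (b x - b x') <= beta * \<bar>x - x'\<bar>" for x x'
  proof -
   have "cmod (complex_of_real x - of_real x') = \<bar>x - x'\<bar>" by (metis norm_of_real of_real_diff)
   hence "cmod (b x - b x') <= Kb * \<bar>x - x'\<bar>" using Kb(3)[of "of_real x" "of_real x'"] y1 Fb(3) by simp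
   thus ?thesis by (rule up) (use beta in auto)
  qed
  show "\<bar>Im z\<bar> < y1 ==> \<bar>Im z'\<bar> < y1 ==> cmod (Fa z - Fa z') <= beta * cmod (z - z')" for z z' using up[OF Ka(3) beta(1)] by simp
  show "\<bar>Im z\<bar> < y1 ==> \<bar>Im z'\<bar> < y1 ==> cmod (bb z - bb z') <= beta * cmod (z - z')" for z z' using up[OF Kc(3) beta(3)] by simp
  show "\<bar>Im z\<bar> < y1 ==> cmod (Fa z) <= beta" for z using Ka(2) beta by force
  show "\<bar>Im z\<bar> < y1 ==> cmod (bb z) <= beta" for z using Kc(2) beta by force
  show "0 < cb" unfolding cb_def using X(2) Xne e(2) by simp
 qed (use y1 beta per Fa Fb bb_per sub X lower in auto)
 thus ?thesis by blast
qed

theorem mainTheorem1: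
  shows "\<exists>K>0::real. \<forall>p>15::real. \<exists>c0::real. 0 < c0 \<and> c0 < 1 \<and>
    (\<forall>(a :: real \<Rightarrow> real) (b :: real \<Rightarrow> complex) (\<rho>0::real) (c::real) (\<alpha>::real) (\<gamma>::real)
       (E'::real) (E''::real).
      admissible a b \<rho>0 \<and> 0 < c \<and> c < 1 \<and> 1 < \<alpha> \<and> 0 < \<gamma> \<longrightarrow>
      (\<exists>N0::nat. \<forall>(\<omega>'::real) (\<omega>''::real).
        (\<forall>\<omega>\<in>{\<omega>'<..<\<omega>''}. \<forall>E\<in>{E'<..<E''}. \<gamma> < lyapunov a b \<omega> E) \<longrightarrow>
        (\<forall>N\<ge>N0. \<exists>\<Omega> :: real set.
          mes_compl_le \<Omega> (K * ln (ln (real N)) powr (- c0)) (K * (real N ^ 2 * ln (real N) powr p)) \<and>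
          (\<forall>\<omega> \<in> ({\<omega>'<..<\<omega>''} \<inter> diophantine c \<alpha>) - \<Omega>. \<exists>\<E> :: real set.
            mes_compl_le \<E> (K * ln (ln (real N)) powr (- c0)) (K * (real N * ln (real N) ^ 6)) \<and>
            (\<forall>x::real. \<forall>j\<in>{1..N}. jacobi_E a b N j x \<omega> \<in> {E'<..<E''} - \<E> \<longrightarrow>
              (\<forall>k\<in>{1..N}. k \<noteq> j \<longrightarrow>
                \<bar>jacobi_E a b N j x \<omega> - jacobi_E a b N k x \<omega>\<bar>
                  \<ge> 1 / (real N * ln (real N) powr p)))))))"
proof (rule exI[of _ 1], rule conjI, simp, intro allI impI, rule exI[of _ "1/2"], unfold mult_1, intro conjI allI impI, simp, simp, goal_cases)
 \<comment> \<open>\<open>separated\<close> comes without multiplicative constants, hence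
   \<open>K = 1\<close>. The exponent 1/2 is a choice, since the exceptional sets are bounded by a
   negative power of \<open>ln N\<close>.\<close>
 case (1 p a b rho0 c alpha gamma E' E'')
 show ?case
 proof (cases "E' < E''")
  case False
  hence "{E'<..<E''} = {}" by simp
  thus ?thesis by (auto intro!: exI[of _ "{}"] mes_compl_le_empty)
 next
  case True
  obtain ac bb y1 beta X cb kb where "jacobi_data_zeros a b ac bb y1 beta X cb kb" using admissible_imp_jacobi_data_zeros 1 by blast
  from jacobi_data_zeros.spectral_separation[OF this _ _ _ True, of c alpha gamma p] 1
  obtain N0 where N0: "\<And>N. N0 <= N ==> separated a b c alpha gamma E' E'' p N" by auto
  show ?thesis
  proof (rule exI[of _ N0], intro allI impI, goal_cases)
   case ly: (1 \<omega>' \<omega>'' N)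
   show ?case
   proof (rule exE[OF N0[OF ly(2), unfolded separated_def holds_off_def]], elim conjE, rule exI, rule conjI, assumption, rule ballI, goal_cases)
    case (1 \<Omega> \<omega>)
    have *: "\<omega> \<notin> \<Omega>" "\<omega> \<in> diophantine c alpha" "\<forall>E\<in>{E'<..<E''}. gamma < lyapunov a b \<omega> E" using 1(3) ly(1) by auto
    show ?case
    proof (rule exE[OF 1(2)[THEN spec, THEN mp, OF *(1), THEN mp, OF *(2), THEN mp, OF *(3)]], elim conjE, rule exI, rule conjI, assumption, intro allI ballI impI, goal_cases)
     case (1 \<E> x j k)
     \<comment> \<open>\<open>jacobi_E\<close> counts from 1, the list of eigenvalues from
       0.\<close>
     have "j - 1 < N \<and> k - 1 < N \<and> k - 1 \<noteq> j - 1" using 1(3,5,6) by auto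
     thus ?case using 1(2,4) unfolding jacobi_E_def by blast
    qed
   qed
  qed
 qed
qed

end
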